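(* Let $\ell$ be a prime, $n\ge 1$ an integer, $m\ge 1$ an integer, and let $\mathcal{G}$ be a pro-$\ell$ group. Put $H=\mathcal{G}^{(2)}=[\mathcal{G},\mathcal{G}]\,\mathcal{G}^{\ell^n}$ and $G=\mathcal{G}/H$, and assume $G\cong\prod_i\mathbb{Z}/\ell^n$. Let $\phi\in H^1(H,\mathcal{I}_m^\vee)^G$. Consider the statements: (1) $\phi$ lies in the image of the map $H^1(H,\Lambda_m^\vee)^G\to H^1(H,\mathcal{I}_m^\vee)^G$ induced by the restriction $\Lambda_m^\vee\to\mathcal{I}_m^\vee$ (dual to the inclusion $\mathcal{I}_m\hookrightarrow\Lambda_m$); (2) $\Psi(\phi)=0$ in $H^3(G,\mathbb{Z}/\ell^n)$. Then (1) implies (2). If moreover the inflation map $H^2(G,\mathbb{Z}/\ell^n)\to H^2(\mathcal{G},\mathbb{Z}/\ell^n)$ is surjective, then (1) and (2) are equivalent.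
   Context: All cohomology is continuous cochain cohomology, and all homomorphisms are continuous. For an abelian (profinite or discrete) group $M$, $M^\vee=\mathrm{Hom}(M,\mathbb{Z}/\ell^n)$ (continuous homomorphisms). For a pro-$\ell$ group $\mathcal{G}$, the mod-$\ell^n$ central descending series is $\mathcal{G}^{(1)}=\mathcal{G}$, $\mathcal{G}^{(k+1)}=[\mathcal{G},\mathcal{G}^{(k)}](\mathcal{G}^{(k)})^{\ell^n}$. Every $G$-module is regarded as a $\mathcal{G}$-module via $\mathcal{G}\to G$ (so $H$ acts trivially). $\Lambda=\mathbb{Z}/\ell^n[[G]]$ is the completed group ring, $\mathcal{I}$ its augmentation ideal, $\Lambda_m=\Lambda/\mathcal{I}^m$, $\mathcal{I}_m=\mathcal{I}/\mathcal{I}^m$; duals of $G$-modules carry the action $(\sigma f)(x)=f(\sigma^{-1}x)$. Since $H$ acts trivially on $\Lambda_m^\vee,\mathcal{I}_m^\vee$, the groups $H^1(H,\Lambda_m^\vee)$, $H^1(H,\mathcal{I}_m^\vee)$ carry the natural $G$-action, and $(\cdot)^G$ denotes invariants. The map $\Psi\colon H^1(H,\mathcal{I}_m^\vee)^G\to H^3(G,\mathbb{Z}/\ell^n)$ is the composition $\delta\circ d_2$, where $d_2\colon H^1(H,\mathcal{I}_m^\vee)^G=E_2^{0,1}\to E_2^{2,0}=H^2(G,\mathcal{I}_m^\vee)$ is the differential of the Hochschild–Serre spectral sequence $H^i(G,H^j(H,M))\Rightarrow H^{i+j}(\mathcal{G},M)$ of the extension $1\to H\to\mathcal{G}\to G\to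 1$ (with $M=\mathcal{I}_m^\vee$), and $\delta\colon H^2(G,\mathcal{I}_m^\vee)\to H^3(G,\mathbb{Z}/\ell^n)$ is the connecting homomorphism of the short exact sequence of $G$-modules $0\to\mathbb{Z}/\ell^n\to\Lambda_m^\vee\to\mathcal{I}_m^\vee\to 0$ (dual to $0\to\mathcal{I}_m\to\Lambda_m\to\Lambda/\mathcal{I}\cong\mathbb{Z}/\ell^n\to0$). *)

theory Defs
  imports "HOL-Analysis.Analysis" "HOL-Algebra.Ideal_Product" "HOL-Algebra.Product_Groups"
    "HOL-Number_Theory.Residues"
begin

section \<open>Topological groups, pro-\<open>\<ell>\<close> groups\<close>

record 'a tgroup = "'a monoid" +
  gtop :: "'a topology"

definition with_top :: "('a, 'b) monoid_scheme \<Rightarrow> 'a topology \<Rightarrow> 'a tgroup" where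
  "with_top G T = \<lparr>carrier = carrier G, monoid.mult = monoid.mult G, one = one G, gtop = T\<rparr>"

locale topological_group = group G for G :: "('a, 'b) tgroup_scheme" (structure) +
  assumes topspace_gtop: "topspace (gtop G) = carrier G"
    and continuous_mult:
      "continuous_map (prod_topology (gtop G) (gtop G)) (gtop G) (\<lambda>(x, y). x \<otimes> y)"
    and continuous_inv: "continuous_map (gtop G) (gtop G) (\<lambda>x. inv x)"

locale profinite_group = topological_group +
  assumes compact: "compact_space (gtop G)"
    and Hausdorff: "Hausdorff_space (gtop G)"
    and totally_disconnected: "connectedin (gtop G) S \<Longrightarrow> \<exists>a. S \<subseteq> {a}"

definition open_normal :: "('a, 'b) tgroup_scheme \<Rightarrow> 'a set set" where
  "open_normal G = {U. U \<lhd> G \<and> openin (gtop G) U}"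

locale pro_l_group = profinite_group +
  fixes l :: nat
  assumes index_power: "U \<in> open_normal G \<Longrightarrow> \<exists>k. card (rcosets U) = l ^ k"

definition tsub :: "('a, 'b) tgroup_scheme \<Rightarrow> 'a set \<Rightarrow> 'a tgroup" where
  "tsub G H = with_top (G\<lparr>carrier := H\<rparr>) (subtopology (gtop G) H)"

definition tquot :: "('a, 'b) tgroup_scheme \<Rightarrow> 'a set \<Rightarrow> 'a set tgroup" where
  "tquot G H = with_top (G Mod H)
     (topology (\<lambda>V. V \<subseteq> rcosets\<^bsub>G\<^esub> H \<and> openin (gtop G) {x \<in> topspace (gtop G). H #>\<^bsub>G\<^esub> x \<in> V}))"

definition tproduct :: "'i set \<Rightarrow> ('i \<Rightarrow> ('a, 'b) tgroup_scheme) \<Rightarrow> ('i \<Rightarrow> 'a) tgroup" where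
  "tproduct I G = with_top (product_group I G) (product_topology (\<lambda>i. gtop (G i)) I)"

definition tiso :: "('a, 'c) tgroup_scheme \<Rightarrow> ('b, 'd) tgroup_scheme \<Rightarrow> ('a \<Rightarrow> 'b) set" where
  "tiso G K = {h \<in> iso G K. homeomorphic_map (gtop G) (gtop K) h}"

text \<open>The additive group of a ring \<open>R\<close>, with the discrete topology.\<close>

definition discrete_add :: "('a, 'b) ring_scheme \<Rightarrow> 'a tgroup" where
  "discrete_add R = with_top (add_monoid R) (discrete_topology (carrier R))"

text \<open>
  The mod-\<open>N\<close> central descending series, indexed from 1 (the value at 0 is a dummy).  As usual for
  profinite groups, the subgroup \<open>[G, K] K\<^sup>N\<close> is the closed subgroup generated by the commutators
  and the \<open>N\<close>-th powers.
\<close>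

definition comm_pow :: "('a, 'b) tgroup_scheme \<Rightarrow> nat \<Rightarrow> 'a set \<Rightarrow> 'a set" where
  "comm_pow G N K = gtop G closure_of generate G
     ({x \<otimes>\<^bsub>G\<^esub> y \<otimes>\<^bsub>G\<^esub> inv\<^bsub>G\<^esub> x \<otimes>\<^bsub>G\<^esub> inv\<^bsub>G\<^esub> y | x y. x \<in> carrier G \<and> y \<in> K} \<union>
      {y [^]\<^bsub>G\<^esub> N | y. y \<in> K})"

fun central_series :: "('a, 'b) tgroup_scheme \<Rightarrow> nat \<Rightarrow> nat \<Rightarrow> 'a set" where
  "central_series G N 0 = carrier G"
| "central_series G N (Suc 0) = carrier G"
| "central_series G N (Suc (Suc k)) = comm_pow G N (central_series G N (Suc k))"


section \<open>Continuous cochain cohomology\<close>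

text \<open>
  A topological \<open>G\<close>-module is an abelian topological group with an action of \<open>G\<close>.  The group law of
  a module is the multiplication of the underlying \<open>monoid\<close> record, so \<open>\<one>\<close> is its zero element and
  \<open>x [^] (-1)\<close> is \<open>- x\<close>.
\<close>

record ('g, 'm) tmod = "'m tgroup" +
  act :: "'g \<Rightarrow> 'm \<Rightarrow> 'm"

definition with_act :: "('m, 'b) tgroup_scheme \<Rightarrow> ('g \<Rightarrow> 'm \<Rightarrow> 'm) \<Rightarrow> ('g, 'm) tmod" where
  "with_act M a = \<lparr>carrier = carrier M, monoid.mult = monoid.mult M, one = one M, gtop = gtop M,
     act = a\<rparr>"

definition trivial_mod :: "('m, 'b) tgroup_scheme \<Rightarrow> ('g, 'm) tmod" where
  "trivial_mod M = with_act M (\<lambda>g x. x)"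

definition pullback_mod :: "('h \<Rightarrow> 'g) \<Rightarrow> ('g, 'm) tmod \<Rightarrow> ('h, 'm) tmod" where
  "pullback_mod \<alpha> M = with_act M (\<lambda>h. act M (\<alpha> h))"

definition tuples :: "('g, 'b) tgroup_scheme \<Rightarrow> nat \<Rightarrow> (nat \<Rightarrow> 'g) set" where
  "tuples G k = (\<Pi>\<^sub>E i\<in>{..<k}. carrier G)"

definition cochains :: "('g, 'b) tgroup_scheme \<Rightarrow> ('g, 'm) tmod \<Rightarrow> nat \<Rightarrow> ((nat \<Rightarrow> 'g) \<Rightarrow> 'm) set" where
  "cochains G M k = {f \<in> tuples G k \<rightarrow>\<^sub>E carrier M.
     continuous_map (product_topology (\<lambda>_. gtop G) {..<k}) (gtop M) f}"

definition cochain_group ::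
    "('g, 'b) tgroup_scheme \<Rightarrow> ('g, 'm) tmod \<Rightarrow> nat \<Rightarrow> ((nat \<Rightarrow> 'g) \<Rightarrow> 'm) monoid" where
  "cochain_group G M k = \<lparr>carrier = cochains G M k,
     monoid.mult = (\<lambda>f f'. \<lambda>x\<in>tuples G k. f x \<otimes>\<^bsub>M\<^esub> f' x),
     one = (\<lambda>x\<in>tuples G k. \<one>\<^bsub>M\<^esub>)\<rparr>"

text \<open>
  The inhomogeneous differential; with entries numbered from 0,
  \<open>(df)(x\<^sub>0,\<dots>,x\<^sub>k) = x\<^sub>0 f(x\<^sub>1,\<dots>,x\<^sub>k) + \<Sum>\<^sub>j\<^sub><\<^sub>k (-1)\<^sup>j\<^sup>+\<^sup>1 f(\<dots>,x\<^sub>j x\<^sub>j\<^sub>+\<^sub>1,\<dots>) + (-1)\<^sup>k\<^sup>+\<^sup>1 f(x\<^sub>0,\<dots>,x\<^sub>k\<^sub>-\<^sub>1)\<close>.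
\<close>

definition coboundary ::
    "('g, 'b) tgroup_scheme \<Rightarrow> ('g, 'm) tmod \<Rightarrow> nat \<Rightarrow> ((nat \<Rightarrow> 'g) \<Rightarrow> 'm) \<Rightarrow> (nat \<Rightarrow> 'g) \<Rightarrow> 'm" where
  "coboundary G M k f = (\<lambda>x\<in>tuples G (Suc k).
     act M (x 0) (f (\<lambda>i\<in>{..<k}. x (Suc i)))
     \<otimes>\<^bsub>M\<^esub> (\<Otimes>\<^bsub>M\<^esub>j\<in>{..<k}.
           f (\<lambda>i\<in>{..<k}. if i < j then x i else if i = j then x i \<otimes>\<^bsub>G\<^esub> x (Suc i) else x (Suc i))
             [^]\<^bsub>M\<^esub> ((-1 :: int) ^ Suc j))
     \<otimes>\<^bsub>M\<^esub> f (\<lambda>i\<in>{..<k}. x i) [^]\<^bsub>M\<^esub> ((-1 :: int) ^ Suc k))"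

definition cocycles :: "('g, 'b) tgroup_scheme \<Rightarrow> ('g, 'm) tmod \<Rightarrow> nat \<Rightarrow> ((nat \<Rightarrow> 'g) \<Rightarrow> 'm) set" where
  "cocycles G M k = {f \<in> cochains G M k. coboundary G M k f = \<one>\<^bsub>cochain_group G M (Suc k)\<^esub>}"

definition coboundaries ::
    "('g, 'b) tgroup_scheme \<Rightarrow> ('g, 'm) tmod \<Rightarrow> nat \<Rightarrow> ((nat \<Rightarrow> 'g) \<Rightarrow> 'm) set" where
  "coboundaries G M k =
     (if k = 0 then {\<one>\<^bsub>cochain_group G M 0\<^esub>} else coboundary G M (k - 1) ` cochains G M (k - 1))"

definition cohomology ::
    "('g, 'b) tgroup_scheme \<Rightarrow> ('g, 'm) tmod \<Rightarrow> nat \<Rightarrow> ((nat \<Rightarrow> 'g) \<Rightarrow> 'm) set monoid" where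
  "cohomology G M k = (cochain_group G M k)\<lparr>carrier := cocycles G M k\<rparr> Mod coboundaries G M k"

definition coh_class ::
    "('g, 'b) tgroup_scheme \<Rightarrow> ('g, 'm) tmod \<Rightarrow> nat \<Rightarrow> ((nat \<Rightarrow> 'g) \<Rightarrow> 'm) \<Rightarrow> ((nat \<Rightarrow> 'g) \<Rightarrow> 'm) set" where
  "coh_class G M k f = coboundaries G M k #>\<^bsub>cochain_group G M k\<^esub> f"

text \<open>
  A pair of a homomorphism \<open>\<alpha> : G' \<rightarrow> G\<close> and a compatible homomorphism of modules \<open>\<beta> : M \<rightarrow> M'\<close>
  induces \<open>H\<^sup>k(G, M) \<rightarrow> H\<^sup>k(G', M')\<close>, the class of \<open>f\<close> going to the class of \<open>\<beta> \<circ> f \<circ> \<alpha>\<close>.  The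
  arguments of \<open>coh_map\<close> are those of the target.
\<close>

definition cochain_map ::
    "('h, 'b) tgroup_scheme \<Rightarrow> nat \<Rightarrow> ('h \<Rightarrow> 'g) \<Rightarrow> ('m \<Rightarrow> 'n) \<Rightarrow> ((nat \<Rightarrow> 'g) \<Rightarrow> 'm) \<Rightarrow> (nat \<Rightarrow> 'h) \<Rightarrow> 'n" where
  "cochain_map G' k \<alpha> \<beta> f = (\<lambda>x\<in>tuples G' k. \<beta> (f (\<lambda>i\<in>{..<k}. \<alpha> (x i))))"

definition coh_map ::
    "('h, 'b) tgroup_scheme \<Rightarrow> ('h, 'n) tmod \<Rightarrow> nat \<Rightarrow> ('h \<Rightarrow> 'g) \<Rightarrow> ('m \<Rightarrow> 'n) \<Rightarrow>
      ((nat \<Rightarrow> 'g) \<Rightarrow> 'm) set \<Rightarrow> ((nat \<Rightarrow> 'h) \<Rightarrow> 'n) set" where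
  "coh_map G' M' k \<alpha> \<beta> c = the_elem ((\<lambda>f. coh_class G' M' k (cochain_map G' k \<alpha> \<beta> f)) ` c)"

text \<open>
  The connecting homomorphism \<open>H\<^sup>k(G, M'') \<rightarrow> H\<^sup>k\<^sup>+\<^sup>1(G, M')\<close> of a short exact sequence
  \<open>0 \<rightarrow> M' \<rightarrow> M \<rightarrow> M'' \<rightarrow> 0\<close> with maps \<open>i\<close> and \<open>p\<close>: lift a cocycle along \<open>p\<close>, apply the differential
  and pull the result back along \<open>i\<close>.
\<close>

definition connecting ::
    "('g, 'b) tgroup_scheme \<Rightarrow> ('g, 'm1) tmod \<Rightarrow> ('m1 \<Rightarrow> 'm) \<Rightarrow> ('g, 'm) tmod \<Rightarrow> ('m \<Rightarrow> 'm2) \<Rightarrow> nat \<Rightarrow>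
      ((nat \<Rightarrow> 'g) \<Rightarrow> 'm2) set \<Rightarrow> ((nat \<Rightarrow> 'g) \<Rightarrow> 'm1) set" where
  "connecting G M' i M p k c = (THE c'. \<exists>y\<in>cochains G M k. \<exists>z\<in>cocycles G M' (Suc k).
     cochain_map G k (\<lambda>g. g) p y \<in> c \<and>
     cochain_map G (Suc k) (\<lambda>g. g) i z = coboundary G M k y \<and>
     c' = coh_class G M' (Suc k) z)"

text \<open>
  For \<open>H\<close> normal in \<open>G\<close> and a \<open>G\<close>-module \<open>M\<close>, an element \<open>\<sigma>\<close> of \<open>G\<close> acts on \<open>H\<^sup>k(H, M)\<close> by
  \<open>(\<sigma> f)(h\<^sub>1, \<dots>) = \<sigma> f(\<sigma>\<^sup>-\<^sup>1 h\<^sub>1 \<sigma>, \<dots>)\<close>.  As \<open>H\<close> acts trivially on cohomology, this is the action of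
  \<open>G / H\<close>, and the set below is \<open>H\<^sup>k(H, M)\<^bsup>G/H\<^esup>\<close>.
\<close>

definition coh_invariants ::
    "('g, 'b) tgroup_scheme \<Rightarrow> 'g set \<Rightarrow> ('g, 'm) tmod \<Rightarrow> nat \<Rightarrow> ((nat \<Rightarrow> 'g) \<Rightarrow> 'm) set set" where
  "coh_invariants G H M k = {c \<in> carrier (cohomology (tsub G H) M k).
     \<forall>\<sigma>\<in>carrier G.
       coh_map (tsub G H) M k (\<lambda>h. inv\<^bsub>G\<^esub> \<sigma> \<otimes>\<^bsub>G\<^esub> h \<otimes>\<^bsub>G\<^esub> \<sigma>) (act M \<sigma>) c = c}"


section \<open>The Hochschild--Serre spectral sequence\<close>

text \<open>
  This is the spectral sequence of the Hochschild--Serre filtration of the complex of normalized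
  cochains: \<open>F\<^sup>p C\<^sup>k\<close> consists of those \<open>f\<close> for which \<open>f(x\<^sub>1,\<dots>,x\<^sub>k)\<close> depends only on
  \<open>x\<^sub>1,\<dots>,x\<^sub>k\<^sub>-\<^sub>p\<close> and the cosets of \<open>x\<^sub>k\<^sub>-\<^sub>p\<^sub>+\<^sub>1,\<dots>,x\<^sub>k\<close> modulo \<open>H\<close>; it is everything for \<open>p \<le> 0\<close> and
  zero for \<open>p > k\<close>.  Throughout, \<open>k\<close> is the total degree, so \<open>hs_E G H M r p k\<close> is
  \<open>E\<^sub>r\<^bsup>p,k-p\<^esup>\<close>, and
  \<open>Z\<^sub>r\<^sup>p = {f \<in> F\<^sup>p. df \<in> F\<^bsup>p+r\<^esup>}\<close>, \<open>B\<^sub>r\<^sup>p = Z\<^bsub>r-1\<^esub>\<^bsup>p+1\<^esup> + d Z\<^bsub>r-1\<^esub>\<^bsup>p-r+1\<^esup>\<close>, \<open>E\<^sub>r\<^sup>p = Z\<^sub>r\<^sup>p / B\<^sub>r\<^sup>p\<close>.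
\<close>

definition normalized :: "('g, 'b) tgroup_scheme \<Rightarrow> ('g, 'm) tmod \<Rightarrow> nat \<Rightarrow> ((nat \<Rightarrow> 'g) \<Rightarrow> 'm) \<Rightarrow> bool" where
  "normalized G M k f \<longleftrightarrow> (\<forall>x\<in>tuples G k. (\<exists>i<k. x i = \<one>\<^bsub>G\<^esub>) \<longrightarrow> f x = \<one>\<^bsub>M\<^esub>)"

definition hs_filtration ::
    "('g, 'b) tgroup_scheme \<Rightarrow> 'g set \<Rightarrow> ('g, 'm) tmod \<Rightarrow> int \<Rightarrow> nat \<Rightarrow> ((nat \<Rightarrow> 'g) \<Rightarrow> 'm) set" where
  "hs_filtration G H M p k = {f \<in> cochains G M k. normalized G M k f \<and>
     (int k < p \<longrightarrow> f = \<one>\<^bsub>cochain_group G M k\<^esub>) \<and>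
     (\<forall>x\<in>tuples G k. \<forall>y\<in>tuples G k.
        (\<forall>i<k. (int i < int k - p \<longrightarrow> x i = y i) \<and> H #>\<^bsub>G\<^esub> x i = H #>\<^bsub>G\<^esub> y i) \<longrightarrow> f x = f y)}"

definition hs_Z ::
    "('g, 'b) tgroup_scheme \<Rightarrow> 'g set \<Rightarrow> ('g, 'm) tmod \<Rightarrow> int \<Rightarrow> int \<Rightarrow> nat \<Rightarrow> ((nat \<Rightarrow> 'g) \<Rightarrow> 'm) set" where
  "hs_Z G H M r p k =
     {f \<in> hs_filtration G H M p k. coboundary G M k f \<in> hs_filtration G H M (p + r) (Suc k)}"

definition hs_B ::
    "('g, 'b) tgroup_scheme \<Rightarrow> 'g set \<Rightarrow> ('g, 'm) tmod \<Rightarrow> int \<Rightarrow> int \<Rightarrow> nat \<Rightarrow> ((nat \<Rightarrow> 'g) \<Rightarrow> 'm) set" where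
  "hs_B G H M r p k = hs_Z G H M (r - 1) (p + 1) k <#>\<^bsub>cochain_group G M k\<^esub>
     (if k = 0 then {\<one>\<^bsub>cochain_group G M 0\<^esub>}
      else coboundary G M (k - 1) ` hs_Z G H M (r - 1) (p - r + 1) (k - 1))"

definition hs_E ::
    "('g, 'b) tgroup_scheme \<Rightarrow> 'g set \<Rightarrow> ('g, 'm) tmod \<Rightarrow> int \<Rightarrow> int \<Rightarrow> nat \<Rightarrow>
      ((nat \<Rightarrow> 'g) \<Rightarrow> 'm) set monoid" where
  "hs_E G H M r p k = (cochain_group G M k)\<lparr>carrier := hs_Z G H M r p k\<rparr> Mod hs_B G H M r p k"

definition hs_class ::
    "('g, 'b) tgroup_scheme \<Rightarrow> 'g set \<Rightarrow> ('g, 'm) tmod \<Rightarrow> int \<Rightarrow> int \<Rightarrow> nat \<Rightarrow>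
      ((nat \<Rightarrow> 'g) \<Rightarrow> 'm) \<Rightarrow> ((nat \<Rightarrow> 'g) \<Rightarrow> 'm) set" where
  "hs_class G H M r p k f = hs_B G H M r p k #>\<^bsub>cochain_group G M k\<^esub> f"

definition hs_d ::
    "('g, 'b) tgroup_scheme \<Rightarrow> 'g set \<Rightarrow> ('g, 'm) tmod \<Rightarrow> int \<Rightarrow> int \<Rightarrow> nat \<Rightarrow>
      ((nat \<Rightarrow> 'g) \<Rightarrow> 'm) set \<Rightarrow> ((nat \<Rightarrow> 'g) \<Rightarrow> 'm) set" where
  "hs_d G H M r p k \<xi> =
     the_elem ((\<lambda>f. hs_class G H M r (p + r) (Suc k) (coboundary G M k f)) ` \<xi>)"

text \<open>
  The identifications \<open>E\<^sub>2\<^sup>0\<^sup>,\<^sup>1 = H\<^sup>1(H, M)\<^bsup>G/H\<^esup>\<close>, by restriction of cochains to \<open>H\<close>, and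
  \<open>H\<^sup>2(G/H, N) = E\<^sub>2\<^sup>2\<^sup>,\<^sup>0\<close>, by inflation of normalized cocycles, where \<open>M\<close> is a \<open>G/H\<close>-module \<open>N\<close> regarded
  as a \<open>G\<close>-module (so that \<open>M\<^sup>H = N\<close>).
\<close>

definition hs_edge_res ::
    "('g, 'b) tgroup_scheme \<Rightarrow> 'g set \<Rightarrow> ('g, 'm) tmod \<Rightarrow>
      ((nat \<Rightarrow> 'g) \<Rightarrow> 'm) set \<Rightarrow> ((nat \<Rightarrow> 'g) \<Rightarrow> 'm) set" where
  "hs_edge_res G H M \<xi> =
     the_elem ((\<lambda>f. coh_class (tsub G H) M 1 (cochain_map (tsub G H) 1 (\<lambda>h. h) (\<lambda>x. x) f)) ` \<xi>)"

definition inflated :: "('g, 'b) tgroup_scheme \<Rightarrow> 'g set \<Rightarrow> ('g set, 'm) tmod \<Rightarrow> ('g, 'm) tmod" where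
  "inflated G H N = pullback_mod (\<lambda>g. H #>\<^bsub>G\<^esub> g) N"

definition hs_edge_inf ::
    "('g, 'b) tgroup_scheme \<Rightarrow> 'g set \<Rightarrow> ('g set, 'm) tmod \<Rightarrow>
      ((nat \<Rightarrow> 'g set) \<Rightarrow> 'm) set \<Rightarrow> ((nat \<Rightarrow> 'g) \<Rightarrow> 'm) set" where
  "hs_edge_inf G H N c =
     the_elem ((\<lambda>z. hs_class G H (inflated G H N) 2 2 2
                      (cochain_map G 2 (\<lambda>g. H #>\<^bsub>G\<^esub> g) (\<lambda>x. x) z))
               ` {z \<in> c. normalized (tquot G H) N 2 z})"

definition hs_d2 ::
    "('g, 'b) tgroup_scheme \<Rightarrow> 'g set \<Rightarrow> ('g set, 'm) tmod \<Rightarrow>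
      ((nat \<Rightarrow> 'g) \<Rightarrow> 'm) set \<Rightarrow> ((nat \<Rightarrow> 'g set) \<Rightarrow> 'm) set" where
  "hs_d2 G H N \<phi> =
     inv_into (carrier (cohomology (tquot G H) N 2)) (hs_edge_inf G H N)
       (hs_d G H (inflated G H N) 2 0 1
         (inv_into (carrier (hs_E G H (inflated G H N) 2 0 1)) (hs_edge_res G H (inflated G H N)) \<phi>))"


section \<open>The completed group ring and its truncations\<close>

definition group_ring :: "('r, 'b) ring_scheme \<Rightarrow> ('q, 'c) monoid_scheme \<Rightarrow> ('q \<Rightarrow> 'r) ring" where
  "group_ring R Q = \<lparr>carrier = carrier Q \<rightarrow>\<^sub>E carrier R,
     monoid.mult = (\<lambda>a b. \<lambda>c\<in>carrier Q. (\<Oplus>\<^bsub>R\<^esub>x\<in>carrier Q. a x \<otimes>\<^bsub>R\<^esub> b (inv\<^bsub>Q\<^esub> x \<otimes>\<^bsub>Q\<^esub> c))),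
     one = (\<lambda>c\<in>carrier Q. if c = \<one>\<^bsub>Q\<^esub> then \<one>\<^bsub>R\<^esub> else \<zero>\<^bsub>R\<^esub>),
     ring.zero = (\<lambda>c\<in>carrier Q. \<zero>\<^bsub>R\<^esub>),
     ring.add = (\<lambda>a b. \<lambda>c\<in>carrier Q. a c \<oplus>\<^bsub>R\<^esub> b c)\<rparr>"

text \<open>
  \<open>R[[G]]\<close> for a finite ring \<open>R\<close> and a profinite group \<open>G\<close> is the inverse limit of the finite rings
  \<open>R[G/U]\<close> over the open normal subgroups \<open>U\<close>; the transition map \<open>R[G/V] \<rightarrow> R[G/U]\<close> for \<open>V \<subseteq> U\<close>
  sums the coefficients over the cosets of \<open>V\<close> contained in a coset of \<open>U\<close>.
\<close>

type_synonym ('g, 'r) cgr = "'g set \<Rightarrow> 'g set \<Rightarrow> 'r"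

definition completed_group_ring ::
    "('r, 'b) ring_scheme \<Rightarrow> ('g, 'c) tgroup_scheme \<Rightarrow> ('g, 'r) cgr ring" where
  "completed_group_ring R G = \<lparr>
     carrier = {x \<in> (\<Pi>\<^sub>E U\<in>open_normal G. carrier (group_ring R (G Mod U))).
       \<forall>U\<in>open_normal G. \<forall>V\<in>open_normal G. V \<subseteq> U \<longrightarrow>
         (\<forall>c\<in>carrier (G Mod U). x U c = (\<Oplus>\<^bsub>R\<^esub>d\<in>{d \<in> carrier (G Mod V). d \<subseteq> c}. x V d))},
     monoid.mult = (\<lambda>x y. \<lambda>U\<in>open_normal G. x U \<otimes>\<^bsub>group_ring R (G Mod U)\<^esub> y U),
     one = (\<lambda>U\<in>open_normal G. \<one>\<^bsub>group_ring R (G Mod U)\<^esub>),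
     ring.zero = (\<lambda>U\<in>open_normal G. \<zero>\<^bsub>group_ring R (G Mod U)\<^esub>),
     ring.add = (\<lambda>x y. \<lambda>U\<in>open_normal G. x U \<oplus>\<^bsub>group_ring R (G Mod U)\<^esub> y U)\<rparr>"

definition cgr_topology ::
    "('r, 'b) ring_scheme \<Rightarrow> ('g, 'c) tgroup_scheme \<Rightarrow> ('g, 'r) cgr topology" where
  "cgr_topology R G = subtopology
     (product_topology (\<lambda>U. discrete_topology (carrier (group_ring R (G Mod U)))) (open_normal G))
     (carrier (completed_group_ring R G))"

definition group_elem ::
    "('r, 'b) ring_scheme \<Rightarrow> ('g, 'c) tgroup_scheme \<Rightarrow> 'g \<Rightarrow> ('g, 'r) cgr" where
  "group_elem R G g =
     (\<lambda>U\<in>open_normal G. \<lambda>c\<in>carrier (G Mod U). if g \<in> c then \<one>\<^bsub>R\<^esub> else \<zero>\<^bsub>R\<^esub>)"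

text \<open>The augmentation is the component at \<open>U = G\<close>, since \<open>R[G/G] = R\<close>.\<close>

definition augmentation :: "('g, 'c) tgroup_scheme \<Rightarrow> ('g, 'r) cgr \<Rightarrow> 'r" where
  "augmentation G x = x (carrier G) (carrier G)"

definition augmentation_ideal ::
    "('r, 'b) ring_scheme \<Rightarrow> ('g, 'c) tgroup_scheme \<Rightarrow> ('g, 'r) cgr set" where
  "augmentation_ideal R G = a_kernel (completed_group_ring R G) R (augmentation G)"

text \<open>
  Powers of the augmentation ideal are closed ideals, so that the quotients are profinite.  The
  duals of the quotients are the same with and without the closure, because a continuous
  homomorphism to a discrete group that vanishes on a set vanishes on its closure.
\<close>

definition aug_power ::
    "('r, 'b) ring_scheme \<Rightarrow> ('g, 'c) tgroup_scheme \<Rightarrow> nat \<Rightarrow> ('g, 'r) cgr set" where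
  "aug_power R G m = cgr_topology R G closure_of
     (augmentation_ideal R G [^]\<^bsub>ideals_set (completed_group_ring R G)\<^esub> m)"

definition cgr_add :: "('r, 'b) ring_scheme \<Rightarrow> ('g, 'c) tgroup_scheme \<Rightarrow> ('g, 'r) cgr tgroup" where
  "cgr_add R G = with_top (add_monoid (completed_group_ring R G)) (cgr_topology R G)"

text \<open>
  \<open>\<Lambda>\<^sub>m = \<Lambda>/\<I>\<^sup>m\<close> and \<open>\<I>\<^sub>m = \<I>/\<I>\<^sup>m\<close> as \<open>G\<close>-modules.  Elements of both are cosets of \<open>\<I>\<^sup>m\<close>, so the inclusion
  \<open>\<I>\<^sub>m \<rightarrow> \<Lambda>\<^sub>m\<close> is the identity, and \<open>g\<close> maps the coset \<open>K\<close> to the coset \<open>{g x | x \<in> K}\<close>.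
\<close>

definition Lambda_mod ::
    "('r, 'b) ring_scheme \<Rightarrow> ('g, 'c) tgroup_scheme \<Rightarrow> nat \<Rightarrow> ('g, ('g, 'r) cgr set) tmod" where
  "Lambda_mod R G m = with_act (tquot (cgr_add R G) (aug_power R G m))
     (\<lambda>g K. group_elem R G g <#\<^bsub>completed_group_ring R G\<^esub> K)"

definition Aug_mod ::
    "('r, 'b) ring_scheme \<Rightarrow> ('g, 'c) tgroup_scheme \<Rightarrow> nat \<Rightarrow> ('g, ('g, 'r) cgr set) tmod" where
  "Aug_mod R G m = with_act (tquot (tsub (cgr_add R G) (augmentation_ideal R G)) (aug_power R G m))
     (\<lambda>g K. group_elem R G g <#\<^bsub>completed_group_ring R G\<^esub> K)"

text \<open>
  The dual \<open>M\<^sup>\<or> = Hom(M, R)\<close> of a profinite \<open>G\<close>-module \<open>M\<close>; it is discrete, and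
  \<open>(\<sigma> f)(x) = f(\<sigma>\<^sup>-\<^sup>1 x)\<close>.
\<close>

definition dual_mod ::
    "('r, 'b) ring_scheme \<Rightarrow> ('g, 'c) tgroup_scheme \<Rightarrow> ('g, 'm) tmod \<Rightarrow> ('g, 'm \<Rightarrow> 'r) tmod" where
  "dual_mod R G M = (let D = {f \<in> hom M (add_monoid R) \<inter> extensional (carrier M).
       continuous_map (gtop M) (discrete_topology (carrier R)) f} in
     \<lparr>carrier = D,
      monoid.mult = (\<lambda>f f'. \<lambda>x\<in>carrier M. f x \<oplus>\<^bsub>R\<^esub> f' x),
      one = (\<lambda>x\<in>carrier M. \<zero>\<^bsub>R\<^esub>),
      gtop = discrete_topology D,
      act = (\<lambda>\<sigma> f. \<lambda>x\<in>carrier M. f (act M (inv\<^bsub>G\<^esub> \<sigma>) x))\<rparr>)"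

text \<open>
  The maps of \<open>0 \<rightarrow> R \<rightarrow> \<Lambda>\<^sub>m\<^sup>\<or> \<rightarrow> \<I>\<^sub>m\<^sup>\<or> \<rightarrow> 0\<close>.  The first one is dual to the augmentation
  \<open>\<Lambda>\<^sub>m \<rightarrow> R\<close>, with \<open>a\<close> in \<open>R\<close> identified with the homomorphism \<open>b \<mapsto> a b\<close> from \<open>R\<close> to \<open>R\<close>.
\<close>

definition dual_augmentation ::
    "('r, 'b) ring_scheme \<Rightarrow> ('g, 'c) tgroup_scheme \<Rightarrow> nat \<Rightarrow> 'r \<Rightarrow> ('g, 'r) cgr set \<Rightarrow> 'r" where
  "dual_augmentation R G m a =
     (\<lambda>K\<in>carrier (Lambda_mod R G m). a \<otimes>\<^bsub>R\<^esub> the_elem (augmentation G ` K))"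

definition dual_restriction ::
    "('r, 'b) ring_scheme \<Rightarrow> ('g, 'c) tgroup_scheme \<Rightarrow> nat \<Rightarrow>
      (('g, 'r) cgr set \<Rightarrow> 'r) \<Rightarrow> ('g, 'r) cgr set \<Rightarrow> 'r" where
  "dual_restriction R G m f = (\<lambda>K\<in>carrier (Aug_mod R G m). f K)"

text \<open>\<open>\<Psi> = \<delta> \<circ> d\<^sub>2\<close>, for the group \<open>GG\<close> and its normal subgroup \<open>H\<close>, with \<open>G = GG/H\<close>.\<close>

definition Psi ::
    "('r, 'b) ring_scheme \<Rightarrow> ('g, 'c) tgroup_scheme \<Rightarrow> 'g set \<Rightarrow> nat \<Rightarrow>
      ((nat \<Rightarrow> 'g) \<Rightarrow> ('g set, 'r) cgr set \<Rightarrow> 'r) set \<Rightarrow> ((nat \<Rightarrow> 'g set) \<Rightarrow> 'r) set" where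
  "Psi R GG H m \<phi> = (let G = tquot GG H in
     connecting G (trivial_mod (discrete_add R)) (dual_augmentation R G m)
       (dual_mod R G (Lambda_mod R G m)) (dual_restriction R G m) 2
       (hs_d2 GG H (dual_mod R G (Aug_mod R G m)) \<phi>))"

end

theory Submission
  imports Defs "HOL-Algebra.Zassenhaus"
begin

text \<open>
  A class \<open>\<phi>\<close> in \<open>H\<^sup>1(H, N)\<^sup>G\<close> is an invariant homomorphism \<open>f\<close>. It extends to a continuous 1-cochain \<open>F\<close>
  of \<open>GG\<close> with \<open>F(g h) = F(g) + g f(h)\<close>, whose coboundary is inflated from a cocycle \<open>u\<close> of \<open>G\<close>, and
  \<open>d\<^sub>2 \<phi>\<close> is the class of \<open>u\<close>. If \<open>\<phi>\<close> lifts to the dual of \<open>\<Lambda>\<^sub>m\<close>, so do \<open>F\<close> and \<open>u\<close>, hence \<open>\<Psi>(\<phi>) = 0\<close>.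
  Conversely, if \<open>\<Psi>(\<phi>) = 0\<close>, then \<open>u\<close> lifts to a cocycle \<open>y\<close> with values in the dual of \<open>\<Lambda>\<^sub>m\<close>. For any
  cochain \<open>F'\<close> lifting \<open>F\<close> the difference of \<open>d F'\<close> and the inflation of \<open>y\<close> is a 2-cocycle of \<open>GG\<close> with
  constant coefficients. If inflation is surjective, this cocycle is the coboundary of some \<open>a\<close> plus an
  inflated cocycle, so \<open>d(F' - a)\<close> is inflated from \<open>G\<close>, and, after normalization, the restriction of
  \<open>F' - a\<close> to \<open>H\<close> is an invariant homomorphism lifting \<open>f\<close>.
\<close>

section \<open>Continuous cochains in low degrees\<close>

text \<open>The definition of \<open>hs_d2\<close> inverts two edge maps by arbitrary preimages, so
  its value must be shown independent of them: two cochains with inflated coboundary and the same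
  restriction to \<open>H\<close> differ by an inflated 1-cochain, which changes the cocycle on the
  quotient by a coboundary. The filtration consists of normalized cochains; this is the origin of
  the corrections by constant cochains that force the value 0 at 1. All coefficient modules are
  discrete, so cochains are lifted along a surjection of modules by any set-theoretic section. That
  the duals are discrete modules rests on the fact that a continuous functional on the inverse limit
  sees only finitely many components. Functionals extend from the augmentation ideal to the whole
  ring because x - \<epsilon>(x) 1 projects additively onto the ideal; this projection is in general
  not equivariant. The kernel of the restriction of functionals is Z/l^n because every additive
  endomorphism of Z/l^n is multiplication by a constant, and the trivial action on this kernel
  brings the hypothesis on inflation into play.\<close>

lemma continuous_map_discrete_iff:
  "continuous_map X (discrete_topology D) f \<longleftrightarrow>
    f \<in> topspace X \<rightarrow> D \<and> (\<forall>d\<in>D. openin X {x \<in> topspace X. f x = d})"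
proof
  assume f: "continuous_map X (discrete_topology D) f"
  have "openin X {x \<in> topspace X. f x \<in> {d}}" if "d \<in> D" for d
    using f that by (intro openin_continuous_map_preimage[OF f]) auto
  then show "f \<in> topspace X \<rightarrow> D \<and> (\<forall>d\<in>D. openin X {x \<in> topspace X. f x = d})"
    using f by (auto simp: continuous_map_def)
next
  assume f: "f \<in> topspace X \<rightarrow> D \<and> (\<forall>d\<in>D. openin X {x \<in> topspace X. f x = d})"
  have "openin X {x \<in> topspace X. f x \<in> U}" if "U \<subseteq> D" for U
  proof -
    have "{x \<in> topspace X. f x \<in> U} = (\<Union>d\<in>U. {x \<in> topspace X. f x = d})" by auto
    also have "openin X \<dots>" using f that by (intro openin_Union) auto
    finally show ?thesis .
  qed
  then show "continuous_map X (discrete_topology D) f"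
    using f by (auto simp: continuous_map_def)
qed

text \<open>The fibres of \<open>f\<close> are open and cover the domain, and on each of them the
  map is the continuous \<open>h d\<close>. This upgrades continuity of an action in the group
  variable, given for each fixed module element, to joint continuity.\<close>

lemma continuous_map_discrete_dependent:
  assumes f: "continuous_map X (discrete_topology D) f"
    and h: "\<And>d. d \<in> D \<Longrightarrow> continuous_map X (discrete_topology E) (h d)"
  shows "continuous_map X (discrete_topology E) (\<lambda>x. h (f x) x)"
proof -
  have "openin X {x \<in> topspace X. h (f x) x = e}" if "e \<in> E" for e
  proof -
    have "{x \<in> topspace X. h (f x) x = e}
        = (\<Union>d\<in>D. {x \<in> topspace X. f x = d} \<inter> {x \<in> topspace X. h d x = e})"
      using f by (auto simp: continuous_map_discrete_iff)
    also have "openin X \<dots>"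
      using f h that by (intro openin_Union) (auto simp: continuous_map_discrete_iff)
    finally show ?thesis .
  qed
  then show ?thesis using f h by (fastforce simp: continuous_map_discrete_iff)
qed

lemma continuous_map_discrete_binary:
  assumes "continuous_map X (discrete_topology D) f" "continuous_map X (discrete_topology E) g"
    and "\<And>d e. d \<in> D \<Longrightarrow> e \<in> E \<Longrightarrow> h d e \<in> F"
  shows "continuous_map X (discrete_topology F) (\<lambda>x. h (f x) (g x))"
proof (rule continuous_map_discrete_dependent[OF assms(1)])
  fix d assume "d \<in> D"
  then have "continuous_map (discrete_topology E) (discrete_topology F) (h d)"
    using assms(3) by auto
  then show "continuous_map X (discrete_topology F) (\<lambda>x. h d (g x))"
    using continuous_map_compose[OF assms(2), of _ "h d"] by (simp add: o_def)
qed

lemma continuous_map_discrete_unary: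
  assumes "continuous_map X (discrete_topology D) f" "h \<in> D \<rightarrow> E"
  shows "continuous_map X (discrete_topology E) (\<lambda>x. h (f x))"
  using continuous_map_discrete_binary[OF assms(1) assms(1), of "\<lambda>d e. h d" E] assms(2) by auto

text \<open>Every element of \<open>tuples G k\<close> has this form by extensionality, so
  identities between cochains of low degree reduce to explicit arguments such as
  \<open>tup [a, b]\<close>.\<close>

definition tup :: "'g list \<Rightarrow> nat \<Rightarrow> 'g" where
  "tup xs = (\<lambda>i\<in>{..<length xs}. xs ! i)"

lemma tup_nth [simp]: "i < length xs \<Longrightarrow> tup xs i = xs ! i"
  by (simp add: tup_def)

lemma tup_in_tuples [simp]: "tup xs \<in> tuples G k" if "length xs = k" "set xs \<subseteq> carrier G"
  using that by (auto simp: tup_def tuples_def)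

lemma tuples_eq_tup: "x \<in> tuples G k \<Longrightarrow> x = tup (map x [0..<k])"
  by (rule ext) (auto simp: tup_def tuples_def PiE_def extensional_def)

lemma tuples_1E:
  assumes "x \<in> tuples G (Suc 0)"
  obtains a where "a \<in> carrier G" "x = tup [a]"
proof -
  have "map x [0..<(Suc 0)] = [x 0]" by (simp add: upt_rec numeral_2_eq_2 numeral_3_eq_3)
  then have *: "x = tup [x 0]" using tuples_eq_tup[OF assms] by metis
  have **: "x i \<in> carrier G" if "i < (Suc 0)" for i using assms that by (auto simp: tuples_def)
  show ?thesis by (rule that[OF ** *]) simp_all
qed

lemma tuples_2E:
  assumes "x \<in> tuples G 2"
  obtains a b where "a \<in> carrier G" "b \<in> carrier G" "x = tup [a, b]"
proof -
  have "map x [0..<2] = [x 0, x 1]" by (simp add: upt_rec numeral_2_eq_2 numeral_3_eq_3)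
  then have *: "x = tup [x 0, x 1]" using tuples_eq_tup[OF assms] by metis
  have **: "x i \<in> carrier G" if "i < 2" for i using assms that by (auto simp: tuples_def)
  show ?thesis by (rule that[OF ** ** *]) simp_all
qed

lemma tuples_3E:
  assumes "x \<in> tuples G 3"
  obtains a b c where "a \<in> carrier G" "b \<in> carrier G" "c \<in> carrier G" "x = tup [a, b, c]"
proof -
  have "map x [0..<3] = [x 0, x 1, x 2]" by (simp add: upt_rec numeral_2_eq_2 numeral_3_eq_3)
  then have *: "x = tup [x 0, x 1, x 2]" using tuples_eq_tup[OF assms] by metis
  have **: "x i \<in> carrier G" if "i < 3" for i using assms that by (auto simp: tuples_def)
  show ?thesis by (rule that[OF ** ** ** *]) simp_all
qed

lemma tuples_4E:
  assumes "x \<in> tuples G 4"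
  obtains a b c d where "a \<in> carrier G" "b \<in> carrier G" "c \<in> carrier G" "d \<in> carrier G" "x = tup [a, b, c, d]"
proof -
  have "map x [0..<4] = [x 0, x 1, x 2, x 3]" by (simp add: upt_rec numeral_2_eq_2 numeral_3_eq_3)
  then have *: "x = tup [x 0, x 1, x 2, x 3]" using tuples_eq_tup[OF assms] by metis
  have **: "x i \<in> carrier G" if "i < 4" for i using assms that by (auto simp: tuples_def)
  show ?thesis by (rule that[OF ** ** ** ** *]) simp_all
qed

lemma restrict_tup_map:
  "k = length xs \<Longrightarrow> (\<lambda>i\<in>{..<k}. \<alpha> (tup xs i)) = tup (map \<alpha> xs)"
  by (auto simp: tup_def fun_eq_iff)

lemma tup_drop: "k = length xs \<Longrightarrow> (\<lambda>i\<in>{..<k}. tup (x # xs) (Suc i)) = tup xs"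
  by (auto simp: tup_def fun_eq_iff)

lemma tup_take: "k \<le> length xs \<Longrightarrow> (\<lambda>i\<in>{..<k}. tup xs i) = tup (take k xs)"
  by (auto simp: tup_def fun_eq_iff)

text \<open>The inner faces of the bar construction. The two outer faces, which drop the first or
  the last entry, enter the coboundary formula separately.\<close>

definition face :: "('g, 'b) tgroup_scheme \<Rightarrow> nat \<Rightarrow> nat \<Rightarrow> (nat \<Rightarrow> 'g) \<Rightarrow> nat \<Rightarrow> 'g" where
  "face G k j x =
    (\<lambda>i\<in>{..<k}. if i < j then x i else if i = j then x i \<otimes>\<^bsub>G\<^esub> x (Suc i) else x (Suc i))"

lemma diff_eq_SucD: "(x :: nat) - j = Suc y \<Longrightarrow> x = Suc (j + y)"
  by simp

lemma face_tup:
  "j < k \<Longrightarrow> length xs = Suc k \<Longrightarrow>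
    face G k j (tup xs) = tup (take j xs @ (xs ! j \<otimes>\<^bsub>G\<^esub> xs ! Suc j) # drop (Suc (Suc j)) xs)"
  by (rule ext) (auto simp: face_def tup_def nth_append nth_Cons min_def split: nat.splits
      dest!: diff_eq_SucD)

lemma carrier_cochain_group [simp]: "carrier (cochain_group G M k) = cochains G M k"
  by (simp add: cochain_group_def)

lemma cochain_mult_apply [simp]:
  "x \<in> tuples G k \<Longrightarrow> (f \<otimes>\<^bsub>cochain_group G M k\<^esub> f') x = f x \<otimes>\<^bsub>M\<^esub> f' x"
  by (simp add: cochain_group_def)

lemma cochain_one_apply [simp]: "x \<in> tuples G k \<Longrightarrow> \<one>\<^bsub>cochain_group G M k\<^esub> x = \<one>\<^bsub>M\<^esub>"
  by (simp add: cochain_group_def)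

lemma cochain_extensional [simp]:
  "f \<otimes>\<^bsub>cochain_group G M k\<^esub> f' \<in> extensional (tuples G k)"
  "\<one>\<^bsub>cochain_group G M k\<^esub> \<in> extensional (tuples G k)"
  "coboundary G M k f \<in> extensional (tuples G (Suc k))"
  by (simp_all add: cochain_group_def coboundary_def)

lemma tuples_eqI:
  assumes "f \<in> extensional (tuples G k)" "f' \<in> extensional (tuples G k)"
    and "\<And>x. x \<in> tuples G k \<Longrightarrow> f x = f' x"
  shows "f = f'"
  using assms by (rule extensionalityI)

lemma cochains_extensional: "f \<in> cochains G M k \<Longrightarrow> f \<in> extensional (tuples G k)"
  by (auto simp: cochains_def PiE_def)

lemma cochains_closed: "f \<in> cochains G M k \<Longrightarrow> x \<in> tuples G k \<Longrightarrow> f x \<in> carrier M"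
  by (auto simp: cochains_def)

context topological_group
begin

lemma topspace_tuples: "topspace (product_topology (\<lambda>_. gtop G) {..<k}) = tuples G k"
  by (simp add: tuples_def topspace_gtop)

lemma continuous_map_mult:
  assumes "continuous_map X (gtop G) f" "continuous_map X (gtop G) f'"
  shows "continuous_map X (gtop G) (\<lambda>x. f x \<otimes> f' x)"
  using continuous_map_compose[OF continuous_map_pairedI[OF assms] continuous_mult]
  by (simp add: o_def)

lemma continuous_map_tuples_component:
  "i < k \<Longrightarrow> continuous_map (product_topology (\<lambda>_. gtop G) {..<k}) (gtop G) (\<lambda>x. x i)"
  using continuous_map_product_projection[of i "{..<k}" "\<lambda>_. gtop G"] by simp

lemma continuous_map_face:
  assumes "j < k"
  shows "continuous_map (product_topology (\<lambda>_. gtop G) {..<Suc k})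
    (product_topology (\<lambda>_. gtop G) {..<k}) (face G k j)"
  unfolding face_def
  using assms
  by (auto simp: continuous_map_componentwise intro!: continuous_map_mult continuous_map_tuples_component)

lemma continuous_map_drop:
  "continuous_map (product_topology (\<lambda>_. gtop G) {..<Suc k})
    (product_topology (\<lambda>_. gtop G) {..<k}) (\<lambda>x. \<lambda>i\<in>{..<k}. x (Suc i))"
  by (auto simp: continuous_map_componentwise intro!: continuous_map_tuples_component)

lemma continuous_map_take:
  "continuous_map (product_topology (\<lambda>_. gtop G) {..<Suc k})
    (product_topology (\<lambda>_. gtop G) {..<k}) (\<lambda>x. \<lambda>i\<in>{..<k}. x i)"
  by (auto simp: continuous_map_componentwise intro!: continuous_map_tuples_component)

end

lemma (in topological_group) face_in_tuples: "j < k \<Longrightarrow> x \<in> tuples G (Suc k) \<Longrightarrow> face G k j x \<in> tuples G k"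
  by (auto simp: face_def tuples_def PiE_def Pi_def)

lemma drop_in_tuples: "x \<in> tuples G (Suc k) \<Longrightarrow> (\<lambda>i\<in>{..<k}. x (Suc i)) \<in> tuples G k"
  by (auto simp: tuples_def)

lemma take_in_tuples: "x \<in> tuples G (Suc k) \<Longrightarrow> (\<lambda>i\<in>{..<k}. x i) \<in> tuples G k"
  by (simp add: tuples_def PiE_def Pi_def)

lemma (in comm_monoid) mult_mult_mult_swap:
  assumes "a \<in> carrier G" "b \<in> carrier G" "c \<in> carrier G"
    "a' \<in> carrier G" "b' \<in> carrier G" "c' \<in> carrier G"
  shows "(a \<otimes> a') \<otimes> (b \<otimes> b') \<otimes> (c \<otimes> c') = (a \<otimes> b \<otimes> c) \<otimes> (a' \<otimes> b' \<otimes> c')"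
  using assms by (simp add: m_ac)

text \<open>Continuity is asked of each orbit map; since the module is discrete, joint continuity of
  the action follows in \<open>continuous_map_act\<close>.\<close>

locale discrete_module = topological_group G + M: comm_group M
  for G :: "('g, 'b) tgroup_scheme" (structure) and M :: "('g, 'm) tmod" +
  assumes gtop_M: "gtop M = discrete_topology (carrier M)"
    and act_hom: "g \<in> carrier G \<Longrightarrow> act M g \<in> hom M M"
    and act_one: "x \<in> carrier M \<Longrightarrow> act M \<one> x = x"
    and act_act: "g \<in> carrier G \<Longrightarrow> h \<in> carrier G \<Longrightarrow> x \<in> carrier M \<Longrightarrow>
      act M (g \<otimes> h) x = act M g (act M h x)"
    and act_continuous: "x \<in> carrier M \<Longrightarrow>
      continuous_map (gtop G) (discrete_topology (carrier M)) (\<lambda>g. act M g x)"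
begin

lemma act_closed [simp]: "g \<in> carrier G \<Longrightarrow> x \<in> carrier M \<Longrightarrow> act M g x \<in> carrier M"
  using act_hom by (auto simp: hom_def)

lemma act_mult: "g \<in> carrier G \<Longrightarrow> x \<in> carrier M \<Longrightarrow> y \<in> carrier M \<Longrightarrow>
    act M g (x \<otimes>\<^bsub>M\<^esub> y) = act M g x \<otimes>\<^bsub>M\<^esub> act M g y"
  using act_hom by (auto simp: hom_def)

lemma act_group_hom: "g \<in> carrier G \<Longrightarrow> group_hom M M (act M g)"
  by (simp add: act_hom group_hom_axioms_def group_hom_def M.group_axioms)

lemma act_inv: "g \<in> carrier G \<Longrightarrow> x \<in> carrier M \<Longrightarrow> act M g (inv\<^bsub>M\<^esub> x) = inv\<^bsub>M\<^esub> act M g x"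
  using act_group_hom by (simp add: group_hom.hom_inv)

lemma act_unit [simp]: "g \<in> carrier G \<Longrightarrow> act M g \<one>\<^bsub>M\<^esub> = \<one>\<^bsub>M\<^esub>"
  using act_group_hom by (simp add: group_hom.hom_one)

lemma continuous_map_mult_M:
  assumes "continuous_map X (gtop M) f" "continuous_map X (gtop M) f'"
  shows "continuous_map X (gtop M) (\<lambda>x. f x \<otimes>\<^bsub>M\<^esub> f' x)"
  using assms unfolding gtop_M by (rule continuous_map_discrete_binary) auto

lemma continuous_map_int_pow_M:
  assumes "continuous_map X (gtop M) f"
  shows "continuous_map X (gtop M) (\<lambda>x. f x [^]\<^bsub>M\<^esub> (e :: int))"
  using assms unfolding gtop_M by (rule continuous_map_discrete_unary) auto

lemma continuous_map_finprod_M: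
  assumes "finite A" "\<And>j. j \<in> A \<Longrightarrow> continuous_map X (gtop M) (f j)"
  shows "continuous_map X (gtop M) (\<lambda>x. \<Otimes>\<^bsub>M\<^esub>j\<in>A. f j x)"
  using assms
proof (induction A)
  case empty
  then show ?case by (simp add: gtop_M)
next
  case (insert a A)
  have "continuous_map X (gtop M) (\<lambda>x. f a x \<otimes>\<^bsub>M\<^esub> (\<Otimes>\<^bsub>M\<^esub>j\<in>A. f j x))"
    using insert by (intro continuous_map_mult_M) auto
  then show ?case
  proof (rule continuous_map_eq)
    fix x assume "x \<in> topspace X"
    then have "f j x \<in> carrier M" if "j \<in> insert a A" for j
      using insert.prems[OF that] by (auto simp: continuous_map_def gtop_M)
    then show "f a x \<otimes>\<^bsub>M\<^esub> (\<Otimes>\<^bsub>M\<^esub>j\<in>A. f j x) = (\<Otimes>\<^bsub>M\<^esub>j\<in>insert a A. f j x)"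
      using insert by (subst M.finprod_insert) (auto simp: Pi_def)
  qed
qed

lemma continuous_map_act:
  assumes "continuous_map X (gtop G) a" "continuous_map X (gtop M) f"
  shows "continuous_map X (gtop M) (\<lambda>x. act M (a x) (f x))"
  unfolding gtop_M
proof (rule continuous_map_discrete_dependent[OF assms(2)[unfolded gtop_M]])
  fix m assume "m \<in> carrier M"
  then show "continuous_map X (discrete_topology (carrier M)) (\<lambda>x. act M (a x) m)"
    using continuous_map_compose[OF assms(1) act_continuous] by (simp add: o_def)
qed

lemma cochains_iff:
  "f \<in> cochains G M k \<longleftrightarrow> f \<in> extensional (tuples G k) \<and>
     continuous_map (product_topology (\<lambda>_. gtop G) {..<k}) (gtop M) f"
  by (auto simp: cochains_def continuous_map_def tuples_def topspace_gtop gtop_M PiE_def)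

lemma cochainsI:
  assumes "continuous_map (product_topology (\<lambda>_. gtop G) {..<k}) (gtop M) f"
  shows "(\<lambda>x\<in>tuples G k. f x) \<in> cochains G M k"
  unfolding cochains_iff
  using continuous_map_eq[OF assms, of "restrict f (tuples G k)"] by (simp add: tuples_def topspace_gtop)

lemma cochain_continuous:
  "f \<in> cochains G M k \<Longrightarrow> continuous_map (product_topology (\<lambda>_. gtop G) {..<k}) (gtop M) f"
  by (simp add: cochains_iff)

lemma coboundary_face:
  "coboundary G M k f = (\<lambda>x\<in>tuples G (Suc k).
     act M (x 0) (f (\<lambda>i\<in>{..<k}. x (Suc i)))
     \<otimes>\<^bsub>M\<^esub> (\<Otimes>\<^bsub>M\<^esub>j\<in>{..<k}. f (face G k j x) [^]\<^bsub>M\<^esub> ((-1 :: int) ^ Suc j))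
     \<otimes>\<^bsub>M\<^esub> f (\<lambda>i\<in>{..<k}. x i) [^]\<^bsub>M\<^esub> ((-1 :: int) ^ Suc k))"
  by (simp add: coboundary_def face_def)

lemma coboundary_in_cochains:
  assumes "f \<in> cochains G M k"
  shows "coboundary G M k f \<in> cochains G M (Suc k)"
proof -
  note c = continuous_map_compose[OF _ cochain_continuous[OF assms], unfolded o_def]
  show ?thesis
    unfolding coboundary_face
    by (intro cochainsI continuous_map_mult_M continuous_map_act continuous_map_finprod_M
        continuous_map_int_pow_M c continuous_map_face continuous_map_drop continuous_map_take
        continuous_map_tuples_component) auto
qed

lemma cochain_mult_closed:
  assumes "f \<in> cochains G M k" "f' \<in> cochains G M k"
  shows "f \<otimes>\<^bsub>cochain_group G M k\<^esub> f' \<in> cochains G M k"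
  unfolding cochain_group_def monoid.simps
  using assms by (intro cochainsI continuous_map_mult_M cochain_continuous)

lemma cochain_one_closed: "\<one>\<^bsub>cochain_group G M k\<^esub> \<in> cochains G M k"
  unfolding cochain_group_def monoid.simps by (intro cochainsI) (simp add: gtop_M)

lemma cochain_eqI:
  assumes "f \<in> cochains G M k" "f' \<in> cochains G M k" "\<And>x. x \<in> tuples G k \<Longrightarrow> f x = f' x"
  shows "f = f'"
  using assms by (intro tuples_eqI) (auto simp: cochains_extensional)

lemma group_cochains: "comm_group (cochain_group G M k)"
proof (rule comm_groupI)
  fix f assume f: "f \<in> carrier (cochain_group G M k)"
  then show "\<one>\<^bsub>cochain_group G M k\<^esub> \<otimes>\<^bsub>cochain_group G M k\<^esub> f = f"
    by (intro cochain_eqI) (auto simp: cochains_closed cochain_mult_closed cochain_one_closed)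
  let ?g = "\<lambda>x\<in>tuples G k. f x [^]\<^bsub>M\<^esub> (-1 :: int)"
  have g: "?g \<in> cochains G M k"
    using f by (intro cochainsI continuous_map_int_pow_M cochain_continuous) auto
  moreover have "?g \<otimes>\<^bsub>cochain_group G M k\<^esub> f = \<one>\<^bsub>cochain_group G M k\<^esub>"
    using f g by (intro cochain_eqI[of _ k])
      (auto simp: M.int_pow_neg cochains_closed cochain_mult_closed cochain_one_closed)
  ultimately show "\<exists>y\<in>carrier (cochain_group G M k). y \<otimes>\<^bsub>cochain_group G M k\<^esub> f
      = \<one>\<^bsub>cochain_group G M k\<^esub>"
    unfolding carrier_cochain_group by blast
qed (auto intro!: tuples_eqI[of _ G k] simp: cochain_mult_closed cochain_one_closed cochains_closed M.m_ac)

lemma cochain_inv: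
  assumes "f \<in> cochains G M k" "x \<in> tuples G k"
  shows "(inv\<^bsub>cochain_group G M k\<^esub> f) x = inv\<^bsub>M\<^esub> (f x)"
proof -
  interpret C: comm_group "cochain_group G M k" by (rule group_cochains)
  have c: "inv\<^bsub>cochain_group G M k\<^esub> f \<in> cochains G M k" using C.inv_closed assms by simp
  have "inv\<^bsub>cochain_group G M k\<^esub> f \<otimes>\<^bsub>cochain_group G M k\<^esub> f = \<one>\<^bsub>cochain_group G M k\<^esub>"
    using C.l_inv assms by simp
  from fun_cong[OF this, of x]
have "(inv\<^bsub>cochain_group G M k\<^esub> f) x \<otimes>\<^bsub>M\<^esub> f x = \<one>\<^bsub>M\<^esub>"
    by (simp only: cochain_mult_apply[OF assms(2)] cochain_one_apply[OF assms(2)])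
  then show ?thesis using assms c by (metis M.inv_equality cochains_closed)
qed

lemma coboundary_apply:
  "x \<in> tuples G (Suc k) \<Longrightarrow> coboundary G M k f x =
     act M (x 0) (f (\<lambda>i\<in>{..<k}. x (Suc i)))
     \<otimes>\<^bsub>M\<^esub> (\<Otimes>\<^bsub>M\<^esub>j\<in>{..<k}. f (face G k j x) [^]\<^bsub>M\<^esub> ((-1 :: int) ^ Suc j))
     \<otimes>\<^bsub>M\<^esub> f (\<lambda>i\<in>{..<k}. x i) [^]\<^bsub>M\<^esub> ((-1 :: int) ^ Suc k)"
  by (simp add: coboundary_face)

text \<open>Each of the three blocks of the formula (the first face with the action, the product
  over the inner faces, the last face) is multiplicative in the cochain because the module is
  commutative; the blocks are then regrouped.\<close>

lemma coboundary_mult: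
  assumes f: "f \<in> cochains G M k" and f': "f' \<in> cochains G M k"
  shows "coboundary G M k (f \<otimes>\<^bsub>cochain_group G M k\<^esub> f')
    = coboundary G M k f \<otimes>\<^bsub>cochain_group G M (Suc k)\<^esub> coboundary G M k f'"
proof (rule tuples_eqI)
  fix x assume x: "x \<in> tuples G (Suc k)"
  note c = cochains_closed[OF f] cochains_closed[OF f']
  have x0: "x 0 \<in> carrier G" using x by (auto simp: tuples_def)
  let ?P = "\<lambda>f. (\<Otimes>\<^bsub>M\<^esub>j\<in>{..<k}. f (face G k j x) [^]\<^bsub>M\<^esub> ((-1 :: int) ^ Suc j))"
  let ?a = "\<lambda>f. act M (x 0) (f (\<lambda>i\<in>{..<k}. x (Suc i)))"
  let ?t = "\<lambda>f. f (\<lambda>i\<in>{..<k}. x i) [^]\<^bsub>M\<^esub> ((-1 :: int) ^ Suc k)"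
  let ?ff = "f \<otimes>\<^bsub>cochain_group G M k\<^esub> f'"
  have "?P ?ff = (\<Otimes>\<^bsub>M\<^esub>j\<in>{..<k}. f (face G k j x) [^]\<^bsub>M\<^esub> ((-1 :: int) ^ Suc j) \<otimes>\<^bsub>M\<^esub>
           f' (face G k j x) [^]\<^bsub>M\<^esub> ((-1 :: int) ^ Suc j))"
    using x by (intro M.finprod_cong') (auto simp: c face_in_tuples M.int_pow_distrib)
  also have "\<dots> = ?P f \<otimes>\<^bsub>M\<^esub> ?P f'"
    using x by (intro M.finprod_multf) (auto simp: c face_in_tuples)
  finally have P: "?P ?ff = ?P f \<otimes>\<^bsub>M\<^esub> ?P f'" .
  have Pc: "?P f \<in> carrier M" "?P f' \<in> carrier M"
    using x by (auto intro!: M.finprod_closed simp: c face_in_tuples simp del: power_Suc)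
  have ac: "?a f \<in> carrier M" "?a f' \<in> carrier M" "?t f \<in> carrier M" "?t f' \<in> carrier M"
    using x x0 by (auto simp: c drop_in_tuples take_in_tuples simp del: power_Suc)
  have a: "?a ?ff = ?a f \<otimes>\<^bsub>M\<^esub> ?a f'"
    using x x0 c by (simp add: act_mult drop_in_tuples)
  have t: "?t ?ff = ?t f \<otimes>\<^bsub>M\<^esub> ?t f'"
    using x c by (simp add: M.int_pow_distrib take_in_tuples del: power_Suc)
  have "coboundary G M k ?ff x = (?a f \<otimes>\<^bsub>M\<^esub> ?a f') \<otimes>\<^bsub>M\<^esub> (?P f \<otimes>\<^bsub>M\<^esub> ?P f') \<otimes>\<^bsub>M\<^esub> (?t f \<otimes>\<^bsub>M\<^esub> ?t f')"
    unfolding coboundary_apply[OF x] P a t ..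
  also have "\<dots> = (?a f \<otimes>\<^bsub>M\<^esub> ?P f \<otimes>\<^bsub>M\<^esub> ?t f) \<otimes>\<^bsub>M\<^esub> (?a f' \<otimes>\<^bsub>M\<^esub> ?P f' \<otimes>\<^bsub>M\<^esub> ?t f')"
    by (rule M.mult_mult_mult_swap) (fact ac Pc)+
  also have "\<dots> = (coboundary G M k f \<otimes>\<^bsub>cochain_group G M (Suc k)\<^esub> coboundary G M k f') x"
    unfolding cochain_mult_apply[OF x] coboundary_apply[OF x] ..
  finally show "coboundary G M k ?ff x
    = (coboundary G M k f \<otimes>\<^bsub>cochain_group G M (Suc k)\<^esub> coboundary G M k f') x" .
qed auto

lemma coboundary_group_hom:
  "group_hom (cochain_group G M k) (cochain_group G M (Suc k)) (coboundary G M k)"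
  using coboundary_mult coboundary_in_cochains group_cochains
  by (auto simp: group_hom_def group_hom_axioms_def comm_group_def hom_def)

end

lemma (in comm_group) finprod_group_hom:
  assumes "comm_group K" "h \<in> hom G K" "finite A" "f \<in> A \<rightarrow> carrier G"
  shows "h (\<Otimes>j\<in>A. f j) = (\<Otimes>\<^bsub>K\<^esub>j\<in>A. h (f j))"
proof -
  interpret K: comm_group K by fact
  interpret h: group_hom G K h
    using assms by (simp add: group_hom_def group_hom_axioms_def K.group_axioms group_axioms)
  show ?thesis
    using assms(3,4) by (induction A) (simp_all add: Pi_def)
qed

section \<open>Explicit coboundaries in degrees 0 to 3 and the vanishing of d d\<close>

lemma (in comm_group) mult_inv_cancel:
  "x = y \<Longrightarrow> y \<in> carrier G \<Longrightarrow> x \<otimes> inv y = \<one>"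
  by simp

text \<open>The six letters are the values of a 1-cochain that enter d d; each occurs once with each
  sign. Positive and negative occurrences are collected into two products that agree up to
  order.\<close>

lemma (in comm_group) coboundary_squared_1_aux:
  assumes c: "A \<in> carrier G" "B \<in> carrier G" "C \<in> carrier G" "D \<in> carrier G" "E \<in> carrier G"
    "F \<in> carrier G"
  shows "(A \<otimes> inv B \<otimes> C) \<otimes> inv (A \<otimes> inv D \<otimes> E) \<otimes> (B \<otimes> inv D \<otimes> F) \<otimes> inv (C \<otimes> inv E \<otimes> F) = \<one>"
proof -
  \<comment> \<open>Cancellation is held back so that both products come out in full; the second is
    then recognized as the inverse of a reordering of the first.\<close>
  have "(A \<otimes> inv B \<otimes> C) \<otimes> inv (A \<otimes> inv D \<otimes> E) \<otimes> (B \<otimes> inv D \<otimes> F) \<otimes> inv (C \<otimes> inv E \<otimes> F)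
    = (A \<otimes> C \<otimes> D \<otimes> B \<otimes> F \<otimes> E) \<otimes> (inv B \<otimes> inv A \<otimes> inv E \<otimes> inv D \<otimes> inv C \<otimes> inv F)"
    using c by (simp add: inv_mult m_ac del: r_inv l_inv Units_r_inv Units_l_inv)
  also have "(inv B \<otimes> inv A \<otimes> inv E \<otimes> inv D \<otimes> inv C \<otimes> inv F) = inv (B \<otimes> A \<otimes> E \<otimes> D \<otimes> C \<otimes> F)"
    using c by (simp add: inv_mult)
  finally show ?thesis using c by (simp only:) (intro mult_inv_cancel; simp add: m_ac)
qed

text \<open>The same bookkeeping for the ten values of a 2-cochain in d d.\<close>

lemma (in comm_group) coboundary_squared_2_aux:
  assumes c: "A \<in> carrier G" "B \<in> carrier G" "C \<in> carrier G" "D \<in> carrier G" "E \<in> carrier G"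
    "F \<in> carrier G" "K \<in> carrier G" "H \<in> carrier G" "I \<in> carrier G" "J \<in> carrier G"
  shows "(A \<otimes> inv B \<otimes> C \<otimes> inv D) \<otimes> inv (A \<otimes> inv E \<otimes> F \<otimes> inv K) \<otimes> (B \<otimes> inv E \<otimes> H \<otimes> inv I)
    \<otimes> inv (C \<otimes> inv F \<otimes> H \<otimes> inv J) \<otimes> (D \<otimes> inv K \<otimes> I \<otimes> inv J) = \<one>"
proof -
  have "(A \<otimes> inv B \<otimes> C \<otimes> inv D) \<otimes> inv (A \<otimes> inv E \<otimes> F \<otimes> inv K) \<otimes> (B \<otimes> inv E \<otimes> H \<otimes> inv I)
    \<otimes> inv (C \<otimes> inv F \<otimes> H \<otimes> inv J) \<otimes> (D \<otimes> inv K \<otimes> I \<otimes> inv J)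
    = (A \<otimes> C \<otimes> E \<otimes> K \<otimes> B \<otimes> H \<otimes> F \<otimes> J \<otimes> D \<otimes> I)
      \<otimes> (inv B \<otimes> inv D \<otimes> inv A \<otimes> inv F \<otimes> inv E \<otimes> inv I \<otimes> inv C \<otimes> inv H \<otimes> inv K \<otimes> inv J)"
    using c by (simp add: inv_mult m_ac del: r_inv l_inv Units_r_inv Units_l_inv)
  also have "(inv B \<otimes> inv D \<otimes> inv A \<otimes> inv F \<otimes> inv E \<otimes> inv I \<otimes> inv C \<otimes> inv H \<otimes> inv K \<otimes> inv J)
      = inv (B \<otimes> D \<otimes> A \<otimes> F \<otimes> E \<otimes> I \<otimes> C \<otimes> H \<otimes> K \<otimes> J)"
    using c by (simp add: inv_mult)
  finally show ?thesis using c by (simp only:) (intro mult_inv_cancel; simp add: m_ac)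
qed

lemma restrict_empty_tup: "restrict x {} = tup []"
  by (simp add: tup_def restrict_def fun_eq_iff)

context discrete_module
begin

lemma int_pow_uminus_one: "x \<in> carrier M \<Longrightarrow> x [^]\<^bsub>M\<^esub> (-1 :: int) = inv\<^bsub>M\<^esub> x"
  by (simp add: M.int_pow_neg)

lemma coboundary_0:
  assumes f: "f \<in> cochains G M 0" and a: "a \<in> carrier G"
  shows "coboundary G M 0 f (tup [a]) = act M a (f (tup [])) \<otimes>\<^bsub>M\<^esub> inv\<^bsub>M\<^esub> f (tup [])"
proof -
  have "f (tup []) \<in> carrier M" by (rule cochains_closed[OF f]) simp
  then show ?thesis
    using a by (subst coboundary_apply) (simp_all add: restrict_empty_tup int_pow_uminus_one)
qed

lemma coboundary_1:
  assumes f: "f \<in> cochains G M (Suc 0)" and a: "a \<in> carrier G" and b: "b \<in> carrier G"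
  shows "coboundary G M (Suc 0) f (tup [a, b])
    = act M a (f (tup [b])) \<otimes>\<^bsub>M\<^esub> inv\<^bsub>M\<^esub> f (tup [a \<otimes> b]) \<otimes>\<^bsub>M\<^esub> f (tup [a])"
proof -
  have c: "f (tup [x]) \<in> carrier M" if "x \<in> carrier G" for x
    using that by (intro cochains_closed[OF f]) simp
  have d: "(\<lambda>i\<in>{..<Suc 0}. tup [a, b] (Suc i)) = tup [b]"
    using tup_drop[of "Suc 0" "[b]"] by simp
  have t: "(\<lambda>i\<in>{..<Suc 0}. tup [a, b] i) = tup [a]"
    using tup_take[of "Suc 0" "[a, b]"] by simp
  have e: "face G (Suc 0) 0 (tup [a, b]) = tup [a \<otimes> b]"
    using face_tup[of 0 "Suc 0" "[a, b]"] by simp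
  have "coboundary G M (Suc 0) f (tup [a, b]) = act M a (f (tup [b]))
     \<otimes>\<^bsub>M\<^esub> (\<Otimes>\<^bsub>M\<^esub>j\<in>{..<Suc 0}. f (face G (Suc 0) j (tup [a, b])) [^]\<^bsub>M\<^esub> ((-1 :: int) ^ Suc j))
     \<otimes>\<^bsub>M\<^esub> f (tup [a]) [^]\<^bsub>M\<^esub> ((-1 :: int) ^ Suc (Suc 0))"
    using a b by (subst coboundary_apply) (simp_all only: d t tup_in_tuples, simp_all)
  also have "(\<Otimes>\<^bsub>M\<^esub>j\<in>{..<Suc 0}. f (face G (Suc 0) j (tup [a, b])) [^]\<^bsub>M\<^esub> ((-1 :: int) ^ Suc j))
     = inv\<^bsub>M\<^esub> f (tup [a \<otimes> b])"
    using a b by (simp add: lessThan_Suc e c int_pow_uminus_one)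
  finally show ?thesis using a b c by simp
qed

lemma coboundary_2:
  assumes f: "f \<in> cochains G M 2" and a: "a \<in> carrier G" and b: "b \<in> carrier G" and x: "x \<in> carrier G"
  shows "coboundary G M 2 f (tup [a, b, x])
    = act M a (f (tup [b, x])) \<otimes>\<^bsub>M\<^esub> inv\<^bsub>M\<^esub> f (tup [a \<otimes> b, x]) \<otimes>\<^bsub>M\<^esub> f (tup [a, b \<otimes> x])
      \<otimes>\<^bsub>M\<^esub> inv\<^bsub>M\<^esub> f (tup [a, b])"
proof -
  have c: "f (tup [x, y]) \<in> carrier M" if "x \<in> carrier G" "y \<in> carrier G" for x y
    using that by (intro cochains_closed[OF f]) simp
  have d: "(\<lambda>i\<in>{..<2}. tup [a, b, x] (Suc i)) = tup [b, x]"
    using tup_drop[of 2 "[b, x]"] by simp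
  have t: "(\<lambda>i\<in>{..<2}. tup [a, b, x] i) = tup [a, b]"
    using tup_take[of 2 "[a, b, x]"] by simp
  have e: "face G 2 0 (tup [a, b, x]) = tup [a \<otimes> b, x]"
    "face G 2 (Suc 0) (tup [a, b, x]) = tup [a, b \<otimes> x]"
    using face_tup[of 0 2 "[a, b, x]"] face_tup[of "Suc 0" 2 "[a, b, x]"] by simp_all
  have s: "{..<2} = {0, Suc 0}" by auto
  have "coboundary G M 2 f (tup [a, b, x]) = act M a (f (tup [b, x]))
     \<otimes>\<^bsub>M\<^esub> (\<Otimes>\<^bsub>M\<^esub>j\<in>{..<2}. f (face G 2 j (tup [a, b, x])) [^]\<^bsub>M\<^esub> ((-1 :: int) ^ Suc j))
     \<otimes>\<^bsub>M\<^esub> f (tup [a, b]) [^]\<^bsub>M\<^esub> ((-1 :: int) ^ Suc 2)"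
    using a b x by (subst coboundary_apply) (simp_all only: d t tup_in_tuples, simp_all)
  also have "(\<Otimes>\<^bsub>M\<^esub>j\<in>{..<2}. f (face G 2 j (tup [a, b, x])) [^]\<^bsub>M\<^esub> ((-1 :: int) ^ Suc j))
     = inv\<^bsub>M\<^esub> f (tup [a \<otimes> b, x]) \<otimes>\<^bsub>M\<^esub> f (tup [a, b \<otimes> x])"
    using a b x unfolding s by (simp add: e c int_pow_uminus_one)
  finally show ?thesis using a b x c by (simp add: int_pow_uminus_one M.m_assoc)
qed

lemma coboundary_3:
  assumes f: "f \<in> cochains G M 3" and a: "a \<in> carrier G" and b: "b \<in> carrier G" and x: "x \<in> carrier G"
    and y: "y \<in> carrier G"
  shows "coboundary G M 3 f (tup [a, b, x, y])
    = act M a (f (tup [b, x, y])) \<otimes>\<^bsub>M\<^esub> inv\<^bsub>M\<^esub> f (tup [a \<otimes> b, x, y]) \<otimes>\<^bsub>M\<^esub> f (tup [a, b \<otimes> x, y])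
      \<otimes>\<^bsub>M\<^esub> inv\<^bsub>M\<^esub> f (tup [a, b, x \<otimes> y]) \<otimes>\<^bsub>M\<^esub> f (tup [a, b, x])"
proof -
  have c: "f (tup [x, y, z]) \<in> carrier M" if "x \<in> carrier G" "y \<in> carrier G" "z \<in> carrier G" for x y z
    using that by (intro cochains_closed[OF f]) simp
  have d: "(\<lambda>i\<in>{..<3}. tup [a, b, x, y] (Suc i)) = tup [b, x, y]"
    using tup_drop[of 3 "[b, x, y]"] by simp
  have t: "(\<lambda>i\<in>{..<3}. tup [a, b, x, y] i) = tup [a, b, x]"
    using tup_take[of 3 "[a, b, x, y]"] by simp
  have e: "face G 3 0 (tup [a, b, x, y]) = tup [a \<otimes> b, x, y]"
    "face G 3 (Suc 0) (tup [a, b, x, y]) = tup [a, b \<otimes> x, y]"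
    "face G 3 (Suc (Suc 0)) (tup [a, b, x, y]) = tup [a, b, x \<otimes> y]"
    using face_tup[of 0 3 "[a, b, x, y]"] face_tup[of "Suc 0" 3 "[a, b, x, y]"]
      face_tup[of "Suc (Suc 0)" 3 "[a, b, x, y]"] by simp_all
  have s: "{..<3} = {0, Suc 0, Suc (Suc 0)}" by auto
  have "coboundary G M 3 f (tup [a, b, x, y]) = act M a (f (tup [b, x, y]))
     \<otimes>\<^bsub>M\<^esub> (\<Otimes>\<^bsub>M\<^esub>j\<in>{..<3}. f (face G 3 j (tup [a, b, x, y])) [^]\<^bsub>M\<^esub> ((-1 :: int) ^ Suc j))
     \<otimes>\<^bsub>M\<^esub> f (tup [a, b, x]) [^]\<^bsub>M\<^esub> ((-1 :: int) ^ Suc 3)"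
    using a b x y by (subst coboundary_apply) (simp_all only: d t tup_in_tuples, simp_all)
  also have "(\<Otimes>\<^bsub>M\<^esub>j\<in>{..<3}. f (face G 3 j (tup [a, b, x, y])) [^]\<^bsub>M\<^esub> ((-1 :: int) ^ Suc j))
     = inv\<^bsub>M\<^esub> f (tup [a \<otimes> b, x, y]) \<otimes>\<^bsub>M\<^esub> (f (tup [a, b \<otimes> x, y]) \<otimes>\<^bsub>M\<^esub> inv\<^bsub>M\<^esub> f (tup [a, b, x \<otimes> y]))"
    using a b x y unfolding s by (simp add: e c int_pow_uminus_one)
  finally show ?thesis using a b x y c by (simp add: int_pow_uminus_one M.m_assoc)
qed

lemma coboundary_squared_1:
  assumes f: "f \<in> cochains G M (Suc 0)"
  shows "coboundary G M 2 (coboundary G M (Suc 0) f) = \<one>\<^bsub>cochain_group G M 3\<^esub>"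
proof (rule tuples_eqI[of _ G 3])
  fix x assume "x \<in> tuples G 3"
  then obtain a b c where abc: "a \<in> carrier G" "b \<in> carrier G" "c \<in> carrier G" "x = tup [a, b, c]"
    by (rule tuples_3E)
  have fc: "f (tup [x]) \<in> carrier M" if "x \<in> carrier G" for x
    using that by (intro cochains_closed[OF f]) simp
  have df: "coboundary G M (Suc 0) f \<in> cochains G M 2"
    using coboundary_in_cochains[OF f] by (simp add: numeral_2_eq_2)
  show "coboundary G M 2 (coboundary G M (Suc 0) f) x = \<one>\<^bsub>cochain_group G M 3\<^esub> x"
    using abc fc M.coboundary_squared_1_aux[of "act M (a \<otimes> b) (f (tup [c]))" "act M a (f (tup [b \<otimes> c]))"
      "act M a (f (tup [b]))" "f (tup [a \<otimes> b \<otimes> c])" "f (tup [a \<otimes> b])" "f (tup [a])"]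
    by (simp add: coboundary_2[OF df] coboundary_1[OF f] act_mult act_inv act_act m_assoc)
qed (use cochain_extensional(3)[of G M 2] in \<open>simp_all del: cochain_extensional(3)\<close>)

text \<open>Serves the connecting homomorphism, where the coboundary of a lifted 2-cocycle has to be
  closed.\<close>

lemma coboundary_squared_2:
  assumes f: "f \<in> cochains G M 2"
  shows "coboundary G M 3 (coboundary G M 2 f) = \<one>\<^bsub>cochain_group G M 4\<^esub>"
proof (rule tuples_eqI[of _ G 4])
  fix x assume "x \<in> tuples G 4"
  then obtain a b c d where abc: "a \<in> carrier G" "b \<in> carrier G" "c \<in> carrier G" "d \<in> carrier G"
      "x = tup [a, b, c, d]"
    by (rule tuples_4E)
  have fc: "f (tup [x, y]) \<in> carrier M" if "x \<in> carrier G" "y \<in> carrier G" for x y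
    using that by (intro cochains_closed[OF f]) simp
  have df: "coboundary G M 2 f \<in> cochains G M 3"
    using coboundary_in_cochains[OF f] by simp
  show "coboundary G M 3 (coboundary G M 2 f) x = \<one>\<^bsub>cochain_group G M 4\<^esub> x"
    using abc fc M.coboundary_squared_2_aux[of "act M (a \<otimes> b) (f (tup [c, d]))"
        "act M a (f (tup [b \<otimes> c, d]))" "act M a (f (tup [b, c \<otimes> d]))" "act M a (f (tup [b, c]))"
        "f (tup [a \<otimes> b \<otimes> c, d])" "f (tup [a \<otimes> b, c \<otimes> d])" "f (tup [a \<otimes> b, c])"
        "f (tup [a, b \<otimes> c \<otimes> d])" "f (tup [a, b \<otimes> c])" "f (tup [a, b])"]
    by (simp add: coboundary_3[OF df] coboundary_2[OF f] act_mult act_inv act_act m_assoc)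
qed (use cochain_extensional(3)[of G M 3] in \<open>simp_all del: cochain_extensional(3)\<close>)

end

text \<open>Contravariant in the group and covariant in the module, as in
  \<open>cochain_map\<close>. Inflation, restriction to \<open>H\<close> and change of coefficients
  are all instances.\<close>

locale module_map = A: discrete_module G M + B: discrete_module G' M'
  for G :: "('g, 'b) tgroup_scheme" and M :: "('g, 'm) tmod"
    and G' :: "('h, 'c) tgroup_scheme" and M' :: "('h, 'n) tmod" +
  fixes \<alpha> :: "'h \<Rightarrow> 'g" and \<beta> :: "'m \<Rightarrow> 'n"
  assumes \<alpha>_hom: "\<alpha> \<in> hom G' G"
    and \<alpha>_continuous: "continuous_map (gtop G') (gtop G) \<alpha>"
    and \<beta>_hom: "\<beta> \<in> hom M M'"
    and equivariant: "g \<in> carrier G' \<Longrightarrow> x \<in> carrier M \<Longrightarrow> \<beta> (act M (\<alpha> g) x) = act M' g (\<beta> x)"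
begin

lemma \<beta>_group_hom: "group_hom M M' \<beta>"
  using \<beta>_hom by (simp add: group_hom_def group_hom_axioms_def A.M.group_axioms B.M.group_axioms)

lemmas \<beta>_one = group_hom.hom_one[OF \<beta>_group_hom]
lemmas \<beta>_mult = group_hom.hom_mult[OF \<beta>_group_hom]
lemmas \<beta>_inv = group_hom.hom_inv[OF \<beta>_group_hom]
lemmas \<beta>_int_pow = group_hom.hom_int_pow[OF \<beta>_group_hom]
lemmas \<beta>_closed [simp] = group_hom.hom_closed[OF \<beta>_group_hom]

lemma \<alpha>_closed [simp]: "g \<in> carrier G' \<Longrightarrow> \<alpha> g \<in> carrier G"
  using \<alpha>_hom by (auto simp: hom_def)

lemma \<alpha>_mult: "g \<in> carrier G' \<Longrightarrow> h \<in> carrier G' \<Longrightarrow> \<alpha> (g \<otimes>\<^bsub>G'\<^esub> h) = \<alpha> g \<otimes>\<^bsub>G\<^esub> \<alpha> h"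
  using \<alpha>_hom by (auto simp: hom_def)

lemma map_in_tuples: "x \<in> tuples G' k \<Longrightarrow> (\<lambda>i\<in>{..<k}. \<alpha> (x i)) \<in> tuples G k"
  by (simp add: tuples_def PiE_def Pi_def)

lemma cochain_map_apply:
  "x \<in> tuples G' k \<Longrightarrow> cochain_map G' k \<alpha> \<beta> f x = \<beta> (f (\<lambda>i\<in>{..<k}. \<alpha> (x i)))"
  by (simp add: cochain_map_def)

lemma cochain_map_tup:
  "k = length xs \<Longrightarrow> set xs \<subseteq> carrier G' \<Longrightarrow>
    cochain_map G' k \<alpha> \<beta> f (tup xs) = \<beta> (f (tup (map \<alpha> xs)))"
  by (simp add: cochain_map_apply restrict_tup_map)

lemma cochain_map_closed:
  assumes "f \<in> cochains G M k"
  shows "cochain_map G' k \<alpha> \<beta> f \<in> cochains G' M' k"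
  unfolding cochain_map_def
proof (rule B.cochainsI)
  have "continuous_map (product_topology (\<lambda>_. gtop G') {..<k}) (product_topology (\<lambda>_. gtop G) {..<k})
      (\<lambda>x. \<lambda>i\<in>{..<k}. \<alpha> (x i))"
    by (auto simp: continuous_map_componentwise
        intro!: continuous_map_compose[OF B.continuous_map_tuples_component \<alpha>_continuous, unfolded o_def])
  from continuous_map_compose[OF this A.cochain_continuous[OF assms]]
  have "continuous_map (product_topology (\<lambda>_. gtop G') {..<k}) (gtop M)
      (\<lambda>x. f (\<lambda>i\<in>{..<k}. \<alpha> (x i)))"
    by (simp add: o_def)
  then show "continuous_map (product_topology (\<lambda>_. gtop G') {..<k}) (gtop M')
      (\<lambda>x. \<beta> (f (\<lambda>i\<in>{..<k}. \<alpha> (x i))))"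
    unfolding A.gtop_M B.gtop_M by (rule continuous_map_discrete_unary) simp
qed

lemma cochain_map_mult:
  assumes "f \<in> cochains G M k" "f' \<in> cochains G M k"
  shows "cochain_map G' k \<alpha> \<beta> (f \<otimes>\<^bsub>cochain_group G M k\<^esub> f')
    = cochain_map G' k \<alpha> \<beta> f \<otimes>\<^bsub>cochain_group G' M' k\<^esub> cochain_map G' k \<alpha> \<beta> f'"
  using assms
  by (intro B.cochain_eqI[of _ k])
    (simp_all add: cochain_map_closed A.cochain_mult_closed B.cochain_mult_closed cochain_map_apply
      map_in_tuples cochains_closed \<beta>_mult)

lemma cochain_map_hom: "cochain_map G' k \<alpha> \<beta> \<in> hom (cochain_group G M k) (cochain_group G' M' k)"
  by (auto simp: hom_def cochain_map_mult cochain_map_closed)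

lemma cochain_map_group_hom:
  "group_hom (cochain_group G M k) (cochain_group G' M' k) (cochain_map G' k \<alpha> \<beta>)"
  using A.group_cochains B.group_cochains cochain_map_hom
  by (simp add: group_hom_def group_hom_axioms_def comm_group_def)

lemma face_map:
  assumes "j < k" "x \<in> tuples G' (Suc k)"
  shows "(\<lambda>i\<in>{..<k}. \<alpha> (face G' k j x i)) = face G k j (\<lambda>i\<in>{..<Suc k}. \<alpha> (x i))"
  using assms by (auto simp: face_def fun_eq_iff tuples_def \<alpha>_mult PiE_def Pi_def)

text \<open>The homomorphism \<open>\<alpha>\<close> commutes with every face and
  \<open>\<beta>\<close> with products; equivariance handles the first term, which carries the
  action.\<close>

lemma cochain_map_coboundary:
  assumes f: "f \<in> cochains G M k"
  shows "cochain_map G' (Suc k) \<alpha> \<beta> (coboundary G M k f) = coboundary G' M' k (cochain_map G' k \<alpha> \<beta> f)"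
proof (rule tuples_eqI)
  fix x assume x: "x \<in> tuples G' (Suc k)"
  let ?y = "\<lambda>i\<in>{..<Suc k}. \<alpha> (x i)"
  have y: "?y \<in> tuples G (Suc k)" using x by (rule map_in_tuples)
  have x0: "x 0 \<in> carrier G'" using x by (auto simp: tuples_def)
  note c = cochains_closed[OF f]
  have y0: "?y 0 = \<alpha> (x 0)" by simp
  have d: "(\<lambda>i\<in>{..<k}. \<alpha> ((\<lambda>i\<in>{..<k}. x (Suc i)) i)) = (\<lambda>i\<in>{..<k}. ?y (Suc i))"
    and t: "(\<lambda>i\<in>{..<k}. \<alpha> ((\<lambda>i\<in>{..<k}. x i) i)) = (\<lambda>i\<in>{..<k}. ?y i)"
    by (auto simp: fun_eq_iff)
  have P: "(\<Otimes>\<^bsub>M'\<^esub>j\<in>{..<k}. cochain_map G' k \<alpha> \<beta> f (face G' k j x) [^]\<^bsub>M'\<^esub> ((-1 :: int) ^ Suc j))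
      = \<beta> (\<Otimes>\<^bsub>M\<^esub>j\<in>{..<k}. f (face G k j ?y) [^]\<^bsub>M\<^esub> ((-1 :: int) ^ Suc j))"
  proof -
    have "(\<Otimes>\<^bsub>M'\<^esub>j\<in>{..<k}. cochain_map G' k \<alpha> \<beta> f (face G' k j x) [^]\<^bsub>M'\<^esub> ((-1 :: int) ^ Suc j))
      = (\<Otimes>\<^bsub>M'\<^esub>j\<in>{..<k}. \<beta> (f (face G k j ?y) [^]\<^bsub>M\<^esub> ((-1 :: int) ^ Suc j)))"
      using x y c by (intro B.M.finprod_cong')
        (auto simp: cochain_map_apply B.face_in_tuples face_map A.face_in_tuples \<beta>_int_pow \<beta>_mult simp del: power_Suc)
    also have "\<dots> = \<beta> (\<Otimes>\<^bsub>M\<^esub>j\<in>{..<k}. f (face G k j ?y) [^]\<^bsub>M\<^esub> ((-1 :: int) ^ Suc j))"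
      using y c by (subst A.M.finprod_group_hom[OF B.M.comm_group_axioms \<beta>_hom])
        (auto simp: A.face_in_tuples simp del: power_Suc)
    finally show ?thesis .
  qed
  have Pc: "(\<Otimes>\<^bsub>M\<^esub>j\<in>{..<k}. f (face G k j ?y) [^]\<^bsub>M\<^esub> ((-1 :: int) ^ Suc j)) \<in> carrier M"
    using y c by (auto intro!: A.M.finprod_closed simp: A.face_in_tuples simp del: power_Suc)
  have gen: "\<beta> (act M (\<alpha> g) u \<otimes>\<^bsub>M\<^esub> p \<otimes>\<^bsub>M\<^esub> v [^]\<^bsub>M\<^esub> e)
      = act M' g (\<beta> u) \<otimes>\<^bsub>M'\<^esub> \<beta> p \<otimes>\<^bsub>M'\<^esub> \<beta> v [^]\<^bsub>M'\<^esub> e"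
    if "g \<in> carrier G'" "u \<in> carrier M" "p \<in> carrier M" "v \<in> carrier M" for g u p v and e :: int
    using that by (simp add: \<beta>_int_pow \<beta>_mult equivariant)
  show "cochain_map G' (Suc k) \<alpha> \<beta> (coboundary G M k f) x
      = coboundary G' M' k (cochain_map G' k \<alpha> \<beta> f) x"
    unfolding B.coboundary_apply[OF x] P cochain_map_apply[OF x] A.coboundary_apply[OF y]
      cochain_map_apply[OF drop_in_tuples[OF x]] cochain_map_apply[OF take_in_tuples[OF x]] d t
      y0
    by (rule gen[OF x0 c[OF drop_in_tuples[OF y]] Pc c[OF take_in_tuples[OF y]]])
qed (auto simp: cochain_map_def)

end

section \<open>Topological groups and their quotients\<close>

lemma with_top_simps [simp]:
  "carrier (with_top G T) = carrier G" "monoid.mult (with_top G T) = monoid.mult G"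
  "one (with_top G T) = one G" "gtop (with_top G T) = T"
  by (simp_all add: with_top_def)

lemma with_top_eqs [simp]:
  "m_inv (with_top G T) = m_inv G" "r_coset (with_top G T) = r_coset G"
  "l_coset (with_top G T) = l_coset G" "RCOSETS (with_top G T) = RCOSETS G"
  "set_mult (with_top G T) = set_mult G"
  by (auto simp: m_inv_def r_coset_def l_coset_def RCOSETS_def set_mult_def fun_eq_iff)

lemma group_with_top [simp]: "group (with_top G T) = group G"
  unfolding group_def monoid_def group_axioms_def Units_def by (simp only: with_top_simps)

lemma comm_group_with_top [simp]: "comm_group (with_top G T) = comm_group G"
  unfolding comm_group_def comm_monoid_def monoid_def comm_monoid_axioms_def
  by (simp only: with_top_simps group_with_top)

text \<open>The conjugate of \<open>h\<close> by \<open>x\<close> is the commutator of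
  \<open>x\<close> and \<open>h\<close> times \<open>h\<close>.\<close>

lemma (in group) subgroup_containing_commutators_normal:
  assumes K: "subgroup K G"
    and comm: "\<And>x y. x \<in> carrier G \<Longrightarrow> y \<in> carrier G \<Longrightarrow> x \<otimes> y \<otimes> inv x \<otimes> inv y \<in> K"
  shows "K \<lhd> G"
  unfolding normal_inv_iff
proof (intro conjI K ballI)
  fix x h assume x: "x \<in> carrier G" and h: "h \<in> K"
  then have hc: "h \<in> carrier G" using subgroup.mem_carrier[OF K] by simp
  have "x \<otimes> h \<otimes> inv x \<otimes> inv h \<otimes> h \<in> K"
    using subgroup.m_closed[OF K comm[OF x hc] h] .
  then show "x \<otimes> h \<otimes> inv x \<in> K" using x hc by (simp add: m_assoc)
qed

context topological_group
begin

lemma translate_continuous: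
  assumes "a \<in> carrier G" "b \<in> carrier G"
  shows "continuous_map (gtop G) (gtop G) (\<lambda>x. a \<otimes> x \<otimes> b)"
  using assms by (intro continuous_map_mult) (auto simp: topspace_gtop)

lemma openin_subset_carrier: "openin (gtop G) U \<Longrightarrow> U \<subseteq> carrier G"
  using openin_subset topspace_gtop by blast

lemma openin_translate:
  assumes U: "openin (gtop G) U" and a: "a \<in> carrier G" and b: "b \<in> carrier G"
  shows "openin (gtop G) ((\<lambda>x. a \<otimes> x \<otimes> b) ` U)"
proof -
  have Uc: "U \<subseteq> carrier G" using U openin_subset_carrier by blast
  have "(\<lambda>x. a \<otimes> x \<otimes> b) ` U = {x \<in> topspace (gtop G). inv a \<otimes> x \<otimes> inv b \<in> U}"
  proof (intro equalityI subsetI)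
    fix x assume "x \<in> (\<lambda>x. a \<otimes> x \<otimes> b) ` U"
    then obtain u where u: "u \<in> U" "x = a \<otimes> u \<otimes> b" by blast
    then have uc: "u \<in> carrier G" using Uc by blast
    have "inv a \<otimes> (a \<otimes> u \<otimes> b) \<otimes> inv b = u"
      using uc a b by (simp add: inv_solve_right' m_assoc inv_solve_left' m_closed)
    then show "x \<in> {x \<in> topspace (gtop G). inv a \<otimes> x \<otimes> inv b \<in> U}"
      using u uc a b by (simp add: topspace_gtop)
  next
    fix x assume x: "x \<in> {x \<in> topspace (gtop G). inv a \<otimes> x \<otimes> inv b \<in> U}"
    then have xc: "x \<in> carrier G" by (simp add: topspace_gtop)
    have "x = a \<otimes> (inv a \<otimes> x \<otimes> inv b) \<otimes> b"
      using xc a b by (metis inv_closed inv_inv inv_solve_left m_assoc m_closed inv_solve_right)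
    then show "x \<in> (\<lambda>x. a \<otimes> x \<otimes> b) ` U" using x by blast
  qed
  also have "openin (gtop G) \<dots>"
    using a b U translate_continuous[of "inv a" "inv b"] by (intro openin_continuous_map_preimage) auto
  finally show ?thesis .
qed

lemma openin_r_coset: "openin (gtop G) U \<Longrightarrow> a \<in> carrier G \<Longrightarrow> openin (gtop G) (U #> a)"
proof -
  assume U: "openin (gtop G) U" and a: "a \<in> carrier G"
  have "U #> a = (\<lambda>x. \<one> \<otimes> x \<otimes> a) ` U"
    using openin_subset_carrier[OF U] a by (force simp: r_coset_def)
  then show ?thesis using openin_translate[OF U _ a, of \<one>] by simp
qed

lemma openin_l_translate: "openin (gtop G) U \<Longrightarrow> a \<in> carrier G \<Longrightarrow> openin (gtop G) ((\<lambda>x. a \<otimes> x) ` U)"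
proof -
  assume U: "openin (gtop G) U" and a: "a \<in> carrier G"
  have "(\<lambda>x. a \<otimes> x) ` U = (\<lambda>x. a \<otimes> x \<otimes> \<one>) ` U"
    using openin_subset_carrier[OF U] a by (intro image_cong) auto
  then show ?thesis using openin_translate[OF U a, of \<one>] by simp
qed

text \<open>The translates of \<open>V\<close> by elements of \<open>K\<close> stay inside
  \<open>K\<close> and cover it.\<close>

lemma openin_subgroupI:
  assumes K: "subgroup K G" and V: "openin (gtop G) V" "\<one> \<in> V" "V \<subseteq> K"
  shows "openin (gtop G) K"
proof -
  have "\<exists>T. openin (gtop G) T \<and> x \<in> T \<and> T \<subseteq> K" if "x \<in> K" for x
  proof (intro exI conjI)
    have xc: "x \<in> carrier G" using that subgroup.mem_carrier[OF K] by blast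
    show "openin (gtop G) ((\<lambda>v. x \<otimes> v) ` V)" using V(1) xc by (rule openin_l_translate)
    show "x \<in> (\<lambda>v. x \<otimes> v) ` V" using V(2) xc by (auto intro!: image_eqI[of _ _ \<one>])
    show "(\<lambda>v. x \<otimes> v) ` V \<subseteq> K" using V(3) that subgroup.m_closed[OF K] by blast
  qed
  then show ?thesis by (subst openin_subopen) blast
qed

text \<open>A continuous operation that preserves \<open>K\<close> maps the closure of
  \<open>K\<close> into itself; for the product this uses that the closure of the square of
  \<open>K\<close> is the square of the closure.\<close>

lemma subgroup_closure_of:
  assumes K: "subgroup K G"
  shows "subgroup (gtop G closure_of K) G"
proof (rule subgroupI)
  show "gtop G closure_of K \<subseteq> carrier G"
    using closure_of_subset_topspace topspace_gtop by metis
  have Kc: "K \<subseteq> topspace (gtop G)" using subgroup.subset[OF K] topspace_gtop by simp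
  show "gtop G closure_of K \<noteq> {}"
    using closure_of_subset[OF Kc] subgroup.one_closed[OF K] by blast
  show "inv x \<in> gtop G closure_of K" if "x \<in> gtop G closure_of K" for x
  proof -
    have "(\<lambda>x. inv x) ` K \<subseteq> K" using subgroup.m_inv_closed[OF K] by blast
    then have "(\<lambda>x. inv x) ` (gtop G closure_of K) \<subseteq> gtop G closure_of K"
      using continuous_map_image_closure_subset[OF continuous_inv, of K] closure_of_mono by blast
    then show ?thesis using that by blast
  qed
  show "x \<otimes> y \<in> gtop G closure_of K" if "x \<in> gtop G closure_of K" "y \<in> gtop G closure_of K" for x y
  proof -
    have "(\<lambda>(x, y). x \<otimes> y) ` (K \<times> K) \<subseteq> K" using subgroup.m_closed[OF K] by auto
    then have "(\<lambda>(x, y). x \<otimes> y) ` (prod_topology (gtop G) (gtop G) closure_of (K \<times> K))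
        \<subseteq> gtop G closure_of K"
      using continuous_map_image_closure_subset[OF continuous_mult, of "K \<times> K"] closure_of_mono by blast
    then show ?thesis using that by (auto simp: closure_of_Times)
  qed
qed

text \<open>Normality comes from the commutators among the generators, which survive in the closure.
  Closedness is what later allows homomorphisms on \<open>H\<close> to be extended to cochains of
  the whole group.\<close>

lemma comm_pow_normal:
  shows "comm_pow G N (carrier G) \<lhd> G" "closedin (gtop G) (comm_pow G N (carrier G))"
proof -
  let ?S = "{x \<otimes> y \<otimes> inv x \<otimes> inv y | x y. x \<in> carrier G \<and> y \<in> carrier G} \<union> {y [^] N | y. y \<in> carrier G}"
  have S: "?S \<subseteq> carrier G" by auto
  then have sub: "subgroup (generate G ?S) G" by (rule generate_is_subgroup)
  have "generate G ?S \<subseteq> comm_pow G N (carrier G)"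
    unfolding comm_pow_def using subgroup.subset[OF sub] topspace_gtop by (intro closure_of_subset) simp
  moreover have "x \<otimes> y \<otimes> inv x \<otimes> inv y \<in> generate G ?S" if "x \<in> carrier G" "y \<in> carrier G" for x y
    using that by (intro generate.incl) blast
  ultimately show "comm_pow G N (carrier G) \<lhd> G"
    using subgroup_closure_of[OF sub]
    by (intro subgroup_containing_commutators_normal) (auto simp: comm_pow_def)
  show "closedin (gtop G) (comm_pow G N (carrier G))" by (simp add: comm_pow_def)
qed

end

text \<open>The constant \<open>topology\<close> returns the given family of open sets only once
  this family is known to be a topology; here it is one because preimages commute with intersections
  and unions.\<close>

lemma openin_tquot:
  "openin (gtop (tquot G H)) V \<longleftrightarrow>
    V \<subseteq> rcosets\<^bsub>G\<^esub> H \<and> openin (gtop G) {x \<in> topspace (gtop G). H #>\<^bsub>G\<^esub> x \<in> V}"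
proof -
  let ?P = "\<lambda>V. V \<subseteq> rcosets\<^bsub>G\<^esub> H \<and> openin (gtop G) {x \<in> topspace (gtop G). H #>\<^bsub>G\<^esub> x \<in> V}"
  have "istopology ?P"
    unfolding istopology_def
  proof (intro conjI allI impI)
    fix S T assume ST: "?P S" "?P T"
    have "{x \<in> topspace (gtop G). H #>\<^bsub>G\<^esub> x \<in> S \<inter> T}
      = {x \<in> topspace (gtop G). H #>\<^bsub>G\<^esub> x \<in> S} \<inter> {x \<in> topspace (gtop G). H #>\<^bsub>G\<^esub> x \<in> T}" by auto
    then show "openin (gtop G) {x \<in> topspace (gtop G). H #>\<^bsub>G\<^esub> x \<in> S \<inter> T}"
      using openin_Int[OF conjunct2[OF ST(1)] conjunct2[OF ST(2)]] by (simp only:)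
    show "S \<inter> T \<subseteq> rcosets\<^bsub>G\<^esub> H" using ST by blast
  next
    fix \<K> assume \<K>: "\<forall>K\<in>\<K>. ?P K"
    have "{x \<in> topspace (gtop G). H #>\<^bsub>G\<^esub> x \<in> \<Union>\<K>}
      = (\<Union>K\<in>\<K>. {x \<in> topspace (gtop G). H #>\<^bsub>G\<^esub> x \<in> K})" by auto
    with \<K> show "openin (gtop G) {x \<in> topspace (gtop G). H #>\<^bsub>G\<^esub> x \<in> \<Union>\<K>}" by auto
    show "\<Union>\<K> \<subseteq> rcosets\<^bsub>G\<^esub> H" using \<K> by blast
  qed
  then show ?thesis by (simp add: tquot_def topology_inverse')
qed

lemma carrier_tquot: "carrier (tquot G H) = rcosets\<^bsub>G\<^esub> H"
  by (simp add: tquot_def FactGroup_def)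

lemma mult_tquot [simp]: "monoid.mult (tquot G H) = set_mult G"
  by (simp add: tquot_def)

lemma one_tquot [simp]: "one (tquot G H) = H"
  by (simp add: tquot_def)

text \<open>Products of quotient maps need not be quotient maps, but open maps are stable under
  finite products. This transfers the quotient property of the projection to tuples.\<close>

lemma open_map_product:
  assumes fin: "finite I" and f: "open_map X Y f"
  shows "open_map (product_topology (\<lambda>_. X) I) (product_topology (\<lambda>_. Y) I) (\<lambda>x. \<lambda>i\<in>I. f (x i))"
  unfolding open_map_def
proof (intro allI impI)
  fix S assume S: "openin (product_topology (\<lambda>_. X) I) S"
  show "openin (product_topology (\<lambda>_. Y) I) ((\<lambda>x. \<lambda>i\<in>I. f (x i)) ` S)"
    unfolding openin_product_topology_alt
  proof (rule ballI)
    fix y assume "y \<in> (\<lambda>x. \<lambda>i\<in>I. f (x i)) ` S"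
    then obtain x where x: "x \<in> S" "y = (\<lambda>i\<in>I. f (x i))" by blast
    from S x(1) obtain U where U: "\<forall>i\<in>I. openin X (U i)" "x \<in> Pi\<^sub>E I U" "Pi\<^sub>E I U \<subseteq> S"
      unfolding openin_product_topology_alt by blast
    have "z \<in> (\<lambda>x. \<lambda>i\<in>I. f (x i)) ` S" if z: "z \<in> (\<Pi>\<^sub>E i\<in>I. f ` U i)" for z
    proof -
      have "\<forall>i\<in>I. \<exists>u\<in>U i. z i = f u" using z by (auto simp: PiE_def Pi_def)
      then obtain u where u: "\<forall>i\<in>I. u i \<in> U i \<and> z i = f (u i)" by metis
      have "z = (\<lambda>i\<in>I. f (restrict u I i))"
        using u z by (auto simp: fun_eq_iff PiE_def extensional_def)
      moreover have "restrict u I \<in> S" using u U(3) by auto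
      ultimately show ?thesis by blast
    qed
    moreover have "\<forall>i\<in>I. openin Y (f ` U i)" using U(1) f by (simp add: open_map_def)
    moreover have "y \<in> (\<Pi>\<^sub>E i\<in>I. f ` U i)" using U(2) x(2) by (auto simp: PiE_def Pi_def)
    ultimately show "\<exists>V. finite {i \<in> I. V i \<noteq> topspace Y} \<and> (\<forall>i\<in>I. openin Y (V i)) \<and> y \<in> Pi\<^sub>E I V \<and>
        Pi\<^sub>E I V \<subseteq> (\<lambda>x. \<lambda>i\<in>I. f (x i)) ` S"
      using fin by (intro exI[of _ "\<lambda>i. f ` U i"]) auto
  qed
qed

lemma open_map_prod:
  assumes "open_map X X' f" "open_map Y Y' g"
  shows "open_map (prod_topology X Y) (prod_topology X' Y') (\<lambda>(x, y). (f x, g y))"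
  unfolding open_map_def
proof (intro allI impI)
  fix S assume S: "openin (prod_topology X Y) S"
  show "openin (prod_topology X' Y') ((\<lambda>(x, y). (f x, g y)) ` S)"
    unfolding openin_prod_topology_alt
  proof (intro allI impI)
    fix x' y' assume "(x', y') \<in> (\<lambda>(x, y). (f x, g y)) ` S"
    then obtain x y where xy: "(x, y) \<in> S" "x' = f x" "y' = g y" by auto
    then obtain U V where UV: "openin X U" "openin Y V" "x \<in> U" "y \<in> V" "U \<times> V \<subseteq> S"
      using S unfolding openin_prod_topology_alt by metis
    then have "f ` U \<times> g ` V \<subseteq> (\<lambda>(x, y). (f x, g y)) ` S" by force
    with UV xy assms show "\<exists>U V. openin X' U \<and> openin Y' V \<and> x' \<in> U \<and> y'
        \<in> V \<and> U \<times> V \<subseteq> (\<lambda>(x, y). (f x, g y)) ` S"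
      unfolding open_map_def by blast
  qed
qed

locale topological_quotient = topological_group G + normal H G
    for G :: "('g, 'b) tgroup_scheme" (structure) and H
begin

abbreviation Q where "Q \<equiv> tquot G H"
abbreviation proj where "proj \<equiv> \<lambda>x. H #> x"

lemma group_Q: "group Q"
  using factorgroup_is_group by (simp add: tquot_def)

lemma topspace_Q: "topspace (gtop Q) = rcosets H"
proof (rule antisym)
  show "topspace (gtop Q) \<subseteq> rcosets H"
    using openin_topspace[of "gtop Q"] unfolding openin_tquot by blast
  have "{x \<in> topspace (gtop G). H #> x \<in> rcosets H} = topspace (gtop G)"
    by (auto simp: topspace_gtop RCOSETS_def)
  then have "openin (gtop Q) (rcosets H)" unfolding openin_tquot by simp
  then show "rcosets H \<subseteq> topspace (gtop Q)" by (rule openin_subset)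
qed

lemma proj_in_Q [simp]: "x \<in> carrier G \<Longrightarrow> proj x \<in> carrier Q"
  by (auto simp: carrier_tquot RCOSETS_def)

lemma Q_cases:
  assumes "q \<in> carrier Q"
  obtains x where "x \<in> carrier G" "q = proj x"
  using assms by (auto simp: carrier_tquot RCOSETS_def)

lemma proj_hom: "proj \<in> hom G Q"
  by (auto simp: hom_def rcos_sum)

lemma proj_mult: "x \<in> carrier G \<Longrightarrow> y \<in> carrier G \<Longrightarrow> proj x <#> proj y = proj (x \<otimes> y)"
  by (rule rcos_sum)

lemma proj_H: "h \<in> H \<Longrightarrow> proj h = H"
  by (rule rcos_const[OF group_axioms])

lemma proj_one: "proj \<one> = H"
  by (rule proj_H) simp

text \<open>Right cosets yield \<open>y \<otimes> inv x\<close>; normality of \<open>H\<close>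
  conjugates this by \<open>x\<close> into the form suited to products with a factor from
  \<open>H\<close> on the right.\<close>

lemma proj_eq_iff: "x \<in> carrier G \<Longrightarrow> y \<in> carrier G \<Longrightarrow> proj x = proj y \<longleftrightarrow> inv x \<otimes> y \<in> H"
proof -
  assume x: "x \<in> carrier G" and y: "y \<in> carrier G"
  have "proj x = proj y \<longleftrightarrow> y \<otimes> inv x \<in> H"
    using x y by (metis rcos_self rcos_module repr_independence is_subgroup group_axioms)
  also have "\<dots> \<longleftrightarrow> inv x \<otimes> y \<in> H"
  proof
    assume "y \<otimes> inv x \<in> H"
    then have "inv x \<otimes> (y \<otimes> inv x) \<otimes> x \<in> H" using x by (rule inv_op_closed1[rotated])
    then show "inv x \<otimes> y \<in> H" using x y by (simp add: m_assoc)
  next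
    assume "inv x \<otimes> y \<in> H"
    then have "x \<otimes> (inv x \<otimes> y) \<otimes> inv x \<in> H" using x by (rule inv_op_closed2[rotated])
    then show "y \<otimes> inv x \<in> H" using x y by (simp add: m_assoc[symmetric])
  qed
  finally show ?thesis .
qed

lemma proj_mult_H: "x \<in> carrier G \<Longrightarrow> h \<in> H \<Longrightarrow> proj (x \<otimes> h) = proj x"
  by (subst eq_commute, subst proj_eq_iff) (auto simp: m_assoc[symmetric])

lemma proj_inv: "x \<in> carrier G \<Longrightarrow> inv\<^bsub>Q\<^esub> proj x = proj (inv x)"
proof -
  assume x: "x \<in> carrier G"
  interpret Q: group Q by (rule group_Q)
  show ?thesis using x by (intro Q.inv_equality) (auto simp: proj_mult proj_one)
qed

lemma quotient_map_proj: "quotient_map (gtop G) (gtop Q) proj"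
  unfolding quotient_map_def topspace_Q
  by (auto simp: openin_tquot topspace_gtop RCOSETS_def)

lemma proj_continuous: "continuous_map (gtop G) (gtop Q) proj"
  using quotient_map_proj by (rule quotient_imp_continuous_map)

text \<open>The saturation of an open set is the union of its right translates by the elements of
  \<open>H\<close>.\<close>

lemma proj_open: "open_map (gtop G) (gtop Q) proj"
  unfolding open_map_def
proof (intro allI impI)
  fix U assume U: "openin (gtop G) U"
  have Uc: "U \<subseteq> carrier G" using U by (rule openin_subset_carrier)
  have "{x \<in> topspace (gtop G). proj x \<in> proj ` U} = (\<Union>h\<in>H. (\<lambda>x. x \<otimes> h) ` U)"
  proof (intro equalityI subsetI)
    fix x assume "x \<in> {x \<in> topspace (gtop G). proj x \<in> proj ` U}"
    then obtain u where u: "u \<in> U" "proj x = proj u" "x \<in> carrier G" by (auto simp: topspace_gtop)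
    then have uc: "u \<in> carrier G" using Uc by blast
    have "x = u \<otimes> (inv u \<otimes> x)" using u uc by (simp add: m_assoc[symmetric])
    moreover have "inv u \<otimes> x \<in> H" using u uc proj_eq_iff[of u x] by simp
    ultimately show "x \<in> (\<Union>h\<in>H. (\<lambda>x. x \<otimes> h) ` U)" using u(1) by blast
  next
    fix x assume "x \<in> (\<Union>h\<in>H. (\<lambda>x. x \<otimes> h) ` U)"
    then obtain u h where "u \<in> U" "h \<in> H" "x = u \<otimes> h" by blast
    then show "x \<in> {x \<in> topspace (gtop G). proj x \<in> proj ` U}"
      using Uc by (auto simp: topspace_gtop proj_mult_H)
  qed
  moreover have "openin (gtop G) ((\<lambda>x. x \<otimes> h) ` U)" if "h \<in> H" for h
  proof -
    have "(\<lambda>x. x \<otimes> h) ` U = U #> h" by (auto simp: r_coset_def)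
    then show ?thesis using that openin_r_coset[OF U, of h] by simp
  qed
  ultimately have "openin (gtop G) {x \<in> topspace (gtop G). proj x \<in> proj ` U}" by auto
  moreover have "proj ` U \<subseteq> rcosets H" using Uc by (auto simp: RCOSETS_def)
  ultimately show "openin (gtop Q) (proj ` U)" unfolding openin_tquot by blast
qed

lemma proj_prod_quotient_map:
  "quotient_map (prod_topology (gtop G) (gtop G)) (prod_topology (gtop Q) (gtop Q)) (\<lambda>(x, y). (proj x, proj y))"
proof (rule continuous_open_imp_quotient_map)
  show "continuous_map (prod_topology (gtop G) (gtop G)) (prod_topology (gtop Q) (gtop Q)) (\<lambda>(x, y). (proj x, proj y))"
    using continuous_map_prod_top[of "gtop G" "gtop G" "gtop Q" "gtop Q" proj proj] proj_continuous by simp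
  show "(\<lambda>(x, y). (proj x, proj y)) ` topspace (prod_topology (gtop G) (gtop G))
      = topspace (prod_topology (gtop Q) (gtop Q))"
    by (force simp: topspace_Q topspace_gtop RCOSETS_def)
qed (rule open_map_prod[OF proj_open proj_open])

text \<open>Composed with the projection, both operations are continuous; the projection is a
  quotient map, also on pairs, so continuity descends.\<close>

lemma topological_group_Q: "topological_group Q"
proof -
  interpret Q: group Q by (rule group_Q)
  show ?thesis
  proof
    show "topspace (gtop Q) = carrier Q" by (simp add: topspace_Q carrier_tquot)
    have "continuous_map (prod_topology (gtop G) (gtop G)) (gtop Q) ((\<lambda>(x, y). x \<otimes>\<^bsub>Q\<^esub> y) \<circ> (\<lambda>(x, y). (proj x, proj y)))"
    proof (rule continuous_map_eq[OF continuous_map_compose[OF continuous_mult proj_continuous]])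
      fix z assume "z \<in> topspace (prod_topology (gtop G) (gtop G))"
      then show "(proj \<circ> (\<lambda>(x, y). x \<otimes> y)) z = ((\<lambda>(x, y). x \<otimes>\<^bsub>Q\<^esub> y) \<circ> (\<lambda>(x, y). (proj x, proj y))) z"
        by (auto simp: topspace_gtop proj_mult)
    qed
    then show "continuous_map (prod_topology (gtop Q) (gtop Q)) (gtop Q) (\<lambda>(x, y). x \<otimes>\<^bsub>Q\<^esub> y)"
      by (rule continuous_compose_quotient_map[OF proj_prod_quotient_map])
    have "continuous_map (gtop G) (gtop Q) ((\<lambda>x. inv\<^bsub>Q\<^esub> x) \<circ> proj)"
    proof (rule continuous_map_eq[OF continuous_map_compose[OF continuous_inv proj_continuous]])
      fix z assume "z \<in> topspace (gtop G)"
      then show "(proj \<circ> m_inv G) z = ((\<lambda>x. inv\<^bsub>Q\<^esub> x) \<circ> proj) z"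
        by (auto simp: topspace_gtop proj_inv)
    qed
    then show "continuous_map (gtop Q) (gtop Q) (\<lambda>x. inv\<^bsub>Q\<^esub> x)"
      by (rule continuous_compose_quotient_map[OF quotient_map_proj])
  qed
qed

sublocale Q: topological_group Q by (rule topological_group_Q)

text \<open>Continuous, open and surjective. Because of this a function on tuples of cosets is
  continuous as soon as its inflation is.\<close>

lemma proj_tuples_quotient_map:
  fixes k :: nat
  shows "quotient_map (product_topology (\<lambda>_. gtop G) {..<k}) (product_topology (\<lambda>_. gtop Q) {..<k})
     (\<lambda>x. \<lambda>i\<in>{..<k}. proj (x i))"
proof (rule continuous_open_imp_quotient_map)
  show "continuous_map (product_topology (\<lambda>_. gtop G) {..<k}) (product_topology (\<lambda>_. gtop Q) {..<k})
     (\<lambda>x. \<lambda>i\<in>{..<k}. proj (x i))"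
    by (auto simp: continuous_map_componentwise
        intro!: continuous_map_compose[OF continuous_map_tuples_component proj_continuous, unfolded o_def])
  have "y \<in> (\<lambda>x. \<lambda>i\<in>{..<k}. proj (x i)) ` tuples G k" if y: "y \<in> tuples Q k" for y
  proof -
    have "\<forall>i<k. \<exists>x\<in>carrier G. y i = proj x" using y by (auto simp: tuples_def elim!: Q_cases)
    then obtain x where x: "\<forall>i<k. x i \<in> carrier G \<and> y i = proj (x i)" by metis
    then have "y = (\<lambda>i\<in>{..<k}. proj (restrict x {..<k} i))"
      using y by (auto simp: fun_eq_iff tuples_def PiE_def extensional_def)
    moreover have "restrict x {..<k} \<in> tuples G k" using x by (simp add: tuples_def PiE_def Pi_def)
    ultimately show ?thesis by blast
  qed
  moreover have "(\<lambda>i\<in>{..<k}. proj (x i)) \<in> tuples Q k" if "x \<in> tuples G k" for x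
    using that by (simp add: tuples_def PiE_def Pi_def)
  ultimately show "(\<lambda>x. \<lambda>i\<in>{..<k}. proj (x i)) ` topspace (product_topology (\<lambda>_. gtop G) {..<k})
      = topspace (product_topology (\<lambda>_. gtop Q) {..<k})"
    unfolding topspace_tuples Q.topspace_tuples by blast
qed (rule open_map_product[OF _ proj_open], simp)

lemma compact_Q: "compact_space (gtop G) \<Longrightarrow> compact_space (gtop Q)"
  using image_compactin[OF _ proj_continuous, of "topspace (gtop G)"]
    quotient_imp_surjective_map[OF quotient_map_proj]
  by (simp add: compact_space_def)

end

section \<open>Open normal subgroups of compact and profinite groups\<close>

lemma (in topological_group) open_normal_finite_index:
  assumes "compact_space (gtop G)" and U: "U \<in> open_normal G"
  shows "finite (rcosets U)"
proof -
  have n: "U \<lhd> G" and o: "openin (gtop G) U" using U by (auto simp: open_normal_def)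
  interpret topological_quotient G U
    using n by (simp add: topological_quotient_def topological_group_axioms)
  have "openin (gtop G) {x \<in> topspace (gtop G). U #> x = c}" if c: "c \<in> rcosets U" for c
  proof -
    obtain a where a: "a \<in> carrier G" "c = U #> a"
      by (rule Q_cases[unfolded carrier_tquot, OF c])
    have "{x \<in> topspace (gtop G). U #> x = c} = U #> a"
    proof (intro equalityI subsetI)
      fix x assume "x \<in> {x \<in> topspace (gtop G). U #> x = c}"
      then show "x \<in> U #> a" using a rcos_self[of x U] is_subgroup by (auto simp: topspace_gtop)
    next
      fix x assume x: "x \<in> U #> a"
      then have "x \<in> carrier G" using a r_coset_subset_G[of U a] subset by blast
      then show "x \<in> {x \<in> topspace (gtop G). U #> x = c}"
        using x a repr_independence[of x U a] is_subgroup by (simp add: topspace_gtop)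
    qed
    then show ?thesis using openin_r_coset[OF o a(1)] by simp
  qed
  \<comment> \<open>The map to cosets is locally constant, so its image, which is the set of all
    cosets, is compact in a discrete space.\<close>
  then have "continuous_map (gtop G) (discrete_topology (rcosets U)) (\<lambda>x. U #> x)"
    by (auto simp: continuous_map_discrete_iff topspace_gtop RCOSETS_def)
  then have "compactin (discrete_topology (rcosets U)) ((\<lambda>x. U #> x) ` carrier G)"
    using assms(1) topspace_gtop image_compactin unfolding compact_space_def by metis
  moreover have "(\<lambda>x. U #> x) ` carrier G = rcosets U" by (auto simp: RCOSETS_def)
  ultimately show ?thesis by (simp add: compactin_discrete_topology)
qed

text \<open>In a compact Hausdorff space quasi-components coincide with components, so here they are
  points, and a clopen set separates a quasi-component from any compact set disjoint from
  it.\<close>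

lemma (in profinite_group) clopen_neighbourhood:
  assumes O: "openin (gtop G) U" and "x \<in> U"
  obtains W where "openin (gtop G) W" "closedin (gtop G) W" "x \<in> W" "W \<subseteq> U"
proof -
  let ?X = "gtop G"
  have x: "x \<in> topspace ?X" using assms openin_subset by blast
  have "connectedin ?X (quasi_component_of_set ?X x)"
    using quasi_eq_connected_components_of[of ?X] compact Hausdorff x
    unfolding quasi_eq_connected_components_of_alt by (auto simp: quasi_components_of_def)
  then have "quasi_component_of_set ?X x = {x}"
    using totally_disconnected x quasi_component_of_refl[of ?X x] by blast
  then have "{x} \<in> quasi_components_of ?X" using x by (auto simp: quasi_components_of_def)
  moreover have "compactin ?X (topspace ?X - U)"
    using O compact by (intro closedin_compact_space) auto
  ultimately have "separated_between ?X {x} (topspace ?X - U)"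
    using \<open>x \<in> U\<close> by (simp add: separated_between_quasi_component_compact)
  then obtain A B where AB: "openin ?X A" "openin ?X B" "A \<union> B = topspace ?X" "disjnt A B" "{x} \<subseteq> A"
      "topspace ?X - U \<subseteq> B"
    unfolding separated_between_def by metis
  have "A = topspace ?X - B" using AB by (auto simp: disjnt_def)
  then have "closedin ?X A" using AB(2) by auto
  moreover have "A \<subseteq> U" using AB by (auto simp: disjnt_def)
  ultimately show ?thesis using AB that by blast
qed

text \<open>For a clopen neighbourhood \<open>W\<close> of 1, the elements \<open>v\<close> such that \<open>a v b\<close> and \<open>a b\<close> are always
  on the same side of \<open>W\<close> form an open normal subgroup.\<close>

lemma (in profinite_group) open_normal_base:
  assumes "openin (gtop G) U" "\<one> \<in> U"
  obtains V where "V \<in> open_normal G" "V \<subseteq> U"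
proof -
  obtain W where W: "openin (gtop G) W" "closedin (gtop G) W" "\<one> \<in> W" "W \<subseteq> U"
    using clopen_neighbourhood[OF assms] .
  define N where "N = {v \<in> carrier G. \<forall>a\<in>carrier G. \<forall>b\<in>carrier G. a \<otimes> v \<otimes> b \<in> W \<longleftrightarrow> a \<otimes> b \<in> W}"
  have sub: "subgroup N G"
  proof (rule subgroupI)
    show "N \<noteq> {}" by (auto simp: N_def intro!: exI[of _ \<one>])
    show "inv v \<in> N" if v: "v \<in> N" for v
    proof -
      have "a \<otimes> inv v \<otimes> b \<in> W \<longleftrightarrow> a \<otimes> b \<in> W" if "a \<in> carrier G" "b \<in> carrier G" for a b
      proof -
        have "(a \<otimes> inv v) \<otimes> v \<otimes> b \<in> W \<longleftrightarrow> (a \<otimes> inv v) \<otimes> b \<in> W" using v that by (simp add: N_def)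
        then show ?thesis using v that by (simp add: N_def m_assoc)
      qed
      then show ?thesis using v by (simp add: N_def)
    qed
    show "v \<otimes> w \<in> N" if v: "v \<in> N" and w: "w \<in> N" for v w
    proof -
      have "a \<otimes> (v \<otimes> w) \<otimes> b \<in> W \<longleftrightarrow> a \<otimes> b \<in> W" if "a \<in> carrier G" "b \<in> carrier G" for a b
      proof -
        have "a \<otimes> v \<otimes> (w \<otimes> b) \<in> W \<longleftrightarrow> a \<otimes> (w \<otimes> b) \<in> W" using v w that by (simp add: N_def)
        moreover have "a \<otimes> w \<otimes> b \<in> W \<longleftrightarrow> a \<otimes> b \<in> W" using w that by (simp add: N_def)
        ultimately show ?thesis using v w that by (simp add: N_def m_assoc)
      qed
      then show ?thesis using v w by (simp add: N_def)
    qed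
  qed (auto simp: N_def)
  have "N \<lhd> G"
    unfolding normal_inv_iff
  proof (intro conjI sub ballI)
    fix x v assume x: "x \<in> carrier G" and v: "v \<in> N"
    then have vc: "v \<in> carrier G" by (simp add: N_def)
    have "a \<otimes> (x \<otimes> v \<otimes> inv x) \<otimes> b \<in> W \<longleftrightarrow> a \<otimes> b \<in> W" if a: "a \<in> carrier G" and b: "b \<in> carrier G" for a b
    proof -
      have "\<forall>a\<in>carrier G. \<forall>b\<in>carrier G. a \<otimes> v \<otimes> b \<in> W \<longleftrightarrow> a \<otimes> b \<in> W" using v by (simp add: N_def)
      then have "(a \<otimes> x) \<otimes> v \<otimes> (inv x \<otimes> b) \<in> W \<longleftrightarrow> (a \<otimes> x) \<otimes> (inv x \<otimes> b) \<in> W"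
        using x a b by (meson m_closed inv_closed)
      moreover have "(a \<otimes> x) \<otimes> (inv x \<otimes> b) = a \<otimes> b"
        using x a b by (metis inv_closed l_one m_assoc m_closed r_inv)
      moreover have "a \<otimes> (x \<otimes> v \<otimes> inv x) \<otimes> b = (a \<otimes> x) \<otimes> v \<otimes> (inv x \<otimes> b)"
        using x a b vc by (simp add: m_assoc)
      ultimately show ?thesis by simp
    qed
    then show "x \<otimes> v \<otimes> inv x \<in> N" using x vc by (simp add: N_def)
  qed
  moreover have "openin (gtop G) N"
  proof -
    let ?GG = "prod_topology (gtop G) (gtop G)"
    let ?X = "prod_topology ?GG (gtop G)"
    let ?f = "\<lambda>z. fst (fst z) \<otimes> snd z \<otimes> snd (fst z)" and ?g = "\<lambda>z. fst (fst z) \<otimes> snd (fst z)"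
    have pr: "continuous_map ?X (gtop G) (\<lambda>z. fst (fst z))" "continuous_map ?X (gtop G) (\<lambda>z. snd (fst z))"
      "continuous_map ?X (gtop G) snd"
      using continuous_map_compose[OF continuous_map_fst continuous_map_fst]
        continuous_map_compose[OF continuous_map_fst continuous_map_snd] continuous_map_snd
      by (fastforce simp: o_def)+
    have f: "continuous_map ?X (gtop G) ?f" and g: "continuous_map ?X (gtop G) ?g"
      by (intro continuous_map_mult pr)+
    \<comment> \<open>The triples for which the two products lie on the same side of
      \<open>W\<close>. This set is open because \<open>W\<close> is clopen, and it contains the
      slice over 1, so compactness of G x G supplies a tube around that slice.\<close>
    let ?S = "({z \<in> topspace ?X. ?f z \<in> W} \<inter> {z \<in> topspace ?X. ?g z \<in> W}) \<union>
       ({z \<in> topspace ?X. ?f z \<in> topspace (gtop G) - W} \<inter> {z \<in> topspace ?X. ?g z \<in> topspace (gtop G) - W})"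
    have "openin ?X ?S"
      using W by (intro openin_Un openin_Int openin_continuous_map_preimage[OF f]
          openin_continuous_map_preimage[OF g]) auto
    moreover have "compactin ?GG (topspace ?GG)"
      using compact compact_space_prod_topology[of "gtop G" "gtop G"] unfolding compact_space_def by blast
    moreover have "\<one> \<in> topspace (gtop G)" by (simp add: topspace_gtop)
    moreover have "topspace ?GG \<times> {\<one>} \<subseteq> ?S" by (auto simp: topspace_gtop)
    ultimately obtain V where V: "openin (gtop G) V" "\<one> \<in> V" "topspace ?GG \<times> V \<subseteq> ?S"
      using tube_lemma_left[of ?GG "gtop G" ?S "topspace ?GG" \<one>]
      by (meson order_trans Sigma_mono order_refl subset_trans)
    have "V \<subseteq> N"
    proof
      fix v assume v: "v \<in> V"
      then have "v \<in> carrier G" using V(1) openin_subset_carrier by blast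
      moreover have "a \<otimes> v \<otimes> b \<in> W \<longleftrightarrow> a \<otimes> b \<in> W" if "a \<in> carrier G" "b \<in> carrier G" for a b
      proof -
        have "((a, b), v) \<in> ?S"
          by (rule subsetD[OF V(3)]) (use that v in \<open>simp add: topspace_gtop\<close>)
        then show ?thesis by auto
      qed
      ultimately show "v \<in> N" by (simp add: N_def)
    qed
    then show ?thesis by (rule openin_subgroupI[OF sub V(1,2)])
  qed
  ultimately have "N \<in> open_normal G" by (simp add: open_normal_def)
  moreover have "N \<subseteq> U"
  proof
    fix v assume v: "v \<in> N"
    then have vc: "v \<in> carrier G"
      and *: "\<forall>a\<in>carrier G. \<forall>b\<in>carrier G. a \<otimes> v \<otimes> b \<in> W \<longleftrightarrow> a \<otimes> b \<in> W"
      by (simp_all add: N_def)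
    have "v \<in> W" using bspec[OF bspec[OF * one_closed] one_closed] vc W(3) by simp
    then show "v \<in> U" using W(4) by blast
  qed
  ultimately show ?thesis using that by blast
qed

section \<open>Cohomology of a quotient\<close>

lemma with_act_simps [simp]:
  "carrier (with_act M a) = carrier M" "monoid.mult (with_act M a) = monoid.mult M"
  "one (with_act M a) = one M" "gtop (with_act M a) = gtop M" "act (with_act M a) = a"
  by (simp_all add: with_act_def)

lemma m_inv_with_act [simp]: "m_inv (with_act M a) = m_inv M"
  by (simp add: m_inv_def fun_eq_iff)

lemma comm_group_with_act [simp]: "comm_group (with_act M a) = comm_group M"
  unfolding comm_group_def comm_monoid_def monoid_def comm_monoid_axioms_def
    group_def group_axioms_def Units_def
  by (simp only: with_act_simps)

lemma tsub_simps [simp]: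
  "carrier (tsub G H) = H" "monoid.mult (tsub G H) = monoid.mult G" "one (tsub G H) = one G"
  "gtop (tsub G H) = subtopology (gtop G) H"
  by (simp_all add: tsub_def)

lemma (in topological_group) topological_group_tsub:
  assumes "subgroup K G"
  shows "topological_group (tsub G K)"
proof -
  have Kc: "K \<subseteq> carrier G" using assms by (rule subgroup.subset)
  interpret K: group "tsub G K"
    using subgroup_imp_group[OF assms] by (simp add: tsub_def)
  show ?thesis
  proof
    show "topspace (gtop (tsub G K)) = carrier (tsub G K)" using Kc by (auto simp: topspace_gtop)
    have "continuous_map (subtopology (prod_topology (gtop G) (gtop G)) (K \<times> K)) (subtopology (gtop G) K)
        (\<lambda>(x, y). x \<otimes> y)"
      using subgroup.m_closed[OF assms] continuous_map_from_subtopology[OF continuous_mult, of "K \<times> K"]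
      by (intro continuous_map_into_subtopology) auto
    then show "continuous_map (prod_topology (gtop (tsub G K)) (gtop (tsub G K))) (gtop (tsub G K))
        (\<lambda>(x, y). x \<otimes>\<^bsub>tsub G K\<^esub> y)"
      by (simp add: subtopology_Times)
    have "continuous_map (subtopology (gtop G) K) (subtopology (gtop G) K) (\<lambda>x. inv x)"
      using subgroup.m_inv_closed[OF assms] continuous_map_from_subtopology[OF continuous_inv, of K]
      by (intro continuous_map_into_subtopology) auto
    then show "continuous_map (gtop (tsub G K)) (gtop (tsub G K)) (\<lambda>x. inv\<^bsub>tsub G K\<^esub> x)"
    proof (simp, elim continuous_map_eq)
      fix x assume "x \<in> topspace (subtopology (gtop G) K)"
      then have "x \<in> K" by simp
      then show "inv x = inv\<^bsub>tsub G K\<^esub> x" using m_inv_consistent[OF assms, of x] by (simp add: tsub_def)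
    qed
  qed
qed

lemma carrier_cohomology: "carrier (cohomology G M k) = coh_class G M k ` cocycles G M k"
  by (simp add: cohomology_def carrier_FactGroup coh_class_def r_coset_def)

lemma one_cohomology: "\<one>\<^bsub>cohomology G M k\<^esub> = coboundaries G M k"
  by (simp add: cohomology_def)

lemma coh_class_eq: "coh_class G M k f = {b \<otimes>\<^bsub>cochain_group G M k\<^esub> f | b. b \<in> coboundaries G M k}"
  by (auto simp: coh_class_def r_coset_def)

lemma coboundaries_Suc [simp]: "coboundaries G M (Suc k) = coboundary G M k ` cochains G M k"
  by (simp add: coboundaries_def)

lemma coboundaries_2 [simp]: "coboundaries G M 2 = coboundary G M (Suc 0) ` cochains G M (Suc 0)"
  by (simp add: numeral_2_eq_2)

lemma coboundaries_3 [simp]: "coboundaries G M 3 = coboundary G M 2 ` cochains G M 2"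
  using coboundaries_Suc[of G M 2] by simp

context discrete_module
begin

lemma coboundaries_subgroup: "subgroup (coboundaries G M k) (cochain_group G M k)"
proof (cases k)
  case 0
  interpret C: comm_group "cochain_group G M 0" by (rule group_cochains)
  show ?thesis using 0 C.triv_subgroup by (simp add: coboundaries_def)
next
  case (Suc j)
  interpret d: group_hom "cochain_group G M j" "cochain_group G M (Suc j)" "coboundary G M j"
    by (rule coboundary_group_hom)
  show ?thesis using Suc d.img_is_subgroup by simp
qed

lemma coh_class_self: "f \<in> cochains G M k \<Longrightarrow> f \<in> coh_class G M k f"
proof -
  interpret C: comm_group "cochain_group G M k" by (rule group_cochains)
  show "f \<in> cochains G M k \<Longrightarrow> f \<in> coh_class G M k f"
    unfolding coh_class_def using C.rcos_self coboundaries_subgroup by simp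
qed

lemma coh_class_eqI:
  assumes "f \<in> cochains G M k" "f' \<in> coh_class G M k f"
  shows "coh_class G M k f' = coh_class G M k f"
proof -
  interpret C: comm_group "cochain_group G M k" by (rule group_cochains)
  show ?thesis
    using assms C.repr_independence[OF _ _ coboundaries_subgroup] unfolding coh_class_def by fastforce
qed

lemma coh_class_one_iff:
  assumes "f \<in> cochains G M k"
  shows "coh_class G M k f = \<one>\<^bsub>cohomology G M k\<^esub> \<longleftrightarrow> f \<in> coboundaries G M k"
proof -
  interpret C: comm_group "cochain_group G M k" by (rule group_cochains)
  have "coboundaries G M k #>\<^bsub>cochain_group G M k\<^esub> f = coboundaries G M k \<longleftrightarrow> f \<in> coboundaries G M k"
    using assms coboundaries_subgroup
    by (metis C.coset_join1 C.coset_join2 carrier_cochain_group subgroup.subset)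
  then show ?thesis by (simp add: one_cohomology coh_class_def)
qed

text \<open>The inverse-free form, ready for substituting the unit for some of the
  arguments.\<close>

lemma cocycle_2_iff:
  "z \<in> cocycles G M 2 \<longleftrightarrow> z \<in> cochains G M 2 \<and>
    (\<forall>a\<in>carrier G. \<forall>b\<in>carrier G. \<forall>c\<in>carrier G.
      act M a (z (tup [b, c])) \<otimes>\<^bsub>M\<^esub> z (tup [a, b \<otimes> c]) = z (tup [a \<otimes> b, c]) \<otimes>\<^bsub>M\<^esub> z (tup [a, b]))"
proof (cases "z \<in> cochains G M 2")
  case True
  have zc: "z (tup [x, y]) \<in> carrier M" if "x \<in> carrier G" "y \<in> carrier G" for x y
    using that by (intro cochains_closed[OF True]) simp
  have alg: "A \<otimes>\<^bsub>M\<^esub> inv\<^bsub>M\<^esub> B \<otimes>\<^bsub>M\<^esub> C \<otimes>\<^bsub>M\<^esub> inv\<^bsub>M\<^esub> D = \<one>\<^bsub>M\<^esub> \<longleftrightarrow> A \<otimes>\<^bsub>M\<^esub> C = B \<otimes>\<^bsub>M\<^esub> D"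
    if "A \<in> carrier M" "B \<in> carrier M" "C \<in> carrier M" "D \<in> carrier M" for A B C D
  proof -
    have "A \<otimes>\<^bsub>M\<^esub> inv\<^bsub>M\<^esub> B \<otimes>\<^bsub>M\<^esub> C \<otimes>\<^bsub>M\<^esub> inv\<^bsub>M\<^esub> D = (A \<otimes>\<^bsub>M\<^esub> C) \<otimes>\<^bsub>M\<^esub> inv\<^bsub>M\<^esub> (B \<otimes>\<^bsub>M\<^esub> D)"
      using that by (simp add: M.inv_mult M.m_ac)
    then show ?thesis using that
      by (metis M.inv_closed M.inv_equality M.inv_inv M.m_closed M.r_inv)
  qed
  have "z \<in> cocycles G M 2 \<longleftrightarrow> (\<forall>x\<in>tuples G 3. coboundary G M 2 z x = \<one>\<^bsub>M\<^esub>)"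
    using True cochain_extensional(2)[of G M 3] cochain_extensional(3)[of G M 2 z]
    by (auto simp: cocycles_def simp del: cochain_extensional intro: tuples_eqI)
  also have "\<dots> \<longleftrightarrow> (\<forall>a\<in>carrier G. \<forall>b\<in>carrier G. \<forall>c\<in>carrier G. coboundary G M 2 z (tup [a, b, c]) = \<one>\<^bsub>M\<^esub>)"
    by (auto elim!: tuples_3E)
  also have "\<dots> \<longleftrightarrow> (\<forall>a\<in>carrier G. \<forall>b\<in>carrier G. \<forall>c\<in>carrier G.
      act M a (z (tup [b, c])) \<otimes>\<^bsub>M\<^esub> z (tup [a, b \<otimes> c]) = z (tup [a \<otimes> b, c]) \<otimes>\<^bsub>M\<^esub> z (tup [a, b]))"
    by (intro ball_cong refl) (simp add: coboundary_2[OF True] alg zc)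
  finally show ?thesis using True by simp
qed (simp add: cocycles_def)

lemma cochain_1_eqI:
  assumes "f \<in> cochains G M (Suc 0)" "f' \<in> cochains G M (Suc 0)"
    and "\<And>a. a \<in> carrier G \<Longrightarrow> f (tup [a]) = f' (tup [a])"
  shows "f = f'"
  using assms by (intro cochain_eqI[of _ "Suc 0"]) (auto elim!: tuples_1E)

lemma cochain_1_closed: "f \<in> cochains G M (Suc 0) \<Longrightarrow> a \<in> carrier G \<Longrightarrow> f (tup [a]) \<in> carrier M"
  by (rule cochains_closed, assumption, simp)

lemma cochain_2_closed:
  "f \<in> cochains G M 2 \<Longrightarrow> a \<in> carrier G \<Longrightarrow> b \<in> carrier G \<Longrightarrow> f (tup [a, b]) \<in> carrier M"
  by (rule cochains_closed, assumption, simp)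

lemma coboundary_1_in_cochains: "f \<in> cochains G M (Suc 0) \<Longrightarrow> coboundary G M (Suc 0) f \<in> cochains G M 2"
  using coboundary_in_cochains[of f "Suc 0"] by (simp add: numeral_2_eq_2)

lemma coboundary_2_in_cochains: "f \<in> cochains G M 2 \<Longrightarrow> coboundary G M 2 f \<in> cochains G M 3"
  using coboundary_in_cochains[of f 2] by simp

lemma coboundary_1_cocycle: "f \<in> cochains G M (Suc 0) \<Longrightarrow> coboundary G M (Suc 0) f \<in> cocycles G M 2"
  by (simp add: cocycles_def coboundary_1_in_cochains coboundary_squared_1)

lemma coboundary_1_group_hom:
  "group_hom (cochain_group G M (Suc 0)) (cochain_group G M 2) (coboundary G M (Suc 0))"
  using coboundary_group_hom[of "Suc 0"] by (simp add: numeral_2_eq_2)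

lemma coboundary_2_group_hom:
  "group_hom (cochain_group G M 2) (cochain_group G M 3) (coboundary G M 2)"
  using coboundary_group_hom[of 2] by simp

definition cochain_1_of :: "('g \<Rightarrow> 'm) \<Rightarrow> (nat \<Rightarrow> 'g) \<Rightarrow> 'm" where
  "cochain_1_of F = (\<lambda>x\<in>tuples G (Suc 0). F (x 0))"

lemma cochain_1_of_in_cochains:
  assumes "continuous_map (gtop G) (gtop M) F"
  shows "cochain_1_of F \<in> cochains G M (Suc 0)"
  unfolding cochain_1_of_def
  using continuous_map_compose[OF continuous_map_tuples_component assms, of 0 "Suc 0"]
  by (intro cochainsI) (simp add: o_def)

lemma cochain_1_of_tup [simp]: "a \<in> carrier G \<Longrightarrow> cochain_1_of F (tup [a]) = F a"
  by (simp add: cochain_1_of_def)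

text \<open>Subtracting the coboundary of the constant cochain \<open>z(1, 1)\<close> normalizes \<open>z\<close>.\<close>

lemma cocycle_2_normalize:
  assumes z: "z \<in> cocycles G M 2"
  obtains k where "k \<in> cochains G M (Suc 0)"
    "normalized G M 2 (coboundary G M (Suc 0) k \<otimes>\<^bsub>cochain_group G M 2\<^esub> z)"
    "\<And>a. a \<in> carrier G \<Longrightarrow> k (tup [a]) = inv\<^bsub>M\<^esub> z (tup [\<one>, \<one>])"
proof -
  define m where "m = z (tup [\<one>, \<one>])"
  let ?k = "cochain_1_of (\<lambda>_. inv\<^bsub>M\<^esub> m)"
  have zc: "z \<in> cochains G M 2" using z by (simp add: cocycles_def)
  have m: "m \<in> carrier M" using cochain_2_closed[OF zc] by (simp add: m_def)
  have k: "?k \<in> cochains G M (Suc 0)" using m by (intro cochain_1_of_in_cochains) (simp add: gtop_M)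
  have coc: "act M a (z (tup [b, c])) \<otimes>\<^bsub>M\<^esub> z (tup [a, b \<otimes> c]) = z (tup [a \<otimes> b, c]) \<otimes>\<^bsub>M\<^esub> z (tup [a, b])"
    if "a \<in> carrier G" "b \<in> carrier G" "c \<in> carrier G" for a b c
    using z that by (simp add: cocycle_2_iff)
  \<comment> \<open>The cocycle identity at (1, 1, a) and, in the next step, at (a, 1, 1).\<close>
  have left: "z (tup [\<one>, a]) = m" if a: "a \<in> carrier G" for a
    using coc[of \<one> \<one> a] a m cochain_2_closed[OF zc, of \<one> a] by (simp add: act_one m_def[symmetric])
  have right: "z (tup [a, \<one>]) = act M a m" if a: "a \<in> carrier G" for a
    using coc[of a \<one> \<one>] a m cochain_2_closed[OF zc, of a \<one>] by (simp add: m_def[symmetric])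
  \<comment> \<open>For a constant cochain the two untwisted terms of the coboundary cancel and
    leave a(-m), the negative of both values found above, with a = 1 in the case of
    \<open>left\<close>.\<close>
  have dk: "coboundary G M (Suc 0) ?k (tup [a, b]) = inv\<^bsub>M\<^esub> act M a m" if "a \<in> carrier G" "b \<in> carrier G"
      for a b
    using that m k by (simp add: coboundary_1 act_inv M.m_assoc)
  show ?thesis
  proof (rule that[OF k])
    show "normalized G M 2 (coboundary G M (Suc 0) ?k \<otimes>\<^bsub>cochain_group G M 2\<^esub> z)"
      unfolding normalized_def
    proof (intro ballI impI)
      fix x assume "x \<in> tuples G 2" and ex: "\<exists>i<2. x i = \<one>"
      then obtain a b where ab: "a \<in> carrier G" "b \<in> carrier G" "x = tup [a, b]" by (elim tuples_2E)
      then have "a = \<one> \<or> b = \<one>" using ex by (auto simp: less_2_cases_iff)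
      then show "(coboundary G M (Suc 0) ?k \<otimes>\<^bsub>cochain_group G M 2\<^esub> z) x = \<one>\<^bsub>M\<^esub>"
        using ab m by (auto simp: dk left right act_one)
    qed
  qed (simp add: m_def)
qed

end

section \<open>Modules over G/H and inflation of cochains\<close>

locale quotient_module = topological_quotient G H + N: discrete_module "tquot G H" N
  for G :: "('g, 'b) tgroup_scheme" (structure) and H and N :: "('g set, 'm) tmod"
begin

abbreviation M where "M \<equiv> inflated G H N"

lemma inflated_simps [simp]:
  "carrier M = carrier N" "monoid.mult M = monoid.mult N" "one M = one N" "gtop M = gtop N"
  "act M = (\<lambda>g. act N (proj g))" "m_inv M = m_inv N"
  by (simp_all add: inflated_def pullback_mod_def)

lemma discrete_module_inflated: "discrete_module G M"
proof -
  interpret M: comm_group M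
    using N.M.comm_group_axioms by (simp add: inflated_def pullback_mod_def)
  show ?thesis
  proof
    fix x assume "x \<in> carrier M"
    then show "continuous_map (gtop G) (discrete_topology (carrier M)) (\<lambda>g. act M g x)"
      using continuous_map_compose[OF proj_continuous N.act_continuous] by (simp add: o_def)
  qed (use N.act_hom N.act_one N.act_act in
      \<open>auto simp: N.gtop_M proj_one proj_mult[symmetric] hom_def\<close>)
qed

sublocale M: discrete_module G M by (rule discrete_module_inflated)

lemma discrete_module_restricted: "discrete_module (tsub G H) M"
proof -
  interpret T: topological_group "tsub G H" by (rule topological_group_tsub[OF is_subgroup])
  show ?thesis
  proof (intro discrete_module.intro discrete_module_axioms.intro T.topological_group_axioms
      M.M.comm_group_axioms)
    fix x assume "x \<in> carrier M"
    then show "continuous_map (gtop (tsub G H)) (discrete_topology (carrier M)) (\<lambda>g. act M g x)"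
      using M.act_continuous by (simp add: continuous_map_from_subtopology)
  qed (use M.act_hom M.act_one M.act_act M.gtop_M in auto)
qed

sublocale T: discrete_module "tsub G H" M by (rule discrete_module_restricted)

lemma act_H: "h \<in> H \<Longrightarrow> x \<in> carrier N \<Longrightarrow> act N (proj h) x = x"
  using N.act_one by (simp add: proj_H)

lemma inflation_map: "module_map Q N G M proj (\<lambda>x. x)"
proof (intro module_map.intro module_map_axioms.intro N.discrete_module_axioms M.discrete_module_axioms)
  show "(\<lambda>x. x) \<in> hom N M" by (auto simp: hom_def)
qed (simp_all add: proj_hom proj_continuous)

sublocale inf: module_map Q N G M proj "\<lambda>x. x" by (rule inflation_map)

abbreviation infl :: "nat \<Rightarrow> ((nat \<Rightarrow> 'g set) \<Rightarrow> 'm) \<Rightarrow> (nat \<Rightarrow> 'g) \<Rightarrow> 'm" where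
  "infl k \<equiv> cochain_map G k proj (\<lambda>x. x)"

lemma proj_tuples_surj:
  assumes "y \<in> tuples Q k"
  obtains x where "x \<in> tuples G k" "(\<lambda>i\<in>{..<k}. proj (x i)) = y"
proof -
  have "y \<in> (\<lambda>x. \<lambda>i\<in>{..<k}. proj (x i)) ` tuples G k"
    using quotient_imp_surjective_map[OF proj_tuples_quotient_map[of k]] assms
    unfolding topspace_tuples Q.topspace_tuples by simp
  then show ?thesis by (rule imageE) (rule that, assumption, rule sym)
qed

lemma infl_inj:
  assumes u: "u \<in> cochains Q N k" and u': "u' \<in> cochains Q N k" and eq: "infl k u = infl k u'"
  shows "u = u'"
proof (rule N.cochain_eqI[OF u u'])
  fix y assume "y \<in> tuples Q k"
  then obtain x where "x \<in> tuples G k" "(\<lambda>i\<in>{..<k}. proj (x i)) = y" by (rule proj_tuples_surj)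
  then show "u y = u' y" using fun_cong[OF eq, of x] by (simp add: inf.cochain_map_apply)
qed

text \<open>The value at a tuple of cosets is read off at any tuple of representatives, and
  continuity passes down because the projection of tuples is a quotient map.\<close>

lemma infl_surj:
  assumes D: "D \<in> cochains G M k"
    and inv: "\<And>x y. x \<in> tuples G k \<Longrightarrow> y \<in> tuples G k \<Longrightarrow> (\<And>i. i < k \<Longrightarrow> proj (x i) = proj (y i)) \<Longrightarrow> D x = D y"
  obtains u where "u \<in> cochains Q N k" "infl k u = D"
proof -
  let ?\<pi> = "\<lambda>x. \<lambda>i\<in>{..<k}. proj (x i)"
  define u where "u = (\<lambda>y\<in>tuples Q k. D (SOME x. x \<in> tuples G k \<and> ?\<pi> x = y))"
  have \<pi>: "?\<pi> x \<in> tuples Q k" if "x \<in> tuples G k" for x using that by (rule inf.map_in_tuples)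
  have u\<pi>: "u (?\<pi> x) = D x" if x: "x \<in> tuples G k" for x
  proof -
    let ?y = "SOME y. y \<in> tuples G k \<and> ?\<pi> y = ?\<pi> x"
    have y: "?y \<in> tuples G k \<and> ?\<pi> ?y = ?\<pi> x" by (rule someI[of _ x]) (simp add: x)
    have "proj (?y i) = proj (x i)" if "i < k" for i using fun_cong[OF conjunct2[OF y], of i] that by simp
    then have "D ?y = D x" using x y by (intro inv) blast+
    then show ?thesis using \<pi>[OF x] by (simp add: u_def)
  qed
  have "continuous_map (product_topology (\<lambda>_. gtop G) {..<k}) (gtop N) (u \<circ> ?\<pi>)"
    by (rule continuous_map_eq[OF M.cochain_continuous[OF D, unfolded inflated_simps]])
      (simp only: topspace_tuples o_def u\<pi>)
  then have "continuous_map (product_topology (\<lambda>_. gtop Q) {..<k}) (gtop N) u"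
    by (rule continuous_compose_quotient_map[OF proj_tuples_quotient_map])
  then have "u \<in> cochains Q N k" by (simp add: N.cochains_iff u_def)
  moreover from this have "infl k u = D"
    using D by (intro M.cochain_eqI[of _ k]) (auto simp: inf.cochain_map_closed inf.cochain_map_apply u\<pi>)
  ultimately show ?thesis using that by blast
qed

text \<open>The subgroup \<open>H\<close> acts trivially on an inflated module, so all differences h
  m - m vanish. Classes in the first cohomology of \<open>H\<close> are therefore
  singletons.\<close>

lemma coboundaries_H: "coboundaries (tsub G H) M (Suc 0) = {\<one>\<^bsub>cochain_group (tsub G H) M (Suc 0)\<^esub>}"
proof -
  interpret d: group_hom "cochain_group (tsub G H) M 0" "cochain_group (tsub G H) M (Suc 0)"
    "coboundary (tsub G H) M 0" by (rule T.coboundary_group_hom)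
  have "coboundary (tsub G H) M 0 f = \<one>\<^bsub>cochain_group (tsub G H) M (Suc 0)\<^esub>"
    if f: "f \<in> cochains (tsub G H) M 0" for f
  proof (rule T.cochain_1_eqI)
    fix a assume a: "a \<in> carrier (tsub G H)"
    have fc: "f (tup []) \<in> carrier N" using cochains_closed[OF f, of "tup []"] by simp
    have "a \<in> H" using a by simp
    have "coboundary (tsub G H) M 0 f (tup [a]) = \<one>\<^bsub>N\<^esub>"
      unfolding T.coboundary_0[OF f a] inflated_simps act_H[OF \<open>a \<in> H\<close> fc] using fc by (rule N.M.r_inv)
    moreover have "\<one>\<^bsub>cochain_group (tsub G H) M (Suc 0)\<^esub> (tup [a]) = \<one>\<^bsub>N\<^esub>"
      using a by (subst cochain_one_apply) simp_all
    ultimately show "coboundary (tsub G H) M 0 f (tup [a]) = \<one>\<^bsub>cochain_group (tsub G H) M (Suc 0)\<^esub> (tup [a])"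
      by (simp only:)
  qed (use that in \<open>auto simp: T.coboundary_in_cochains T.cochain_one_closed\<close>)
  then show ?thesis using T.cochain_one_closed[of 0] d.hom_one by auto
qed

lemma coh_class_H: "f \<in> cochains (tsub G H) M (Suc 0) \<Longrightarrow> coh_class (tsub G H) M (Suc 0) f = {f}"
proof -
  interpret C: comm_group "cochain_group (tsub G H) M (Suc 0)" by (rule T.group_cochains)
  show "f \<in> cochains (tsub G H) M (Suc 0) \<Longrightarrow> coh_class (tsub G H) M (Suc 0) f = {f}"
    unfolding coh_class_eq coboundaries_H using C.l_one[of f] by auto
qed

definition invariant_hom :: "((nat \<Rightarrow> 'g) \<Rightarrow> 'm) \<Rightarrow> bool" where
  "invariant_hom f \<longleftrightarrow> f \<in> cochains (tsub G H) M (Suc 0) \<and>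
    (\<forall>a\<in>H. \<forall>b\<in>H. f (tup [a \<otimes> b]) = f (tup [a]) \<otimes>\<^bsub>N\<^esub> f (tup [b])) \<and>
    (\<forall>\<sigma>\<in>carrier G. \<forall>h\<in>H. f (tup [h]) = act N (proj \<sigma>) (f (tup [inv \<sigma> \<otimes> h \<otimes> \<sigma>])))"

text \<open>For a trivial action the 1-cocycles are the homomorphisms, and in the absence of nonzero
  coboundaries an invariant class is the same as an invariant function.\<close>

lemma coh_invariants_eq: "coh_invariants G H M (Suc 0) = {{f} | f. invariant_hom f}"
proof -
  have closed: "f (tup [h]) \<in> carrier N" if "f \<in> cochains (tsub G H) M (Suc 0)" "h \<in> H" for f h
    using T.cochain_1_closed[OF that(1), of h] that(2) by simp
  have coc: "f \<in> cocycles (tsub G H) M (Suc 0) \<longleftrightarrow>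
      (\<forall>a\<in>H. \<forall>b\<in>H. f (tup [a \<otimes> b]) = f (tup [a]) \<otimes>\<^bsub>N\<^esub> f (tup [b]))"
    if f: "f \<in> cochains (tsub G H) M (Suc 0)" for f
  proof -
    have alg: "A \<otimes>\<^bsub>N\<^esub> inv\<^bsub>N\<^esub> B \<otimes>\<^bsub>N\<^esub> C = \<one>\<^bsub>N\<^esub> \<longleftrightarrow> B = C \<otimes>\<^bsub>N\<^esub> A"
      if "A \<in> carrier N" "B \<in> carrier N" "C \<in> carrier N" for A B C
    proof -
      have "A \<otimes>\<^bsub>N\<^esub> inv\<^bsub>N\<^esub> B \<otimes>\<^bsub>N\<^esub> C = (C \<otimes>\<^bsub>N\<^esub> A) \<otimes>\<^bsub>N\<^esub> inv\<^bsub>N\<^esub> B" using that by (simp add: N.M.m_ac)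
      then show ?thesis using that
        by (metis N.M.inv_closed N.M.inv_equality N.M.inv_inv N.M.m_closed N.M.r_inv)
    qed
    have "f \<in> cocycles (tsub G H) M (Suc 0) \<longleftrightarrow>
        (\<forall>x\<in>tuples (tsub G H) 2. coboundary (tsub G H) M (Suc 0) f x = \<one>\<^bsub>N\<^esub>)"
      using f cochain_extensional(2)[of "tsub G H" M 2] cochain_extensional(3)[of "tsub G H" M "Suc 0" f]
      by (auto simp: cocycles_def numeral_2_eq_2 simp del: cochain_extensional intro: tuples_eqI)
    also have "\<dots> \<longleftrightarrow> (\<forall>a\<in>H. \<forall>b\<in>H. coboundary (tsub G H) M (Suc 0) f (tup [a, b]) = \<one>\<^bsub>N\<^esub>)"
      by (auto elim!: tuples_2E)
    also have "\<dots> \<longleftrightarrow> (\<forall>a\<in>H. \<forall>b\<in>H. f (tup [a \<otimes> b]) = f (tup [a]) \<otimes>\<^bsub>N\<^esub> f (tup [b]))"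
      using T.coboundary_1[OF f] by (intro ball_cong refl) (simp add: act_H closed[OF f] alg)
    finally show ?thesis .
  qed
  have conj: "inv \<sigma> \<otimes> h \<otimes> \<sigma> \<in> H" if "\<sigma> \<in> carrier G" "h \<in> H" for \<sigma> h
    using that by (rule inv_op_closed1)
  let ?c = "\<lambda>\<sigma>. cochain_map (tsub G H) (Suc 0) (\<lambda>h. inv \<sigma> \<otimes> h \<otimes> \<sigma>) (act N (proj \<sigma>))"
  have c_tup: "?c \<sigma> f (tup [h]) = act N (proj \<sigma>) (f (tup [inv \<sigma> \<otimes> h \<otimes> \<sigma>]))" if "h \<in> H" for f \<sigma> h
    using that restrict_tup_map[of "Suc 0" "[h]" "\<lambda>h. inv \<sigma> \<otimes> h \<otimes> \<sigma>"] by (simp add: cochain_map_def)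
  have inv_iff: "coh_map (tsub G H) M (Suc 0) (\<lambda>h. inv \<sigma> \<otimes> h \<otimes> \<sigma>) (act N (proj \<sigma>)) {f} = {f}
      \<longleftrightarrow> (\<forall>h\<in>H. f (tup [h]) = act N (proj \<sigma>) (f (tup [inv \<sigma> \<otimes> h \<otimes> \<sigma>])))"
    if f: "f \<in> cochains (tsub G H) M (Suc 0)" and \<sigma>: "\<sigma> \<in> carrier G" for f \<sigma>
  proof -
    let ?one = "\<one>\<^bsub>cochain_group (tsub G H) M (Suc 0)\<^esub>"
    have "coh_map (tsub G H) M (Suc 0) (\<lambda>h. inv \<sigma> \<otimes> h \<otimes> \<sigma>) (act N (proj \<sigma>)) {f}
        = {?one \<otimes>\<^bsub>cochain_group (tsub G H) M (Suc 0)\<^esub> ?c \<sigma> f}"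
      unfolding coh_map_def coh_class_eq coboundaries_H by simp
    moreover have "?one \<otimes>\<^bsub>cochain_group (tsub G H) M (Suc 0)\<^esub> ?c \<sigma> f = f \<longleftrightarrow>
        (\<forall>h\<in>H. ?c \<sigma> f (tup [h]) = f (tup [h]))"
    proof -
      have "(?one \<otimes>\<^bsub>cochain_group (tsub G H) M (Suc 0)\<^esub> ?c \<sigma> f) (tup [h]) = ?c \<sigma> f (tup [h])" if "h \<in> H" for h
      proof -
        have "?c \<sigma> f (tup [h]) \<in> carrier N"
          unfolding c_tup[OF that] using that f \<sigma> conj by (simp add: closed)
        then show ?thesis using that by simp
      qed
      then show ?thesis
        using cochains_extensional[OF f]
        by (metis (no_types, lifting) cochain_extensional(1) extensionalityI tsub_simps(1) tuples_1E)
    qed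
    ultimately show ?thesis by (auto simp: c_tup)
  qed
  show ?thesis
  proof (intro equalityI subsetI)
    fix c assume c: "c \<in> coh_invariants G H M (Suc 0)"
    then obtain f where f: "f \<in> cocycles (tsub G H) M (Suc 0)" "c = coh_class (tsub G H) M (Suc 0) f"
      by (auto simp: coh_invariants_def carrier_cohomology)
    then have fc: "f \<in> cochains (tsub G H) M (Suc 0)" by (simp add: cocycles_def)
    then have "c = {f}" using f coh_class_H by simp
    with c f fc show "c \<in> {{f} | f. invariant_hom f}"
      using inv_iff[OF fc] coc[OF fc] by (auto simp: coh_invariants_def invariant_hom_def)
  next
    fix c assume "c \<in> {{f} | f. invariant_hom f}"
    then obtain f where c: "c = {f}" and f: "invariant_hom f" by blast
    then have fc: "f \<in> cochains (tsub G H) M (Suc 0)" by (simp add: invariant_hom_def)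
    with f have "f \<in> cocycles (tsub G H) M (Suc 0)" using coc[OF fc] by (simp add: invariant_hom_def)
    then have "c \<in> carrier (cohomology (tsub G H) M (Suc 0))"
      using c coh_class_H[OF fc] by (auto simp: carrier_cohomology)
    then show "c \<in> coh_invariants G H M (Suc 0)"
      using c f inv_iff[OF fc] by (simp add: coh_invariants_def invariant_hom_def)
  qed
qed

end

section \<open>Extension of invariant homomorphisms from H to cochains of the whole group\<close>

locale profinite_quotient_module = quotient_module G H N + profinite_group G
  for G :: "('g, 'b) tgroup_scheme" (structure) and H and N :: "('g set, 'm) tmod" +
  assumes closed_H: "closedin (gtop G) H"
begin

text \<open>Choose an open normal \<open>V\<close> with \<open>V \<inter> H\<close> in the kernel of \<open>f\<close> and representatives \<open>t\<close> of the
  cosets of \<open>H V\<close>, with \<open>t = 1\<close> for \<open>H V\<close> itself. The extension sends \<open>t h v\<close> to \<open>t f(h)\<close>.\<close>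

lemma invariant_hom_extends:
  assumes f: "invariant_hom f"
  obtains F where "F \<in> cochains G M (Suc 0)" "\<And>h. h \<in> H \<Longrightarrow> F (tup [h]) = f (tup [h])"
    "\<And>g h. g \<in> carrier G \<Longrightarrow> h \<in> H \<Longrightarrow>
       F (tup [g \<otimes> h]) = F (tup [g]) \<otimes>\<^bsub>N\<^esub> act N (proj g) (F (tup [h]))"
proof -
  define \<phi> where "\<phi> = (\<lambda>h. f (tup [h]))"
  have Hc: "h \<in> carrier G" if "h \<in> H" for h using that by simp
  have fc: "f \<in> cochains (tsub G H) M (Suc 0)" using f by (simp add: invariant_hom_def)
  have \<phi>_closed [simp]: "\<phi> h \<in> carrier N" if "h \<in> H" for h
    using T.cochain_1_closed[OF fc, of h] that by (simp add: \<phi>_def)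
  have \<phi>_mult: "\<phi> (a \<otimes> b) = \<phi> a \<otimes>\<^bsub>N\<^esub> \<phi> b" if "a \<in> H" "b \<in> H" for a b
    using f that by (simp add: invariant_hom_def \<phi>_def)
  have \<phi>_conj: "\<phi> (\<sigma> \<otimes> h \<otimes> inv \<sigma>) = act N (proj \<sigma>) (\<phi> h)" if "\<sigma> \<in> carrier G" "h \<in> H" for \<sigma> h
  proof -
    have "inv \<sigma> \<otimes> (\<sigma> \<otimes> h \<otimes> inv \<sigma>) \<otimes> \<sigma> = h" using that Hc by (simp add: m_assoc inv_solve_left')
    then show ?thesis using f that inv_op_closed2[OF that] unfolding invariant_hom_def \<phi>_def by metis
  qed
  have \<phi>_eq: "\<phi> a = \<phi> b" if "a \<in> H" "b \<in> H" "\<phi> (inv a \<otimes> b) = \<one>\<^bsub>N\<^esub>" for a b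
  proof -
    have "\<phi> b = \<phi> (a \<otimes> (inv a \<otimes> b))" using that Hc by (simp add: m_assoc[symmetric])
    also have "\<dots> = \<phi> a" using that by (subst \<phi>_mult) simp_all
    finally show ?thesis ..
  qed
  have "continuous_map (gtop (tsub G H)) (product_topology (\<lambda>_. gtop (tsub G H)) {..<Suc 0}) (\<lambda>h. tup [h])"
    by (auto simp: continuous_map_componentwise tup_def)
  then have "continuous_map (gtop (tsub G H)) (gtop M) \<phi>"
    unfolding \<phi>_def using continuous_map_compose[OF _ T.cochain_continuous[OF fc], of _ "\<lambda>h. tup [h]"]
    by (simp add: o_def)
  then have "openin (subtopology (gtop G) H) {h \<in> topspace (subtopology (gtop G) H). \<phi> h = \<one>\<^bsub>N\<^esub>}"
    by (simp add: N.gtop_M continuous_map_discrete_iff)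
  then obtain O' where O': "openin (gtop G) O'" "{h \<in> topspace (subtopology (gtop G) H). \<phi> h = \<one>\<^bsub>N\<^esub>} = O' \<inter> H"
    by (auto simp: openin_subtopology)
  have \<phi>_one: "\<phi> \<one> = \<one>\<^bsub>N\<^esub>"
  proof -
    have "\<phi> \<one> \<otimes>\<^bsub>N\<^esub> \<phi> \<one> = \<phi> (\<one> \<otimes> \<one>)" by (rule \<phi>_mult[symmetric]) simp_all
    also have "\<dots> = \<phi> \<one>" by simp
    finally show ?thesis using N.M.l_cancel_one'[of "\<phi> \<one>" "\<phi> \<one>"] \<phi>_closed[of \<one>] by auto
  qed
  \<comment> \<open>The kernel of the homomorphism is open in \<open>H\<close> only. Adding the
    complement of \<open>H\<close>, which is open because \<open>H\<close> is closed, gives an open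
    neighbourhood of 1 in \<open>G\<close> that meets \<open>H\<close> in the kernel.\<close>
  have "openin (gtop G) (O' \<union> (topspace (gtop G) - H))" using O'(1) closed_H by auto
  moreover have "\<one> \<in> O' \<inter> H"
    unfolding O'(2)[symmetric] using \<phi>_one by (simp add: topspace_gtop)
  then have "\<one> \<in> O' \<union> (topspace (gtop G) - H)" by blast
  ultimately obtain V where V: "V \<in> open_normal G" "V \<subseteq> O' \<union> (topspace (gtop G) - H)"
    by (rule open_normal_base)
  have V_normal: "V \<lhd> G" and V_open: "openin (gtop G) V" using V(1) by (auto simp: open_normal_def)
  interpret V: normal V G by (rule V_normal)
  have V_ker: "\<phi> x = \<one>\<^bsub>N\<^esub>" if "x \<in> V" "x \<in> H" for x
  proof -
    have "x \<in> O' \<inter> H" using that V(2) by blast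
    then show ?thesis unfolding O'(2)[symmetric] by blast
  qed
  define W where "W = H <#> V"
  have W: "subgroup W G" unfolding W_def
    using mult_norm_subgroup[OF normal_axioms] V_normal normal_imp_subgroup by blast
  have W_H: "h \<in> W" if "h \<in> H" for h
  proof -
    have "h \<otimes> \<one> \<in> H <#> V" using that V.one_closed unfolding set_mult_def by blast
    then show ?thesis using that by (simp add: W_def)
  qed
  have W_V: "v \<in> W" if "v \<in> V" for v
  proof -
    have "\<one> \<otimes> v \<in> H <#> V" using that one_closed unfolding set_mult_def by blast
    then show ?thesis using that by (simp add: W_def)
  qed
  define C where "C = (\<lambda>g. {x \<in> carrier G. inv g \<otimes> x \<in> W})"
  \<comment> \<open>The choice depends on the coset \<open>C g\<close> alone, so \<open>t\<close> is
    constant on left cosets of \<open>W\<close>; preferring 1 makes the extension agree with the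
    given homomorphism on \<open>H\<close>.\<close>
  define t where "t = (\<lambda>g. if \<one> \<in> C g then \<one> else SOME x. x \<in> C g)"
  have C_W: "C (g \<otimes> w) = C g" if g: "g \<in> carrier G" and w: "w \<in> W" for g w
  proof -
    have wc: "w \<in> carrier G" using w subgroup.mem_carrier[OF W] by simp
    have "inv (g \<otimes> w) \<otimes> x \<in> W \<longleftrightarrow> inv g \<otimes> x \<in> W" if x: "x \<in> carrier G" for x
    proof -
      have "inv (g \<otimes> w) \<otimes> x = inv w \<otimes> (inv g \<otimes> x)" using g wc x by (simp add: inv_mult_group m_assoc)
      moreover have "inv g \<otimes> x = w \<otimes> (inv w \<otimes> (inv g \<otimes> x))" using g wc x by (simp add: m_assoc[symmetric])
      ultimately show ?thesis
        using subgroup.m_closed[OF W] subgroup.m_inv_closed[OF W w] w by metis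
    qed
    then show ?thesis by (auto simp: C_def)
  qed
  have t_W: "t (g \<otimes> w) = t g" if "g \<in> carrier G" "w \<in> W" for g w
    using C_W[OF that] by (simp add: t_def)
  have t_C: "t g \<in> C g" if "g \<in> carrier G" for g
  proof -
    have "g \<in> C g" using that subgroup.one_closed[OF W] by (simp add: C_def)
    then have "(SOME x. x \<in> C g) \<in> C g" by (rule someI)
    then show ?thesis by (simp add: t_def)
  qed
  have tc [simp]: "t g \<in> carrier G" if "g \<in> carrier G" for g using t_C[OF that] by (simp add: C_def)
  have decomp: "\<exists>h\<in>H. \<exists>v\<in>V. g = t g \<otimes> h \<otimes> v" if g: "g \<in> carrier G" for g
  proof -
    have "inv (inv g \<otimes> t g) \<in> W" using t_C[OF g] subgroup.m_inv_closed[OF W] by (simp add: C_def)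
    then have "inv (t g) \<otimes> g \<in> W" using g by (simp add: inv_mult_group)
    then obtain h v where hv: "h \<in> H" "v \<in> V" "inv (t g) \<otimes> g = h \<otimes> v"
      by (auto simp: W_def set_mult_def)
    have "g = t g \<otimes> (inv (t g) \<otimes> g)" using g by (simp add: m_assoc[symmetric])
    also have "\<dots> = t g \<otimes> h \<otimes> v" using hv g Hc by (simp add: m_assoc)
    finally show ?thesis using hv by blast
  qed
  define hh where "hh = (\<lambda>g. SOME h. h \<in> H \<and> (\<exists>v\<in>V. g = t g \<otimes> h \<otimes> v))"
  have hh: "hh g \<in> H \<and> (\<exists>v\<in>V. g = t g \<otimes> hh g \<otimes> v)" if "g \<in> carrier G" for g
  proof -
    have "\<exists>h. h \<in> H \<and> (\<exists>v\<in>V. g = t g \<otimes> h \<otimes> v)" using decomp[OF that] by (simp only: Bex_def)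
    then show ?thesis unfolding hh_def by (rule someI_ex)
  qed
  define F where "F = (\<lambda>g. act N (proj (t g)) (\<phi> (hh g)))"
  \<comment> \<open>The component in \<open>H\<close> is determined by \<open>g\<close> only up to
    \<open>V \<inter> H\<close>, where the homomorphism vanishes; hence every such decomposition of
    \<open>g\<close> computes \<open>F\<close>.\<close>
  have F_eq: "F g = act N (proj (t g)) (\<phi> h)"
    if g: "g \<in> carrier G" and h: "h \<in> H" and v: "v \<in> V" and eq: "g = t g \<otimes> h \<otimes> v" for g h v
  proof -
    obtain v' where v': "v' \<in> V" "g = t g \<otimes> hh g \<otimes> v'" and hhg: "hh g \<in> H" using hh[OF g] by blast
    have c: "h \<in> carrier G" "v \<in> carrier G" "v' \<in> carrier G" "hh g \<in> carrier G" "t g \<in> carrier G"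
      using h v v' hhg g Hc by auto
    have "t g \<otimes> (hh g \<otimes> v') = t g \<otimes> (h \<otimes> v)" using eq v' c by (metis m_assoc)
    then have "hh g \<otimes> v' = h \<otimes> v" using c by simp
    then have "inv (hh g) \<otimes> (hh g \<otimes> v') \<otimes> inv v = inv (hh g) \<otimes> (h \<otimes> v) \<otimes> inv v" by simp
    moreover have "inv (hh g) \<otimes> (hh g \<otimes> v') = v'" using c by (simp add: m_assoc[symmetric])
    moreover have "inv (hh g) \<otimes> (h \<otimes> v) \<otimes> inv v = inv (hh g) \<otimes> h" using c by (simp add: m_assoc)
    ultimately have "inv (hh g) \<otimes> h \<in> V" using v v' by (metis V.m_closed V.m_inv_closed)
    then have "\<phi> (hh g) = \<phi> h" using h hhg by (intro \<phi>_eq V_ker) simp_all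
    then show ?thesis by (simp add: F_def)
  qed
  have F_closed: "F g \<in> carrier N" if "g \<in> carrier G" for g
    using hh[OF that] that by (simp add: F_def)
  have F_V: "F (g \<otimes> w) = F g" if g: "g \<in> carrier G" and w: "w \<in> V" for g w
  proof -
    obtain h v where hv: "h \<in> H" "v \<in> V" "g = t g \<otimes> h \<otimes> v" using decomp[OF g] by blast
    have tw: "t (g \<otimes> w) = t g" using t_W[OF g W_V[OF w]] .
    have "g \<otimes> w = (t g \<otimes> h \<otimes> v) \<otimes> w" using hv(3) by simp
    also have "\<dots> = t (g \<otimes> w) \<otimes> h \<otimes> (v \<otimes> w)" using hv(1,2) g w Hc by (simp add: tw m_assoc)
    finally have "F (g \<otimes> w) = act N (proj (t g)) (\<phi> h)"
      using F_eq[of "g \<otimes> w" h "v \<otimes> w"] hv(1,2) g w tw by simp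
    also have "\<dots> = F g" using F_eq[OF g hv] by simp
    finally show ?thesis .
  qed
  have F_H: "F h = \<phi> h" if h: "h \<in> H" for h
  proof -
    have "inv h \<in> W" using W_H subgroup.m_inv_closed[OF W] h by blast
    then have "t h = \<one>" using h Hc by (simp add: t_def C_def)
    then show ?thesis using F_eq[of h h \<one>] h Hc N.act_one by (simp add: proj_one)
  qed
  have F_mult: "F (g \<otimes> k) = F g \<otimes>\<^bsub>N\<^esub> act N (proj g) (\<phi> k)" if g: "g \<in> carrier G" and k: "k \<in> H" for g k
  proof -
    obtain h v where hv: "h \<in> H" "v \<in> V" "g = t g \<otimes> h \<otimes> v" using decomp[OF g] by blast
    have c: "h \<in> carrier G" "v \<in> carrier G" "k \<in> carrier G" "t g \<in> carrier G"
      using hv k g Hc by auto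
    have tk: "t (g \<otimes> k) = t g" using t_W[OF g W_H[OF k]] .
    have "g \<otimes> k = (t g \<otimes> h \<otimes> v) \<otimes> k" using hv(3) by simp
    \<comment> \<open>Normality of \<open>V\<close> lets \<open>v\<close> pass \<open>k\<close>,
      leaving its conjugate by \<open>k\<close> as the new component in \<open>V\<close>.\<close>
    also have "\<dots> = t (g \<otimes> k) \<otimes> (h \<otimes> k) \<otimes> (inv k \<otimes> v \<otimes> k)"
    proof -
      have "k \<otimes> (inv k \<otimes> (v \<otimes> k)) = v \<otimes> k" using c by (simp add: m_assoc[symmetric])
      then show ?thesis using c by (simp add: tk m_assoc)
    qed
    finally have "F (g \<otimes> k) = act N (proj (t g)) (\<phi> (h \<otimes> k))"
      using F_eq[of "g \<otimes> k" "h \<otimes> k" "inv k \<otimes> v \<otimes> k"] hv(1,2) g k c tk V.inv_op_closed1 by simp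
    also have "\<dots> = act N (proj (t g)) (\<phi> h) \<otimes>\<^bsub>N\<^esub> act N (proj (t g)) (\<phi> k)"
      using hv(1) k c by (simp add: \<phi>_mult N.act_mult)
    also have "act N (proj (t g)) (\<phi> h) = F g" using F_eq[OF g hv] by simp
    \<comment> \<open>The elements \<open>g\<close> and \<open>t g\<close> differ by
      \<open>h\<close> and \<open>v\<close>. The first acts trivially; the second fixes
      \<open>\<phi> k\<close> because \<open>k\<close> and its conjugate by \<open>v\<close> differ
      by an element of \<open>V \<inter> H\<close>.\<close>
    also have "act N (proj (t g)) (\<phi> k) = act N (proj g) (\<phi> k)"
    proof -
      have vk: "v \<otimes> k \<otimes> inv v \<in> H" using inv_op_closed2[OF c(2) k] .
      have "inv k \<otimes> (v \<otimes> k \<otimes> inv v) = (inv k \<otimes> v \<otimes> k) \<otimes> inv v" using c by (simp add: m_assoc)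
      also have "\<dots> \<in> V" using V.inv_op_closed1[OF c(3) hv(2)] hv(2) by simp
      finally have "\<phi> k = \<phi> (v \<otimes> k \<otimes> inv v)" using k vk by (intro \<phi>_eq V_ker) simp_all
      also have "\<dots> = act N (proj v) (\<phi> k)" using \<phi>_conj[OF c(2) k] .
      finally have vk': "act N (proj v) (\<phi> k) = \<phi> k" ..
      have "proj g = proj (t g) <#> (proj h <#> proj v)"
        using c arg_cong[OF hv(3), of proj] by (simp add: proj_mult m_assoc)
      then have "act N (proj g) (\<phi> k) = act N (proj (t g)) (act N (proj h) (act N (proj v) (\<phi> k)))"
        using c k N.act_act[of "proj (t g)" "proj h <#> proj v" "\<phi> k"] N.act_act[of "proj h" "proj v" "\<phi> k"]
        by (simp add: proj_mult)
      then show ?thesis using k by (simp add: vk' act_H[OF hv(1)])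
    qed
    finally show ?thesis .
  qed
  \<comment> \<open>By \<open>F_V\<close> the fibres of \<open>F\<close> are unions of left cosets
    of the open subgroup \<open>V\<close>.\<close>
  have "continuous_map (gtop G) (gtop M) F"
    unfolding inflated_simps N.gtop_M continuous_map_discrete_iff
  proof (intro conjI ballI)
    show "F \<in> topspace (gtop G) \<rightarrow> carrier N" using F_closed by (simp add: topspace_gtop)
    fix d assume "d \<in> carrier N"
    have "{x \<in> topspace (gtop G). F x = d} = (\<Union>g\<in>{x \<in> carrier G. F x = d}. (\<lambda>v. g \<otimes> v) ` V)"
    proof (intro equalityI subsetI)
      fix x assume "x \<in> {x \<in> topspace (gtop G). F x = d}"
      then have x: "x \<in> carrier G" "F x = d" by (auto simp: topspace_gtop)
      then have "x \<otimes> \<one> \<in> (\<lambda>v. x \<otimes> v) ` V" by (intro imageI) simp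
      then show "x \<in> (\<Union>g\<in>{x \<in> carrier G. F x = d}. (\<lambda>v. g \<otimes> v) ` V)" using x by auto
    next
      fix x assume "x \<in> (\<Union>g\<in>{x \<in> carrier G. F x = d}. (\<lambda>v. g \<otimes> v) ` V)"
      then obtain g v where "g \<in> carrier G" "F g = d" "v \<in> V" "x = g \<otimes> v" by blast
      then show "x \<in> {x \<in> topspace (gtop G). F x = d}" using F_V[of g v] by (simp add: topspace_gtop)
    qed
    also have "openin (gtop G) \<dots>" using openin_l_translate[OF V_open] by (intro openin_Union) auto
    finally show "openin (gtop G) {x \<in> topspace (gtop G). F x = d}" .
  qed
  then have "M.cochain_1_of F \<in> cochains G M (Suc 0)" by (rule M.cochain_1_of_in_cochains)
  then show ?thesis by (rule that) (use F_H F_mult Hc in \<open>simp_all add: \<phi>_def\<close>)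
qed

end

section \<open>Transgression and the Hochschild--Serre differential\<close>

lemma r_cosetI: "b \<in> B \<Longrightarrow> b \<otimes>\<^bsub>K\<^esub> f \<in> B #>\<^bsub>K\<^esub> f"
  by (auto simp: r_coset_def)

lemma r_cosetE:
  assumes "x \<in> B #>\<^bsub>K\<^esub> f"
  obtains b where "b \<in> B" "x = b \<otimes>\<^bsub>K\<^esub> f"
  using assms by (auto simp: r_coset_def)

lemma (in group) eq_if_mult_inv_eq_one:
  "x \<otimes> inv y = \<one> \<Longrightarrow> x \<in> carrier G \<Longrightarrow> y \<in> carrier G \<Longrightarrow> x = y"
  using inv_equality[of x "inv y"] by simp

lemma (in group) mult_inv_mult_cancel:
  "x \<in> carrier G \<Longrightarrow> y \<in> carrier G \<Longrightarrow> x \<otimes> inv y \<otimes> y = x"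
  by (simp add: m_assoc)

lemma (in comm_group) mult_mult_mult_inv_cancel:
  "x \<in> carrier G \<Longrightarrow> y \<in> carrier G \<Longrightarrow> z \<in> carrier G \<Longrightarrow> x \<otimes> y \<otimes> z \<otimes> inv x = z \<otimes> y"
  using m_comm[of "x \<otimes> y" z] m_assoc[of "z \<otimes> y" x "inv x"] m_comm[of x y] by (simp add: m_assoc)

context discrete_module
begin

lemma cocycles_subgroup: "subgroup (cocycles G M k) (cochain_group G M k)"
  using group_hom.subgroup_kernel[OF coboundary_group_hom, of k] by (simp add: cocycles_def kernel_def)

lemma normalized_1_iff:
  "normalized G M (Suc 0) f \<longleftrightarrow> f (tup [\<one>]) = \<one>\<^bsub>M\<^esub>"
proof
  assume "normalized G M (Suc 0) f"
  moreover have "tup [\<one>] \<in> tuples G (Suc 0)" "tup [\<one>] 0 = \<one>" by simp_all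
  ultimately show "f (tup [\<one>]) = \<one>\<^bsub>M\<^esub>" unfolding normalized_def by blast
next
  assume "f (tup [\<one>]) = \<one>\<^bsub>M\<^esub>"
  then show "normalized G M (Suc 0) f" by (auto simp: normalized_def elim!: tuples_1E)
qed

lemma normalized_2_iff:
  "normalized G M 2 f \<longleftrightarrow> (\<forall>a\<in>carrier G. f (tup [a, \<one>]) = \<one>\<^bsub>M\<^esub> \<and> f (tup [\<one>, a]) = \<one>\<^bsub>M\<^esub>)"
proof
  assume n: "normalized G M 2 f"
  show "\<forall>a\<in>carrier G. f (tup [a, \<one>]) = \<one>\<^bsub>M\<^esub> \<and> f (tup [\<one>, a]) = \<one>\<^bsub>M\<^esub>"
  proof (intro ballI conjI)
    fix a assume a: "a \<in> carrier G"
    have "\<exists>i<2. tup [a, \<one>] i = \<one>" by (rule exI[of _ 1]) simp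
    then show "f (tup [a, \<one>]) = \<one>\<^bsub>M\<^esub>" using n a by (simp add: normalized_def)
    have "\<exists>i<2. tup [\<one>, a] i = \<one>" by (rule exI[of _ 0]) simp
    then show "f (tup [\<one>, a]) = \<one>\<^bsub>M\<^esub>" using n a by (simp add: normalized_def)
  qed
next
  assume "\<forall>a\<in>carrier G. f (tup [a, \<one>]) = \<one>\<^bsub>M\<^esub> \<and> f (tup [\<one>, a]) = \<one>\<^bsub>M\<^esub>"
  then show "normalized G M 2 f"
    unfolding normalized_def by (auto simp: less_2_cases_iff elim!: tuples_2E)
qed

lemma normalized_coboundary_1:
  assumes "f \<in> cochains G M (Suc 0)" "f (tup [\<one>]) = \<one>\<^bsub>M\<^esub>"
  shows "normalized G M 2 (coboundary G M (Suc 0) f)"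
  unfolding normalized_2_iff
  using assms by (auto simp: coboundary_1 cochain_1_closed act_one)

lemma coh_class_coboundary_mult:
  assumes "b \<in> cochains G M (Suc 0)" "z \<in> cochains G M 2"
  shows "coh_class G M 2 (coboundary G M (Suc 0) b \<otimes>\<^bsub>cochain_group G M 2\<^esub> z) = coh_class G M 2 z"
  using assms by (intro coh_class_eqI) (auto simp: coh_class_eq)

end

section \<open>Cochains whose coboundary is inflated from G/H\<close>

context quotient_module
begin

text \<open>The transgression as a relation between cochains: the class of \<open>u\<close> is
  attached to the restriction of \<open>F\<close> to \<open>H\<close>. The value at 1 is prescribed
  so that \<open>F\<close> lies in the complex of normalized cochains.\<close>

definition transgression :: "((nat \<Rightarrow> 'g) \<Rightarrow> 'm) \<Rightarrow> ((nat \<Rightarrow> 'g set) \<Rightarrow> 'm) \<Rightarrow> bool" where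
  "transgression F u \<longleftrightarrow> F \<in> cochains G M (Suc 0) \<and> F (tup [\<one>]) = \<one>\<^bsub>N\<^esub> \<and> u \<in> cochains Q N 2 \<and>
     infl 2 u = coboundary G M (Suc 0) F"

abbreviation res_H :: "((nat \<Rightarrow> 'g) \<Rightarrow> 'm) \<Rightarrow> (nat \<Rightarrow> 'g) \<Rightarrow> 'm" where
  "res_H \<equiv> cochain_map (tsub G H) (Suc 0) (\<lambda>h. h) (\<lambda>x. x)"

lemma restriction_map: "module_map G M (tsub G H) M (\<lambda>h. h) (\<lambda>x. x)"
proof (intro module_map.intro module_map_axioms.intro M.discrete_module_axioms T.discrete_module_axioms)
  show "(\<lambda>h. h) \<in> hom (tsub G H) G" by (auto simp: hom_def)
  show "continuous_map (gtop (tsub G H)) (gtop G) (\<lambda>h. h)"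
    by (simp add: continuous_map_from_subtopology)
qed (auto simp: hom_def)

lemma res_H_closed: "F \<in> cochains G M (Suc 0) \<Longrightarrow> res_H F \<in> cochains (tsub G H) M (Suc 0)"
  using restriction_map by (rule module_map.cochain_map_closed)

lemma res_H_tup: "h \<in> H \<Longrightarrow> res_H F (tup [h]) = F (tup [h])"
  using module_map.cochain_map_tup[OF restriction_map, of "Suc 0" "[h]" F] by simp

lemma infl_1_tup: "a \<in> carrier G \<Longrightarrow> infl (Suc 0) b (tup [a]) = b (tup [proj a])"
  using inf.cochain_map_tup[of "Suc 0" "[a]" b] by simp

lemma infl_2_tup: "a \<in> carrier G \<Longrightarrow> c \<in> carrier G \<Longrightarrow> infl 2 u (tup [a, c]) = u (tup [proj a, proj c])"
  using inf.cochain_map_tup[of 2 "[a, c]" u] by simp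

lemma coboundary_infl_1: "b \<in> cochains Q N (Suc 0) \<Longrightarrow>
    coboundary G M (Suc 0) (infl (Suc 0) b) = infl 2 (coboundary Q N (Suc 0) b)"
  using inf.cochain_map_coboundary[of b "Suc 0"] by (simp add: numeral_2_eq_2)

lemma transgression_formula:
  assumes "transgression F u" and a: "a \<in> carrier G" and b: "b \<in> carrier G"
  shows "u (tup [proj a, proj b]) = act N (proj a) (F (tup [b])) \<otimes>\<^bsub>N\<^esub> inv\<^bsub>N\<^esub> F (tup [a \<otimes> b]) \<otimes>\<^bsub>N\<^esub> F (tup [a])"
proof -
  have F: "F \<in> cochains G M (Suc 0)" and u: "infl 2 u = coboundary G M (Suc 0) F"
    using assms(1) by (auto simp: transgression_def)
  have "u (tup [proj a, proj b]) = infl 2 u (tup [a, b])" by (rule infl_2_tup[OF a b, symmetric])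
  also have "\<dots> = coboundary G M (Suc 0) F (tup [a, b])" by (simp only: u)
  also have "\<dots> = act N (proj a) (F (tup [b])) \<otimes>\<^bsub>N\<^esub> inv\<^bsub>N\<^esub> F (tup [a \<otimes> b]) \<otimes>\<^bsub>N\<^esub> F (tup [a])"
    using M.coboundary_1[OF F a b] by simp
  finally show ?thesis .
qed

lemma transgression_closed:
  assumes "transgression F u" "a \<in> carrier G"
  shows "F (tup [a]) \<in> carrier N"
  using M.cochain_1_closed[of F a] assms by (simp add: transgression_def)

text \<open>Inflation is injective on cochains and commutes with the coboundary, so the identity d d
  F = 0 descends to the quotient.\<close>

lemma transgression_cocycle:
  assumes tr: "transgression F u"
  shows "u \<in> cocycles Q N 2"
proof -
  have F: "F \<in> cochains G M (Suc 0)" and u: "u \<in> cochains Q N 2" "infl 2 u = coboundary G M (Suc 0) F"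
    using tr by (auto simp: transgression_def)
  have "infl 3 (coboundary Q N 2 u) = coboundary G M 2 (infl 2 u)"
    using inf.cochain_map_coboundary[OF u(1)] by simp
  also have "\<dots> = \<one>\<^bsub>cochain_group G M 3\<^esub>" unfolding u(2) by (rule M.coboundary_squared_1[OF F])
  also have "\<dots> = infl 3 \<one>\<^bsub>cochain_group Q N 3\<^esub>"
    using group_hom.hom_one[OF inf.cochain_map_group_hom] by metis
  finally have "coboundary Q N 2 u = \<one>\<^bsub>cochain_group Q N 3\<^esub>"
    by (intro infl_inj[of _ 3]) (auto intro: N.coboundary_2_in_cochains[OF u(1)] N.cochain_one_closed)
  then show ?thesis using u(1) by (simp add: cocycles_def)
qed

lemma transgression_normalized:
  assumes tr: "transgression F u"
  shows "normalized Q N 2 u"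
  unfolding N.normalized_2_iff
proof (intro ballI conjI)
  fix q assume "q \<in> carrier Q"
  then obtain a where a: "a \<in> carrier G" "q = proj a" by (rule Q_cases)
  have F1: "F (tup [\<one>]) = \<one>\<^bsub>N\<^esub>" using tr by (simp add: transgression_def)
  show "u (tup [q, \<one>\<^bsub>Q\<^esub>]) = \<one>\<^bsub>N\<^esub>"
    using transgression_formula[OF tr a(1), of \<one>] a transgression_closed[OF tr a(1)]
    by (simp add: F1 proj_one)
  show "u (tup [\<one>\<^bsub>Q\<^esub>, q]) = \<one>\<^bsub>N\<^esub>"
    using transgression_formula[OF tr _ a(1), of \<one>] a transgression_closed[OF tr a(1)] N.act_one
    by (simp add: F1 proj_one)
qed

text \<open>The normalized cocycle \<open>u\<close> vanishes as soon as one entry is the trivial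
  coset, so the coboundary of \<open>F\<close> vanishes at (a, h). The next lemma uses (h, a) in the
  same way.\<close>

lemma transgression_mult_right:
  assumes tr: "transgression F u" and a: "a \<in> carrier G" and h: "h \<in> H"
  shows "F (tup [a \<otimes> h]) = F (tup [a]) \<otimes>\<^bsub>N\<^esub> act N (proj a) (F (tup [h]))"
proof -
  have hc: "h \<in> carrier G" using h by simp
  note c = transgression_closed[OF tr]
  have "u (tup [proj a, proj h]) = \<one>\<^bsub>N\<^esub>"
    using transgression_normalized[OF tr] a h by (simp add: N.normalized_2_iff proj_H)
  then have "F (tup [a]) \<otimes>\<^bsub>N\<^esub> act N (proj a) (F (tup [h])) \<otimes>\<^bsub>N\<^esub> inv\<^bsub>N\<^esub> F (tup [a \<otimes> h]) = \<one>\<^bsub>N\<^esub>"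
    using transgression_formula[OF tr a hc] c a hc by (simp add: N.M.m_ac)
  then show ?thesis by (rule N.M.eq_if_mult_inv_eq_one[symmetric]) (use c a hc in simp_all)
qed

lemma transgression_mult_left:
  assumes tr: "transgression F u" and a: "a \<in> carrier G" and h: "h \<in> H"
  shows "F (tup [h \<otimes> a]) = F (tup [h]) \<otimes>\<^bsub>N\<^esub> F (tup [a])"
proof -
  have hc: "h \<in> carrier G" using h by simp
  note c = transgression_closed[OF tr]
  have "u (tup [proj h, proj a]) = \<one>\<^bsub>N\<^esub>"
    using transgression_normalized[OF tr] a h by (simp add: N.normalized_2_iff proj_H)
  then have "F (tup [h]) \<otimes>\<^bsub>N\<^esub> F (tup [a]) \<otimes>\<^bsub>N\<^esub> inv\<^bsub>N\<^esub> F (tup [h \<otimes> a]) = \<one>\<^bsub>N\<^esub>"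
    using transgression_formula[OF tr hc a] c a hc by (simp add: N.M.m_ac act_H[OF h])
  then show ?thesis by (rule N.M.eq_if_mult_inv_eq_one[symmetric]) (use c a hc in simp_all)
qed

text \<open>Additivity is the left rule inside \<open>H\<close>. Invariance comes from evaluating
  \<open>F\<close> at the product of \<open>h\<close> and \<open>\<sigma>\<close> by the left rule
  and then, writing the product as \<open>\<sigma>\<close> times a conjugate of \<open>h\<close>, by
  the right rule.\<close>

lemma transgression_invariant_hom:
  assumes tr: "transgression F u"
  shows "invariant_hom (res_H F)"
  unfolding invariant_hom_def
proof (intro conjI ballI)
  show "res_H F \<in> cochains (tsub G H) M (Suc 0)" using tr by (simp add: transgression_def res_H_closed)
  show "res_H F (tup [a \<otimes> b]) = res_H F (tup [a]) \<otimes>\<^bsub>N\<^esub> res_H F (tup [b])" if "a \<in> H" "b \<in> H" for a b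
    using transgression_mult_left[OF tr, of b a] that by (simp add: res_H_tup)
  show "res_H F (tup [h]) = act N (proj \<sigma>) (res_H F (tup [inv \<sigma> \<otimes> h \<otimes> \<sigma>]))"
    if \<sigma>: "\<sigma> \<in> carrier G" and h: "h \<in> H" for \<sigma> h
  proof -
    have hc: "h \<in> carrier G" using h by simp
    have h': "inv \<sigma> \<otimes> h \<otimes> \<sigma> \<in> H" using \<sigma> h by (rule inv_op_closed1)
    then have h'c: "inv \<sigma> \<otimes> h \<otimes> \<sigma> \<in> carrier G" by simp
    note c = transgression_closed[OF tr]
    have "F (tup [\<sigma>]) \<otimes>\<^bsub>N\<^esub> F (tup [h]) = F (tup [h \<otimes> \<sigma>])"
      using transgression_mult_left[OF tr \<sigma> h] c \<sigma> hc by (simp add: N.M.m_comm)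
    also have "h \<otimes> \<sigma> = \<sigma> \<otimes> (inv \<sigma> \<otimes> h \<otimes> \<sigma>)" using \<sigma> hc by (simp add: m_assoc[symmetric])
    also have "F (tup [\<sigma> \<otimes> (inv \<sigma> \<otimes> h \<otimes> \<sigma>)]) = F (tup [\<sigma>]) \<otimes>\<^bsub>N\<^esub> act N (proj \<sigma>) (F (tup [inv \<sigma> \<otimes> h \<otimes> \<sigma>]))"
      by (rule transgression_mult_right[OF tr \<sigma> h'])
    finally have "F (tup [h]) = act N (proj \<sigma>) (F (tup [inv \<sigma> \<otimes> h \<otimes> \<sigma>]))"
      using c[OF \<sigma>] c[OF hc] c[OF h'c] \<sigma> by simp
    then show ?thesis using h h' by (simp add: res_H_tup)
  qed
qed

text \<open>Both cochains change by the same amount under right multiplication by \<open>H\<close>,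
  so their difference descends to the quotient, where it is \<open>b\<close>. This is the
  independence of the transgression from the chosen extension.\<close>

lemma transgression_unique:
  assumes tr: "transgression F u" and tr': "transgression F' u'"
    and eq: "\<And>h. h \<in> H \<Longrightarrow> F (tup [h]) = F' (tup [h])"
  obtains b where "b \<in> cochains Q N (Suc 0)" "b (tup [H]) = \<one>\<^bsub>N\<^esub>"
    "u = coboundary Q N (Suc 0) b \<otimes>\<^bsub>cochain_group Q N 2\<^esub> u'"
proof -
  interpret C: comm_group "cochain_group G M (Suc 0)" by (rule M.group_cochains)
  interpret C2: comm_group "cochain_group G M 2" by (rule M.group_cochains)
  interpret d: group_hom "cochain_group G M (Suc 0)" "cochain_group G M 2" "coboundary G M (Suc 0)"
    by (rule M.coboundary_1_group_hom)
  have F: "F \<in> cochains G M (Suc 0)" and u: "u \<in> cochains Q N 2" "infl 2 u = coboundary G M (Suc 0) F"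
    using tr by (auto simp: transgression_def)
  have F': "F' \<in> cochains G M (Suc 0)" and u': "u' \<in> cochains Q N 2" "infl 2 u' = coboundary G M (Suc 0) F'"
    using tr' by (auto simp: transgression_def)
  let ?D = "F \<otimes>\<^bsub>cochain_group G M (Suc 0)\<^esub> inv\<^bsub>cochain_group G M (Suc 0)\<^esub> F'"
  have iF': "inv\<^bsub>cochain_group G M (Suc 0)\<^esub> F' \<in> cochains G M (Suc 0)" using C.inv_closed F' by simp
  have D: "?D \<in> cochains G M (Suc 0)" using F iF' by (rule M.cochain_mult_closed)
  have D_tup: "?D (tup [a]) = F (tup [a]) \<otimes>\<^bsub>N\<^esub> inv\<^bsub>N\<^esub> F' (tup [a])" if "a \<in> carrier G" for a
    using that M.cochain_inv[OF F', of "tup [a]"] by simp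
  have D_const: "?D (tup [a]) = ?D (tup [b])" if a: "a \<in> carrier G" and b: "b \<in> carrier G"
      and ab: "proj a = proj b" for a b
  proof -
    let ?h = "inv a \<otimes> b"
    have h: "?h \<in> H" using ab a b proj_eq_iff by blast
    then have hc: "?h \<in> carrier G" by simp
    have b_eq: "b = a \<otimes> ?h" using a b by (simp add: m_assoc[symmetric])
    have "?D (tup [b]) = F (tup [b]) \<otimes>\<^bsub>N\<^esub> inv\<^bsub>N\<^esub> F' (tup [b])" by (rule D_tup[OF b])
    also have "F (tup [b]) = F (tup [a]) \<otimes>\<^bsub>N\<^esub> act N (proj a) (F (tup [?h]))"
      using transgression_mult_right[OF tr a h] b_eq by simp
    also have "F' (tup [b]) = F' (tup [a]) \<otimes>\<^bsub>N\<^esub> act N (proj a) (F (tup [?h]))"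
      using transgression_mult_right[OF tr' a h] b_eq eq[OF h] by simp
    also have "F (tup [a]) \<otimes>\<^bsub>N\<^esub> act N (proj a) (F (tup [?h])) \<otimes>\<^bsub>N\<^esub> inv\<^bsub>N\<^esub> (F' (tup [a]) \<otimes>\<^bsub>N\<^esub> act N (proj a) (F (tup [?h])))
        = F (tup [a]) \<otimes>\<^bsub>N\<^esub> inv\<^bsub>N\<^esub> F' (tup [a])"
    proof -
      have *: "x \<otimes>\<^bsub>N\<^esub> w \<otimes>\<^bsub>N\<^esub> inv\<^bsub>N\<^esub> (y \<otimes>\<^bsub>N\<^esub> w) = x \<otimes>\<^bsub>N\<^esub> inv\<^bsub>N\<^esub> y"
        if "x \<in> carrier N" "y \<in> carrier N" "w \<in> carrier N" for x y w
        using that by (simp add: N.M.inv_mult N.M.m_assoc N.M.m_lcomm[of w])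
      show ?thesis
        using transgression_closed[OF tr a] transgression_closed[OF tr' a] transgression_closed[OF tr hc] a
        by (intro *) simp_all
    qed
    also have "\<dots> = ?D (tup [a])" by (rule D_tup[OF a, symmetric])
    finally show ?thesis ..
  qed
  obtain b where b: "b \<in> cochains Q N (Suc 0)" "infl (Suc 0) b = ?D"
  proof (rule infl_surj[OF D])
    fix x y assume "x \<in> tuples G (Suc 0)" "y \<in> tuples G (Suc 0)" "\<And>i. i < Suc 0 \<Longrightarrow> proj (x i) = proj (y i)"
    then obtain a b where ab: "a \<in> carrier G" "b \<in> carrier G" "x = tup [a]" "y = tup [b]" "proj a = proj b"
      by (elim tuples_1E) simp
    show "?D x = ?D y" unfolding ab(3,4) by (rule D_const[OF ab(1,2,5)])
  qed (rule that)
  have "b (tup [H]) = ?D (tup [\<one>])"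
    using infl_1_tup[of \<one> b] b(2) by (simp add: proj_one)
  also have "\<dots> = \<one>\<^bsub>N\<^esub>" using D_tup[of \<one>] tr tr' by (simp add: transgression_def)
  finally have b1: "b (tup [H]) = \<one>\<^bsub>N\<^esub>" .
  have db: "coboundary Q N (Suc 0) b \<in> cochains Q N 2" using b(1) by (rule N.coboundary_1_in_cochains)
  have "infl 2 (coboundary Q N (Suc 0) b \<otimes>\<^bsub>cochain_group Q N 2\<^esub> u')
      = infl 2 (coboundary Q N (Suc 0) b) \<otimes>\<^bsub>cochain_group G M 2\<^esub> infl 2 u'"
    by (rule inf.cochain_map_mult[OF db u'(1)])
  also have "infl 2 (coboundary Q N (Suc 0) b) = coboundary G M (Suc 0) ?D"
    using coboundary_infl_1[OF b(1)] b(2) by simp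
  also have "\<dots> = coboundary G M (Suc 0) F \<otimes>\<^bsub>cochain_group G M 2\<^esub> inv\<^bsub>cochain_group G M 2\<^esub> coboundary G M (Suc 0) F'"
    using F F' iF' by simp
  also have "\<dots> \<otimes>\<^bsub>cochain_group G M 2\<^esub> infl 2 u' = coboundary G M (Suc 0) F"
    unfolding u'(2) using F F' by (intro C2.mult_inv_mult_cancel) (simp_all add: M.coboundary_1_in_cochains)
  also have "\<dots> = infl 2 u" using u(2) ..
  finally have "coboundary Q N (Suc 0) b \<otimes>\<^bsub>cochain_group Q N 2\<^esub> u' = u"
    by (intro infl_inj[of _ 2]) (use db u u' in \<open>auto intro: N.cochain_mult_closed\<close>)
  then show ?thesis using that b(1) b1 by blast
qed

section \<open>Low-degree terms of the Hochschild-Serre filtration\<close>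

lemma hs_filtration_0_1:
  "hs_filtration G H M 0 (Suc 0) = {f \<in> cochains G M (Suc 0). f (tup [\<one>]) = \<one>\<^bsub>N\<^esub>}"
proof -
  have "f x = f y" if "x \<in> tuples G (Suc 0)" "y \<in> tuples G (Suc 0)"
    "\<forall>i<Suc 0. (int i < int (Suc 0) - 0 \<longrightarrow> x i = y i) \<and> proj (x i) = proj (y i)"
        for f :: "(nat \<Rightarrow> 'g) \<Rightarrow> 'm" and x y
    using that by (elim tuples_1E) simp
  then show ?thesis by (auto simp: hs_filtration_def M.normalized_1_iff)
qed

lemma hs_filtration_1_iff:
  "f \<in> hs_filtration G H M 1 (Suc 0) \<longleftrightarrow> f \<in> cochains G M (Suc 0) \<and> f (tup [\<one>]) = \<one>\<^bsub>N\<^esub> \<and>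
     (\<forall>x\<in>tuples G (Suc 0). \<forall>y\<in>tuples G (Suc 0). proj (x 0) = proj (y 0) \<longrightarrow> f x = f y)"
  by (simp add: hs_filtration_def M.normalized_1_iff)

lemma hs_filtration_2_iff:
  "f \<in> hs_filtration G H M 2 2 \<longleftrightarrow> f \<in> cochains G M 2 \<and> normalized G M 2 f \<and>
     (\<forall>x\<in>tuples G 2. \<forall>y\<in>tuples G 2. (\<forall>i<2. proj (x i) = proj (y i)) \<longrightarrow> f x = f y)"
  by (simp add: hs_filtration_def)

text \<open>In the top filtration degree every entry counts only modulo \<open>H\<close>, so the
  cochain is inflated, and normalization transfers along the projection. The same holds in degree 2
  below.\<close>

lemma hs_filtration_1_1:
  "hs_filtration G H M 1 (Suc 0) = infl (Suc 0) ` {b \<in> cochains Q N (Suc 0). b (tup [H]) = \<one>\<^bsub>N\<^esub>}"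
proof (intro equalityI subsetI)
  fix f assume f: "f \<in> hs_filtration G H M 1 (Suc 0)"
  have fc: "f \<in> cochains G M (Suc 0)" and f1: "f (tup [\<one>]) = \<one>\<^bsub>N\<^esub>"
    and fx: "\<forall>x\<in>tuples G (Suc 0). \<forall>y\<in>tuples G (Suc 0). proj (x 0) = proj (y 0) \<longrightarrow> f x = f y"
    using f[unfolded hs_filtration_1_iff] by blast+
  obtain b where b: "b \<in> cochains Q N (Suc 0)" "infl (Suc 0) b = f"
  proof (rule infl_surj[OF fc])
    fix x y assume "x \<in> tuples G (Suc 0)" "y \<in> tuples G (Suc 0)" "\<And>i. i < Suc 0 \<Longrightarrow> proj (x i) = proj (y i)"
    then show "f x = f y" using fx by blast
  qed (rule that)
  moreover have "b (tup [H]) = \<one>\<^bsub>N\<^esub>" using infl_1_tup[of \<one> b] b(2) f1 by (simp add: proj_one)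
  ultimately show "f \<in> infl (Suc 0) ` {b \<in> cochains Q N (Suc 0). b (tup [H]) = \<one>\<^bsub>N\<^esub>}" by blast
next
  fix f assume "f \<in> infl (Suc 0) ` {b \<in> cochains Q N (Suc 0). b (tup [H]) = \<one>\<^bsub>N\<^esub>}"
  then obtain b where b: "b \<in> cochains Q N (Suc 0)" "b (tup [H]) = \<one>\<^bsub>N\<^esub>" "f = infl (Suc 0) b" by blast
  have "f \<in> cochains G M (Suc 0)" unfolding b(3) by (rule inf.cochain_map_closed[OF b(1)])
  moreover have "f (tup [\<one>]) = \<one>\<^bsub>N\<^esub>" unfolding b(3) using b(2) by (simp add: infl_1_tup proj_one)
  moreover have "f x = f y" if x: "x \<in> tuples G (Suc 0)" and y: "y \<in> tuples G (Suc 0)"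
      and xy: "proj (x 0) = proj (y 0)" for x y
  proof -
    obtain a where a: "a \<in> carrier G" "x = tup [a]" using x by (rule tuples_1E)
    obtain c where c: "c \<in> carrier G" "y = tup [c]" using y by (rule tuples_1E)
    show ?thesis unfolding b(3) using a c xy by (simp add: infl_1_tup)
  qed
  ultimately show "f \<in> hs_filtration G H M 1 (Suc 0)" unfolding hs_filtration_1_iff by blast
qed

lemma hs_filtration_2_2:
  "hs_filtration G H M 2 2 = infl 2 ` {u \<in> cochains Q N 2. normalized Q N 2 u}"
proof (intro equalityI subsetI)
  fix f assume f: "f \<in> hs_filtration G H M 2 2"
  have fc: "f \<in> cochains G M 2" and fn: "normalized G M 2 f"
    and fx: "\<forall>x\<in>tuples G 2. \<forall>y\<in>tuples G 2. (\<forall>i<2. proj (x i) = proj (y i)) \<longrightarrow> f x = f y"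
    using f[unfolded hs_filtration_2_iff] by blast+
  obtain u where u: "u \<in> cochains Q N 2" "infl 2 u = f"
  proof (rule infl_surj[OF fc])
    fix x y assume "x \<in> tuples G 2" "y \<in> tuples G 2" "\<And>i. i < 2 \<Longrightarrow> proj (x i) = proj (y i)"
    then show "f x = f y" using fx by blast
  qed (rule that)
  have "normalized Q N 2 u"
    unfolding N.normalized_2_iff
  proof
    fix q assume "q \<in> carrier Q"
    then obtain a where a: "a \<in> carrier G" "q = proj a" by (rule Q_cases)
    then show "u (tup [q, \<one>\<^bsub>Q\<^esub>]) = \<one>\<^bsub>N\<^esub> \<and> u (tup [\<one>\<^bsub>Q\<^esub>, q]) = \<one>\<^bsub>N\<^esub>"
      using fn infl_2_tup[of a \<one> u] infl_2_tup[of \<one> a u] u(2)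
      by (simp add: M.normalized_2_iff proj_one)
  qed
  then show "f \<in> infl 2 ` {u \<in> cochains Q N 2. normalized Q N 2 u}" using u by blast
next
  fix f assume "f \<in> infl 2 ` {u \<in> cochains Q N 2. normalized Q N 2 u}"
  then obtain u where u: "u \<in> cochains Q N 2" "normalized Q N 2 u" "f = infl 2 u" by blast
  have "f \<in> cochains G M 2" unfolding u(3) by (rule inf.cochain_map_closed[OF u(1)])
  moreover have "normalized G M 2 f"
    unfolding u(3) using u(2) by (simp add: M.normalized_2_iff N.normalized_2_iff infl_2_tup proj_one)
  moreover have "f x = f y" if x: "x \<in> tuples G 2" and y: "y \<in> tuples G 2"
      and xy: "\<forall>i<2. proj (x i) = proj (y i)" for x y
  proof -
    obtain a b where ab: "a \<in> carrier G" "b \<in> carrier G" "x = tup [a, b]" using x by (rule tuples_2E)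
    obtain c d where cd: "c \<in> carrier G" "d \<in> carrier G" "y = tup [c, d]" using y by (rule tuples_2E)
    have "proj a = proj c" "proj b = proj d" using spec[OF xy, of 0] spec[OF xy, of 1] ab cd by simp_all
    then show ?thesis unfolding u(3) using ab cd by (simp add: infl_2_tup)
  qed
  ultimately show "f \<in> hs_filtration G H M 2 2" unfolding hs_filtration_2_iff by blast
qed

lemma one_in_hs_filtration: "\<one>\<^bsub>cochain_group G M k\<^esub> \<in> hs_filtration G H M p k"
  by (simp add: hs_filtration_def M.cochain_one_closed normalized_def)

lemma coboundary_one: "coboundary G M k \<one>\<^bsub>cochain_group G M k\<^esub> = \<one>\<^bsub>cochain_group G M (Suc k)\<^esub>"
  using group_hom.hom_one[OF M.coboundary_group_hom] .

lemma one_in_hs_Z: "\<one>\<^bsub>cochain_group G M k\<^esub> \<in> hs_Z G H M r p k"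
  by (simp add: hs_Z_def one_in_hs_filtration coboundary_one)

text \<open>The condition on the coboundary says that it is inflated from a normalized cochain, and
  this normalization is a consequence of the value of \<open>F\<close> at 1.\<close>

lemma hs_Z_2_0_1: "hs_Z G H M 2 0 (Suc 0) = {F. \<exists>u. transgression F u}"
proof -
  have "coboundary G M (Suc 0) F \<in> hs_filtration G H M 2 2 \<longleftrightarrow> (\<exists>u. transgression F u)"
    if "F \<in> cochains G M (Suc 0)" "F (tup [\<one>]) = \<one>\<^bsub>N\<^esub>" for F
  proof
    assume "coboundary G M (Suc 0) F \<in> hs_filtration G H M 2 2"
    then obtain u where "u \<in> cochains Q N 2" "infl 2 u = coboundary G M (Suc 0) F"
      unfolding hs_filtration_2_2 by fastforce
    then show "\<exists>u. transgression F u" using that by (auto simp: transgression_def)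
  next
    assume "\<exists>u. transgression F u"
    then obtain u where tr: "transgression F u" by blast
    then show "coboundary G M (Suc 0) F \<in> hs_filtration G H M 2 2"
      unfolding hs_filtration_2_2 using transgression_normalized[OF tr]
      by (auto simp: transgression_def intro!: image_eqI[of _ _ u])
  qed
  then show ?thesis
    unfolding hs_Z_def hs_filtration_0_1 by (auto simp: transgression_def numeral_2_eq_2)
qed

text \<open>The coboundary of an inflated normalized cochain is again inflated and normalized, so
  the condition on the coboundary holds automatically.\<close>

lemma hs_Z_1_1_1: "hs_Z G H M 1 1 (Suc 0) = hs_filtration G H M 1 (Suc 0)"
proof -
  have "coboundary G M (Suc 0) (infl (Suc 0) b) \<in> hs_filtration G H M 2 2"
    if "b \<in> cochains Q N (Suc 0)" "b (tup [H]) = \<one>\<^bsub>N\<^esub>" for b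
    using that N.normalized_coboundary_1[OF that(1)]
    unfolding coboundary_infl_1[OF that(1)] hs_filtration_2_2
    by (auto intro!: N.coboundary_1_in_cochains)
  then show ?thesis unfolding hs_Z_def hs_filtration_1_1 by (auto simp: numeral_2_eq_2)
qed

text \<open>Filtration degree 3 is zero on cochains of degree 2, so the first summand disappears.
  The second consists of the coboundaries of inflated 1-cochains that vanish at the trivial
  coset.\<close>

lemma hs_B_2_2_2:
  "hs_B G H M 2 2 2
    = infl 2 ` coboundary Q N (Suc 0) ` {b \<in> cochains Q N (Suc 0). b (tup [H]) = \<one>\<^bsub>N\<^esub>}"
proof -
  interpret C: comm_group "cochain_group G M 2" by (rule M.group_cochains)
  have Z: "hs_Z G H M 1 3 2 = {\<one>\<^bsub>cochain_group G M 2\<^esub>}"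
    using one_in_hs_Z[of 2 1 3] by (auto simp: hs_Z_def hs_filtration_def)
  have d: "coboundary G M (Suc 0) ` hs_Z G H M 1 1 (Suc 0)
      = infl 2 ` coboundary Q N (Suc 0) ` {b \<in> cochains Q N (Suc 0). b (tup [H]) = \<one>\<^bsub>N\<^esub>}"
    unfolding hs_Z_1_1_1 hs_filtration_1_1 image_image
    by (intro image_cong refl) (simp add: coboundary_infl_1)
  have dc: "infl 2 ` coboundary Q N (Suc 0) ` {b \<in> cochains Q N (Suc 0). b (tup [H]) = \<one>\<^bsub>N\<^esub>} \<subseteq> cochains G M 2"
    using N.coboundary_1_in_cochains inf.cochain_map_closed by blast
  have one_mult: "{\<one>\<^bsub>cochain_group G M 2\<^esub>} <#>\<^bsub>cochain_group G M 2\<^esub> X = X" if X: "X \<subseteq> cochains G M 2" for X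
  proof -
    have "{\<one>\<^bsub>cochain_group G M 2\<^esub>} <#>\<^bsub>cochain_group G M 2\<^esub> X
        = (\<lambda>x. \<one>\<^bsub>cochain_group G M 2\<^esub> \<otimes>\<^bsub>cochain_group G M 2\<^esub> x) ` X"
      by (auto simp: set_mult_def)
    also have "\<dots> = (\<lambda>x. x) ` X" using X C.l_one by (intro image_cong refl) auto
    finally show ?thesis by simp
  qed
  have "hs_B G H M 2 2 2 = hs_Z G H M 1 3 2 <#>\<^bsub>cochain_group G M 2\<^esub>
      coboundary G M (Suc 0) ` hs_Z G H M 1 1 (Suc 0)"
    by (simp add: hs_B_def)
  then show ?thesis unfolding Z d one_mult[OF dc] .
qed

lemma hs_B_2_2_2_subgroup: "subgroup (hs_B G H M 2 2 2) (cochain_group G M 2)"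
proof -
  interpret B: comm_group "cochain_group Q N (Suc 0)" by (rule N.group_cochains)
  interpret d: group_hom "cochain_group Q N (Suc 0)" "cochain_group Q N 2" "coboundary Q N (Suc 0)"
    by (rule N.coboundary_1_group_hom)
  interpret i: group_hom "cochain_group Q N 2" "cochain_group G M 2" "infl 2"
    by (rule inf.cochain_map_group_hom)
  have "subgroup {b \<in> cochains Q N (Suc 0). b (tup [H]) = \<one>\<^bsub>N\<^esub>} (cochain_group Q N (Suc 0))"
  proof (rule B.subgroupI)
    have H: "H \<in> carrier Q" using proj_in_Q[of \<one>] by (simp add: proj_one)
    then have t: "tup [H] \<in> tuples Q (Suc 0)" by simp
    show "{b \<in> cochains Q N (Suc 0). b (tup [H]) = \<one>\<^bsub>N\<^esub>} \<noteq> {}"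
      using N.cochain_one_closed[of "Suc 0"] t by (auto intro!: exI[of _ "\<one>\<^bsub>cochain_group Q N (Suc 0)\<^esub>"])
    fix b assume b: "b \<in> {b \<in> cochains Q N (Suc 0). b (tup [H]) = \<one>\<^bsub>N\<^esub>}"
    then show "inv\<^bsub>cochain_group Q N (Suc 0)\<^esub> b \<in> {b \<in> cochains Q N (Suc 0). b (tup [H]) = \<one>\<^bsub>N\<^esub>}"
      using B.inv_closed[of b] N.cochain_inv[of b "Suc 0" "tup [H]"] t by simp
    fix c assume c: "c \<in> {b \<in> cochains Q N (Suc 0). b (tup [H]) = \<one>\<^bsub>N\<^esub>}"
    then show "b \<otimes>\<^bsub>cochain_group Q N (Suc 0)\<^esub> c \<in> {b \<in> cochains Q N (Suc 0). b (tup [H]) = \<one>\<^bsub>N\<^esub>}"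
      using b t by (simp add: N.cochain_mult_closed)
  qed auto
  then show ?thesis unfolding hs_B_2_2_2
    using d.subgroup_img_is_subgroup i.subgroup_img_is_subgroup by blast
qed

section \<open>The edge maps and the differential of the second page\<close>

lemma hs_class_eqI:
  assumes "b \<in> cochains Q N (Suc 0)" "b (tup [H]) = \<one>\<^bsub>N\<^esub>" "u \<in> cochains Q N 2"
  shows "hs_class G H M 2 2 2 (infl 2 (coboundary Q N (Suc 0) b \<otimes>\<^bsub>cochain_group Q N 2\<^esub> u))
    = hs_class G H M 2 2 2 (infl 2 u)"
proof -
  interpret C: comm_group "cochain_group G M 2" by (rule M.group_cochains)
  have db: "coboundary Q N (Suc 0) b \<in> cochains Q N 2" using assms(1) by (rule N.coboundary_1_in_cochains)
  have "infl 2 (coboundary Q N (Suc 0) b) \<in> hs_B G H M 2 2 2" using assms unfolding hs_B_2_2_2 by blast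
  then have "infl 2 (coboundary Q N (Suc 0) b \<otimes>\<^bsub>cochain_group Q N 2\<^esub> u)
      \<in> hs_B G H M 2 2 2 #>\<^bsub>cochain_group G M 2\<^esub> infl 2 u"
    unfolding inf.cochain_map_mult[OF db assms(3)] by (rule r_cosetI)
  then show ?thesis
    unfolding hs_class_def
    using C.repr_independence[OF _ _ hs_B_2_2_2_subgroup] inf.cochain_map_closed[OF assms(3)] by simp
qed

lemma hs_class_eqD:
  assumes u: "u \<in> cochains Q N 2" and u': "u' \<in> cochains Q N 2"
    and eq: "hs_class G H M 2 2 2 (infl 2 u) = hs_class G H M 2 2 2 (infl 2 u')"
  obtains b where "b \<in> cochains Q N (Suc 0)" "u = coboundary Q N (Suc 0) b \<otimes>\<^bsub>cochain_group Q N 2\<^esub> u'"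
proof -
  interpret C: comm_group "cochain_group G M 2" by (rule M.group_cochains)
  have "infl 2 u \<in> hs_class G H M 2 2 2 (infl 2 u)"
    unfolding hs_class_def using C.rcos_self[OF _ hs_B_2_2_2_subgroup] inf.cochain_map_closed[OF u] by simp
  then have "infl 2 u \<in> hs_B G H M 2 2 2 #>\<^bsub>cochain_group G M 2\<^esub> infl 2 u'" using eq by (simp add: hs_class_def)
  then obtain b where b: "b \<in> cochains Q N (Suc 0)"
      "infl 2 u = infl 2 (coboundary Q N (Suc 0) b) \<otimes>\<^bsub>cochain_group G M 2\<^esub> infl 2 u'"
    by (elim r_cosetE) (auto simp: hs_B_2_2_2)
  have db: "coboundary Q N (Suc 0) b \<in> cochains Q N 2" using b(1) by (rule N.coboundary_1_in_cochains)
  have "infl 2 u = infl 2 (coboundary Q N (Suc 0) b \<otimes>\<^bsub>cochain_group Q N 2\<^esub> u')"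
    unfolding inf.cochain_map_mult[OF db u'] by (rule b(2))
  then have "u = coboundary Q N (Suc 0) b \<otimes>\<^bsub>cochain_group Q N 2\<^esub> u'"
    by (rule infl_inj[OF u N.cochain_mult_closed[OF db u']])
  then show ?thesis using that b(1) by blast
qed

text \<open>Two normalized cocycles of one class differ by the coboundary of some \<open>b\<close>.
  At the pair of trivial cosets this coboundary takes the value of \<open>b\<close> at the trivial
  coset, which must therefore be 0, so the inflated difference lies in \<open>hs_B\<close>.\<close>

lemma hs_edge_inf_eq:
  assumes u: "u \<in> cocycles Q N 2" and n: "normalized Q N 2 u"
  shows "hs_edge_inf G H N (coh_class Q N 2 u) = hs_class G H M 2 2 2 (infl 2 u)"
proof -
  have uc: "u \<in> cochains Q N 2" using u by (simp add: cocycles_def)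
  have H: "H \<in> carrier Q" using proj_in_Q[of \<one>] by (simp add: proj_one)
  have "hs_class G H M 2 2 2 (infl 2 z) = hs_class G H M 2 2 2 (infl 2 u)"
    if z: "z \<in> coh_class Q N 2 u" and zn: "normalized Q N 2 z" for z
  proof -
    obtain b where b: "b \<in> cochains Q N (Suc 0)" "z = coboundary Q N (Suc 0) b \<otimes>\<^bsub>cochain_group Q N 2\<^esub> u"
      using z by (auto simp: coh_class_eq)
    have "z (tup [H, H]) = \<one>\<^bsub>N\<^esub>" "u (tup [H, H]) = \<one>\<^bsub>N\<^esub>"
      using zn n H by (simp_all add: N.normalized_2_iff)
    moreover have "z (tup [H, H]) = coboundary Q N (Suc 0) b (tup [H, H]) \<otimes>\<^bsub>N\<^esub> u (tup [H, H])"
      unfolding b(2) using H by simp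
    moreover have "coboundary Q N (Suc 0) b (tup [H, H]) = b (tup [H])"
      using N.coboundary_1[OF b(1) H H] N.cochain_1_closed[OF b(1) H] N.act_one Q.l_one[OF H] by simp
    ultimately have "b (tup [H]) = \<one>\<^bsub>N\<^esub>" using N.cochain_1_closed[OF b(1) H] by simp
    then show ?thesis unfolding b(2) by (rule hs_class_eqI[OF b(1) _ uc])
  qed
  then have "(\<lambda>z. hs_class G H M 2 2 2 (infl 2 z)) ` {z \<in> coh_class Q N 2 u. normalized Q N 2 z}
      = {hs_class G H M 2 2 2 (infl 2 u)}"
  proof (intro equalityI subsetI)
    fix x assume "x \<in> {hs_class G H M 2 2 2 (infl 2 u)}"
    then show "x \<in> (\<lambda>z. hs_class G H M 2 2 2 (infl 2 z)) ` {z \<in> coh_class Q N 2 u. normalized Q N 2 z}"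
      using N.coh_class_self[OF uc] n by blast
  qed blast
  then show ?thesis unfolding hs_edge_inf_def by simp
qed

text \<open>The elements are inflated 1-cochains plus coboundaries of module elements m. The latter
  have the values a m - m, which depend only on the coset of a because \<open>H\<close> acts
  trivially.\<close>

lemma hs_B_2_0_1:
  shows "hs_B G H M 2 0 (Suc 0) \<noteq> {}" "hs_B G H M 2 0 (Suc 0) \<subseteq> hs_filtration G H M 1 (Suc 0)"
proof -
  have B: "hs_B G H M 2 0 (Suc 0) = hs_filtration G H M 1 (Suc 0) <#>\<^bsub>cochain_group G M (Suc 0)\<^esub>
      coboundary G M 0 ` hs_Z G H M 1 (-1) 0"
    by (simp add: hs_B_def flip: hs_Z_1_1_1)
  show "hs_B G H M 2 0 (Suc 0) \<noteq> {}"
    unfolding B set_mult_def using one_in_hs_filtration[of "Suc 0" 1] one_in_hs_Z[of 0 1 "-1"] by blast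
  show "hs_B G H M 2 0 (Suc 0) \<subseteq> hs_filtration G H M 1 (Suc 0)"
  proof
    fix f assume "f \<in> hs_B G H M 2 0 (Suc 0)"
    then obtain g m where g: "g \<in> hs_filtration G H M 1 (Suc 0)" and m: "m \<in> hs_Z G H M 1 (-1) 0"
      and f: "f = g \<otimes>\<^bsub>cochain_group G M (Suc 0)\<^esub> coboundary G M 0 m"
      unfolding B set_mult_def by blast
    have mc: "m \<in> cochains G M 0" using m by (simp add: hs_Z_def hs_filtration_def)
    have gc: "g \<in> cochains G M (Suc 0)" and g1: "g (tup [\<one>]) = \<one>\<^bsub>N\<^esub>"
      and gx: "\<forall>x\<in>tuples G (Suc 0). \<forall>y\<in>tuples G (Suc 0). proj (x 0) = proj (y 0) \<longrightarrow> g x = g y"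
      using g[unfolded hs_filtration_1_iff] by blast+
    have dm: "coboundary G M 0 m (tup [a]) = act N (proj a) (m (tup [])) \<otimes>\<^bsub>N\<^esub> inv\<^bsub>N\<^esub> m (tup [])"
      if "a \<in> carrier G" for a using M.coboundary_0[OF mc that] by simp
    have m0: "m (tup []) \<in> carrier N" using cochains_closed[OF mc, of "tup []"] by simp
    have "f \<in> cochains G M (Suc 0)"
      unfolding f using gc mc by (intro M.cochain_mult_closed M.coboundary_in_cochains)
    moreover have "f (tup [\<one>]) = \<one>\<^bsub>N\<^esub>"
      using g1 m0 N.act_one unfolding f by (simp add: dm proj_one)
    moreover have "f x = f y" if x: "x \<in> tuples G (Suc 0)" and y: "y \<in> tuples G (Suc 0)"
        and xy: "proj (x 0) = proj (y 0)" for x y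
    proof -
      obtain a where a: "a \<in> carrier G" "x = tup [a]" using x by (rule tuples_1E)
      obtain c where c: "c \<in> carrier G" "y = tup [c]" using y by (rule tuples_1E)
      have "g x = g y" using gx x y xy by blast
      then show ?thesis unfolding f using a c xy by (simp add: dm)
    qed
    ultimately show "f \<in> hs_filtration G H M 1 (Suc 0)" unfolding hs_filtration_1_iff by blast
  qed
qed

lemma hs_B_2_0_1_cases:
  assumes "g \<in> hs_B G H M 2 0 (Suc 0)"
  obtains b where "b \<in> cochains Q N (Suc 0)" "b (tup [H]) = \<one>\<^bsub>N\<^esub>" "g = infl (Suc 0) b"
  using subsetD[OF hs_B_2_0_1(2) assms] unfolding hs_filtration_1_1 by blast

text \<open>A change of representative adds an inflated \<open>b\<close> with value 0 at the trivial
  coset, and this is invisible on \<open>H\<close>.\<close>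

lemma hs_edge_res_eq:
  assumes tr: "transgression F u"
  shows "hs_edge_res G H M (hs_B G H M 2 0 (Suc 0) #>\<^bsub>cochain_group G M (Suc 0)\<^esub> F) = {res_H F}"
proof -
  have F: "F \<in> cochains G M (Suc 0)" using tr by (simp add: transgression_def)
  have "coh_class (tsub G H) M (Suc 0) (res_H f) = {res_H F}"
    if f: "f \<in> hs_B G H M 2 0 (Suc 0) #>\<^bsub>cochain_group G M (Suc 0)\<^esub> F" for f
  proof -
    obtain g where g: "g \<in> hs_B G H M 2 0 (Suc 0)" "f = g \<otimes>\<^bsub>cochain_group G M (Suc 0)\<^esub> F"
      using f by (elim r_cosetE) blast
    obtain b where b: "b \<in> cochains Q N (Suc 0)" "b (tup [H]) = \<one>\<^bsub>N\<^esub>" "g = infl (Suc 0) b"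
      using g(1) by (rule hs_B_2_0_1_cases)
    have fc: "f \<in> cochains G M (Suc 0)"
      unfolding g(2) b(3) using b(1) F by (intro M.cochain_mult_closed inf.cochain_map_closed)
    have "res_H f = res_H F"
    proof (rule T.cochain_1_eqI[OF res_H_closed[OF fc] res_H_closed[OF F]])
      fix h assume "h \<in> carrier (tsub G H)"
      then have h: "h \<in> H" "h \<in> carrier G" by simp_all
      have "f (tup [h]) = F (tup [h])"
        unfolding g(2) using h transgression_closed[OF tr h(2)] b by (simp add: infl_1_tup proj_H)
      then show "res_H f (tup [h]) = res_H F (tup [h])" using h by (simp add: res_H_tup)
    qed
    then show ?thesis using coh_class_H[OF res_H_closed[OF F]] by simp
  qed
  moreover have "hs_B G H M 2 0 (Suc 0) #>\<^bsub>cochain_group G M (Suc 0)\<^esub> F \<noteq> {}"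
    using hs_B_2_0_1(1) r_cosetI[of _ "hs_B G H M 2 0 (Suc 0)" "cochain_group G M (Suc 0)" F] by blast
  ultimately have "(\<lambda>f. coh_class (tsub G H) M (Suc 0) (res_H f)) `
      (hs_B G H M 2 0 (Suc 0) #>\<^bsub>cochain_group G M (Suc 0)\<^esub> F) = {{res_H F}}"
    by (auto simp: image_def)
  then show ?thesis unfolding hs_edge_res_def by simp
qed

text \<open>A change of representative alters the coboundary by the inflated coboundary of
  \<open>b\<close>, which is an element of \<open>hs_B\<close>.\<close>

lemma hs_d_eq:
  assumes tr: "transgression F u"
  shows "hs_d G H M 2 0 (Suc 0) (hs_B G H M 2 0 (Suc 0) #>\<^bsub>cochain_group G M (Suc 0)\<^esub> F)
    = hs_class G H M 2 2 2 (infl 2 u)"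
proof -
  have F: "F \<in> cochains G M (Suc 0)" and u: "u \<in> cochains Q N 2" "infl 2 u = coboundary G M (Suc 0) F"
    using tr by (auto simp: transgression_def)
  have "hs_class G H M 2 2 2 (coboundary G M (Suc 0) f) = hs_class G H M 2 2 2 (infl 2 u)"
    if f: "f \<in> hs_B G H M 2 0 (Suc 0) #>\<^bsub>cochain_group G M (Suc 0)\<^esub> F" for f
  proof -
    obtain g where g: "g \<in> hs_B G H M 2 0 (Suc 0)" "f = g \<otimes>\<^bsub>cochain_group G M (Suc 0)\<^esub> F"
      using f by (elim r_cosetE) blast
    obtain b where b: "b \<in> cochains Q N (Suc 0)" "b (tup [H]) = \<one>\<^bsub>N\<^esub>" "g = infl (Suc 0) b"
      using g(1) by (rule hs_B_2_0_1_cases)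
    have db: "coboundary Q N (Suc 0) b \<in> cochains Q N 2" using b(1) by (rule N.coboundary_1_in_cochains)
    have "coboundary G M (Suc 0) f
        = coboundary G M (Suc 0) (infl (Suc 0) b) \<otimes>\<^bsub>cochain_group G M 2\<^esub> coboundary G M (Suc 0) F"
      unfolding g(2) b(3) using M.coboundary_mult[OF inf.cochain_map_closed[OF b(1)] F]
      by (simp add: numeral_2_eq_2)
    also have "\<dots> = infl 2 (coboundary Q N (Suc 0) b \<otimes>\<^bsub>cochain_group Q N 2\<^esub> u)"
      unfolding inf.cochain_map_mult[OF db u(1)] u(2) coboundary_infl_1[OF b(1)] ..
    finally show ?thesis using hs_class_eqI[OF b(1,2) u(1)] by simp
  qed
  moreover have "hs_B G H M 2 0 (Suc 0) #>\<^bsub>cochain_group G M (Suc 0)\<^esub> F \<noteq> {}"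
    using hs_B_2_0_1(1) r_cosetI[of _ "hs_B G H M 2 0 (Suc 0)" "cochain_group G M (Suc 0)" F] by blast
  ultimately have "(\<lambda>f. hs_class G H M 2 2 2 (coboundary G M (Suc 0) f)) `
      (hs_B G H M 2 0 (Suc 0) #>\<^bsub>cochain_group G M (Suc 0)\<^esub> F) = {hs_class G H M 2 2 2 (infl 2 u)}"
    by (auto simp: image_def)
  then show ?thesis unfolding hs_d_def by (simp add: numeral_2_eq_2)
qed

lemma carrier_hs_E:
  "carrier (hs_E G H M 2 0 (Suc 0))
    = {hs_B G H M 2 0 (Suc 0) #>\<^bsub>cochain_group G M (Suc 0)\<^esub> F | F. \<exists>u. transgression F u}"
  unfolding hs_E_def carrier_FactGroup by (auto simp: hs_Z_2_0_1)

text \<open>Each of the two inversions in \<open>hs_d2\<close> returns some preimage. The first is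
  the class of a cochain with the same restriction to \<open>H\<close>, which
  \<open>transgression_unique\<close> compares with \<open>F\<close>. The second is a cohomology
  class with a normalized representative whose inflation has the same class in the spectral sequence
  as that of \<open>u\<close>; such cocycles are cohomologous.\<close>

theorem hs_d2_eq:
  assumes tr: "transgression F u" and f: "invariant_hom f"
    and eq: "\<And>h. h \<in> H \<Longrightarrow> F (tup [h]) = f (tup [h])"
  shows "hs_d2 G H N {f} = coh_class Q N 2 u"
proof -
  have fc: "f \<in> cochains (tsub G H) M (Suc 0)" using f by (simp add: invariant_hom_def)
  have Fc: "F \<in> cochains G M (Suc 0)" and uc: "u \<in> cochains Q N 2" using tr
    by (simp_all add: transgression_def)
  have resF: "res_H F = f"
    using fc res_H_closed[OF Fc] eq by (intro T.cochain_1_eqI) (auto simp: res_H_tup)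
  let ?E = "carrier (hs_E G H M 2 0 (Suc 0))" and ?e = "hs_edge_res G H M"
  have "{f} \<in> ?e ` ?E"
    using hs_edge_res_eq[OF tr] tr resF unfolding carrier_hs_E by force
  then have \<xi>: "inv_into ?E ?e {f} \<in> ?E" "?e (inv_into ?E ?e {f}) = {f}"
    by (rule inv_into_into, rule f_inv_into_f)
  then obtain F1 u1 where tr1: "transgression F1 u1"
    and \<xi>1: "inv_into ?E ?e {f} = hs_B G H M 2 0 (Suc 0) #>\<^bsub>cochain_group G M (Suc 0)\<^esub> F1"
    unfolding carrier_hs_E by blast
  have resF1: "res_H F1 = f" using \<xi>(2) unfolding \<xi>1 hs_edge_res_eq[OF tr1] by simp
  have d: "hs_d G H M 2 0 (Suc 0) (inv_into ?E ?e {f}) = hs_class G H M 2 2 2 (infl 2 u1)"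
    unfolding \<xi>1 by (rule hs_d_eq[OF tr1])
  have u1c: "u1 \<in> cochains Q N 2" using tr1 by (simp add: transgression_def)
  have "F (tup [h]) = F1 (tup [h])" if "h \<in> H" for h
    using eq[OF that] resF1 res_H_tup[OF that, of F1] by simp
  then obtain b where b: "b \<in> cochains Q N (Suc 0)" "b (tup [H]) = \<one>\<^bsub>N\<^esub>"
    "u = coboundary Q N (Suc 0) b \<otimes>\<^bsub>cochain_group Q N 2\<^esub> u1"
    using transgression_unique[OF tr tr1] by metis
  have d': "hs_d G H M 2 0 (Suc 0) (inv_into ?E ?e {f}) = hs_class G H M 2 2 2 (infl 2 u)"
    unfolding d b(3) using hs_class_eqI[OF b(1,2) u1c] ..
  let ?C = "carrier (cohomology Q N 2)" and ?i = "hs_edge_inf G H N"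
  have "hs_class G H M 2 2 2 (infl 2 u) \<in> ?i ` ?C"
    using hs_edge_inf_eq[OF transgression_cocycle[OF tr] transgression_normalized[OF tr]]
      transgression_cocycle[OF tr] unfolding carrier_cohomology by (metis imageI)
  then have c: "inv_into ?C ?i (hs_class G H M 2 2 2 (infl 2 u)) \<in> ?C"
    "?i (inv_into ?C ?i (hs_class G H M 2 2 2 (infl 2 u))) = hs_class G H M 2 2 2 (infl 2 u)"
    by (rule inv_into_into, rule f_inv_into_f)
  then obtain z where z: "z \<in> cocycles Q N 2" "inv_into ?C ?i (hs_class G H M 2 2 2 (infl 2 u))
      = coh_class Q N 2 z"
    unfolding carrier_cohomology by blast
  have zc: "z \<in> cochains Q N 2" using z(1) by (simp add: cocycles_def)
  \<comment> \<open>The representative taken from the class need not be normalized, as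
    \<open>hs_edge_inf_eq\<close> demands.\<close>
  obtain k where k: "k \<in> cochains Q N (Suc 0)"
    "normalized Q N 2 (coboundary Q N (Suc 0) k \<otimes>\<^bsub>cochain_group Q N 2\<^esub> z)"
    using N.cocycle_2_normalize[OF z(1)] by blast
  let ?z = "coboundary Q N (Suc 0) k \<otimes>\<^bsub>cochain_group Q N 2\<^esub> z"
  have z'c: "?z \<in> cochains Q N 2"
    using k(1) zc by (intro N.cochain_mult_closed N.coboundary_1_in_cochains)
  have "?z \<in> cocycles Q N 2"
    by (rule subgroup.m_closed[OF N.cocycles_subgroup N.coboundary_1_cocycle[OF k(1)] z(1)])
  moreover have cz: "coh_class Q N 2 ?z = coh_class Q N 2 z" by (rule N.coh_class_coboundary_mult[OF k(1) zc])
  ultimately have "hs_class G H M 2 2 2 (infl 2 u) = hs_class G H M 2 2 2 (infl 2 ?z)"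
    using c(2) k(2) hs_edge_inf_eq[of ?z] unfolding z(2) by metis
  then obtain b' where "b' \<in> cochains Q N (Suc 0)" "u = coboundary Q N (Suc 0) b' \<otimes>\<^bsub>cochain_group Q N 2\<^esub> ?z"
    by (rule hs_class_eqD[OF uc z'c])
  then have "coh_class Q N 2 u = coh_class Q N 2 z" using N.coh_class_coboundary_mult z'c cz by metis
  then show ?thesis unfolding hs_d2_def One_nat_def d' z(2) ..
qed

end

section \<open>Existence of extensions with inflated coboundary\<close>

context profinite_quotient_module
begin

text \<open>The coboundary of the extension does not change when an entry is multiplied by an
  element of \<open>H\<close>. In the second entry the extra terms cancel by the product rule for
  \<open>F\<close>. In the first entry \<open>h\<close> is moved past \<open>b\<close>, where it
  becomes a conjugate, and invariance of \<open>f\<close> identifies the resulting term.\<close>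

lemma invariant_hom_transgression:
  assumes f: "invariant_hom f"
  obtains F u where "transgression F u" "\<And>h. h \<in> H \<Longrightarrow> F (tup [h]) = f (tup [h])"
proof -
  obtain F where F: "F \<in> cochains G M (Suc 0)" "\<And>h. h \<in> H \<Longrightarrow> F (tup [h]) = f (tup [h])"
    "\<And>g h. g \<in> carrier G \<Longrightarrow> h \<in> H \<Longrightarrow> F (tup [g \<otimes> h]) = F (tup [g]) \<otimes>\<^bsub>N\<^esub> act N (proj g) (F (tup [h]))"
  proof (rule invariant_hom_extends[OF f])
  qed (rule that)
  note f' = f[unfolded invariant_hom_def]
  have Fc [simp]: "F (tup [a]) \<in> carrier N" if "a \<in> carrier G" for a
    using M.cochain_1_closed[OF F(1) that] by simp
  have F1: "F (tup [\<one>]) = \<one>\<^bsub>N\<^esub>"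
  proof -
    have "F (tup [\<one>]) \<otimes>\<^bsub>N\<^esub> F (tup [\<one>]) = F (tup [\<one> \<otimes> \<one>])"
    proof -
      have "f (tup [\<one> \<otimes> \<one>]) = f (tup [\<one>]) \<otimes>\<^bsub>N\<^esub> f (tup [\<one>])" using f' one_closed by blast
      then show ?thesis using F(2)[of \<one>] by simp
    qed
    also have "\<dots> = F (tup [\<one>])" by simp
    finally show ?thesis using N.M.l_cancel_one[of "F (tup [\<one>])" "F (tup [\<one>])"] Fc[of \<one>] by auto
  qed
  have conj: "act N (proj g) (F (tup [inv g \<otimes> h \<otimes> g])) = F (tup [h])" if "g \<in> carrier G" "h \<in> H" for g h
    using f' F(2) that inv_op_closed1[OF that] by metis
  let ?D = "coboundary G M (Suc 0) F"
  have D: "?D \<in> cochains G M 2" using F(1) by (rule M.coboundary_1_in_cochains)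
  have D_tup: "?D (tup [a, b]) = act N (proj a) (F (tup [b])) \<otimes>\<^bsub>N\<^esub> inv\<^bsub>N\<^esub> F (tup [a \<otimes> b]) \<otimes>\<^bsub>N\<^esub> F (tup [a])"
    if "a \<in> carrier G" "b \<in> carrier G" for a b
    using M.coboundary_1[OF F(1) that] by simp
  have D_right: "?D (tup [a, b \<otimes> h]) = ?D (tup [a, b])"
    if a: "a \<in> carrier G" and b: "b \<in> carrier G" and h: "h \<in> H" for a b h
  proof -
    have hc: "h \<in> carrier G" using h by simp
    have F_abh: "F (tup [a \<otimes> (b \<otimes> h)]) = F (tup [a \<otimes> b]) \<otimes>\<^bsub>N\<^esub> act N (proj a) (act N (proj b) (F (tup [h])))"
      using F(3)[of "a \<otimes> b" h] a b h hc N.act_act[of "proj a" "proj b" "F (tup [h])"]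
      by (simp add: m_assoc proj_mult)
    have alg: "(p \<otimes>\<^bsub>N\<^esub> w) \<otimes>\<^bsub>N\<^esub> inv\<^bsub>N\<^esub> (q \<otimes>\<^bsub>N\<^esub> w) \<otimes>\<^bsub>N\<^esub> r = p \<otimes>\<^bsub>N\<^esub> inv\<^bsub>N\<^esub> q \<otimes>\<^bsub>N\<^esub> r"
      if "p \<in> carrier N" "q \<in> carrier N" "r \<in> carrier N" "w \<in> carrier N" for p q r w
    proof -
      have "(p \<otimes>\<^bsub>N\<^esub> w) \<otimes>\<^bsub>N\<^esub> inv\<^bsub>N\<^esub> (q \<otimes>\<^bsub>N\<^esub> w) = p \<otimes>\<^bsub>N\<^esub> inv\<^bsub>N\<^esub> q"
        using that by (simp add: N.M.inv_mult N.M.m_assoc N.M.m_lcomm[of w])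
      then show ?thesis by simp
    qed
    have "?D (tup [a, b \<otimes> h]) = (act N (proj a) (F (tup [b])) \<otimes>\<^bsub>N\<^esub> act N (proj a) (act N (proj b) (F (tup [h]))))
        \<otimes>\<^bsub>N\<^esub> inv\<^bsub>N\<^esub> (F (tup [a \<otimes> b]) \<otimes>\<^bsub>N\<^esub> act N (proj a) (act N (proj b) (F (tup [h])))) \<otimes>\<^bsub>N\<^esub> F (tup [a])"
      using a b h hc by (simp add: D_tup F_abh F(3) N.act_mult)
    also have "\<dots> = ?D (tup [a, b])" unfolding D_tup[OF a b] using a b hc by (intro alg) simp_all
    finally show ?thesis .
  qed
  have D_left: "?D (tup [a \<otimes> h, b]) = ?D (tup [a, b])"
    if a: "a \<in> carrier G" and b: "b \<in> carrier G" and h: "h \<in> H" for a b h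
  proof -
    let ?h = "inv b \<otimes> h \<otimes> b"
    have hc: "h \<in> carrier G" using h by simp
    have h': "?h \<in> H" using b h by (rule inv_op_closed1)
    have "b \<otimes> (inv b \<otimes> (h \<otimes> b)) = h \<otimes> b" using b hc by (simp add: m_assoc[symmetric])
    then have "a \<otimes> h \<otimes> b = (a \<otimes> b) \<otimes> ?h" using a b hc by (simp add: m_assoc)
    then have "F (tup [a \<otimes> h \<otimes> b]) = F (tup [a \<otimes> b]) \<otimes>\<^bsub>N\<^esub> act N (proj (a \<otimes> b)) (F (tup [?h]))"
      using F(3)[of "a \<otimes> b" ?h] a b h' by simp
    also have "act N (proj (a \<otimes> b)) (F (tup [?h])) = act N (proj a) (F (tup [h]))"
      using N.act_act[of "proj a" "proj b" "F (tup [?h])"] conj[OF b h] a b h' by (simp add: proj_mult)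
    finally have F_ahb: "F (tup [a \<otimes> h \<otimes> b]) = F (tup [a \<otimes> b]) \<otimes>\<^bsub>N\<^esub> act N (proj a) (F (tup [h]))" .
    have alg: "p \<otimes>\<^bsub>N\<^esub> inv\<^bsub>N\<^esub> (q \<otimes>\<^bsub>N\<^esub> w) \<otimes>\<^bsub>N\<^esub> (r \<otimes>\<^bsub>N\<^esub> w) = p \<otimes>\<^bsub>N\<^esub> inv\<^bsub>N\<^esub> q \<otimes>\<^bsub>N\<^esub> r"
      if "p \<in> carrier N" "q \<in> carrier N" "r \<in> carrier N" "w \<in> carrier N" for p q r w
    proof -
      have "inv\<^bsub>N\<^esub> (q \<otimes>\<^bsub>N\<^esub> w) \<otimes>\<^bsub>N\<^esub> (r \<otimes>\<^bsub>N\<^esub> w) = (inv\<^bsub>N\<^esub> q \<otimes>\<^bsub>N\<^esub> r) \<otimes>\<^bsub>N\<^esub> (inv\<^bsub>N\<^esub> w \<otimes>\<^bsub>N\<^esub> w)"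
        using that by (simp add: N.M.inv_mult N.M.m_ac
            del: N.M.l_inv N.M.r_inv N.M.Units_l_inv N.M.Units_r_inv)
      also have "\<dots> = inv\<^bsub>N\<^esub> q \<otimes>\<^bsub>N\<^esub> r" using that by simp
      finally have "inv\<^bsub>N\<^esub> (q \<otimes>\<^bsub>N\<^esub> w) \<otimes>\<^bsub>N\<^esub> (r \<otimes>\<^bsub>N\<^esub> w) = inv\<^bsub>N\<^esub> q \<otimes>\<^bsub>N\<^esub> r" .
      then show ?thesis using that by (simp add: N.M.m_assoc)
    qed
    have "?D (tup [a \<otimes> h, b]) = act N (proj a) (F (tup [b]))
        \<otimes>\<^bsub>N\<^esub> inv\<^bsub>N\<^esub> (F (tup [a \<otimes> b]) \<otimes>\<^bsub>N\<^esub> act N (proj a) (F (tup [h]))) \<otimes>\<^bsub>N\<^esub> (F (tup [a]) \<otimes>\<^bsub>N\<^esub> act N (proj a) (F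
            (tup [h])))"
      using a b h hc by (simp add: D_tup F_ahb F(3) proj_mult_H)
    also have "\<dots> = ?D (tup [a, b])" unfolding D_tup[OF a b] using a b hc by (intro alg) simp_all
    finally show ?thesis .
  qed
  obtain u where u: "u \<in> cochains Q N 2" "infl 2 u = ?D"
  proof (rule infl_surj[OF D])
    fix x y assume x: "x \<in> tuples G 2" and y: "y \<in> tuples G 2" and xy: "\<And>i. i < 2 \<Longrightarrow> proj (x i) = proj (y i)"
    obtain a b where ab: "a \<in> carrier G" "b \<in> carrier G" "x = tup [a, b]" using x by (rule tuples_2E)
    obtain c d where cd: "c \<in> carrier G" "d \<in> carrier G" "y = tup [c, d]" using y by (rule tuples_2E)
    have "proj a = proj c" "proj b = proj d" using xy[of 0] xy[of 1] ab cd by simp_all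
    then have "inv a \<otimes> c \<in> H" "inv b \<otimes> d \<in> H" using ab cd proj_eq_iff by blast+
    moreover have "c = a \<otimes> (inv a \<otimes> c)" "d = b \<otimes> (inv b \<otimes> d)" using ab cd
      by (simp_all add: m_assoc[symmetric])
    ultimately have "?D (tup [c, d]) = ?D (tup [a, b])"
      using D_left[of a d "inv a \<otimes> c"] D_right[of a b "inv b \<otimes> d"] ab cd by metis
    then show "?D x = ?D y" using ab cd by simp
  qed (rule that)
  have "transgression F u" using F(1) F1 u by (simp add: transgression_def)
  then show ?thesis using that F(2) by blast
qed

end

section \<open>Exact sequences of coefficients\<close>

locale exact_modules = A: discrete_module G A + L: discrete_module G L + J: discrete_module G J
  for G :: "('g, 'b) tgroup_scheme" (structure) and A :: "('g, 'a) tmod" and L :: "('g, 'm) tmod"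
    and J :: "('g, 'n) tmod" +
  fixes i :: "'a \<Rightarrow> 'm" and p :: "'m \<Rightarrow> 'n"
  assumes i_hom: "i \<in> hom A L" and p_hom: "p \<in> hom L J"
    and i_inj: "inj_on i (carrier A)"
    and p_surj: "p ` carrier L = carrier J"
    and exact: "x \<in> carrier L \<Longrightarrow> p x = \<one>\<^bsub>J\<^esub> \<longleftrightarrow> x \<in> i ` carrier A"
    and i_equivariant: "g \<in> carrier G \<Longrightarrow> a \<in> carrier A \<Longrightarrow> i (act A g a) = act L g (i a)"
    and p_equivariant: "g \<in> carrier G \<Longrightarrow> x \<in> carrier L \<Longrightarrow> p (act L g x) = act J g (p x)"
begin

lemma module_map_i: "module_map G A G L (\<lambda>g. g) i"
proof (intro module_map.intro module_map_axioms.intro A.discrete_module_axioms L.discrete_module_axioms i_hom)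
  show "(\<lambda>g. g) \<in> hom G G" by (auto simp: hom_def)
qed (simp_all add: i_equivariant)

lemma module_map_p: "module_map G L G J (\<lambda>g. g) p"
proof (intro module_map.intro module_map_axioms.intro L.discrete_module_axioms J.discrete_module_axioms p_hom)
  show "(\<lambda>g. g) \<in> hom G G" by (auto simp: hom_def)
qed (simp_all add: p_equivariant)

sublocale im: module_map G A G L "\<lambda>g. g" i by (rule module_map_i)
sublocale pm: module_map G L G J "\<lambda>g. g" p by (rule module_map_p)

abbreviation i_map :: "nat \<Rightarrow> ((nat \<Rightarrow> 'g) \<Rightarrow> 'a) \<Rightarrow> (nat \<Rightarrow> 'g) \<Rightarrow> 'm" where
  "i_map k \<equiv> cochain_map G k (\<lambda>g. g) i"
abbreviation p_map :: "nat \<Rightarrow> ((nat \<Rightarrow> 'g) \<Rightarrow> 'm) \<Rightarrow> (nat \<Rightarrow> 'g) \<Rightarrow> 'n" where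
  "p_map k \<equiv> cochain_map G k (\<lambda>g. g) p"

lemma tuples_restrict: "x \<in> tuples G k \<Longrightarrow> (\<lambda>j\<in>{..<k}. x j) = x"
  by (auto simp: tuples_def PiE_def extensional_def fun_eq_iff)

lemma i_map_apply: "x \<in> tuples G k \<Longrightarrow> i_map k f x = i (f x)"
  by (simp add: im.cochain_map_apply tuples_restrict)

lemma p_map_apply: "x \<in> tuples G k \<Longrightarrow> p_map k f x = p (f x)"
  by (simp add: pm.cochain_map_apply tuples_restrict)

text \<open>Composition with any set-theoretic section works, since all functions between discrete
  modules are continuous.\<close>

lemma cochain_lift:
  assumes c: "c \<in> cochains G J k"
  obtains y where "y \<in> cochains G L k" "p_map k y = c"
proof -
  let ?s = "inv_into (carrier L) p"
  have s: "?s x \<in> carrier L" "p (?s x) = x" if "x \<in> carrier J" for x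
    using that p_surj by (auto intro: inv_into_into f_inv_into_f)
  have "continuous_map (product_topology (\<lambda>_. gtop G) {..<k}) (gtop L) (\<lambda>x. ?s (c x))"
    using J.cochain_continuous[OF c] unfolding L.gtop_M J.gtop_M
    by (rule continuous_map_discrete_unary) (use s in auto)
  then have y: "(\<lambda>x\<in>tuples G k. ?s (c x)) \<in> cochains G L k" by (rule L.cochainsI)
  moreover have "p_map k (\<lambda>x\<in>tuples G k. ?s (c x)) = c"
    using c by (intro J.cochain_eqI[of _ k] pm.cochain_map_closed y) (auto simp: p_map_apply s cochains_closed)
  ultimately show ?thesis using that by blast
qed

text \<open>The values lie in the image of \<open>i\<close>, and inverting \<open>i\<close> there
  keeps continuity because the modules are discrete.\<close>

lemma cochain_exact:
  assumes y: "y \<in> cochains G L k" and py: "p_map k y = \<one>\<^bsub>cochain_group G J k\<^esub>"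
  obtains a where "a \<in> cochains G A k" "i_map k a = y"
proof -
  let ?s = "inv_into (carrier A) i"
  have yi: "y x \<in> i ` carrier A" if "x \<in> tuples G k" for x
  proof -
    have "p (y x) = \<one>\<^bsub>J\<^esub>" using fun_cong[OF py, of x] that by (simp add: p_map_apply)
    then show ?thesis using exact cochains_closed[OF y that] by blast
  qed
  have s: "?s x \<in> carrier A" "i (?s x) = x" if "x \<in> i ` carrier A" for x
    using that by (auto intro: inv_into_into f_inv_into_f)
  have "continuous_map (product_topology (\<lambda>_. gtop G) {..<k}) (discrete_topology (i ` carrier A)) y"
    using L.cochain_continuous[OF y] yi im.\<beta>_closed
    unfolding L.gtop_M continuous_map_discrete_iff A.topspace_tuples by auto
  then have "continuous_map (product_topology (\<lambda>_. gtop G) {..<k}) (gtop A) (\<lambda>x. ?s (y x))"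
    unfolding A.gtop_M by (rule continuous_map_discrete_unary) (use s in auto)
  then have a: "(\<lambda>x\<in>tuples G k. ?s (y x)) \<in> cochains G A k" by (rule A.cochainsI)
  moreover have "i_map k (\<lambda>x\<in>tuples G k. ?s (y x)) = y"
    using y by (intro L.cochain_eqI[of _ k] im.cochain_map_closed a) (auto simp: i_map_apply s yi)
  ultimately show ?thesis using that by blast
qed

lemma i_map_inj:
  assumes a: "a \<in> cochains G A k" and b: "b \<in> cochains G A k" and eq: "i_map k a = i_map k b"
  shows "a = b"
proof (rule A.cochain_eqI[OF a b])
  fix x assume x: "x \<in> tuples G k"
  have "i (a x) = i (b x)" using fun_cong[OF eq, of x] x by (simp add: i_map_apply)
  then show "a x = b x" using i_inj cochains_closed[OF a x] cochains_closed[OF b x] by (simp add: inj_on_def)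
qed

lemma p_i_map:
  assumes a: "a \<in> cochains G A k"
  shows "p_map k (i_map k a) = \<one>\<^bsub>cochain_group G J k\<^esub>"
proof (rule J.cochain_eqI[of _ k])
  show "p_map k (i_map k a) \<in> cochains G J k"
    using a by (intro pm.cochain_map_closed im.cochain_map_closed)
  fix x assume x: "x \<in> tuples G k"
  have "p (i (a x)) = \<one>\<^bsub>J\<^esub>" using exact cochains_closed[OF a x] im.\<beta>_closed by blast
  then show "p_map k (i_map k a) x = \<one>\<^bsub>cochain_group G J k\<^esub> x" using x by (simp add: p_map_apply i_map_apply)
qed (rule J.cochain_one_closed)

text \<open>Injectivity of \<open>i\<close> on cochains reduces the claim to d d y = 0.\<close>

lemma connecting_cocycle:
  assumes y: "y \<in> cochains G L 2" and z: "z \<in> cochains G A 3"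
    and eq: "i_map 3 z = coboundary G L 2 y"
  shows "z \<in> cocycles G A 3"
proof -
  have dz: "coboundary G A 3 z \<in> cochains G A 4" using A.coboundary_in_cochains[OF z] by simp
  have "i_map 4 (coboundary G A 3 z) = coboundary G L 3 (i_map 3 z)"
    using im.cochain_map_coboundary[OF z] by simp
  also have "\<dots> = \<one>\<^bsub>cochain_group G L 4\<^esub>" unfolding eq by (rule L.coboundary_squared_2[OF y])
  also have "\<dots> = i_map 4 \<one>\<^bsub>cochain_group G A 4\<^esub>"
    using group_hom.hom_one[OF im.cochain_map_group_hom] by metis
  finally have "coboundary G A 3 z = \<one>\<^bsub>cochain_group G A 4\<^esub>"
    by (rule i_map_inj[OF dz A.cochain_one_closed])
  then show ?thesis using z by (simp add: cocycles_def)
qed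

lemma connecting_exists:
  assumes y: "y \<in> cochains G L 2" and py: "p_map 2 y \<in> cocycles G J 2"
  obtains z where "z \<in> cocycles G A 3" "i_map 3 z = coboundary G L 2 y"
proof -
  have "p_map 3 (coboundary G L 2 y) = coboundary G J 2 (p_map 2 y)"
    using pm.cochain_map_coboundary[OF y] by simp
  also have "\<dots> = \<one>\<^bsub>cochain_group G J 3\<^esub>" using py by (simp add: cocycles_def)
  finally obtain z where "z \<in> cochains G A 3" "i_map 3 z = coboundary G L 2 y"
    by (rule cochain_exact[OF L.coboundary_2_in_cochains[OF y]])
  then show ?thesis using that connecting_cocycle[OF y] by blast
qed

text \<open>When the projections of the two lifts differ by the coboundary of \<open>b\<close>,
  adding to \<open>y\<close> the coboundary of a lift of \<open>b\<close> equalizes the projections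
  and leaves the coboundary of \<open>y\<close> unchanged. The remaining difference comes from a
  cochain \<open>a\<close> of the submodule, and \<open>z'\<close> differs from \<open>z\<close> by
  the coboundary of \<open>a\<close>.\<close>

lemma connecting_unique:
  assumes y: "y \<in> cochains G L 2" and z: "z \<in> cochains G A 3" "i_map 3 z = coboundary G L 2 y"
    and y': "y' \<in> cochains G L 2" and z': "z' \<in> cochains G A 3" "i_map 3 z' = coboundary G L 2 y'"
    and py': "p_map 2 y' \<in> coh_class G J 2 (p_map 2 y)"
  shows "coh_class G A 3 z' = coh_class G A 3 z"
proof -
  interpret CL: comm_group "cochain_group G L 2" by (rule L.group_cochains)
  interpret CL3: comm_group "cochain_group G L 3" by (rule L.group_cochains)
  interpret CJ: comm_group "cochain_group G J 2" by (rule J.group_cochains)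
  interpret dL: group_hom "cochain_group G L 2" "cochain_group G L 3" "coboundary G L 2"
    by (rule L.coboundary_2_group_hom)
  interpret P: group_hom "cochain_group G L 2" "cochain_group G J 2" "p_map 2"
    by (rule pm.cochain_map_group_hom)
  obtain b where b: "b \<in> cochains G J (Suc 0)"
    "p_map 2 y' = coboundary G J (Suc 0) b \<otimes>\<^bsub>cochain_group G J 2\<^esub> p_map 2 y"
    using py' by (auto simp: coh_class_eq)
  obtain c where c: "c \<in> cochains G L (Suc 0)" "p_map (Suc 0) c = b" using b(1) by (rule cochain_lift)
  have dc: "coboundary G L (Suc 0) c \<in> cochains G L 2" using c(1) by (rule L.coboundary_1_in_cochains)
  have pdc: "p_map 2 (coboundary G L (Suc 0) c) = coboundary G J (Suc 0) b"
    using pm.cochain_map_coboundary[OF c(1)] c(2) by (simp add: numeral_2_eq_2)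
  let ?w = "coboundary G L (Suc 0) c \<otimes>\<^bsub>cochain_group G L 2\<^esub> y"
  have w: "?w \<in> cochains G L 2" using dc y by (rule L.cochain_mult_closed)
  have pw: "p_map 2 ?w = p_map 2 y'"
    unfolding b(2) pdc[symmetric] by (rule pm.cochain_map_mult[OF dc y])
  let ?e = "y' \<otimes>\<^bsub>cochain_group G L 2\<^esub> inv\<^bsub>cochain_group G L 2\<^esub> ?w"
  have e: "?e \<in> cochains G L 2"
    using CL.m_closed[of y' "inv\<^bsub>cochain_group G L 2\<^esub> ?w"] CL.inv_closed[of ?w] y' w by simp
  have pe: "p_map 2 ?e = \<one>\<^bsub>cochain_group G J 2\<^esub>"
  proof -
    have "p_map 2 ?e = p_map 2 y' \<otimes>\<^bsub>cochain_group G J 2\<^esub> inv\<^bsub>cochain_group G J 2\<^esub> p_map 2 ?w"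
      using P.hom_mult[of y' "inv\<^bsub>cochain_group G L 2\<^esub> ?w"] P.hom_inv[of ?w] CL.inv_closed[of ?w] y' w by simp
    also have "\<dots> = \<one>\<^bsub>cochain_group G J 2\<^esub>"
      unfolding pw using CJ.r_inv[of "p_map 2 y'"] pm.cochain_map_closed[OF y'] by simp
    finally show ?thesis .
  qed
  obtain a where a: "a \<in> cochains G A 2" "i_map 2 a = ?e" using e pe by (rule cochain_exact)
  have da: "coboundary G A 2 a \<in> cochains G A 3" using a(1) by (rule A.coboundary_2_in_cochains)
  have dw: "coboundary G L 2 ?w = coboundary G L 2 y"
  proof -
    have "coboundary G L 2 ?w = \<one>\<^bsub>cochain_group G L 3\<^esub> \<otimes>\<^bsub>cochain_group G L 3\<^esub> coboundary G L 2 y"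
      using dL.hom_mult[of "coboundary G L (Suc 0) c" y] dc y L.coboundary_squared_1[OF c(1)] by simp
    then show ?thesis using CL3.l_one[of "coboundary G L 2 y"] L.coboundary_2_in_cochains[OF y] by simp
  qed
  have "i_map 3 (coboundary G A 2 a \<otimes>\<^bsub>cochain_group G A 3\<^esub> z)
      = i_map 3 (coboundary G A 2 a) \<otimes>\<^bsub>cochain_group G L 3\<^esub> i_map 3 z"
    by (rule im.cochain_map_mult[OF da z(1)])
  also have "i_map 3 (coboundary G A 2 a) = coboundary G L 2 ?e"
    using im.cochain_map_coboundary[OF a(1)] a(2) by simp
  also have "\<dots> = coboundary G L 2 y' \<otimes>\<^bsub>cochain_group G L 3\<^esub> inv\<^bsub>cochain_group G L 3\<^esub> coboundary G L 2 y"
    using dL.hom_mult[of y' "inv\<^bsub>cochain_group G L 2\<^esub> ?w"] dL.hom_inv[of ?w] CL.inv_closed[of ?w] y' w dw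
    by simp
  also have "\<dots> \<otimes>\<^bsub>cochain_group G L 3\<^esub> i_map 3 z = coboundary G L 2 y'"
    unfolding z(2)
    by (rule CL3.mult_inv_mult_cancel) (use L.coboundary_2_in_cochains y y' in simp_all)
  also have "\<dots> = i_map 3 z'" by (rule z'(2)[symmetric])
  finally have "coboundary G A 2 a \<otimes>\<^bsub>cochain_group G A 3\<^esub> z = z'"
    by (rule i_map_inj[OF A.cochain_mult_closed[OF da z(1)] z'(1)])
  then have "z' \<in> coh_class G A 3 z" using a(1) by (auto simp: coh_class_eq)
  then show ?thesis by (rule A.coh_class_eqI[OF z(1)])
qed

text \<open>The definite description in \<open>connecting\<close> is discharged by
  \<open>connecting_unique\<close>, so any convenient lift may be used for computing.\<close>

lemma connecting_eq:
  assumes y: "y \<in> cochains G L 2" and z: "z \<in> cocycles G A 3" "i_map 3 z = coboundary G L 2 y"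
  shows "connecting G A i L p 2 (coh_class G J 2 (p_map 2 y)) = coh_class G A 3 z"
  unfolding connecting_def
proof (rule the_equality)
  have zc: "z \<in> cochains G A 3" using z(1) by (simp add: cocycles_def)
  have s: "Suc 2 = 3" by simp
  have "p_map 2 y \<in> coh_class G J 2 (p_map 2 y)"
    by (rule J.coh_class_self[OF pm.cochain_map_closed[OF y]])
  then show "\<exists>y'\<in>cochains G L 2. \<exists>z'\<in>cocycles G A (Suc 2). p_map 2 y' \<in> coh_class G J 2 (p_map 2 y) \<and>
      i_map (Suc 2) z' = coboundary G L 2 y' \<and> coh_class G A 3 z = coh_class G A (Suc 2) z'"
    unfolding s using y z by blast
  fix c assume "\<exists>y'\<in>cochains G L 2. \<exists>z'\<in>cocycles G A (Suc 2). p_map 2 y' \<in> coh_class G J 2 (p_map 2 y) \<and>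
      i_map (Suc 2) z' = coboundary G L 2 y' \<and> c = coh_class G A (Suc 2) z'"
  then obtain y' z' where "y' \<in> cochains G L 2" "z' \<in> cochains G A 3"
      "p_map 2 y' \<in> coh_class G J 2 (p_map 2 y)"
    "i_map 3 z' = coboundary G L 2 y'" "c = coh_class G A 3 z'"
    unfolding s cocycles_def by blast
  then show "c = coh_class G A 3 z" using connecting_unique[OF y zc z(2)] by blast
qed

end

section \<open>The obstruction to lifting an invariant class along the coefficient sequence\<close>

locale exact_coefficients = profinite_group G + A: quotient_module G H A +
    L: profinite_quotient_module G H L + J: profinite_quotient_module G H J +
    E: exact_modules "tquot G H" A L J i p
  for G :: "('g, 'b) tgroup_scheme" (structure) and H and A :: "('g set, 'a) tmod"
      and L :: "('g set, 'm) tmod"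
    and J :: "('g set, 'n) tmod" and i :: "'a \<Rightarrow> 'm" and p :: "'m \<Rightarrow> 'n"
begin

abbreviation "Q \<equiv> tquot G H"
abbreviation "proj \<equiv> \<lambda>x. H #> x"
abbreviation "C\<^sub>L \<equiv> cochain_group G L.M"

text \<open>The sequence is used over both groups: over the quotient for the connecting
  homomorphism, over \<open>G\<close> for lifting the cochain that extends the invariant
  homomorphism.\<close>

lemma inflated_exact: "exact_modules G A.M L.M J.M i p"
proof (intro exact_modules.intro exact_modules_axioms.intro A.M.discrete_module_axioms
    L.M.discrete_module_axioms J.M.discrete_module_axioms)
  show "i \<in> hom A.M L.M" using E.i_hom by (auto simp: hom_def)
  show "p \<in> hom L.M J.M" using E.p_hom by (auto simp: hom_def)
qed (simp_all add: E.i_inj E.p_surj E.exact E.i_equivariant E.p_equivariant)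

sublocale I: exact_modules G A.M L.M J.M i p by (rule inflated_exact)

lemma restricted_p: "module_map (tsub G H) L.M (tsub G H) J.M (\<lambda>h. h) p"
proof (intro module_map.intro module_map_axioms.intro L.T.discrete_module_axioms J.T.discrete_module_axioms I.p_hom)
  show "(\<lambda>h. h) \<in> hom (tsub G H) (tsub G H)" by (auto simp: hom_def)
qed (use E.p_equivariant in simp_all)

lemma p_map_infl:
  assumes "u \<in> cochains Q L k"
  shows "I.p_map k (L.infl k u) = J.infl k (E.p_map k u)"
proof (rule J.M.cochain_eqI[of _ k])
  show "I.p_map k (L.infl k u) \<in> cochains G J.M k" "J.infl k (E.p_map k u) \<in> cochains G J.M k"
    using assms by (auto intro: I.pm.cochain_map_closed L.inf.cochain_map_closed J.inf.cochain_map_closed E.pm.cochain_map_closed)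
  fix x assume x: "x \<in> tuples G k"
  then show "I.p_map k (L.infl k u) x = J.infl k (E.p_map k u) x"
    using L.inf.map_in_tuples[OF x]
    by (simp add: I.p_map_apply E.p_map_apply L.inf.cochain_map_apply J.inf.cochain_map_apply)
qed

lemma i_map_infl:
  assumes "u \<in> cochains Q A k"
  shows "I.i_map k (A.infl k u) = L.infl k (E.i_map k u)"
proof (rule L.M.cochain_eqI[of _ k])
  show "I.i_map k (A.infl k u) \<in> cochains G L.M k" "L.infl k (E.i_map k u) \<in> cochains G L.M k"
    using assms by (auto intro: I.im.cochain_map_closed A.inf.cochain_map_closed L.inf.cochain_map_closed E.im.cochain_map_closed)
  fix x assume x: "x \<in> tuples G k"
  then show "I.i_map k (A.infl k u) x = L.infl k (E.i_map k u) x"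
    using A.inf.map_in_tuples[OF x]
    by (simp add: I.i_map_apply E.i_map_apply L.inf.cochain_map_apply A.inf.cochain_map_apply)
qed

lemma coh_map_p_singleton:
  assumes "f \<in> cochains (tsub G H) L.M (Suc 0)"
  shows "coh_map (tsub G H) J.M (Suc 0) (\<lambda>h. h) p {f} = {cochain_map (tsub G H) (Suc 0) (\<lambda>h. h) p f}"
  unfolding coh_map_def
  using J.coh_class_H[OF module_map.cochain_map_closed[OF restricted_p assms]] by simp

lemma cochain_map_p_tup:
  "h \<in> H \<Longrightarrow> cochain_map (tsub G H) (Suc 0) (\<lambda>h. h) p f (tup [h]) = p (f (tup [h]))"
  using module_map.cochain_map_tup[OF restricted_p, of "Suc 0" "[h]" f] by simp

text \<open>Naturality of the transgression in the coefficients: a coefficient map commutes with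
  inflation and with the coboundary.\<close>

lemma transgression_p:
  assumes tr: "L.transgression F u"
  shows "J.transgression (I.p_map (Suc 0) F) (E.p_map 2 u)"
proof -
  have F: "F \<in> cochains G L.M (Suc 0)" "F (tup [\<one>]) = \<one>\<^bsub>L\<^esub>" "u \<in> cochains Q L 2"
    "L.infl 2 u = coboundary G L.M (Suc 0) F" using tr by (simp_all add: L.transgression_def)
  have "J.infl 2 (E.p_map 2 u) = I.p_map 2 (L.infl 2 u)" by (rule p_map_infl[OF F(3), symmetric])
  also have "\<dots> = coboundary G J.M (Suc 0) (I.p_map (Suc 0) F)"
    unfolding F(4) using I.pm.cochain_map_coboundary[OF F(1)] by (simp add: numeral_2_eq_2)
  finally show ?thesis
    using F E.pm.\<beta>_one
    by (simp add: J.transgression_def I.pm.cochain_map_closed E.pm.cochain_map_closed I.p_map_apply)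
qed

text \<open>By naturality the cocycle that represents the value of the differential lifts to a
  cocycle \<open>u\<close>, not merely to a cochain; the coboundary of \<open>u\<close> is 0, so 0
  represents the connecting class.\<close>

lemma lifted_imp_connecting_trivial:
  assumes c: "c \<in> coh_invariants G H L.M (Suc 0)"
    and \<phi>: "\<phi> = coh_map (tsub G H) J.M (Suc 0) (\<lambda>h. h) p c" "\<phi> \<in> coh_invariants G H J.M (Suc 0)"
  shows "connecting Q A i L p 2 (hs_d2 G H J \<phi>) = \<one>\<^bsub>cohomology Q A 3\<^esub>"
proof -
  obtain f where f: "L.invariant_hom f" "c = {f}" using c unfolding L.coh_invariants_eq by blast
  have fc: "f \<in> cochains (tsub G H) L.M (Suc 0)" using f by (simp add: L.invariant_hom_def)
  let ?g = "cochain_map (tsub G H) (Suc 0) (\<lambda>h. h) p f"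
  have \<phi>g: "\<phi> = {?g}" using \<phi>(1) coh_map_p_singleton[OF fc] f(2) by simp
  then have g: "J.invariant_hom ?g" using \<phi>(2) unfolding J.coh_invariants_eq by auto
  obtain F u where tr: "L.transgression F u" and Ff: "\<And>h. h \<in> H \<Longrightarrow> F (tup [h]) = f (tup [h])"
  proof (rule L.invariant_hom_transgression[OF f(1)])
  qed (rule that)
  have u: "u \<in> cocycles Q L 2" by (rule L.transgression_cocycle[OF tr])
  then have uc: "u \<in> cochains Q L 2" and du: "coboundary Q L 2 u = \<one>\<^bsub>cochain_group Q L 3\<^esub>"
    by (simp_all add: cocycles_def)
  have "hs_d2 G H J {?g} = coh_class Q J 2 (E.p_map 2 u)"
  proof (rule J.hs_d2_eq[OF transgression_p[OF tr] g])
    fix h assume h: "h \<in> H"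
    then have "h \<in> carrier G" by simp
    then show "I.p_map (Suc 0) F (tup [h]) = ?g (tup [h])"
      using Ff[OF h] by (simp add: I.p_map_apply cochain_map_p_tup[OF h])
  qed
  moreover have "connecting Q A i L p 2 (coh_class Q J 2 (E.p_map 2 u))
      = coh_class Q A 3 \<one>\<^bsub>cochain_group Q A 3\<^esub>"
  proof (rule E.connecting_eq[OF uc])
    show "\<one>\<^bsub>cochain_group Q A 3\<^esub> \<in> cocycles Q A 3"
      using subgroup.one_closed[OF A.N.cocycles_subgroup] .
    show "E.i_map 3 \<one>\<^bsub>cochain_group Q A 3\<^esub> = coboundary Q L 2 u"
      unfolding du by (rule group_hom.hom_one[OF E.im.cochain_map_group_hom])
  qed
  moreover have "coh_class Q A 3 \<one>\<^bsub>cochain_group Q A 3\<^esub> = \<one>\<^bsub>cohomology Q A 3\<^esub>"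
    using A.N.coh_class_one_iff[OF A.N.cochain_one_closed] subgroup.one_closed[OF A.N.coboundaries_subgroup]
    by blast
  ultimately show ?thesis unfolding \<phi>g by simp
qed

text \<open>Surjectivity on classes made explicit for cocycles. Inflation sends coboundaries to
  coboundaries, so the image of a class may be computed on any representative.\<close>

lemma inflation_surj_cochain:
  assumes surj: "coh_map G A.M 2 proj (\<lambda>x. x) ` carrier (cohomology Q A 2) = carrier (cohomology G A.M 2)"
    and v: "v \<in> cocycles G A.M 2"
  obtains a v' where "a \<in> cochains G A.M (Suc 0)" "v' \<in> cocycles Q A 2"
    "v = coboundary G A.M (Suc 0) a \<otimes>\<^bsub>cochain_group G A.M 2\<^esub> A.infl 2 v'"
proof -
  have vc: "v \<in> cochains G A.M 2" using v by (simp add: cocycles_def)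
  have "coh_class G A.M 2 v \<in> coh_map G A.M 2 proj (\<lambda>x. x) ` carrier (cohomology Q A 2)"
    unfolding surj using v by (simp add: carrier_cohomology)
  then obtain c where "c \<in> carrier (cohomology Q A 2)"
    "coh_class G A.M 2 v = coh_map G A.M 2 proj (\<lambda>x. x) c"
    by blast
  then obtain v' where v': "v' \<in> cocycles Q A 2"
    "coh_class G A.M 2 v = coh_map G A.M 2 proj (\<lambda>x. x) (coh_class Q A 2 v')"
    by (auto simp: carrier_cohomology)
  have v'c: "v' \<in> cochains Q A 2" using v'(1) by (simp add: cocycles_def)
  have "coh_class G A.M 2 (A.infl 2 f) = coh_class G A.M 2 (A.infl 2 v')" if f: "f \<in> coh_class Q A 2 v'" for f
  proof -
    obtain b where b: "b \<in> cochains Q A (Suc 0)" "f = coboundary Q A (Suc 0) b \<otimes>\<^bsub>cochain_group Q A 2\<^esub> v'"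
      using f by (auto simp: coh_class_eq)
    have "A.infl 2 f = coboundary G A.M (Suc 0) (A.infl (Suc 0) b) \<otimes>\<^bsub>cochain_group G A.M 2\<^esub> A.infl 2 v'"
      unfolding b(2) A.inf.cochain_map_mult[OF A.N.coboundary_1_in_cochains[OF b(1)] v'c]
        A.coboundary_infl_1[OF b(1)] ..
    then show ?thesis
      using A.M.coh_class_coboundary_mult[OF A.inf.cochain_map_closed[OF b(1)] A.inf.cochain_map_closed[OF v'c]]
      by simp
  qed
  then have "(\<lambda>f. coh_class G A.M 2 (A.infl 2 f)) ` coh_class Q A 2 v' = {coh_class G A.M 2 (A.infl 2 v')}"
    using A.N.coh_class_self[OF v'c] by (intro equalityI subsetI; blast)
  then have "coh_class G A.M 2 v = coh_class G A.M 2 (A.infl 2 v')"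
    unfolding v'(2) coh_map_def by simp
  then have "v \<in> coh_class G A.M 2 (A.infl 2 v')" using A.M.coh_class_self[OF vc] by simp
  then obtain a where "a \<in> cochains G A.M (Suc 0)"
    "v = coboundary G A.M (Suc 0) a \<otimes>\<^bsub>cochain_group G A.M 2\<^esub> A.infl 2 v'"
    by (auto simp: coh_class_eq)
  then show ?thesis using that v'(1) by blast
qed

text \<open>Vanishing of the connecting class means that the coboundary of a lift \<open>y\<close>
  is the image of the coboundary of some \<open>w\<close>. Subtracting the image of \<open>w\<close>
  from \<open>y\<close> makes it closed and keeps its projection.\<close>

lemma connecting_trivial_cocycle_lift:
  assumes u: "u \<in> cocycles Q J 2"
    and triv: "connecting Q A i L p 2 (coh_class Q J 2 u) = \<one>\<^bsub>cohomology Q A 3\<^esub>"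
  obtains y where "y \<in> cocycles Q L 2" "E.p_map 2 y = u"
proof -
  interpret CL: comm_group "cochain_group Q L 2" by (rule L.N.group_cochains)
  interpret CL3: comm_group "cochain_group Q L 3" by (rule L.N.group_cochains)
  interpret CJ: comm_group "cochain_group Q J 2" by (rule J.N.group_cochains)
  interpret dL: group_hom "cochain_group Q L 2" "cochain_group Q L 3" "coboundary Q L 2"
    by (rule L.N.coboundary_2_group_hom)
  interpret P: group_hom "cochain_group Q L 2" "cochain_group Q J 2" "E.p_map 2"
    by (rule E.pm.cochain_map_group_hom)
  have uc: "u \<in> cochains Q J 2" using u by (simp add: cocycles_def)
  obtain y where y: "y \<in> cochains Q L 2" "E.p_map 2 y = u" using uc by (rule E.cochain_lift)
  obtain z where z: "z \<in> cocycles Q A 3" "E.i_map 3 z = coboundary Q L 2 y"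
    by (rule E.connecting_exists[OF y(1)]) (use y(2) u in auto)
  have "coh_class Q A 3 z = \<one>\<^bsub>cohomology Q A 3\<^esub>"
    using E.connecting_eq[OF y(1) z] triv y(2) by simp
  then have "z \<in> coboundaries Q A 3"
    using A.N.coh_class_one_iff[of z 3] z(1) by (simp add: cocycles_def)
  then obtain w where w: "w \<in> cochains Q A 2" "z = coboundary Q A 2 w" by auto
  have iw: "E.i_map 2 w \<in> cochains Q L 2" using w(1) by (rule E.im.cochain_map_closed)
  have diw: "coboundary Q L 2 (E.i_map 2 w) = coboundary Q L 2 y"
    using E.im.cochain_map_coboundary[OF w(1)] z(2) w(2) by simp
  let ?y = "y \<otimes>\<^bsub>cochain_group Q L 2\<^esub> inv\<^bsub>cochain_group Q L 2\<^esub> E.i_map 2 w"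
  have iiw: "inv\<^bsub>cochain_group Q L 2\<^esub> E.i_map 2 w \<in> cochains Q L 2" using CL.inv_closed[of
      "E.i_map 2 w"] iw by simp
  have "?y \<in> cochains Q L 2" using y(1) iiw by (rule L.N.cochain_mult_closed)
  moreover have "coboundary Q L 2 ?y = \<one>\<^bsub>cochain_group Q L 3\<^esub>"
    using dL.hom_mult[of y "inv\<^bsub>cochain_group Q L 2\<^esub> E.i_map 2 w"] dL.hom_inv[of "E.i_map 2 w"] y(1) iw iiw diw
      CL3.r_inv[of "coboundary Q L 2 y"] L.N.coboundary_2_in_cochains[OF y(1)] by simp
  ultimately have "?y \<in> cocycles Q L 2" by (simp add: cocycles_def)
  moreover have "E.p_map 2 ?y = u"
    using P.hom_mult[of y "inv\<^bsub>cochain_group Q L 2\<^esub> E.i_map 2 w"] P.hom_inv[of "E.i_map 2 w"] y iw iiw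
      E.p_i_map[OF w(1)] CJ.r_one[of u] uc by simp
  ultimately show ?thesis using that by blast
qed

text \<open>The lift \<open>F0\<close> is corrected twice: by \<open>a\<close>, which makes its
  coboundary inflated, and by a constant, which makes its value at 1 vanish. Neither correction is
  seen by \<open>p\<close>: the first lies in the image of \<open>i\<close>, and the second projects
  to the value at 1 of a cochain that vanishes there.\<close>

lemma connecting_trivial_imp_lifted:
  assumes surj: "coh_map G A.M 2 proj (\<lambda>x. x) ` carrier (cohomology Q A 2) = carrier (cohomology G A.M 2)"
    and \<phi>: "\<phi> \<in> coh_invariants G H J.M (Suc 0)"
    and triv: "connecting Q A i L p 2 (hs_d2 G H J \<phi>) = \<one>\<^bsub>cohomology Q A 3\<^esub>"
  shows "\<phi> \<in> coh_map (tsub G H) J.M (Suc 0) (\<lambda>h. h) p ` coh_invariants G H L.M (Suc 0)"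
proof -
  obtain f where f: "J.invariant_hom f" "\<phi> = {f}" using \<phi> unfolding J.coh_invariants_eq by blast
  obtain F u where tr: "J.transgression F u" and Ff: "\<And>h. h \<in> H \<Longrightarrow> F (tup [h]) = f (tup [h])"
  proof (rule J.invariant_hom_transgression[OF f(1)])
  qed (rule that)
  have F: "F \<in> cochains G J.M (Suc 0)" "F (tup [\<one>]) = \<one>\<^bsub>J\<^esub>" "u \<in> cochains Q J 2"
    "J.infl 2 u = coboundary G J.M (Suc 0) F" using tr by (simp_all add: J.transgression_def)
  have d2: "hs_d2 G H J \<phi> = coh_class Q J 2 u" unfolding f(2) by (rule J.hs_d2_eq[OF tr f(1) Ff])
  obtain y where y: "y \<in> cocycles Q L 2" "E.p_map 2 y = u"
    by (rule connecting_trivial_cocycle_lift[OF J.transgression_cocycle[OF tr] triv[unfolded d2]])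
  have yc: "y \<in> cochains Q L 2" using y(1) by (simp add: cocycles_def)
  obtain F0 where F0: "F0 \<in> cochains G L.M (Suc 0)" "I.p_map (Suc 0) F0 = F" using F(1)
    by (rule I.cochain_lift)
  interpret C1: comm_group "C\<^sub>L (Suc 0)" by (rule L.M.group_cochains)
  interpret C2: comm_group "C\<^sub>L 2" by (rule L.M.group_cochains)
  interpret CJ1: comm_group "cochain_group G J.M (Suc 0)" by (rule J.M.group_cochains)
  interpret CJ2: comm_group "cochain_group G J.M 2" by (rule J.M.group_cochains)
  interpret dL: group_hom "C\<^sub>L (Suc 0)" "C\<^sub>L 2" "coboundary G L.M (Suc 0)"
    by (rule L.M.coboundary_1_group_hom)
  interpret P2: group_hom "C\<^sub>L 2" "cochain_group G J.M 2" "I.p_map 2"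
    by (rule I.pm.cochain_map_group_hom)
  interpret P1: group_hom "C\<^sub>L (Suc 0)" "cochain_group G J.M (Suc 0)" "I.p_map (Suc 0)"
    by (rule I.pm.cochain_map_group_hom)
  let ?Y = "L.infl 2 y" and ?dF0 = "coboundary G L.M (Suc 0) F0"
  have Y: "?Y \<in> cocycles G L.M 2"
  proof -
    have "coboundary G L.M 2 ?Y = L.infl 3 (coboundary Q L 2 y)"
      using L.inf.cochain_map_coboundary[OF yc] by simp
    also have "\<dots> = \<one>\<^bsub>C\<^sub>L 3\<^esub>"
      using y(1) group_hom.hom_one[OF L.inf.cochain_map_group_hom, of 3] by (simp add: cocycles_def)
    finally show ?thesis using L.inf.cochain_map_closed[OF yc] by (simp add: cocycles_def)
  qed
  have Yc: "?Y \<in> cochains G L.M 2" using Y by (simp add: cocycles_def)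
  have dF0: "?dF0 \<in> cochains G L.M 2" using F0(1) by (rule L.M.coboundary_1_in_cochains)
  let ?D = "?dF0 \<otimes>\<^bsub>C\<^sub>L 2\<^esub> inv\<^bsub>C\<^sub>L 2\<^esub> ?Y"
  have iY: "inv\<^bsub>C\<^sub>L 2\<^esub> ?Y \<in> cochains G L.M 2" using C2.inv_closed[of ?Y] Yc by simp
  have D_coc: "?D \<in> cocycles G L.M 2"
    using subgroup.m_closed[OF L.M.cocycles_subgroup L.M.coboundary_1_cocycle[OF F0(1)]
        subgroup.m_inv_closed[OF L.M.cocycles_subgroup Y]] .
  then have Dc: "?D \<in> cochains G L.M 2" and dD: "coboundary G L.M 2 ?D = \<one>\<^bsub>C\<^sub>L 3\<^esub>"
    by (simp_all add: cocycles_def)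
  have pdF0: "I.p_map 2 ?dF0 = J.infl 2 u"
    using I.pm.cochain_map_coboundary[OF F0(1)] F0(2) F(4) by (simp add: numeral_2_eq_2)
  have pY: "I.p_map 2 ?Y = J.infl 2 u" using p_map_infl[OF yc] y(2) by simp
  \<comment> \<open>Both terms of \<open>?D\<close> project to the inflation of
    \<open>u\<close>.\<close>
  have "I.p_map 2 ?D = \<one>\<^bsub>cochain_group G J.M 2\<^esub>"
    using P2.hom_mult[of ?dF0 "inv\<^bsub>C\<^sub>L 2\<^esub> ?Y"] P2.hom_inv[of ?Y] dF0 Yc iY pdF0 pY
      CJ2.r_inv[of "J.infl 2 u"] J.inf.cochain_map_closed[OF F(3)] by simp
  then obtain v where v: "v \<in> cochains G A.M 2" "I.i_map 2 v = ?D" by (rule I.cochain_exact[OF Dc])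
  have "v \<in> cocycles G A.M 2"
  proof -
    have "I.i_map 3 (coboundary G A.M 2 v) = coboundary G L.M 2 ?D"
      using I.im.cochain_map_coboundary[OF v(1)] v(2) by simp
    also have "\<dots> = I.i_map 3 \<one>\<^bsub>cochain_group G A.M 3\<^esub>"
      unfolding dD by (rule group_hom.hom_one[OF I.im.cochain_map_group_hom, symmetric])
    finally have "coboundary G A.M 2 v = \<one>\<^bsub>cochain_group G A.M 3\<^esub>"
      by (rule I.i_map_inj[OF A.M.coboundary_2_in_cochains[OF v(1)] A.M.cochain_one_closed])
    then show ?thesis using v(1) by (simp add: cocycles_def)
  qed
  then obtain a v' where a: "a \<in> cochains G A.M (Suc 0)" and v': "v' \<in> cocycles Q A 2"
    and va: "v = coboundary G A.M (Suc 0) a \<otimes>\<^bsub>cochain_group G A.M 2\<^esub> A.infl 2 v'"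
    by (rule inflation_surj_cochain[OF surj])
  have v'c: "v' \<in> cochains Q A 2" using v' by (simp add: cocycles_def)
  have da: "coboundary G A.M (Suc 0) a \<in> cochains G A.M 2" using a by (rule A.M.coboundary_1_in_cochains)
  let ?ia = "I.i_map (Suc 0) a" and ?iv = "E.i_map 2 v'"
  have ia: "?ia \<in> cochains G L.M (Suc 0)" using a by (rule I.im.cochain_map_closed)
  have iia: "inv\<^bsub>C\<^sub>L (Suc 0)\<^esub> ?ia \<in> cochains G L.M (Suc 0)" using C1.inv_closed[of ?ia] ia by simp
  have iv: "?iv \<in> cochains Q L 2" using v'c by (rule E.im.cochain_map_closed)
  have iv_coc: "?iv \<in> cocycles Q L 2"
  proof -
    have "coboundary Q L 2 ?iv = E.i_map 3 (coboundary Q A 2 v')"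
      using E.im.cochain_map_coboundary[OF v'c] by simp
    also have "\<dots> = \<one>\<^bsub>cochain_group Q L 3\<^esub>"
      using v' group_hom.hom_one[OF E.im.cochain_map_group_hom, of 3] by (simp add: cocycles_def)
    finally show ?thesis using iv by (simp add: cocycles_def)
  qed
  let ?F1 = "F0 \<otimes>\<^bsub>C\<^sub>L (Suc 0)\<^esub> inv\<^bsub>C\<^sub>L (Suc 0)\<^esub> ?ia"
  let ?c = "y \<otimes>\<^bsub>cochain_group Q L 2\<^esub> ?iv"
  have F1: "?F1 \<in> cochains G L.M (Suc 0)" using F0(1) iia by (rule L.M.cochain_mult_closed)
  have c: "?c \<in> cocycles Q L 2" using subgroup.m_closed[OF L.N.cocycles_subgroup y(1) iv_coc] .
  then have cc: "?c \<in> cochains Q L 2" by (simp add: cocycles_def)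
  let ?dia = "coboundary G L.M (Suc 0) ?ia" and ?V = "L.infl 2 ?iv"
  have dia: "?dia \<in> cochains G L.M 2" using ia by (rule L.M.coboundary_1_in_cochains)
  have V: "?V \<in> cochains G L.M 2" using iv by (rule L.inf.cochain_map_closed)
  have D_eq: "?D = ?dia \<otimes>\<^bsub>C\<^sub>L 2\<^esub> ?V"
  proof -
    have "?D = I.i_map 2 (coboundary G A.M (Suc 0) a) \<otimes>\<^bsub>C\<^sub>L 2\<^esub> I.i_map 2 (A.infl 2 v')"
      unfolding v(2)[symmetric] va by (rule I.im.cochain_map_mult[OF da A.inf.cochain_map_closed[OF v'c]])
    also have "I.i_map 2 (coboundary G A.M (Suc 0) a) = ?dia"
      using I.im.cochain_map_coboundary[OF a] by (simp add: numeral_2_eq_2)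
    also have "I.i_map 2 (A.infl 2 v') = ?V" by (rule i_map_infl[OF v'c])
    finally show ?thesis .
  qed
  \<comment> \<open>The coboundary of \<open>F0\<close> is the inflation of \<open>y\<close> plus
    \<open>?D\<close>, and \<open>?D\<close> consists of the coboundary of the image of
    \<open>a\<close> and an inflated term. Subtracting the image of \<open>a\<close> removes exactly
    the part that is not visibly inflated.\<close>
  have dF1: "coboundary G L.M (Suc 0) ?F1 = L.infl 2 ?c"
  proof -
    have "coboundary G L.M (Suc 0) ?F1 = ?dF0 \<otimes>\<^bsub>C\<^sub>L 2\<^esub> inv\<^bsub>C\<^sub>L 2\<^esub> ?dia"
      using dL.hom_mult[of F0 "inv\<^bsub>C\<^sub>L (Suc 0)\<^esub> ?ia"] dL.hom_inv[of ?ia] F0(1) ia iia by simp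
    also have "?dF0 = ?D \<otimes>\<^bsub>C\<^sub>L 2\<^esub> ?Y"
      by (rule C2.mult_inv_mult_cancel[symmetric]) (use dF0 Yc in simp_all)
    also have "\<dots> = (?dia \<otimes>\<^bsub>C\<^sub>L 2\<^esub> ?V) \<otimes>\<^bsub>C\<^sub>L 2\<^esub> ?Y"
      by (simp only: D_eq)
    also have "\<dots> \<otimes>\<^bsub>C\<^sub>L 2\<^esub> inv\<^bsub>C\<^sub>L 2\<^esub> ?dia = ?Y \<otimes>\<^bsub>C\<^sub>L 2\<^esub> ?V"
      by (rule C2.mult_mult_mult_inv_cancel) (use dia V Yc in simp_all)
    also have "\<dots> = L.infl 2 ?c" by (rule L.inf.cochain_map_mult[OF yc iv, symmetric])
    finally show ?thesis .
  qed
  have pF1: "I.p_map (Suc 0) ?F1 = F"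
    using P1.hom_mult[of F0 "inv\<^bsub>C\<^sub>L (Suc 0)\<^esub> ?ia"] P1.hom_inv[of ?ia] F0 ia iia
      I.p_i_map[OF a] CJ1.r_one[of F] F(1) by simp
  obtain k where k: "k \<in> cochains Q L (Suc 0)"
    and kn: "normalized Q L 2 (coboundary Q L (Suc 0) k \<otimes>\<^bsub>cochain_group Q L 2\<^esub> ?c)"
    and kv: "\<And>q. q \<in> carrier Q \<Longrightarrow> k (tup [q]) = inv\<^bsub>L\<^esub> ?c (tup [\<one>\<^bsub>Q\<^esub>, \<one>\<^bsub>Q\<^esub>])"
    using L.N.cocycle_2_normalize[OF c] by blast
  let ?F2 = "L.infl (Suc 0) k \<otimes>\<^bsub>C\<^sub>L (Suc 0)\<^esub> ?F1"
  let ?c2 = "coboundary Q L (Suc 0) k \<otimes>\<^bsub>cochain_group Q L 2\<^esub> ?c"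
  have ik: "L.infl (Suc 0) k \<in> cochains G L.M (Suc 0)" using k by (rule L.inf.cochain_map_closed)
  have dk: "coboundary Q L (Suc 0) k \<in> cochains Q L 2" using k by (rule L.N.coboundary_1_in_cochains)
  have F1_closed: "?F1 (tup [g]) \<in> carrier L" if "g \<in> carrier G" for g
    using L.M.cochain_1_closed[OF F1 that] by simp
  \<comment> \<open>The coboundary of a 1-cochain at (1, 1) is its value at 1. Hence the constant
    that normalizes \<open>?c\<close> is the negative of the value of \<open>?F1\<close> at
    1.\<close>
  have c11: "?c (tup [H, H]) = ?F1 (tup [\<one>])"
  proof -
    have "?c (tup [H, H]) = L.infl 2 ?c (tup [\<one>, \<one>])"
      using L.infl_2_tup[of \<one> \<one> ?c] by (simp only: one_closed A.proj_one)
    also have "\<dots> = coboundary G L.M (Suc 0) ?F1 (tup [\<one>, \<one>])" by (simp only: dF1)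
    also have "\<dots> = ?F1 (tup [\<one>])"
    proof -
      have *: "act L H x \<otimes>\<^bsub>L\<^esub> inv\<^bsub>L\<^esub> x \<otimes>\<^bsub>L\<^esub> x = x" if "x \<in> carrier L" for x
        using that L.N.act_one by simp
      show ?thesis
        using L.M.coboundary_1[OF F1 one_closed one_closed] *[OF F1_closed[OF one_closed]]
        by (simp only: L.inflated_simps l_one one_closed A.proj_one)
    qed
    finally show ?thesis .
  qed
  have kF1: "k (tup [proj g]) = inv\<^bsub>L\<^esub> ?F1 (tup [\<one>])" if "g \<in> carrier G" for g
    using kv[of "proj g"] A.proj_in_Q[OF that] by (simp only: one_tquot c11)
  have "L.transgression ?F2 ?c2"
    unfolding L.transgression_def
  proof (intro conjI)
    show "?F2 \<in> cochains G L.M (Suc 0)" using ik F1 by (rule L.M.cochain_mult_closed)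
    show "?c2 \<in> cochains Q L 2" using dk cc by (rule L.N.cochain_mult_closed)
    have "?F2 (tup [\<one>]) = L.infl (Suc 0) k (tup [\<one>]) \<otimes>\<^bsub>L\<^esub> ?F1 (tup [\<one>])"
      using cochain_mult_apply[of "tup [\<one>]" G "Suc 0" L.M "L.infl (Suc 0) k" ?F1]
      by (simp only: L.inflated_simps) simp
    also have "\<dots> = inv\<^bsub>L\<^esub> ?F1 (tup [\<one>]) \<otimes>\<^bsub>L\<^esub> ?F1 (tup [\<one>])"
      by (simp only: L.infl_1_tup[OF one_closed] kF1[OF one_closed])
    also have "\<dots> = \<one>\<^bsub>L\<^esub>" by (rule L.N.M.l_inv[OF F1_closed[OF one_closed]])
    finally show "?F2 (tup [\<one>]) = \<one>\<^bsub>L\<^esub>" .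
    have "L.infl 2 ?c2 = L.infl 2 (coboundary Q L (Suc 0) k) \<otimes>\<^bsub>C\<^sub>L 2\<^esub> L.infl 2 ?c"
      by (rule L.inf.cochain_map_mult[OF dk cc])
    also have "\<dots> = coboundary G L.M (Suc 0) (L.infl (Suc 0) k) \<otimes>\<^bsub>C\<^sub>L 2\<^esub> coboundary G L.M (Suc 0) ?F1"
      by (simp only: L.coboundary_infl_1[OF k] dF1)
    also have "\<dots> = coboundary G L.M (Suc 0) ?F2"
      by (rule dL.hom_mult[symmetric]) (simp_all only: carrier_cochain_group ik F1)
    finally show "L.infl 2 ?c2 = coboundary G L.M (Suc 0) ?F2" .
  qed
  then have inv: "L.invariant_hom (L.res_H ?F2)" by (rule L.transgression_invariant_hom)
  have F2: "?F2 \<in> cochains G L.M (Suc 0)" using ik F1 by (rule L.M.cochain_mult_closed)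
  have pF1_tup: "p (?F1 (tup [g])) = F (tup [g])" if "g \<in> carrier G" for g
    using I.p_map_apply[of "tup [g]" "Suc 0" ?F1] that by (simp only: pF1) simp
  have rc: "L.res_H ?F2 \<in> cochains (tsub G H) L.M (Suc 0)" using F2 by (rule L.res_H_closed)
  have fc: "f \<in> cochains (tsub G H) J.M (Suc 0)" using f(1) by (simp add: J.invariant_hom_def)
  have "cochain_map (tsub G H) (Suc 0) (\<lambda>h. h) p (L.res_H ?F2) = f"
  proof (rule J.T.cochain_1_eqI[OF module_map.cochain_map_closed[OF restricted_p rc] fc])
    fix h assume "h \<in> carrier (tsub G H)"
    then have h: "h \<in> H" "h \<in> carrier G" by simp_all
    have "cochain_map (tsub G H) (Suc 0) (\<lambda>h. h) p (L.res_H ?F2) (tup [h]) = p (?F2 (tup [h]))"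
      by (simp only: cochain_map_p_tup[OF h(1)] L.res_H_tup[OF h(1)])
    also have "?F2 (tup [h]) = inv\<^bsub>L\<^esub> ?F1 (tup [\<one>]) \<otimes>\<^bsub>L\<^esub> ?F1 (tup [h])"
      using cochain_mult_apply[of "tup [h]" G "Suc 0" L.M "L.infl (Suc 0) k" ?F1] h(2)
      by (simp only: L.inflated_simps L.infl_1_tup[OF h(2)] kF1[OF h(2)]) simp
    also have "p (inv\<^bsub>L\<^esub> ?F1 (tup [\<one>]) \<otimes>\<^bsub>L\<^esub> ?F1 (tup [h])) = inv\<^bsub>J\<^esub> F (tup [\<one>]) \<otimes>\<^bsub>J\<^esub> F (tup [h])"
      using E.pm.\<beta>_mult[OF L.N.M.inv_closed[OF F1_closed[OF one_closed]] F1_closed[OF h(2)]]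
        E.pm.\<beta>_inv[OF F1_closed[OF one_closed]]
      by (simp only: pF1_tup[OF one_closed] pF1_tup[OF h(2)])
    \<comment> \<open>The constant correction disappears after projection because \<open>F\<close>
      vanishes at 1.\<close>
    also have "\<dots> = f (tup [h])"
      using F(2) Ff[OF h(1)] J.transgression_closed[OF tr h(2)] by simp
    finally show "cochain_map (tsub G H) (Suc 0) (\<lambda>h. h) p (L.res_H ?F2) (tup [h]) = f (tup [h])" .
  qed
  then have "coh_map (tsub G H) J.M (Suc 0) (\<lambda>h. h) p {L.res_H ?F2} = \<phi>"
    unfolding coh_map_p_singleton[OF rc] f(2) by simp
  moreover have "{L.res_H ?F2} \<in> coh_invariants G H L.M (Suc 0)" using inv unfolding L.coh_invariants_eq
    by blast
  ultimately show ?thesis by blast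
qed

end

section \<open>The completed group ring\<close>

lemma (in abelian_monoid) finsum_swap:
  assumes "finite A" "finite B" "\<And>a b. a \<in> A \<Longrightarrow> b \<in> B \<Longrightarrow> f a b \<in> carrier G"
  shows "(\<Oplus>a\<in>A. \<Oplus>b\<in>B. f a b) = (\<Oplus>b\<in>B. \<Oplus>a\<in>A. f a b)"
  using assms(1,3)
proof (induction A)
  case (insert a A)
  have "(\<Oplus>x\<in>insert a A. \<Oplus>b\<in>B. f x b) = (\<Oplus>b\<in>B. f a b) \<oplus> (\<Oplus>b\<in>B. \<Oplus>x\<in>A. f x b)"
    using insert by (subst finsum_insert) (auto intro!: finsum_closed)
  also have "\<dots> = (\<Oplus>b\<in>B. f a b \<oplus> (\<Oplus>x\<in>A. f x b))"
    using insert assms(2) by (subst finsum_addf) (auto intro!: finsum_closed)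
  also have "\<dots> = (\<Oplus>b\<in>B. \<Oplus>x\<in>insert a A. f x b)"
    using insert assms(2) by (intro add.finprod_cong') (auto intro!: finsum_closed simp: Pi_def)
  finally show ?case .
qed simp

text \<open>This is multiplicativity of the map of group rings induced by \<open>\<tau>\<close>,
  whose coefficients are sums over fibres. The two sums are exchanged, the fibre over
  \<open>c\<close> is translated by the inverse of \<open>x\<close>, and the elements
  \<open>x\<close> are grouped by their images.\<close>

lemma (in cring) convolution_pushforward:
  assumes Q: "group Q" and K: "group K" and \<tau>: "\<tau> \<in> hom Q K"
    and fin: "finite (carrier Q)" "finite (carrier K)"
    and a: "a \<in> carrier Q \<rightarrow> carrier R" and b: "b \<in> carrier Q \<rightarrow> carrier R" and c: "c \<in> carrier K"
  shows "(\<Oplus>d\<in>{d \<in> carrier Q. \<tau> d = c}. \<Oplus>x\<in>carrier Q. a x \<otimes> b (inv\<^bsub>Q\<^esub> x \<otimes>\<^bsub>Q\<^esub> d))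
    = (\<Oplus>y\<in>carrier K. (\<Oplus>x\<in>{x \<in> carrier Q. \<tau> x = y}. a x) \<otimes>
        (\<Oplus>d\<in>{d \<in> carrier Q. \<tau> d = inv\<^bsub>K\<^esub> y \<otimes>\<^bsub>K\<^esub> c}. b d))"
proof -
  interpret Q: group Q by fact
  interpret K: group K by fact
  interpret \<tau>: group_hom Q K \<tau> using \<tau> by unfold_locales
  let ?fib = "\<lambda>y. {x \<in> carrier Q. \<tau> x = y}"
  define B where "B = (\<lambda>y. \<Oplus>d\<in>?fib (inv\<^bsub>K\<^esub> y \<otimes>\<^bsub>K\<^esub> c). b d)"
  have B_closed [simp]: "B y \<in> carrier R" for y using b by (auto simp: B_def intro!: finsum_closed)
  have a_closed [simp]: "a x \<in> carrier R" if "x \<in> carrier Q" for x using a that by blast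
  have b_closed [simp]: "b x \<in> carrier R" if "x \<in> carrier Q" for x using b that by blast
  \<comment> \<open>Left translation by the inverse of \<open>x\<close> is a bijection from the
    fibre over \<open>c\<close> to the fibre over the translated point, so the inner sum depends
    only on the image of \<open>x\<close>.\<close>
  have shift: "(\<Oplus>d\<in>?fib c. b (inv\<^bsub>Q\<^esub> x \<otimes>\<^bsub>Q\<^esub> d)) = B (\<tau> x)" if x: "x \<in> carrier Q" for x
  proof -
    have inj: "inj_on (\<lambda>d. inv\<^bsub>Q\<^esub> x \<otimes>\<^bsub>Q\<^esub> d) (?fib c)" using x by (auto simp: inj_on_def)
    have im: "(\<lambda>d. inv\<^bsub>Q\<^esub> x \<otimes>\<^bsub>Q\<^esub> d) ` ?fib c = ?fib (inv\<^bsub>K\<^esub> \<tau> x \<otimes>\<^bsub>K\<^esub> c)"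
    proof (intro equalityI subsetI)
      fix d assume "d \<in> (\<lambda>d. inv\<^bsub>Q\<^esub> x \<otimes>\<^bsub>Q\<^esub> d) ` ?fib c"
      then show "d \<in> ?fib (inv\<^bsub>K\<^esub> \<tau> x \<otimes>\<^bsub>K\<^esub> c)" using x by auto
    next
      fix d assume d: "d \<in> ?fib (inv\<^bsub>K\<^esub> \<tau> x \<otimes>\<^bsub>K\<^esub> c)"
      then have "x \<otimes>\<^bsub>Q\<^esub> d \<in> ?fib c" using x c by (simp add: K.m_assoc[symmetric])
      moreover have "d = inv\<^bsub>Q\<^esub> x \<otimes>\<^bsub>Q\<^esub> (x \<otimes>\<^bsub>Q\<^esub> d)" using x d by (simp add: Q.m_assoc[symmetric])
      ultimately show "d \<in> (\<lambda>d. inv\<^bsub>Q\<^esub> x \<otimes>\<^bsub>Q\<^esub> d) ` ?fib c" by blast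
    qed
    have "(\<Oplus>d\<in>(\<lambda>d. inv\<^bsub>Q\<^esub> x \<otimes>\<^bsub>Q\<^esub> d) ` ?fib c. b d) = (\<Oplus>d\<in>?fib c. b (inv\<^bsub>Q\<^esub> x \<otimes>\<^bsub>Q\<^esub> d))"
      using x inj by (intro finsum_reindex) auto
    then show ?thesis unfolding im B_def by simp
  qed
  have "(\<Oplus>d\<in>?fib c. \<Oplus>x\<in>carrier Q. a x \<otimes> b (inv\<^bsub>Q\<^esub> x \<otimes>\<^bsub>Q\<^esub> d))
      = (\<Oplus>x\<in>carrier Q. \<Oplus>d\<in>?fib c. a x \<otimes> b (inv\<^bsub>Q\<^esub> x \<otimes>\<^bsub>Q\<^esub> d))"
    using fin by (intro finsum_swap) auto
  also have "\<dots> = (\<Oplus>x\<in>carrier Q. a x \<otimes> B (\<tau> x))"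
  proof (intro add.finprod_cong' refl)
    fix x assume x: "x \<in> carrier Q"
    have "(\<Oplus>d\<in>?fib c. a x \<otimes> b (inv\<^bsub>Q\<^esub> x \<otimes>\<^bsub>Q\<^esub> d)) = a x \<otimes> (\<Oplus>d\<in>?fib c. b (inv\<^bsub>Q\<^esub> x \<otimes>\<^bsub>Q\<^esub> d))"
      using x fin by (intro finsum_rdistr[symmetric]) auto
    then show "(\<Oplus>d\<in>?fib c. a x \<otimes> b (inv\<^bsub>Q\<^esub> x \<otimes>\<^bsub>Q\<^esub> d)) = a x \<otimes> B (\<tau> x)" using shift[OF x] by simp
  qed auto
  also have "\<dots> = (\<Oplus>x\<in>(\<Union>y\<in>carrier K. ?fib y). a x \<otimes> B (\<tau> x))"
  proof -
    have "(\<Union>y\<in>carrier K. ?fib y) = carrier Q" by auto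
    then show ?thesis by (simp only:)
  qed
  also have "(\<Oplus>x\<in>(\<Union>y\<in>carrier K. ?fib y). a x \<otimes> B (\<tau> x)) = (\<Oplus>y\<in>carrier K. \<Oplus>x\<in>?fib y. a x \<otimes> B (\<tau> x))"
    using fin by (intro add.finprod_UN_disjoint) (auto simp: pairwise_def disjnt_def)
  also have "\<dots> = (\<Oplus>y\<in>carrier K. (\<Oplus>x\<in>?fib y. a x) \<otimes> B y)"
  proof (intro add.finprod_cong' refl)
    fix y assume "y \<in> carrier K"
    have "(\<Oplus>x\<in>?fib y. a x \<otimes> B (\<tau> x)) = (\<Oplus>x\<in>?fib y. a x \<otimes> B y)"
      by (intro add.finprod_cong') auto
    also have "\<dots> = (\<Oplus>x\<in>?fib y. a x) \<otimes> B y"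
      using fin by (intro finsum_ldistr[symmetric]) auto
    finally show "(\<Oplus>x\<in>?fib y. a x \<otimes> B (\<tau> x)) = (\<Oplus>x\<in>?fib y. a x) \<otimes> B y" .
  qed (auto intro!: finsum_closed)
  finally show ?thesis by (simp add: B_def)
qed

lemma group_ring_simps [simp]:
  "carrier (group_ring R Q) = carrier Q \<rightarrow>\<^sub>E carrier R"
  "monoid.mult (group_ring R Q) a b
    = (\<lambda>c\<in>carrier Q. (\<Oplus>\<^bsub>R\<^esub>x\<in>carrier Q. a x \<otimes>\<^bsub>R\<^esub> b (inv\<^bsub>Q\<^esub> x \<otimes>\<^bsub>Q\<^esub> c)))"
  "ring.add (group_ring R Q) a b = (\<lambda>c\<in>carrier Q. a c \<oplus>\<^bsub>R\<^esub> b c)"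
  "ring.zero (group_ring R Q) = (\<lambda>c\<in>carrier Q. \<zero>\<^bsub>R\<^esub>)"
  by (simp_all add: group_ring_def)

text \<open>Finiteness of the quotients makes every sum over cosets a genuine finite sum; compact
  groups provide it by \<open>open_normal_finite_index\<close>.\<close>

locale finite_quotients = topological_group G + R: cring R
  for G :: "('g, 'c) tgroup_scheme" (structure) and R :: "('r, 'd) ring_scheme" +
  assumes finite_index: "U \<in> open_normal G \<Longrightarrow> finite (rcosets U)"
begin

abbreviation \<Lambda> where "\<Lambda> \<equiv> completed_group_ring R G"
abbreviation ON where "ON \<equiv> open_normal G"

lemma ON_quotient: "U \<in> ON \<Longrightarrow> topological_quotient G U"
  by (simp add: open_normal_def topological_quotient_def topological_group_axioms)

lemma carrier_Mod: "carrier (G Mod U) = rcosets U"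
  by (simp add: FactGroup_def)

lemma group_Mod: "U \<in> ON \<Longrightarrow> group (G Mod U)"
  by (simp add: open_normal_def normal.factorgroup_is_group)

lemma Mod_mult: "U \<in> ON \<Longrightarrow> x \<in> carrier G \<Longrightarrow> y \<in> carrier G \<Longrightarrow>
    (U #> x) <#> (U #> y) = U #> (x \<otimes> y)"
  by (simp add: open_normal_def normal.rcos_sum)

lemma Mod_inv: "U \<in> ON \<Longrightarrow> x \<in> carrier G \<Longrightarrow> inv\<^bsub>G Mod U\<^esub> (U #> x) = U #> inv x"
proof -
  assume U: "U \<in> ON" and x: "x \<in> carrier G"
  interpret F: group "G Mod U" using U by (rule group_Mod)
  interpret UQ: topological_quotient G U using U by (rule ON_quotient)
  show ?thesis
    using U x by (intro F.inv_equality) (auto simp: carrier_Mod Mod_mult UQ.proj_one RCOSETS_def)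
qed

lemma rcosets_cases:
  assumes "c \<in> rcosets U"
  obtains x where "x \<in> carrier G" "c = U #> x"
  using assms by (auto simp: RCOSETS_def)

lemma r_coset_in_rcosets [simp]: "x \<in> carrier G \<Longrightarrow> U #> x \<in> rcosets U"
  by (auto simp: RCOSETS_def)

text \<open>The cosets of \<open>V\<close> inside a coset \<open>c\<close> of \<open>U\<close> form
  the fibre over \<open>c\<close> of the projection between the two quotients. This links the
  compatibility condition of the inverse limit with \<open>convolution_pushforward\<close>.\<close>

lemma transition:
  assumes U: "U \<in> ON" and V: "V \<in> ON" and VU: "V \<subseteq> U"
  obtains \<tau> where "\<tau> \<in> hom (G Mod V) (G Mod U)" "\<And>x. x \<in> carrier G \<Longrightarrow> \<tau> (V #> x) = U #> x"
    "\<And>c. c \<in> rcosets U \<Longrightarrow> {d \<in> rcosets V. d \<subseteq> c} = {d \<in> rcosets V. \<tau> d = c}"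
proof -
  interpret UQ: topological_quotient G U using U by (rule ON_quotient)
  interpret VQ: topological_quotient G V using V by (rule ON_quotient)
  define \<tau> where "\<tau> = (\<lambda>d. U <#> d)"
  have \<tau>: "\<tau> (V #> x) = U #> x" if x: "x \<in> carrier G" for x
  proof -
    have "U <#> (V #> x) = (U <#> V) #> x"
      by (rule setmult_rcos_assoc[OF UQ.subset VQ.subset x])
    also have "U <#> V = U"
    proof (intro equalityI subsetI)
      fix y assume "y \<in> U <#> V"
      then show "y \<in> U" using VU by (auto simp: set_mult_def)
    next
      fix y assume "y \<in> U"
      then have "y \<otimes> \<one> \<in> U <#> V" unfolding set_mult_def using VQ.one_closed by blast
      then show "y \<in> U <#> V" using \<open>y \<in> U\<close> by simp
    qed
    finally show ?thesis by (simp add: \<tau>_def)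
  qed
  have "\<tau> \<in> hom (G Mod V) (G Mod U)"
    by (rule homI) (auto simp: carrier_Mod \<tau> Mod_mult[OF V] Mod_mult[OF U] elim!: rcosets_cases)
  moreover have "{d \<in> rcosets V. d \<subseteq> c} = {d \<in> rcosets V. \<tau> d = c}" if c: "c \<in> rcosets U" for c
  proof -
    obtain y where y: "y \<in> carrier G" "c = U #> y" using c by (rule rcosets_cases)
    have "V #> x \<subseteq> c \<longleftrightarrow> U #> x = c" if x: "x \<in> carrier G" for x
    proof
      assume "V #> x \<subseteq> c"
      then have "x \<in> U #> y" using rcos_self[OF x VQ.is_subgroup] y by blast
      then show "U #> x = c" using repr_independence[OF _ y(1) UQ.is_subgroup] y by simp
    next
      assume "U #> x = c"
      then show "V #> x \<subseteq> c" using VU by (auto simp: r_coset_def)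
    qed
    then show ?thesis using \<tau> by (auto elim!: rcosets_cases)
  qed
  ultimately show ?thesis using that \<tau> by blast
qed

section \<open>The completed group ring: addition, product and group elements\<close>

definition compatible :: "('g, 'r) cgr \<Rightarrow> bool" where
  "compatible x \<longleftrightarrow> (\<forall>U\<in>ON. \<forall>V\<in>ON. V \<subseteq> U \<longrightarrow>
     (\<forall>c\<in>rcosets U. x U c = (\<Oplus>\<^bsub>R\<^esub>d\<in>{d \<in> rcosets V. d \<subseteq> c}. x V d)))"

lemma carrier_\<Lambda>: "x \<in> carrier \<Lambda> \<longleftrightarrow>
    x \<in> (\<Pi>\<^sub>E U\<in>ON. rcosets U \<rightarrow>\<^sub>E carrier R) \<and> compatible x"
  by (simp add: completed_group_ring_def compatible_def carrier_Mod)

lemma \<Lambda>_compatible: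
  assumes "x \<in> carrier \<Lambda>" "U \<in> ON" "V \<in> ON" "V \<subseteq> U" "c \<in> rcosets U"
  shows "(\<Oplus>\<^bsub>R\<^esub>d\<in>{d \<in> rcosets V. d \<subseteq> c}. x V d) = x U c"
proof -
  have "x U c = (\<Oplus>\<^bsub>R\<^esub>d\<in>{d \<in> rcosets V. d \<subseteq> c}. x V d)"
    using assms unfolding carrier_\<Lambda> compatible_def by blast
  then show ?thesis by (rule sym)
qed

lemma \<Lambda>_component: "x \<in> carrier \<Lambda> \<Longrightarrow> U \<in> ON \<Longrightarrow> x U \<in> rcosets U \<rightarrow>\<^sub>E carrier R"
  by (auto simp: carrier_\<Lambda>)

lemma \<Lambda>_closed [simp]: "x \<in> carrier \<Lambda> \<Longrightarrow> U \<in> ON \<Longrightarrow> c \<in> rcosets U \<Longrightarrow> x U c \<in> carrier R"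
  using \<Lambda>_component by blast

lemma \<Lambda>_eqI:
  assumes x: "x \<in> (\<Pi>\<^sub>E U\<in>ON. rcosets U \<rightarrow>\<^sub>E A)" and y: "y \<in> (\<Pi>\<^sub>E U\<in>ON. rcosets U \<rightarrow>\<^sub>E A)"
    and eq: "\<And>U c. U \<in> ON \<Longrightarrow> c \<in> rcosets U \<Longrightarrow> x U c = y U c"
  shows "x = y"
proof (rule PiE_ext[OF x y])
  fix U assume U: "U \<in> ON"
  show "x U = y U"
    by (rule PiE_ext[OF PiE_mem[OF x U] PiE_mem[OF y U]]) (rule eq[OF U])
qed

lemma \<Lambda>_ext:
  "x \<in> carrier \<Lambda> \<Longrightarrow> y \<in> carrier \<Lambda> \<Longrightarrow> (\<And>U c. U \<in> ON \<Longrightarrow> c \<in> rcosets U \<Longrightarrow> x U c = y U c) \<Longrightarrow> x = y"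
  by (rule \<Lambda>_eqI[where A = "carrier R"]) (auto simp: carrier_\<Lambda>)

lemma add_eq: "x \<oplus>\<^bsub>\<Lambda>\<^esub> y = (\<lambda>U\<in>ON. \<lambda>c\<in>rcosets U. x U c \<oplus>\<^bsub>R\<^esub> y U c)"
  by (simp add: completed_group_ring_def carrier_Mod)

lemma mult_eq: "x \<otimes>\<^bsub>\<Lambda>\<^esub> y = (\<lambda>U\<in>ON. \<lambda>c\<in>rcosets U.
    (\<Oplus>\<^bsub>R\<^esub>a\<in>rcosets U. x U a \<otimes>\<^bsub>R\<^esub> y U (inv\<^bsub>G Mod U\<^esub> a <#> c)))"
  by (simp add: completed_group_ring_def carrier_Mod)

lemma add_apply: "U \<in> ON \<Longrightarrow> c \<in> rcosets U \<Longrightarrow> (x \<oplus>\<^bsub>\<Lambda>\<^esub> y) U c = x U c \<oplus>\<^bsub>R\<^esub> y U c"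
  by (simp add: completed_group_ring_def carrier_Mod)

lemma zero_apply: "U \<in> ON \<Longrightarrow> c \<in> rcosets U \<Longrightarrow> \<zero>\<^bsub>\<Lambda>\<^esub> U c = \<zero>\<^bsub>R\<^esub>"
  by (simp add: completed_group_ring_def carrier_Mod)

lemma mult_apply: "U \<in> ON \<Longrightarrow> c \<in> rcosets U \<Longrightarrow>
    (x \<otimes>\<^bsub>\<Lambda>\<^esub> y) U c = (\<Oplus>\<^bsub>R\<^esub>a\<in>rcosets U. x U a \<otimes>\<^bsub>R\<^esub> y U (inv\<^bsub>G Mod U\<^esub> a <#> c))"
  by (simp add: completed_group_ring_def carrier_Mod)

lemma fibre_finite: "V \<in> ON \<Longrightarrow> finite {d \<in> rcosets V. d \<subseteq> c}"
  using finite_index by simp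

lemma \<Lambda>_zero_closed [simp]: "\<zero>\<^bsub>\<Lambda>\<^esub> \<in> carrier \<Lambda>"
  unfolding carrier_\<Lambda>
proof
  show "\<zero>\<^bsub>\<Lambda>\<^esub> \<in> (\<Pi>\<^sub>E U\<in>ON. rcosets U \<rightarrow>\<^sub>E carrier R)"
    by (simp add: completed_group_ring_def carrier_Mod)
  show "compatible \<zero>\<^bsub>\<Lambda>\<^esub>" by (simp add: compatible_def zero_apply cong: R.finsum_cong)
qed

lemma \<Lambda>_add_closed [simp]:
  assumes x: "x \<in> carrier \<Lambda>" and y: "y \<in> carrier \<Lambda>"
  shows "x \<oplus>\<^bsub>\<Lambda>\<^esub> y \<in> carrier \<Lambda>"
  unfolding carrier_\<Lambda>
proof
  show "x \<oplus>\<^bsub>\<Lambda>\<^esub> y \<in> (\<Pi>\<^sub>E U\<in>ON. rcosets U \<rightarrow>\<^sub>E carrier R)"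
    unfolding add_eq using x y by auto
  have "(x \<oplus>\<^bsub>\<Lambda>\<^esub> y) U c = (\<Oplus>\<^bsub>R\<^esub>d\<in>{d \<in> rcosets V. d \<subseteq> c}. (x \<oplus>\<^bsub>\<Lambda>\<^esub> y) V d)"
    if U: "U \<in> ON" and V: "V \<in> ON" and VU: "V \<subseteq> U" and c: "c \<in> rcosets U" for U V c
  proof -
    have "(\<Oplus>\<^bsub>R\<^esub>d\<in>{d \<in> rcosets V. d \<subseteq> c}. (x \<oplus>\<^bsub>\<Lambda>\<^esub> y) V d)
        = (\<Oplus>\<^bsub>R\<^esub>d\<in>{d \<in> rcosets V. d \<subseteq> c}. x V d \<oplus>\<^bsub>R\<^esub> y V d)"
      using V x y by (intro R.add.finprod_cong') (auto simp: add_apply)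
    also have "\<dots> = (\<Oplus>\<^bsub>R\<^esub>d\<in>{d \<in> rcosets V. d \<subseteq> c}. x V d) \<oplus>\<^bsub>R\<^esub> (\<Oplus>\<^bsub>R\<^esub>d\<in>{d \<in> rcosets V. d \<subseteq> c}. y V d)"
      using V x y by (intro R.finsum_addf) auto
    also have "\<dots> = x U c \<oplus>\<^bsub>R\<^esub> y U c" by (simp only: \<Lambda>_compatible[OF x U V VU c] \<Lambda>_compatible[OF y U V VU c])
    finally show ?thesis using U c by (simp add: add_apply)
  qed
  then show "compatible (x \<oplus>\<^bsub>\<Lambda>\<^esub> y)" by (simp add: compatible_def)
qed

definition scale :: "'r \<Rightarrow> ('g, 'r) cgr \<Rightarrow> ('g, 'r) cgr" where
  "scale r x = (\<lambda>U\<in>ON. \<lambda>c\<in>rcosets U. r \<otimes>\<^bsub>R\<^esub> x U c)"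

lemma scale_apply: "U \<in> ON \<Longrightarrow> c \<in> rcosets U \<Longrightarrow> scale r x U c = r \<otimes>\<^bsub>R\<^esub> x U c"
  by (simp add: scale_def)

lemma scale_closed [simp]:
  assumes r: "r \<in> carrier R" and x: "x \<in> carrier \<Lambda>"
  shows "scale r x \<in> carrier \<Lambda>"
  unfolding carrier_\<Lambda>
proof
  show "scale r x \<in> (\<Pi>\<^sub>E U\<in>ON. rcosets U \<rightarrow>\<^sub>E carrier R)" using r x by (auto simp: scale_def)
  have "scale r x U c = (\<Oplus>\<^bsub>R\<^esub>d\<in>{d \<in> rcosets V. d \<subseteq> c}. scale r x V d)"
    if U: "U \<in> ON" and V: "V \<in> ON" and VU: "V \<subseteq> U" and c: "c \<in> rcosets U" for U V c
  proof -
    have "(\<Oplus>\<^bsub>R\<^esub>d\<in>{d \<in> rcosets V. d \<subseteq> c}. scale r x V d) = (\<Oplus>\<^bsub>R\<^esub>d\<in>{d \<in> rcosets V. d \<subseteq> c}. r \<otimes>\<^bsub>R\<^esub> x V d)"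
      using V x r by (intro R.add.finprod_cong') (auto simp: scale_apply)
    also have "\<dots> = r \<otimes>\<^bsub>R\<^esub> (\<Oplus>\<^bsub>R\<^esub>d\<in>{d \<in> rcosets V. d \<subseteq> c}. x V d)"
      using V x r fibre_finite by (intro R.finsum_rdistr[symmetric]) auto
    also have "(\<Oplus>\<^bsub>R\<^esub>d\<in>{d \<in> rcosets V. d \<subseteq> c}. x V d) = x U c" by (rule \<Lambda>_compatible[OF x U V VU c])
    finally show ?thesis using U c by (simp add: scale_apply)
  qed
  then show "compatible (scale r x)" by (simp add: compatible_def)
qed

text \<open>Negation as a scalar multiple, so that \<open>scale_mult\<close> moves it into the left
  factor of a product.\<close>

abbreviation neg where "neg x \<equiv> scale (\<ominus>\<^bsub>R\<^esub> \<one>\<^bsub>R\<^esub>) x"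

lemma neg_apply: "x \<in> carrier \<Lambda> \<Longrightarrow> U \<in> ON \<Longrightarrow> c \<in> rcosets U \<Longrightarrow> neg x U c = \<ominus>\<^bsub>R\<^esub> x U c"
  by (simp add: scale_apply R.l_minus)

lemma \<Lambda>_comm_group: "comm_group (add_monoid \<Lambda>)"
proof (rule comm_groupI)
  show "x \<otimes>\<^bsub>add_monoid \<Lambda>\<^esub> y \<otimes>\<^bsub>add_monoid \<Lambda>\<^esub> z = x \<otimes>\<^bsub>add_monoid \<Lambda>\<^esub> (y \<otimes>\<^bsub>add_monoid \<Lambda>\<^esub> z)"
    if "x \<in> carrier (add_monoid \<Lambda>)" "y \<in> carrier (add_monoid \<Lambda>)" "z \<in> carrier (add_monoid \<Lambda>)" for x y z
    using that by (intro \<Lambda>_ext) (auto simp: add_apply R.a_assoc)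
  show "x \<otimes>\<^bsub>add_monoid \<Lambda>\<^esub> y = y \<otimes>\<^bsub>add_monoid \<Lambda>\<^esub> x"
    if "x \<in> carrier (add_monoid \<Lambda>)" "y \<in> carrier (add_monoid \<Lambda>)" for x y
    using that by (intro \<Lambda>_ext) (auto simp: add_apply R.a_comm)
  show "\<one>\<^bsub>add_monoid \<Lambda>\<^esub> \<otimes>\<^bsub>add_monoid \<Lambda>\<^esub> x = x" if "x \<in> carrier (add_monoid \<Lambda>)" for x
    using that by (intro \<Lambda>_ext) (auto simp: add_apply zero_apply)
  show "\<exists>y\<in>carrier (add_monoid \<Lambda>). y \<otimes>\<^bsub>add_monoid \<Lambda>\<^esub> x = \<one>\<^bsub>add_monoid \<Lambda>\<^esub>"
    if "x \<in> carrier (add_monoid \<Lambda>)" for x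
  proof (rule bexI[of _ "neg x"])
    show "neg x \<otimes>\<^bsub>add_monoid \<Lambda>\<^esub> x = \<one>\<^bsub>add_monoid \<Lambda>\<^esub>"
      using that by (intro \<Lambda>_ext) (auto simp: add_apply zero_apply neg_apply R.l_neg)
  qed (use that in auto)
qed auto

lemma \<Lambda>_inv: "x \<in> carrier \<Lambda> \<Longrightarrow> inv\<^bsub>add_monoid \<Lambda>\<^esub> x = neg x"
proof -
  interpret L: comm_group "add_monoid \<Lambda>" by (rule \<Lambda>_comm_group)
  assume x: "x \<in> carrier \<Lambda>"
  have "neg x \<oplus>\<^bsub>\<Lambda>\<^esub> x = \<zero>\<^bsub>\<Lambda>\<^esub>"
    using x by (intro \<Lambda>_ext) (auto simp: add_apply zero_apply neg_apply R.l_neg)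
  then show ?thesis using x by (intro L.inv_equality) auto
qed

lemma conv_closed:
  assumes "U \<in> ON" "x \<in> carrier \<Lambda>" "y \<in> carrier \<Lambda>" "c \<in> rcosets U"
  shows "(\<Oplus>\<^bsub>R\<^esub>a\<in>rcosets U. x U a \<otimes>\<^bsub>R\<^esub> y U (inv\<^bsub>G Mod U\<^esub> a <#> c)) \<in> carrier R"
proof -
  interpret F: group "G Mod U" using assms(1) by (rule group_Mod)
  have "inv\<^bsub>G Mod U\<^esub> a <#> c \<in> rcosets U" if "a \<in> rcosets U" for a
    using F.m_closed[of "inv\<^bsub>G Mod U\<^esub> a" c] F.inv_closed[of a] that assms by (simp add: carrier_Mod)
  then show ?thesis using assms by (intro R.finsum_closed) auto
qed

text \<open>Compatibility of a product with the transition maps is multiplicativity of the maps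
  between the finite group rings.\<close>

lemma \<Lambda>_mult_closed [simp]:
  assumes x: "x \<in> carrier \<Lambda>" and y: "y \<in> carrier \<Lambda>"
  shows "x \<otimes>\<^bsub>\<Lambda>\<^esub> y \<in> carrier \<Lambda>"
  unfolding carrier_\<Lambda>
proof
  show "x \<otimes>\<^bsub>\<Lambda>\<^esub> y \<in> (\<Pi>\<^sub>E U\<in>ON. rcosets U \<rightarrow>\<^sub>E carrier R)"
    unfolding mult_eq using conv_closed[OF _ x y] by auto
  have "(x \<otimes>\<^bsub>\<Lambda>\<^esub> y) U c = (\<Oplus>\<^bsub>R\<^esub>d\<in>{d \<in> rcosets V. d \<subseteq> c}. (x \<otimes>\<^bsub>\<Lambda>\<^esub> y) V d)"
    if U: "U \<in> ON" and V: "V \<in> ON" and VU: "V \<subseteq> U" and c: "c \<in> rcosets U" for U V c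
  proof -
    obtain \<tau> where \<tau>: "\<tau> \<in> hom (G Mod V) (G Mod U)" "\<And>x. x \<in> carrier G \<Longrightarrow> \<tau> (V #> x) = U #> x"
      and fib: "\<And>c. c \<in> rcosets U \<Longrightarrow> {d \<in> rcosets V. d \<subseteq> c} = {d \<in> rcosets V. \<tau> d = c}"
    proof (rule transition[OF U V VU])
    qed (rule that)
    interpret F: group "G Mod U" using U by (rule group_Mod)
    have xy: "z U c = (\<Oplus>\<^bsub>R\<^esub>d\<in>{d \<in> rcosets V. \<tau> d = c}. z V d)" if "z \<in> carrier \<Lambda>" "c \<in> rcosets U" for z c
    proof -
      have "z U c = (\<Oplus>\<^bsub>R\<^esub>d\<in>{d \<in> rcosets V. d \<subseteq> c}. z V d)"
        using that U V VU unfolding carrier_\<Lambda> compatible_def by blast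
      then show ?thesis by (simp only: fib[OF that(2)])
    qed
    have "(\<Oplus>\<^bsub>R\<^esub>d\<in>{d \<in> rcosets V. d \<subseteq> c}. (x \<otimes>\<^bsub>\<Lambda>\<^esub> y) V d)
        = (\<Oplus>\<^bsub>R\<^esub>d\<in>{d \<in> rcosets V. \<tau> d = c}. \<Oplus>\<^bsub>R\<^esub>a\<in>rcosets V. x V a \<otimes>\<^bsub>R\<^esub> y V (inv\<^bsub>G Mod V\<^esub> a <#> d))"
      using V conv_closed[OF V x y] unfolding fib[OF c] by (intro R.add.finprod_cong') (auto simp: mult_apply)
    also have "\<dots> = (\<Oplus>\<^bsub>R\<^esub>b\<in>rcosets U. (\<Oplus>\<^bsub>R\<^esub>a\<in>{a \<in> rcosets V. \<tau> a = b}. x V a) \<otimes>\<^bsub>R\<^esub>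
        (\<Oplus>\<^bsub>R\<^esub>d\<in>{d \<in> rcosets V. \<tau> d = inv\<^bsub>G Mod U\<^esub> b <#> c}. y V d))"
      using R.convolution_pushforward[OF group_Mod[OF V] group_Mod[OF U] \<tau>(1), of "x V" "y V" c]
        finite_index[OF U] finite_index[OF V] x y V c by (simp add: carrier_Mod Pi_def)
    also have "\<dots> = (\<Oplus>\<^bsub>R\<^esub>b\<in>rcosets U. x U b \<otimes>\<^bsub>R\<^esub> y U (inv\<^bsub>G Mod U\<^esub> b <#> c))"
    proof (intro R.add.finprod_cong' refl)
      have cl: "inv\<^bsub>G Mod U\<^esub> b <#> c \<in> rcosets U" if "b \<in> rcosets U" for b
        using F.m_closed[of "inv\<^bsub>G Mod U\<^esub> b" c] F.inv_closed[of b] c that by (simp add: carrier_Mod)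
      show "(\<lambda>b. x U b \<otimes>\<^bsub>R\<^esub> y U (inv\<^bsub>G Mod U\<^esub> b <#> c)) \<in> rcosets U \<rightarrow> carrier R"
        using cl x y U by simp
      fix b assume b: "b \<in> rcosets U"
      then have "inv\<^bsub>G Mod U\<^esub> b <#> c \<in> rcosets U" by (rule cl)
      then show "(\<Oplus>\<^bsub>R\<^esub>a\<in>{a \<in> rcosets V. \<tau> a = b}. x V a) \<otimes>\<^bsub>R\<^esub>
        (\<Oplus>\<^bsub>R\<^esub>d\<in>{d \<in> rcosets V. \<tau> d = inv\<^bsub>G Mod U\<^esub> b <#> c}. y V d) = x U b \<otimes>\<^bsub>R\<^esub> y U (inv\<^bsub>G Mod U\<^esub> b <#> c)"
        by (simp only: xy[OF x b] xy[OF y])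
    qed
    finally show ?thesis using U c by (simp add: mult_apply)
  qed
  then show "compatible (x \<otimes>\<^bsub>\<Lambda>\<^esub> y)" by (simp add: compatible_def)
qed

abbreviation \<delta> where "\<delta> \<equiv> group_elem R G"

lemma \<delta>_apply: "U \<in> ON \<Longrightarrow> c \<in> rcosets U \<Longrightarrow> g \<in> carrier G \<Longrightarrow>
    \<delta> g U c = (if c = U #> g then \<one>\<^bsub>R\<^esub> else \<zero>\<^bsub>R\<^esub>)"
proof -
  assume U: "U \<in> ON" and c: "c \<in> rcosets U" and g: "g \<in> carrier G"
  interpret UQ: topological_quotient G U using U by (rule ON_quotient)
  obtain x where x: "x \<in> carrier G" "c = U #> x" using c by (rule rcosets_cases)
  have "g \<in> c \<longleftrightarrow> c = U #> g"
    using x g rcos_self[OF g UQ.is_subgroup] repr_independence[OF _ x(1) UQ.is_subgroup] by metis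
  then show ?thesis using U c by (simp add: group_elem_def carrier_Mod)
qed

text \<open>The fibre over \<open>c\<close> contains the coset of \<open>g\<close> exactly when
  \<open>c\<close> is itself the coset of \<open>g\<close>, so the sum over the fibre has one
  nonzero term or none.\<close>

lemma \<delta>_closed [simp]:
  assumes g: "g \<in> carrier G"
  shows "\<delta> g \<in> carrier \<Lambda>"
  unfolding carrier_\<Lambda>
proof
  show "\<delta> g \<in> (\<Pi>\<^sub>E U\<in>ON. rcosets U \<rightarrow>\<^sub>E carrier R)" by (auto simp: group_elem_def carrier_Mod)
  have "\<delta> g U c = (\<Oplus>\<^bsub>R\<^esub>d\<in>{d \<in> rcosets V. d \<subseteq> c}. \<delta> g V d)"
    if U: "U \<in> ON" and V: "V \<in> ON" and VU: "V \<subseteq> U" and c: "c \<in> rcosets U" for U V c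
  proof -
    obtain \<tau> where "\<tau> \<in> hom (G Mod V) (G Mod U)" and \<tau>: "\<And>x. x \<in> carrier G \<Longrightarrow> \<tau> (V #> x) = U #> x"
      and fib: "\<And>c. c \<in> rcosets U \<Longrightarrow> {d \<in> rcosets V. d \<subseteq> c} = {d \<in> rcosets V. \<tau> d = c}"
    proof (rule transition[OF U V VU])
    qed (rule that)
    have "(\<Oplus>\<^bsub>R\<^esub>d\<in>{d \<in> rcosets V. d \<subseteq> c}. \<delta> g V d)
        = (\<Oplus>\<^bsub>R\<^esub>d\<in>{d \<in> rcosets V. \<tau> d = c}. if d = V #> g then \<one>\<^bsub>R\<^esub> else \<zero>\<^bsub>R\<^esub>)"
      using V g unfolding fib[OF c] by (intro R.add.finprod_cong') (auto simp: \<delta>_apply)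
    also have "\<dots> = (if c = U #> g then \<one>\<^bsub>R\<^esub> else \<zero>\<^bsub>R\<^esub>)"
    proof (cases "c = U #> g")
      case True
      then have "V #> g \<in> {d \<in> rcosets V. \<tau> d = c}" using \<tau> g by simp
      moreover have "finite {d \<in> rcosets V. \<tau> d = c}" using finite_index[OF V] by simp
      ultimately show ?thesis
        using R.add.finprod_singleton_swap[of "V #> g" "{d \<in> rcosets V. \<tau> d = c}" "\<lambda>_. \<one>\<^bsub>R\<^esub>"] True by simp
    next
      case False
      then have "(\<Oplus>\<^bsub>R\<^esub>d\<in>{d \<in> rcosets V. \<tau> d = c}. if d = V #> g then \<one>\<^bsub>R\<^esub> else \<zero>\<^bsub>R\<^esub>)
          = (\<Oplus>\<^bsub>R\<^esub>d\<in>{d \<in> rcosets V. \<tau> d = c}. \<zero>\<^bsub>R\<^esub>)"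
        using \<tau>[OF g] by (intro R.add.finprod_cong') auto
      then show ?thesis using False by simp
    qed
    finally show ?thesis using U c g by (simp add: \<delta>_apply)
  qed
  then show "compatible (\<delta> g)" by (simp add: compatible_def)
qed

text \<open>In the convolution only the coset of \<open>g\<close> contributes, so a group element
  acts by translating coefficients.\<close>

lemma \<delta>_mult_apply:
  assumes U: "U \<in> ON" and g: "g \<in> carrier G" and x: "x \<in> carrier \<Lambda>" and c: "c \<in> rcosets U"
  shows "(\<delta> g \<otimes>\<^bsub>\<Lambda>\<^esub> x) U c = x U ((U #> inv g) <#> c)"
proof -
  interpret F: group "G Mod U" using U by (rule group_Mod)
  have cl: "inv\<^bsub>G Mod U\<^esub> a <#> c \<in> rcosets U" if "a \<in> rcosets U" for a
    using F.m_closed[of "inv\<^bsub>G Mod U\<^esub> a" c] F.inv_closed[of a] that c by (simp add: carrier_Mod)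
  have "(\<delta> g \<otimes>\<^bsub>\<Lambda>\<^esub> x) U c
      = (\<Oplus>\<^bsub>R\<^esub>a\<in>rcosets U. if U #> g = a then x U (inv\<^bsub>G Mod U\<^esub> a <#> c) else \<zero>\<^bsub>R\<^esub>)"
    unfolding mult_apply[OF U c] using U g x cl by (intro R.add.finprod_cong') (auto simp: \<delta>_apply)
  also have "\<dots> = x U (inv\<^bsub>G Mod U\<^esub> (U #> g) <#> c)"
    using R.add.finprod_singleton[of "U #> g" "rcosets U" "\<lambda>a. x U (inv\<^bsub>G Mod U\<^esub> a <#> c)"]
      finite_index[OF U] U g x cl by (simp add: Pi_def)
  finally show ?thesis using U g by (simp add: Mod_inv)
qed

lemma Mod_mult_assoc: "U \<in> ON \<Longrightarrow> a \<in> rcosets U \<Longrightarrow> b \<in> rcosets U \<Longrightarrow> c \<in> rcosets U \<Longrightarrow>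
    a <#> b <#> c = a <#> (b <#> c)"
  using group.is_monoid[OF group_Mod, THEN monoid.m_assoc, of U a b c] by (simp add: carrier_Mod)

lemma Mod_mult_closed: "U \<in> ON \<Longrightarrow> a \<in> rcosets U \<Longrightarrow> b \<in> rcosets U \<Longrightarrow> a <#> b \<in> rcosets U"
  using group.is_monoid[OF group_Mod, THEN monoid.m_closed, of U a b] by (simp add: carrier_Mod)

lemma \<delta>_mult_mult:
  assumes g: "g \<in> carrier G" and h: "h \<in> carrier G" and x: "x \<in> carrier \<Lambda>"
  shows "\<delta> (g \<otimes> h) \<otimes>\<^bsub>\<Lambda>\<^esub> x = \<delta> g \<otimes>\<^bsub>\<Lambda>\<^esub> (\<delta> h \<otimes>\<^bsub>\<Lambda>\<^esub> x)"
proof (rule \<Lambda>_ext)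
  fix U c assume U: "U \<in> ON" and c: "c \<in> rcosets U"
  have "(U #> inv (g \<otimes> h)) <#> c = (U #> inv h) <#> ((U #> inv g) <#> c)"
    using U g h c by (simp add: inv_mult_group Mod_mult Mod_mult_assoc[symmetric])
  then show "(\<delta> (g \<otimes> h) \<otimes>\<^bsub>\<Lambda>\<^esub> x) U c = (\<delta> g \<otimes>\<^bsub>\<Lambda>\<^esub> (\<delta> h \<otimes>\<^bsub>\<Lambda>\<^esub> x)) U c"
    using U g h c x by (simp add: \<delta>_mult_apply Mod_mult_closed)
qed (use assms in simp_all)

lemma \<delta>_one_mult:
  assumes x: "x \<in> carrier \<Lambda>"
  shows "\<delta> \<one> \<otimes>\<^bsub>\<Lambda>\<^esub> x = x"
proof (rule \<Lambda>_ext)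
  fix U c assume U: "U \<in> ON" and c: "c \<in> rcosets U"
  obtain y where "y \<in> carrier G" "c = U #> y" using c by (rule rcosets_cases)
  then have "(U #> inv \<one>) <#> c = c" using U by (simp add: Mod_mult del: coset_mult_one)
  then show "(\<delta> \<one> \<otimes>\<^bsub>\<Lambda>\<^esub> x) U c = x U c" using \<delta>_mult_apply[OF U one_closed x c] by simp
qed (use x in simp_all)

lemma \<delta>_mult_add:
  assumes g: "g \<in> carrier G" and x: "x \<in> carrier \<Lambda>" and y: "y \<in> carrier \<Lambda>"
  shows "\<delta> g \<otimes>\<^bsub>\<Lambda>\<^esub> (x \<oplus>\<^bsub>\<Lambda>\<^esub> y) = \<delta> g \<otimes>\<^bsub>\<Lambda>\<^esub> x \<oplus>\<^bsub>\<Lambda>\<^esub> \<delta> g \<otimes>\<^bsub>\<Lambda>\<^esub> y"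
  using assms by (intro \<Lambda>_ext) (auto simp: \<delta>_mult_apply add_apply Mod_mult_closed)

text \<open>The instance of associativity that makes products of ideals stable under the group; the
  convolution is reindexed by left translation with the coset of \<open>g\<close>.\<close>

lemma \<delta>_mult_prod:
  assumes g: "g \<in> carrier G" and x: "x \<in> carrier \<Lambda>" and y: "y \<in> carrier \<Lambda>"
  shows "\<delta> g \<otimes>\<^bsub>\<Lambda>\<^esub> (x \<otimes>\<^bsub>\<Lambda>\<^esub> y) = (\<delta> g \<otimes>\<^bsub>\<Lambda>\<^esub> x) \<otimes>\<^bsub>\<Lambda>\<^esub> y"
proof (rule \<Lambda>_ext)
  fix U c assume U: "U \<in> ON" and c: "c \<in> rcosets U"
  interpret F: group "G Mod U" using U by (rule group_Mod)
  let ?g = "U #> g" and ?g' = "U #> inv g"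
  have gg: "?g \<in> rcosets U" "?g' \<in> rcosets U" using g by simp_all
  have inv_cl: "inv\<^bsub>G Mod U\<^esub> a \<in> rcosets U" if "a \<in> rcosets U" for a
    using F.inv_closed[of a] that by (simp add: carrier_Mod)
  have inj: "inj_on (\<lambda>a. ?g <#> a) (rcosets U)"
  proof (rule inj_on_inverseI[of _ "\<lambda>a. ?g' <#> a"])
    fix a assume "a \<in> rcosets U"
    then obtain z where "z \<in> carrier G" "a = U #> z" by (rule rcosets_cases)
    then show "?g' <#> (?g <#> a) = a" using U g by (simp add: Mod_mult m_assoc[symmetric])
  qed
  have surj: "(\<lambda>a. ?g <#> a) ` (rcosets U) = rcosets U"
  proof (intro equalityI subsetI)
    fix a assume "a \<in> (\<lambda>a. ?g <#> a) ` (rcosets U)"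
    then show "a \<in> rcosets U" using U gg by (auto intro: Mod_mult_closed)
  next
    fix a assume a: "a \<in> rcosets U"
    obtain z where "z \<in> carrier G" "a = U #> z" using a by (rule rcosets_cases)
    then have "a = ?g <#> (?g' <#> a)" using U g by (simp add: Mod_mult m_assoc[symmetric])
    then show "a \<in> (\<lambda>a. ?g <#> a) ` (rcosets U)" using Mod_mult_closed[OF U gg(2) a] by blast
  qed
  have fPi: "(\<lambda>a. x U (?g' <#> a) \<otimes>\<^bsub>R\<^esub> y U (inv\<^bsub>G Mod U\<^esub> a <#> c)) \<in> (\<lambda>a. ?g <#> a) ` (rcosets U) \<rightarrow> carrier R"
    unfolding surj using U x y c gg by (auto simp: Mod_mult_closed inv_cl)
  have "((\<delta> g \<otimes>\<^bsub>\<Lambda>\<^esub> x) \<otimes>\<^bsub>\<Lambda>\<^esub> y) U c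
      = (\<Oplus>\<^bsub>R\<^esub>a\<in>(\<lambda>a. ?g <#> a) ` (rcosets U). x U (?g' <#> a) \<otimes>\<^bsub>R\<^esub> y U (inv\<^bsub>G Mod U\<^esub> a <#> c))"
    unfolding mult_apply[OF U c] surj
    using U g x y c by (intro R.add.finprod_cong') (auto simp: \<delta>_mult_apply Mod_mult_closed inv_cl)
  also have "\<dots> = (\<Oplus>\<^bsub>R\<^esub>a\<in>rcosets U. x U (?g' <#> (?g <#> a)) \<otimes>\<^bsub>R\<^esub> y U (inv\<^bsub>G Mod U\<^esub> (?g <#> a) <#> c))"
    by (rule R.finsum_reindex[OF fPi inj])
  also have "\<dots> = (\<Oplus>\<^bsub>R\<^esub>a\<in>rcosets U. x U a \<otimes>\<^bsub>R\<^esub> y U (inv\<^bsub>G Mod U\<^esub> a <#> (?g' <#> c)))"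
  proof (intro R.add.finprod_cong' refl)
    fix a assume a: "a \<in> rcosets U"
    obtain z where z: "z \<in> carrier G" "a = U #> z" using a by (rule rcosets_cases)
    have "?g' <#> (?g <#> a) = a" using U g z by (simp add: Mod_mult m_assoc[symmetric])
    moreover have "inv\<^bsub>G Mod U\<^esub> (?g <#> a) = inv\<^bsub>G Mod U\<^esub> a <#> ?g'"
      using U g z by (simp add: Mod_mult Mod_inv inv_mult_group)
    moreover have "inv\<^bsub>G Mod U\<^esub> a <#> ?g' <#> c = inv\<^bsub>G Mod U\<^esub> a <#> (?g' <#> c)"
      by (rule Mod_mult_assoc[OF U inv_cl[OF a] gg(2) c])
    ultimately show "x U (?g' <#> (?g <#> a)) \<otimes>\<^bsub>R\<^esub> y U (inv\<^bsub>G Mod U\<^esub> (?g <#> a) <#> c)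
        = x U a \<otimes>\<^bsub>R\<^esub> y U (inv\<^bsub>G Mod U\<^esub> a <#> (?g' <#> c))" by simp
  qed (use x y U c gg in \<open>simp add: Mod_mult_closed inv_cl\<close>)
  also have "\<dots> = (x \<otimes>\<^bsub>\<Lambda>\<^esub> y) U (?g' <#> c)" using U c gg by (simp add: mult_apply Mod_mult_closed)
  also have "\<dots> = (\<delta> g \<otimes>\<^bsub>\<Lambda>\<^esub> (x \<otimes>\<^bsub>\<Lambda>\<^esub> y)) U c" using U g x y c by (simp add: \<delta>_mult_apply)
  finally show "(\<delta> g \<otimes>\<^bsub>\<Lambda>\<^esub> (x \<otimes>\<^bsub>\<Lambda>\<^esub> y)) U c = ((\<delta> g \<otimes>\<^bsub>\<Lambda>\<^esub> x) \<otimes>\<^bsub>\<Lambda>\<^esub> y) U c" ..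
qed (use assms in simp_all)

lemma scale_mult:
  assumes r: "r \<in> carrier R" and x: "x \<in> carrier \<Lambda>" and y: "y \<in> carrier \<Lambda>"
  shows "scale r (x \<otimes>\<^bsub>\<Lambda>\<^esub> y) = scale r x \<otimes>\<^bsub>\<Lambda>\<^esub> y"
proof (rule \<Lambda>_ext)
  fix U c assume U: "U \<in> ON" and c: "c \<in> rcosets U"
  interpret F: group "G Mod U" using U by (rule group_Mod)
  have cl: "inv\<^bsub>G Mod U\<^esub> a <#> c \<in> rcosets U" if "a \<in> rcosets U" for a
    using F.m_closed[of "inv\<^bsub>G Mod U\<^esub> a" c] F.inv_closed[of a] that c by (simp add: carrier_Mod)
  have "(scale r x \<otimes>\<^bsub>\<Lambda>\<^esub> y) U c
      = (\<Oplus>\<^bsub>R\<^esub>a\<in>rcosets U. r \<otimes>\<^bsub>R\<^esub> (x U a \<otimes>\<^bsub>R\<^esub> y U (inv\<^bsub>G Mod U\<^esub> a <#> c)))"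
    unfolding mult_apply[OF U c] using U r x y cl
    by (intro R.add.finprod_cong') (auto simp: scale_apply R.m_assoc)
  also have "\<dots> = r \<otimes>\<^bsub>R\<^esub> (\<Oplus>\<^bsub>R\<^esub>a\<in>rcosets U. x U a \<otimes>\<^bsub>R\<^esub> y U (inv\<^bsub>G Mod U\<^esub> a <#> c))"
    using finite_index[OF U] U r x y cl by (intro R.finsum_rdistr[symmetric]) auto
  also have "\<dots> = scale r (x \<otimes>\<^bsub>\<Lambda>\<^esub> y) U c" using U c by (simp add: scale_apply mult_apply)
  finally show "scale r (x \<otimes>\<^bsub>\<Lambda>\<^esub> y) U c = (scale r x \<otimes>\<^bsub>\<Lambda>\<^esub> y) U c" ..
qed (use assms in simp_all)

section \<open>The augmentation ideal and its powers\<close>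

abbreviation \<epsilon> :: "('g, 'r) cgr \<Rightarrow> 'r" where "\<epsilon> \<equiv> augmentation G"

lemma carrier_ON: "carrier G \<in> ON"
proof -
  have "carrier G \<lhd> G" by (rule subgroup_containing_commutators_normal[OF subgroup_self]) simp
  then show ?thesis using openin_topspace[of "gtop G"] by (simp add: open_normal_def topspace_gtop)
qed

lemma coset_carrier: "g \<in> carrier G \<Longrightarrow> carrier G #> g = carrier G"
  by (rule coset_join2[OF _ subgroup_self]) simp_all

lemma rcosets_carrier: "rcosets (carrier G) = {carrier G}"
  using coset_carrier one_closed by (auto simp: RCOSETS_def)

lemma \<epsilon>_closed [simp]: "x \<in> carrier \<Lambda> \<Longrightarrow> \<epsilon> x \<in> carrier R"
  by (simp add: augmentation_def carrier_ON rcosets_carrier)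

lemma \<epsilon>_add: "\<epsilon> (x \<oplus>\<^bsub>\<Lambda>\<^esub> y) = \<epsilon> x \<oplus>\<^bsub>R\<^esub> \<epsilon> y"
  by (simp add: augmentation_def carrier_ON rcosets_carrier add_apply)

lemma \<epsilon>_zero: "\<epsilon> \<zero>\<^bsub>\<Lambda>\<^esub> = \<zero>\<^bsub>R\<^esub>"
  by (simp add: augmentation_def carrier_ON rcosets_carrier zero_apply)

lemma \<epsilon>_scale: "\<epsilon> (scale r x) = r \<otimes>\<^bsub>R\<^esub> \<epsilon> x"
  by (simp add: augmentation_def carrier_ON rcosets_carrier scale_apply)

lemma \<epsilon>_\<delta>: "g \<in> carrier G \<Longrightarrow> \<epsilon> (\<delta> g) = \<one>\<^bsub>R\<^esub>"
  by (simp add: augmentation_def carrier_ON rcosets_carrier \<delta>_apply coset_carrier)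

lemma \<epsilon>_mult:
  assumes x: "x \<in> carrier \<Lambda>" and y: "y \<in> carrier \<Lambda>"
  shows "\<epsilon> (x \<otimes>\<^bsub>\<Lambda>\<^esub> y) = \<epsilon> x \<otimes>\<^bsub>R\<^esub> \<epsilon> y"
proof -
  have c: "carrier G \<in> rcosets (carrier G)" by (simp add: rcosets_carrier)
  interpret F: group "G Mod carrier G" using carrier_ON by (rule group_Mod)
  have "inv\<^bsub>G Mod carrier G\<^esub> carrier G <#> carrier G \<in> rcosets (carrier G)"
    using F.m_closed[of "inv\<^bsub>G Mod carrier G\<^esub> carrier G" "carrier G"] F.inv_closed[of "carrier G"] c
    by (simp add: carrier_Mod)
  then have "inv\<^bsub>G Mod carrier G\<^esub> carrier G <#> carrier G = carrier G" by (simp add: rcosets_carrier)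
  then show ?thesis using x y carrier_ON c
    unfolding augmentation_def mult_apply[OF carrier_ON c] by (simp add: rcosets_carrier)
qed

lemma \<epsilon>_\<delta>_mult: "g \<in> carrier G \<Longrightarrow> x \<in> carrier \<Lambda> \<Longrightarrow> \<epsilon> (\<delta> g \<otimes>\<^bsub>\<Lambda>\<^esub> x) = \<epsilon> x"
  by (simp add: \<epsilon>_mult \<epsilon>_\<delta>)

abbreviation \<I> where "\<I> \<equiv> augmentation_ideal R G"

lemma \<I>_iff: "x \<in> \<I> \<longleftrightarrow> x \<in> carrier \<Lambda> \<and> \<epsilon> x = \<zero>\<^bsub>R\<^esub>"
  by (simp add: augmentation_ideal_def a_kernel_def')

text \<open>The properties of the powers of the augmentation ideal that survive taking the closure.\<close>

definition stable_subgroup :: "('g, 'r) cgr set \<Rightarrow> bool" where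
  "stable_subgroup X \<longleftrightarrow> subgroup X (add_monoid \<Lambda>) \<and>
     (\<forall>g\<in>carrier G. \<forall>x\<in>X. \<delta> g \<otimes>\<^bsub>\<Lambda>\<^esub> x \<in> X)"

lemma stable_subgroupI:
  assumes "X \<subseteq> carrier \<Lambda>" "\<zero>\<^bsub>\<Lambda>\<^esub> \<in> X" "\<And>x y. x \<in> X \<Longrightarrow> y \<in> X \<Longrightarrow> x \<oplus>\<^bsub>\<Lambda>\<^esub> y \<in> X" "\<And>x. x \<in> X \<Longrightarrow> neg x \<in> X"
    "\<And>g x. g \<in> carrier G \<Longrightarrow> x \<in> X \<Longrightarrow> \<delta> g \<otimes>\<^bsub>\<Lambda>\<^esub> x \<in> X"
  shows "stable_subgroup X"
proof -
  interpret L: comm_group "add_monoid \<Lambda>" by (rule \<Lambda>_comm_group)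
  have "subgroup X (add_monoid \<Lambda>)"
  proof (rule L.subgroupI)
    fix x assume "x \<in> X"
    then show "inv\<^bsub>add_monoid \<Lambda>\<^esub> x \<in> X" using assms(1,4) \<Lambda>_inv by auto
  qed (use assms in auto)
  then show ?thesis using assms(5) by (simp add: stable_subgroup_def)
qed

lemma stable_subgroupD:
  assumes "stable_subgroup X"
  shows "X \<subseteq> carrier \<Lambda>" "\<zero>\<^bsub>\<Lambda>\<^esub> \<in> X" "\<And>x y. x \<in> X \<Longrightarrow> y \<in> X \<Longrightarrow> x \<oplus>\<^bsub>\<Lambda>\<^esub> y \<in> X" "\<And>x. x \<in> X \<Longrightarrow> neg x \<in> X"
    "\<And>g x. g \<in> carrier G \<Longrightarrow> x \<in> X \<Longrightarrow> \<delta> g \<otimes>\<^bsub>\<Lambda>\<^esub> x \<in> X"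
proof -
  have s: "subgroup X (add_monoid \<Lambda>)" using assms by (simp add: stable_subgroup_def)
  show X: "X \<subseteq> carrier \<Lambda>" using subgroup.subset[OF s] by simp
  show "\<zero>\<^bsub>\<Lambda>\<^esub> \<in> X" using subgroup.one_closed[OF s] by simp
  show "x \<oplus>\<^bsub>\<Lambda>\<^esub> y \<in> X" if "x \<in> X" "y \<in> X" for x y using subgroup.m_closed[OF s that] by simp
  show "neg x \<in> X" if "x \<in> X" for x
    using subgroup.m_inv_closed[OF s that] \<Lambda>_inv[of x] X that by auto
  show "\<delta> g \<otimes>\<^bsub>\<Lambda>\<^esub> x \<in> X" if "g \<in> carrier G" "x \<in> X" for g x
    using assms that by (simp add: stable_subgroup_def)
qed

lemma \<I>_stable: "stable_subgroup \<I>"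
  by (rule stable_subgroupI) (auto simp: \<I>_iff \<epsilon>_zero \<epsilon>_add \<epsilon>_scale \<epsilon>_\<delta>_mult)

text \<open>The set \<open>ideal_prod\<close> is generated inductively by products and sums. Group
  elements and negation act on the left factor of a product, which stays in the stable subgroup, and
  multiplicativity of the augmentation keeps products inside the ideal.\<close>

lemma ideal_prod_stable:
  assumes X: "stable_subgroup X"
  shows "stable_subgroup (ideal_prod \<Lambda> X \<I>)" "ideal_prod \<Lambda> X \<I> \<subseteq> \<I>"
proof -
  note XD = stable_subgroupD[OF X]
  have Xc: "x \<in> carrier \<Lambda>" if "x \<in> X" for x using XD(1) that by blast
  have Ic: "x \<in> carrier \<Lambda>" if "x \<in> \<I>" for x using that by (simp add: \<I>_iff)
  have sub: "s \<in> \<I>" if "s \<in> ideal_prod \<Lambda> X \<I>" for s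
    using that
  proof (induction rule: ideal_prod.induct)
    case (prod x y)
    then show ?case using Xc by (simp add: \<I>_iff \<epsilon>_mult)
  next
    case (sum s t)
    then show ?case using stable_subgroupD(3)[OF \<I>_stable] by blast
  qed
  then show "ideal_prod \<Lambda> X \<I> \<subseteq> \<I>" by blast
  have pc: "s \<in> carrier \<Lambda>" if "s \<in> ideal_prod \<Lambda> X \<I>" for s using sub[OF that] Ic by blast
  show "stable_subgroup (ideal_prod \<Lambda> X \<I>)"
  proof (rule stable_subgroupI)
    show "ideal_prod \<Lambda> X \<I> \<subseteq> carrier \<Lambda>" using pc by blast
    have neg: "neg s \<in> ideal_prod \<Lambda> X \<I>" if "s \<in> ideal_prod \<Lambda> X \<I>" for s
      using that
    proof (induction rule: ideal_prod.induct)
      case (prod x y)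
      have "neg (x \<otimes>\<^bsub>\<Lambda>\<^esub> y) = neg x \<otimes>\<^bsub>\<Lambda>\<^esub> y" using prod Xc Ic by (intro scale_mult) auto
      then show ?case using ideal_prod.prod[OF XD(4)[OF prod(1)] prod(2), of \<Lambda>] by simp
    next
      case (sum s t)
      have "neg (s \<oplus>\<^bsub>\<Lambda>\<^esub> t) = neg s \<oplus>\<^bsub>\<Lambda>\<^esub> neg t"
        using sum pc by (intro \<Lambda>_ext) (auto simp: add_apply scale_apply R.r_distr)
      then show ?case using ideal_prod.sum[OF sum.IH] by simp
    qed
    then show "\<And>s. s \<in> ideal_prod \<Lambda> X \<I> \<Longrightarrow> neg s \<in> ideal_prod \<Lambda> X \<I>" .
    \<comment> \<open>The inductive rules do not mention the zero element, so it is produced as the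
      sum of a product and its negative.\<close>
    have p0: "\<zero>\<^bsub>\<Lambda>\<^esub> \<otimes>\<^bsub>\<Lambda>\<^esub> \<zero>\<^bsub>\<Lambda>\<^esub> \<in> ideal_prod \<Lambda> X \<I>"
      using XD(2) stable_subgroupD(2)[OF \<I>_stable] by (rule ideal_prod.prod)
    have "neg (\<zero>\<^bsub>\<Lambda>\<^esub> \<otimes>\<^bsub>\<Lambda>\<^esub> \<zero>\<^bsub>\<Lambda>\<^esub>) \<oplus>\<^bsub>\<Lambda>\<^esub> \<zero>\<^bsub>\<Lambda>\<^esub> \<otimes>\<^bsub>\<Lambda>\<^esub> \<zero>\<^bsub>\<Lambda>\<^esub> = \<zero>\<^bsub>\<Lambda>\<^esub>"
      by (intro \<Lambda>_ext) (auto simp: add_apply zero_apply neg_apply R.l_neg)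
    then show "\<zero>\<^bsub>\<Lambda>\<^esub> \<in> ideal_prod \<Lambda> X \<I>" using ideal_prod.sum[OF neg[OF p0] p0] by simp
    show "\<And>s t. s \<in> ideal_prod \<Lambda> X \<I> \<Longrightarrow> t \<in> ideal_prod \<Lambda> X \<I> \<Longrightarrow> s \<oplus>\<^bsub>\<Lambda>\<^esub> t \<in> ideal_prod \<Lambda> X \<I>"
      by (rule ideal_prod.sum)
    show "\<delta> g \<otimes>\<^bsub>\<Lambda>\<^esub> s \<in> ideal_prod \<Lambda> X \<I>" if g: "g \<in> carrier G" and s: "s \<in> ideal_prod \<Lambda> X \<I>" for g s
      using s
    proof (induction rule: ideal_prod.induct)
      case (prod x y)
      have "\<delta> g \<otimes>\<^bsub>\<Lambda>\<^esub> (x \<otimes>\<^bsub>\<Lambda>\<^esub> y) = (\<delta> g \<otimes>\<^bsub>\<Lambda>\<^esub> x) \<otimes>\<^bsub>\<Lambda>\<^esub> y" using prod g Xc Ic by (intro \<delta>_mult_prod) auto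
      then show ?case using ideal_prod.prod[OF XD(5)[OF g prod(1)] prod(2), of \<Lambda>] by simp
    next
      case (sum s t)
      then show ?case using ideal_prod.sum[OF sum.IH] pc g by (simp add: \<delta>_mult_add)
    qed
  qed
qed

text \<open>The power is taken in the monoid of ideals, where exponent 0 gives the whole ring and
  each further step multiplies by the augmentation ideal on the right.\<close>

lemma ideal_power_stable:
  "stable_subgroup (\<I> [^]\<^bsub>ideals_set \<Lambda>\<^esub> (k :: nat))"
  "k \<ge> 1 \<Longrightarrow> \<I> [^]\<^bsub>ideals_set \<Lambda>\<^esub> k \<subseteq> \<I>"
proof -
  have pow_Suc: "\<I> [^]\<^bsub>ideals_set \<Lambda>\<^esub> Suc k = ideal_prod \<Lambda> (\<I> [^]\<^bsub>ideals_set \<Lambda>\<^esub> k) \<I>" for k :: nat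
    by (simp add: nat_pow_def ideals_set_def)
  show s: "stable_subgroup (\<I> [^]\<^bsub>ideals_set \<Lambda>\<^esub> k)" for k :: nat
  proof (induction k)
    case 0
    have pow_0: "\<I> [^]\<^bsub>ideals_set \<Lambda>\<^esub> (0 :: nat) = carrier \<Lambda>" by (simp add: nat_pow_def ideals_set_def)
    show ?case unfolding pow_0 by (rule stable_subgroupI) simp_all
  next
    case (Suc k)
    then show ?case unfolding pow_Suc by (rule ideal_prod_stable(1))
  qed
  show "\<I> [^]\<^bsub>ideals_set \<Lambda>\<^esub> k \<subseteq> \<I>" if k: "k \<ge> 1"
  proof -
    obtain j where "k = Suc j" using k by (cases k) auto
    then show ?thesis using ideal_prod_stable(2)[OF s[of j]] by (simp only: pow_Suc)
  qed
qed

end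

section \<open>Duals of the truncated group rings\<close>

lemma dual_mod_simps:
  "carrier (dual_mod R G M) = {f \<in> hom M (add_monoid R) \<inter> extensional (carrier M).
     continuous_map (gtop M) (discrete_topology (carrier R)) f}"
  "monoid.mult (dual_mod R G M) = (\<lambda>f f'. \<lambda>x\<in>carrier M. f x \<oplus>\<^bsub>R\<^esub> f' x)"
  "one (dual_mod R G M) = (\<lambda>x\<in>carrier M. \<zero>\<^bsub>R\<^esub>)"
  "gtop (dual_mod R G M) = discrete_topology (carrier (dual_mod R G M))"
  "act (dual_mod R G M) = (\<lambda>\<sigma> f. \<lambda>x\<in>carrier M. f (act M (inv\<^bsub>G\<^esub> \<sigma>) x))"
  by (simp_all add: dual_mod_def Let_def)

text \<open>One setting for both duals: \<open>K\<close> becomes the additive group of the completed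
  group ring or of its augmentation ideal, \<open>P\<close> the closed power of the ideal,
  \<open>a\<close> the action and \<open>b\<close> the induced action on cosets. The last assumption
  says that a functional vanishing on \<open>P\<close> is fixed by a neighbourhood of 1, which makes
  the dual a discrete module.\<close>

locale quotient_dual = G: topological_group G + topological_quotient K P + R: cring R
  for G :: "('g, 'c) tgroup_scheme" and K :: "('k, 'b) tgroup_scheme" (structure) and P
    and R :: "('r, 'd) ring_scheme" +
  fixes a :: "'g \<Rightarrow> 'k \<Rightarrow> 'k" and b :: "'g \<Rightarrow> 'k set \<Rightarrow> 'k set"
  assumes a_hom: "g \<in> carrier G \<Longrightarrow> a g \<in> hom K K"
    and a_continuous: "g \<in> carrier G \<Longrightarrow> continuous_map (gtop K) (gtop K) (a g)"
    and a_one: "x \<in> carrier K \<Longrightarrow> a \<one>\<^bsub>G\<^esub> x = x"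
    and a_act: "g \<in> carrier G \<Longrightarrow> h \<in> carrier G \<Longrightarrow> x \<in> carrier K \<Longrightarrow> a (g \<otimes>\<^bsub>G\<^esub> h) x = a g (a h x)"
    and b_eq: "g \<in> carrier G \<Longrightarrow> x \<in> carrier K \<Longrightarrow> b g (P #> x) = P #> a g x"
    and locally_fixed: "f \<in> hom K (add_monoid R) \<Longrightarrow>
      continuous_map (gtop K) (discrete_topology (carrier R)) f \<Longrightarrow> (\<And>x. x \<in> P \<Longrightarrow> f x = \<zero>\<^bsub>R\<^esub>) \<Longrightarrow>
      \<exists>V. openin (gtop G) V \<and> \<one>\<^bsub>G\<^esub> \<in> V \<and> (\<forall>v\<in>V. \<forall>x\<in>carrier K. f (a (inv\<^bsub>G\<^esub> v) x) = f x)"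
begin

abbreviation T where "T \<equiv> with_act (tquot K P) b"
abbreviation D where "D \<equiv> dual_mod R G T"

lemma a_closed [simp]: "g \<in> carrier G \<Longrightarrow> x \<in> carrier K \<Longrightarrow> a g x \<in> carrier K"
  using a_hom by (auto simp: hom_def)

lemma a_mult: "g \<in> carrier G \<Longrightarrow> x \<in> carrier K \<Longrightarrow> y \<in> carrier K \<Longrightarrow> a g (x \<otimes> y) = a g x \<otimes> a g y"
  using a_hom by (auto simp: hom_def)

text \<open>Functionals on the quotient are handled through their lifts to \<open>K\<close>;
  continuity may be tested there because the projection is a quotient map.\<close>

lemma D_iff:
  "f \<in> carrier D \<longleftrightarrow> f \<in> extensional (rcosets P) \<and> (\<lambda>x. f (P #> x)) \<in> hom K (add_monoid R) \<and>
     continuous_map (gtop K) (discrete_topology (carrier R)) (\<lambda>x. f (P #> x))"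
proof -
  have "f \<in> hom T (add_monoid R) \<longleftrightarrow> (\<lambda>x. f (P #> x)) \<in> hom K (add_monoid R)"
  proof
    assume f: "f \<in> hom T (add_monoid R)"
    show "(\<lambda>x. f (P #> x)) \<in> hom K (add_monoid R)"
    proof (rule homI)
      fix x y assume x: "x \<in> carrier K" and y: "y \<in> carrier K"
      then show "f (P #> (x \<otimes> y)) = f (P #> x) \<otimes>\<^bsub>add_monoid R\<^esub> f (P #> y)"
        using hom_mult[OF f, of "P #> x" "P #> y"] proj_in_Q by (simp add: proj_mult)
    qed (use hom_in_carrier[OF f] proj_in_Q in auto)
  next
    assume f: "(\<lambda>x. f (P #> x)) \<in> hom K (add_monoid R)"
    show "f \<in> hom T (add_monoid R)"
    proof (rule homI)
      fix X assume "X \<in> carrier T"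
      then obtain x where "x \<in> carrier K" "X = P #> x" by (auto elim: Q_cases)
      then show "f X \<in> carrier (add_monoid R)" using hom_in_carrier[OF f] by simp
      fix Y assume "Y \<in> carrier T"
      then obtain y where "y \<in> carrier K" "Y = P #> y" by (auto elim: Q_cases)
      then show "f (X \<otimes>\<^bsub>T\<^esub> Y) = f X \<otimes>\<^bsub>add_monoid R\<^esub> f Y"
        using hom_mult[OF f] \<open>x \<in> carrier K\<close> \<open>X = P #> x\<close> by (simp add: proj_mult)
    qed
  qed
  moreover have "continuous_map (gtop Q) (discrete_topology (carrier R)) f \<longleftrightarrow>
      continuous_map (gtop K) (discrete_topology (carrier R)) (\<lambda>x. f (P #> x))"
    using continuous_compose_quotient_map_eq[OF quotient_map_proj, of _ f] by (simp add: o_def)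
  ultimately show ?thesis by (auto simp: dual_mod_simps carrier_tquot)
qed

lemma D_continuous: "f \<in> carrier D \<Longrightarrow> continuous_map (gtop K) (discrete_topology (carrier R)) (\<lambda>x. f (P #> x))"
  by (simp add: D_iff)

lemma D_closed: "f \<in> carrier D \<Longrightarrow> x \<in> carrier K \<Longrightarrow> f (P #> x) \<in> carrier R"
  by (auto simp: D_iff hom_def)

lemma D_add: "f \<in> carrier D \<Longrightarrow> x \<in> carrier K \<Longrightarrow> y \<in> carrier K \<Longrightarrow>
    f (P #> (x \<otimes> y)) = f (P #> x) \<oplus>\<^bsub>R\<^esub> f (P #> y)"
  by (auto simp: D_iff hom_def)

lemma D_zero: "f \<in> carrier D \<Longrightarrow> x \<in> P \<Longrightarrow> f (P #> x) = \<zero>\<^bsub>R\<^esub>"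
proof -
  assume f: "f \<in> carrier D" and x: "x \<in> P"
  have "f P \<oplus>\<^bsub>R\<^esub> f P = f P" using D_add[OF f, of "\<one>" "\<one>"] by (simp add: proj_one)
  then have "f P = \<zero>\<^bsub>R\<^esub>"
    using D_closed[OF f, of "\<one>"] R.add.l_cancel_one[of "f P" "f P"] by (simp add: proj_one)
  then show ?thesis using x by (simp add: proj_H)
qed

lemma D_eqI:
  assumes "f \<in> carrier D" "f' \<in> carrier D" "\<And>x. x \<in> carrier K \<Longrightarrow> f (P #> x) = f' (P #> x)"
  shows "f = f'"
proof (rule extensionalityI[of _ "rcosets P"])
  fix X assume "X \<in> rcosets P"
  then obtain x where "x \<in> carrier K" "X = P #> x" by (auto simp: RCOSETS_def)
  then show "f X = f' X" using assms(3) by simp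
qed (use assms in \<open>auto simp: D_iff\<close>)

text \<open>A homomorphism vanishing on \<open>P\<close> is constant on cosets, so an arbitrary
  representative gives the value of the induced functional.\<close>

lemma D_obtain:
  assumes h: "h \<in> hom K (add_monoid R)"
    and cont: "continuous_map (gtop K) (discrete_topology (carrier R)) h"
    and zero: "\<And>x. x \<in> P \<Longrightarrow> h x = \<zero>\<^bsub>R\<^esub>"
  obtains f where "f \<in> carrier D" "\<And>x. x \<in> carrier K \<Longrightarrow> f (P #> x) = h x"
proof -
  define f where "f = (\<lambda>X\<in>rcosets P. h (SOME x. x \<in> X))"
  have f: "f (P #> x) = h x" if x: "x \<in> carrier K" for x
  proof -
    have "(SOME y. y \<in> P #> x) \<in> P #> x" by (rule someI[of _ x]) (rule rcos_self[OF x is_subgroup])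
    then obtain p where p: "p \<in> P" "(SOME y. y \<in> P #> x) = p \<otimes> x" by (auto simp: r_coset_def)
    have "h (p \<otimes> x) = h p \<oplus>\<^bsub>R\<^esub> h x" using hom_mult[OF h, of p x] p(1) x by simp
    also have "\<dots> = h x" using zero[OF p(1)] hom_in_carrier[OF h x] by simp
    finally show ?thesis using proj_in_Q[OF x] p(2) by (simp add: f_def carrier_tquot)
  qed
  have "(\<lambda>x. f (P #> x)) \<in> hom K (add_monoid R)"
    using h f by (simp add: hom_def Pi_def)
  moreover have "continuous_map (gtop K) (discrete_topology (carrier R)) (\<lambda>x. f (P #> x))"
    by (rule continuous_map_eq[OF cont]) (simp add: topspace_gtop f)
  ultimately have "f \<in> carrier D" by (simp add: D_iff f_def)
  then show ?thesis using that f by blast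
qed

lemma D_mult_apply: "x \<in> carrier K \<Longrightarrow> (f \<otimes>\<^bsub>D\<^esub> f') (P #> x) = f (P #> x) \<oplus>\<^bsub>R\<^esub> f' (P #> x)"
  using proj_in_Q[of x] by (simp add: dual_mod_simps)

lemma D_one_apply: "x \<in> carrier K \<Longrightarrow> \<one>\<^bsub>D\<^esub> (P #> x) = \<zero>\<^bsub>R\<^esub>"
  using proj_in_Q[of x] by (simp add: dual_mod_simps)

lemma D_act_apply: "g \<in> carrier G \<Longrightarrow> x \<in> carrier K \<Longrightarrow> act D g f (P #> x) = f (P #> a (inv\<^bsub>G\<^esub> g) x)"
  using proj_in_Q[of x] by (simp add: dual_mod_simps b_eq)

lemma D_extensional:
  "f \<otimes>\<^bsub>D\<^esub> f' \<in> extensional (rcosets P)" "\<one>\<^bsub>D\<^esub> \<in> extensional (rcosets P)" "act D g f \<in> extensional (rcosets P)"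
  by (simp_all add: dual_mod_simps carrier_tquot)

lemma D_I:
  assumes "f \<in> extensional (rcosets P)" "h \<in> hom K (add_monoid R)"
    "continuous_map (gtop K) (discrete_topology (carrier R)) h"
    and eq: "\<And>x. x \<in> carrier K \<Longrightarrow> f (P #> x) = h x"
  shows "f \<in> carrier D"
  unfolding D_iff
proof (intro conjI)
  show "(\<lambda>x. f (P #> x)) \<in> hom K (add_monoid R)"
    using assms(2) eq by (simp add: hom_def Pi_def)
  show "continuous_map (gtop K) (discrete_topology (carrier R)) (\<lambda>x. f (P #> x))"
    by (rule continuous_map_eq[OF assms(3)]) (simp add: topspace_gtop eq)
qed fact

lemma D_mult_closed:
  assumes f: "f \<in> carrier D" and f': "f' \<in> carrier D"
  shows "f \<otimes>\<^bsub>D\<^esub> f' \<in> carrier D"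
proof (rule D_I[OF D_extensional(1) _ _ D_mult_apply])
  show "(\<lambda>x. f (P #> x) \<oplus>\<^bsub>R\<^esub> f' (P #> x)) \<in> hom K (add_monoid R)"
    by (rule homI) (use f f' in \<open>auto simp: D_closed D_add R.a_ac\<close>)
  show "continuous_map (gtop K) (discrete_topology (carrier R)) (\<lambda>x. f (P #> x) \<oplus>\<^bsub>R\<^esub> f' (P #> x))"
    by (rule continuous_map_discrete_binary[OF D_continuous[OF f] D_continuous[OF f'], of
        "\<lambda>r s. r \<oplus>\<^bsub>R\<^esub> s"]) simp
qed

lemma D_one_closed: "\<one>\<^bsub>D\<^esub> \<in> carrier D"
  by (rule D_I[OF D_extensional(2) _ _ D_one_apply]) (auto simp: hom_def)

lemma D_act_closed:
  assumes f: "f \<in> carrier D" and g: "g \<in> carrier G"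
  shows "act D g f \<in> carrier D"
proof (rule D_I[OF D_extensional(3) _ _ D_act_apply[OF g]])
  have g': "inv\<^bsub>G\<^esub> g \<in> carrier G" using g by simp
  show "(\<lambda>x. f (P #> a (inv\<^bsub>G\<^esub> g) x)) \<in> hom K (add_monoid R)"
    by (rule homI) (use f g' in \<open>auto simp: D_closed D_add a_mult\<close>)
  have "continuous_map (gtop K) (discrete_topology (carrier R)) (\<lambda>x. f (P #> x))" using f by (simp add: D_iff)
  from continuous_map_compose[OF a_continuous[OF g'] this]
  show "continuous_map (gtop K) (discrete_topology (carrier R)) (\<lambda>x. f (P #> a (inv\<^bsub>G\<^esub> g) x))"
    by (simp add: o_def)
qed

lemma D_comm_group: "comm_group D"
proof (rule comm_groupI)
  fix f assume f: "f \<in> carrier D"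
  show "\<one>\<^bsub>D\<^esub> \<otimes>\<^bsub>D\<^esub> f = f"
    by (rule D_eqI) (use f in \<open>auto simp: D_mult_closed D_one_closed D_mult_apply D_one_apply D_closed\<close>)
  have "(\<lambda>x. \<ominus>\<^bsub>R\<^esub> f (P #> x)) \<in> hom K (add_monoid R)"
    by (rule homI) (use f in \<open>auto simp: D_closed D_add R.minus_add\<close>)
  moreover have "continuous_map (gtop K) (discrete_topology (carrier R)) (\<lambda>x. \<ominus>\<^bsub>R\<^esub> f (P #> x))"
    by (rule continuous_map_discrete_unary[OF D_continuous[OF f], of "\<lambda>r. \<ominus>\<^bsub>R\<^esub> r"]) simp
  ultimately obtain f' where f': "f' \<in> carrier D" "\<And>x. x \<in> carrier K \<Longrightarrow> f' (P #> x) = \<ominus>\<^bsub>R\<^esub> f (P #> x)"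
    by (rule D_obtain) (use D_zero[OF f] in auto)
  have "f' \<otimes>\<^bsub>D\<^esub> f = \<one>\<^bsub>D\<^esub>"
    by (rule D_eqI)
      (use f f' in \<open>auto simp: D_mult_closed D_one_closed D_mult_apply D_one_apply D_closed R.l_neg\<close>)
  then show "\<exists>y\<in>carrier D. y \<otimes>\<^bsub>D\<^esub> f = \<one>\<^bsub>D\<^esub>" using f'(1) by blast
next
  fix f f' f'' assume "f \<in> carrier D" "f' \<in> carrier D" "f'' \<in> carrier D"
  then show "f \<otimes>\<^bsub>D\<^esub> f' \<otimes>\<^bsub>D\<^esub> f'' = f \<otimes>\<^bsub>D\<^esub> (f' \<otimes>\<^bsub>D\<^esub> f'')"
    by (intro D_eqI) (auto simp: D_mult_closed D_mult_apply D_closed R.a_assoc)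
next
  fix f f' assume "f \<in> carrier D" "f' \<in> carrier D"
  then show "f \<otimes>\<^bsub>D\<^esub> f' = f' \<otimes>\<^bsub>D\<^esub> f"
    by (intro D_eqI) (auto simp: D_mult_closed D_mult_apply D_closed R.a_comm)
qed (auto simp: D_mult_closed D_one_closed)

theorem discrete_module_D: "discrete_module G D"
proof (intro discrete_module.intro discrete_module_axioms.intro G.topological_group_axioms D_comm_group)
  show "gtop D = discrete_topology (carrier D)" by (rule dual_mod_simps(4))
  fix g assume g: "g \<in> carrier G"
  then have g': "inv\<^bsub>G\<^esub> g \<in> carrier G" by simp
  show "act D g \<in> hom D D"
  proof (rule homI)
    fix f f' assume f: "f \<in> carrier D" and f': "f' \<in> carrier D"
    show "act D g (f \<otimes>\<^bsub>D\<^esub> f') = act D g f \<otimes>\<^bsub>D\<^esub> act D g f'"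
      by (rule D_eqI) (use f f' g g' in \<open>auto simp: D_mult_closed D_act_closed D_mult_apply D_act_apply\<close>)
  qed (use g D_act_closed in auto)
  fix h f assume h: "h \<in> carrier G" and f: "f \<in> carrier D"
  then have h': "inv\<^bsub>G\<^esub> h \<in> carrier G" by simp
  show "act D (g \<otimes>\<^bsub>G\<^esub> h) f = act D g (act D h f)"
    by (rule D_eqI) (use f g h g' h' in \<open>auto simp: D_act_closed D_act_apply G.inv_mult_group a_act\<close>)
next
  fix f assume f: "f \<in> carrier D"
  show one: "act D \<one>\<^bsub>G\<^esub> f = f"
    by (rule D_eqI) (use f in \<open>auto simp: D_act_closed D_act_apply a_one\<close>)
  obtain V where V: "openin (gtop G) V" "\<one>\<^bsub>G\<^esub> \<in> V"
    "\<forall>v\<in>V. \<forall>x\<in>carrier K. f (P #> a (inv\<^bsub>G\<^esub> v) x) = f (P #> x)"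
    using locally_fixed[of "\<lambda>x. f (P #> x)"] f D_zero[OF f] by (auto simp: D_iff)
  have Vc: "v \<in> carrier G" if "v \<in> V" for v using G.openin_subset_carrier[OF V(1)] that by blast
  \<comment> \<open>Right multiplication of \<open>g\<close> by elements of \<open>V\<close> does
    not change the translate of \<open>f\<close>, so the fibres of the orbit map are unions of the
    open sets g V.\<close>
  have actV: "act D (g \<otimes>\<^bsub>G\<^esub> v) f = act D g f" if g: "g \<in> carrier G" and v: "v \<in> V" for g v
  proof (rule D_eqI)
    fix x assume x: "x \<in> carrier K"
    have "act D (g \<otimes>\<^bsub>G\<^esub> v) f (P #> x) = f (P #> a (inv\<^bsub>G\<^esub> v) (a (inv\<^bsub>G\<^esub> g) x))"
      using g x Vc[OF v] by (simp add: D_act_apply G.inv_mult_group a_act)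
    also have "\<dots> = f (P #> a (inv\<^bsub>G\<^esub> g) x)" using V(3) v g x by simp
    also have "\<dots> = act D g f (P #> x)" using g x by (simp add: D_act_apply)
    finally show "act D (g \<otimes>\<^bsub>G\<^esub> v) f (P #> x) = act D g f (P #> x)" .
  qed (use f g Vc[OF v] in \<open>auto simp: D_act_closed\<close>)
  show "continuous_map (gtop G) (discrete_topology (carrier D)) (\<lambda>g. act D g f)"
    unfolding continuous_map_discrete_iff
  proof (intro conjI ballI)
    show "(\<lambda>g. act D g f) \<in> topspace (gtop G) \<rightarrow> carrier D" using f D_act_closed
      by (auto simp: G.topspace_gtop)
    fix d assume "d \<in> carrier D"
    have "{g \<in> topspace (gtop G). act D g f = d}
        = (\<Union>g\<in>{g \<in> carrier G. act D g f = d}. (\<lambda>v. g \<otimes>\<^bsub>G\<^esub> v) ` V)"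
    proof (intro equalityI subsetI)
      fix g assume "g \<in> {g \<in> topspace (gtop G). act D g f = d}"
      then have g: "g \<in> carrier G" "act D g f = d" by (auto simp: G.topspace_gtop)
      then have "g \<otimes>\<^bsub>G\<^esub> \<one>\<^bsub>G\<^esub> \<in> (\<lambda>v. g \<otimes>\<^bsub>G\<^esub> v) ` V" using V(2) by blast
      then show "g \<in> (\<Union>g\<in>{g \<in> carrier G. act D g f = d}. (\<lambda>v. g \<otimes>\<^bsub>G\<^esub> v) ` V)" using g by auto
    next
      fix x assume "x \<in> (\<Union>g\<in>{g \<in> carrier G. act D g f = d}. (\<lambda>v. g \<otimes>\<^bsub>G\<^esub> v) ` V)"
      then obtain g v where gv: "g \<in> carrier G" "act D g f = d" "v \<in> V" "x = g \<otimes>\<^bsub>G\<^esub> v" by blast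
      then show "x \<in> {g \<in> topspace (gtop G). act D g f = d}"
        using actV[OF gv(1,3)] Vc[OF gv(3)] by (simp add: G.topspace_gtop)
    qed
    also have "openin (gtop G) \<dots>" using G.openin_l_translate[OF V(1)] by (intro openin_Union) auto
    finally show "openin (gtop G) {g \<in> topspace (gtop G). act D g f = d}" .
  qed
qed

end

section \<open>Topology of the completed group ring and continuity of its operations\<close>

context finite_quotients
begin

abbreviation K where "K \<equiv> cgr_add R G"
abbreviation top\<^sub>\<Lambda> where "top\<^sub>\<Lambda> \<equiv> cgr_topology R G"
abbreviation comp :: "'g set \<Rightarrow> ('g set \<Rightarrow> 'r) set" where "comp U \<equiv> rcosets U \<rightarrow>\<^sub>E carrier R"

lemma K_simps [simp]:
  "carrier K = carrier \<Lambda>" "monoid.mult K = ring.add \<Lambda>" "one K = \<zero>\<^bsub>\<Lambda>\<^esub>" "gtop K = top\<^sub>\<Lambda>"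
  by (simp_all add: cgr_add_def)

lemma K_comm_group: "comm_group K"
  using \<Lambda>_comm_group by (simp add: cgr_add_def)

lemma K_inv: "x \<in> carrier \<Lambda> \<Longrightarrow> inv\<^bsub>K\<^esub> x = neg x"
  using \<Lambda>_inv by (simp add: cgr_add_def)

lemma cgr_topology_eq:
  "top\<^sub>\<Lambda> = subtopology (product_topology (\<lambda>U. discrete_topology (comp U)) ON) (carrier \<Lambda>)"
  by (simp add: cgr_topology_def carrier_Mod)

lemma topspace_\<Lambda>: "topspace top\<^sub>\<Lambda> = carrier \<Lambda>"
proof -
  have "carrier \<Lambda> \<subseteq> Pi\<^sub>E ON comp" by (intro subsetI) (simp only: carrier_\<Lambda>)
  then show ?thesis unfolding cgr_topology_eq by (simp add: Int_absorb1)
qed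

lemma continuous_component: "U \<in> ON \<Longrightarrow> continuous_map top\<^sub>\<Lambda> (discrete_topology (comp U)) (\<lambda>x. x U)"
  unfolding cgr_topology_eq
  using continuous_map_product_projection[of U ON "\<lambda>U. discrete_topology (comp U)"]
  by (rule continuous_map_from_subtopology)

lemma continuous_into_\<Lambda>:
  assumes "\<And>x. x \<in> topspace X \<Longrightarrow> f x \<in> carrier \<Lambda>"
    and "\<And>U. U \<in> ON \<Longrightarrow> continuous_map X (discrete_topology (comp U)) (\<lambda>x. f x U)"
  shows "continuous_map X top\<^sub>\<Lambda> f"
  unfolding cgr_topology_eq
proof (rule continuous_map_into_subtopology)
  show "continuous_map X (product_topology (\<lambda>U. discrete_topology (comp U)) ON) f"
    unfolding continuous_map_componentwise
    using assms by (auto simp: carrier_\<Lambda> PiE_def)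
  show "f \<in> topspace X \<rightarrow> carrier \<Lambda>" using assms(1) by blast
qed

lemma \<epsilon>_continuous: "continuous_map top\<^sub>\<Lambda> (discrete_topology (carrier R)) \<epsilon>"
  unfolding augmentation_def
  by (rule continuous_map_discrete_unary[OF continuous_component[OF carrier_ON], of "\<lambda>y. y (carrier G)"])
    (auto simp: rcosets_carrier)

lemma restrict_component:
  "(\<lambda>c\<in>rcosets U. x c) = x" if "x \<in> comp U" for x :: "'g set \<Rightarrow> 'r"
  using that by (simp add: PiE_restrict)

lemma scale_continuous:
  assumes "continuous_map X (discrete_topology (carrier R)) r" "continuous_map X top\<^sub>\<Lambda> f"
  shows "continuous_map X top\<^sub>\<Lambda> (\<lambda>x. scale (r x) (f x))"
proof (rule continuous_into_\<Lambda>)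
  have r: "r x \<in> carrier R" and f: "f x \<in> carrier \<Lambda>" if "x \<in> topspace X" for x
    using assms that by (auto simp: continuous_map_def topspace_\<Lambda>)
  show "scale (r x) (f x) \<in> carrier \<Lambda>" if "x \<in> topspace X" for x using r[OF that] f[OF that] by simp
  fix U assume U: "U \<in> ON"
  have "continuous_map X (discrete_topology (comp U)) (\<lambda>x. f x U)"
    using continuous_map_compose[OF assms(2) continuous_component[OF U]] by (simp add: o_def)
  with assms(1) have "continuous_map X (discrete_topology (comp U)) (\<lambda>x. (\<lambda>s y. \<lambda>c\<in>rcosets U. s \<otimes>\<^bsub>R\<^esub> y c) (r x) (f x U))"
    by (rule continuous_map_discrete_binary) (auto dest: PiE_mem)
  then show "continuous_map X (discrete_topology (comp U)) (\<lambda>x. scale (r x) (f x) U)"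
    using U by (simp add: scale_def)
qed

lemma add_continuous:
  assumes "continuous_map X top\<^sub>\<Lambda> f" "continuous_map X top\<^sub>\<Lambda> f'"
  shows "continuous_map X top\<^sub>\<Lambda> (\<lambda>x. f x \<oplus>\<^bsub>\<Lambda>\<^esub> f' x)"
proof (rule continuous_into_\<Lambda>)
  have f: "f x \<in> carrier \<Lambda>" "f' x \<in> carrier \<Lambda>" if "x \<in> topspace X" for x
    using assms that by (auto simp: continuous_map_def topspace_\<Lambda>)
  show "f x \<oplus>\<^bsub>\<Lambda>\<^esub> f' x \<in> carrier \<Lambda>" if "x \<in> topspace X" for x using f[OF that] by simp
  fix U assume U: "U \<in> ON"
  have "continuous_map X (discrete_topology (comp U)) (\<lambda>x. f x U)"
    "continuous_map X (discrete_topology (comp U)) (\<lambda>x. f' x U)"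
    using continuous_map_compose[OF assms(1) continuous_component[OF U]]
      continuous_map_compose[OF assms(2) continuous_component[OF U]] by (simp_all add: o_def)
  then have "continuous_map X (discrete_topology (comp U)) (\<lambda>x. (\<lambda>y z. \<lambda>c\<in>rcosets U. y c \<oplus>\<^bsub>R\<^esub> z c) (f x U) (f' x U))"
    by (rule continuous_map_discrete_binary) (auto intro!: R.add.m_closed intro: PiE_mem)
  then show "continuous_map X (discrete_topology (comp U)) (\<lambda>x. (f x \<oplus>\<^bsub>\<Lambda>\<^esub> f' x) U)"
    using U by (simp add: add_eq)
qed

lemma neg_continuous: "continuous_map X top\<^sub>\<Lambda> f \<Longrightarrow> continuous_map X top\<^sub>\<Lambda> (\<lambda>x. neg (f x))"
  by (rule scale_continuous) simp_all

lemma \<delta>_mult_continuous: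
  assumes g: "g \<in> carrier G"
  shows "continuous_map top\<^sub>\<Lambda> top\<^sub>\<Lambda> (\<lambda>x. \<delta> g \<otimes>\<^bsub>\<Lambda>\<^esub> x)"
proof (rule continuous_into_\<Lambda>)
  show "\<delta> g \<otimes>\<^bsub>\<Lambda>\<^esub> x \<in> carrier \<Lambda>" if "x \<in> topspace top\<^sub>\<Lambda>" for x using that g by (simp add: topspace_\<Lambda>)
  fix U assume U: "U \<in> ON"
  have "continuous_map top\<^sub>\<Lambda> (discrete_topology (comp U)) (\<lambda>x. (\<lambda>y. \<lambda>c\<in>rcosets U. y ((U #> inv g) <#> c)) (x U))"
    by (rule continuous_map_discrete_unary[OF continuous_component[OF U]]) (use U g in \<open>auto simp: Mod_mult_closed\<close>)
  then show "continuous_map top\<^sub>\<Lambda> (discrete_topology (comp U)) (\<lambda>x. (\<delta> g \<otimes>\<^bsub>\<Lambda>\<^esub> x) U)"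
  proof (rule continuous_map_eq)
    fix x assume "x \<in> topspace top\<^sub>\<Lambda>"
    then have x: "x \<in> carrier \<Lambda>" by (simp add: topspace_\<Lambda>)
    have "(\<delta> g \<otimes>\<^bsub>\<Lambda>\<^esub> x) U \<in> comp U" using x g U by (intro \<Lambda>_component) simp_all
    then have "(\<lambda>c\<in>rcosets U. (\<delta> g \<otimes>\<^bsub>\<Lambda>\<^esub> x) U c) = (\<delta> g \<otimes>\<^bsub>\<Lambda>\<^esub> x) U" by (rule restrict_component)
    moreover have "(\<lambda>c\<in>rcosets U. x U ((U #> inv g) <#> c)) = (\<lambda>c\<in>rcosets U. (\<delta> g \<otimes>\<^bsub>\<Lambda>\<^esub> x) U c)"
      by (rule restrict_ext) (simp add: \<delta>_mult_apply[OF U g x])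
    ultimately show "(\<lambda>c\<in>rcosets U. x U ((U #> inv g) <#> c)) = (\<delta> g \<otimes>\<^bsub>\<Lambda>\<^esub> x) U" by simp
  qed
qed

lemma topological_group_K: "topological_group K"
proof -
  interpret K: comm_group K by (rule K_comm_group)
  show ?thesis
  proof (intro topological_group.intro topological_group_axioms.intro K.group_axioms)
    show "topspace (gtop K) = carrier K" by (simp add: topspace_\<Lambda>)
    show "continuous_map (prod_topology (gtop K) (gtop K)) (gtop K) (\<lambda>(x, y). x \<otimes>\<^bsub>K\<^esub> y)"
      using add_continuous[OF continuous_map_fst continuous_map_snd] by (simp add: case_prod_unfold)
    have "continuous_map (gtop K) (gtop K) (\<lambda>x. neg x)" using neg_continuous[of top\<^sub>\<Lambda> "\<lambda>x. x"] by simp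
    then show "continuous_map (gtop K) (gtop K) (\<lambda>x. inv\<^bsub>K\<^esub> x)"
      by (rule continuous_map_eq) (simp add: topspace_\<Lambda> K_inv)
  qed
qed

lemma \<I>_closedin: "closedin top\<^sub>\<Lambda> \<I>"
proof -
  have "\<I> = {x \<in> topspace top\<^sub>\<Lambda>. \<epsilon> x \<in> {\<zero>\<^bsub>R\<^esub>}}" by (auto simp: \<I>_iff topspace_\<Lambda>)
  also have "closedin top\<^sub>\<Lambda> \<dots>" by (rule closedin_continuous_map_preimage[OF \<epsilon>_continuous]) simp
  finally show ?thesis .
qed

abbreviation P where "P m \<equiv> aug_power R G m"

text \<open>Closure preserves subgroups of a topological group, and it preserves sets that a
  continuous translation maps into themselves.\<close>

lemma P_stable: "stable_subgroup (P m)"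
proof -
  interpret K: topological_group K by (rule topological_group_K)
  let ?X = "\<I> [^]\<^bsub>ideals_set \<Lambda>\<^esub> m"
  have X: "stable_subgroup ?X" by (rule ideal_power_stable(1))
  then have "subgroup ?X (add_monoid \<Lambda>)" by (simp add: stable_subgroup_def)
  then have "subgroup ?X K" by (simp add: subgroup_def cgr_add_def)
  then have "subgroup (top\<^sub>\<Lambda> closure_of ?X) K" using K.subgroup_closure_of by simp
  then have "subgroup (P m) (add_monoid \<Lambda>)" by (simp add: subgroup_def cgr_add_def aug_power_def)
  moreover have "\<delta> g \<otimes>\<^bsub>\<Lambda>\<^esub> x \<in> P m" if g: "g \<in> carrier G" and x: "x \<in> P m" for g x
  proof -
    have "(\<lambda>x. \<delta> g \<otimes>\<^bsub>\<Lambda>\<^esub> x) ` ?X \<subseteq> ?X" using stable_subgroupD(5)[OF X g] by blast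
    then have "(\<lambda>x. \<delta> g \<otimes>\<^bsub>\<Lambda>\<^esub> x) ` (top\<^sub>\<Lambda> closure_of ?X) \<subseteq> top\<^sub>\<Lambda> closure_of ?X"
      using continuous_map_image_closure_subset[OF \<delta>_mult_continuous[OF g], of ?X] closure_of_mono by blast
    then show ?thesis using x unfolding aug_power_def by blast
  qed
  ultimately show ?thesis by (simp add: stable_subgroup_def)
qed

text \<open>The augmentation is continuous, so its kernel is closed and contains the closure of each
  power with positive exponent. This makes the augmentation well defined on cosets of
  \<open>P m\<close>.\<close>

lemma P_subset_\<I>: "m \<ge> 1 \<Longrightarrow> P m \<subseteq> \<I>"
  unfolding aug_power_def using ideal_power_stable(2) \<I>_closedin by (rule closure_of_minimal)

text \<open>Translation by the inverse of \<open>g\<close> shows that \<open>X\<close> is mapped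
  onto itself, not merely into itself.\<close>

lemma \<delta>_l_coset:
  assumes X: "stable_subgroup X" and g: "g \<in> carrier G" and x: "x \<in> carrier \<Lambda>"
  shows "\<delta> g <#\<^bsub>\<Lambda>\<^esub> (X #>\<^bsub>K\<^esub> x) = X #>\<^bsub>K\<^esub> (\<delta> g \<otimes>\<^bsub>\<Lambda>\<^esub> x)"
proof -
  note XD = stable_subgroupD[OF X]
  have Xc: "p \<in> carrier \<Lambda>" if "p \<in> X" for p using XD(1) that by blast
  show ?thesis
  proof (intro equalityI subsetI)
    fix y assume "y \<in> \<delta> g <#\<^bsub>\<Lambda>\<^esub> (X #>\<^bsub>K\<^esub> x)"
    then obtain p where p: "p \<in> X" "y = \<delta> g \<otimes>\<^bsub>\<Lambda>\<^esub> (p \<oplus>\<^bsub>\<Lambda>\<^esub> x)" by (auto simp: l_coset_def r_coset_def)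
    then have "y = (\<delta> g \<otimes>\<^bsub>\<Lambda>\<^esub> p) \<oplus>\<^bsub>\<Lambda>\<^esub> (\<delta> g \<otimes>\<^bsub>\<Lambda>\<^esub> x)" using g x Xc by (simp add: \<delta>_mult_add)
    then show "y \<in> X #>\<^bsub>K\<^esub> (\<delta> g \<otimes>\<^bsub>\<Lambda>\<^esub> x)" using XD(5)[OF g p(1)] by (auto simp: r_coset_def)
  next
    fix y assume "y \<in> X #>\<^bsub>K\<^esub> (\<delta> g \<otimes>\<^bsub>\<Lambda>\<^esub> x)"
    then obtain p where p: "p \<in> X" "y = p \<oplus>\<^bsub>\<Lambda>\<^esub> (\<delta> g \<otimes>\<^bsub>\<Lambda>\<^esub> x)" by (auto simp: r_coset_def)
    let ?p = "\<delta> (inv g) \<otimes>\<^bsub>\<Lambda>\<^esub> p"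
    have p': "?p \<in> X" using XD(5)[of "inv g" p] g p(1) by simp
    have "\<delta> g \<otimes>\<^bsub>\<Lambda>\<^esub> ?p = p" using g Xc[OF p(1)] by (simp add: \<delta>_mult_mult[symmetric] \<delta>_one_mult)
    then have "y = \<delta> g \<otimes>\<^bsub>\<Lambda>\<^esub> (?p \<oplus>\<^bsub>\<Lambda>\<^esub> x)" using p(2) g x Xc[OF p'] by (simp add: \<delta>_mult_add)
    then show "y \<in> \<delta> g <#\<^bsub>\<Lambda>\<^esub> (X #>\<^bsub>K\<^esub> x)" using p' by (auto simp: l_coset_def r_coset_def)
  qed
qed

text \<open>A continuous homomorphism to a discrete group vanishes on the elements with trivial components
  at finitely many \<open>U\<close>, hence is fixed by the intersection of these \<open>U\<close>.\<close>

lemma \<Lambda>_hom_locally_fixed: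
  assumes f: "f \<in> hom K (add_monoid R)" and cont: "continuous_map top\<^sub>\<Lambda> (discrete_topology (carrier R)) f"
  shows "\<exists>V. openin (gtop G) V \<and> \<one> \<in> V \<and> (\<forall>v\<in>V. \<forall>x\<in>carrier \<Lambda>. f (\<delta> (inv v) \<otimes>\<^bsub>\<Lambda>\<^esub> x) = f x)"
proof -
  interpret K: topological_group K by (rule topological_group_K)
  have f_add: "f (x \<oplus>\<^bsub>\<Lambda>\<^esub> y) = f x \<oplus>\<^bsub>R\<^esub> f y" if "x \<in> carrier \<Lambda>" "y \<in> carrier \<Lambda>" for x y
    using hom_mult[OF f, of x y] that by simp
  have f_closed: "f x \<in> carrier R" if "x \<in> carrier \<Lambda>" for x using hom_in_carrier[OF f, of x] that by simp
  have "f \<zero>\<^bsub>\<Lambda>\<^esub> \<oplus>\<^bsub>R\<^esub> f \<zero>\<^bsub>\<Lambda>\<^esub> = f \<zero>\<^bsub>\<Lambda>\<^esub>" using f_add[of "\<zero>\<^bsub>\<Lambda>\<^esub>" "\<zero>\<^bsub>\<Lambda>\<^esub>"] K.l_one[of "\<zero>\<^bsub>\<Lambda>\<^esub>"] by simp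
  then have f0: "f \<zero>\<^bsub>\<Lambda>\<^esub> = \<zero>\<^bsub>R\<^esub>" using R.add.l_cancel_one[of "f \<zero>\<^bsub>\<Lambda>\<^esub>" "f \<zero>\<^bsub>\<Lambda>\<^esub>"] f_closed[of "\<zero>\<^bsub>\<Lambda>\<^esub>"] by simp
  have "openin top\<^sub>\<Lambda> {x \<in> topspace top\<^sub>\<Lambda>. f x = \<zero>\<^bsub>R\<^esub>}"
    using cont by (simp add: continuous_map_discrete_iff)
  then obtain S where S: "openin (product_topology (\<lambda>U. discrete_topology (comp U)) ON) S"
      "{x \<in> topspace top\<^sub>\<Lambda>. f x = \<zero>\<^bsub>R\<^esub>} = S \<inter> carrier \<Lambda>"
    unfolding cgr_topology_eq openin_subtopology by blast
  have "\<zero>\<^bsub>\<Lambda>\<^esub> \<in> S \<inter> carrier \<Lambda>" unfolding S(2)[symmetric] using f0 by (simp add: topspace_\<Lambda>)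
  then have zS: "\<zero>\<^bsub>\<Lambda>\<^esub> \<in> S" by blast
  \<comment> \<open>A basic open box around 0 inside the open set that cuts out the kernel. Its
    sides are proper at finitely many open normal subgroups only, which are collected in
    \<open>?F\<close>.\<close>
  obtain W where W: "finite {U \<in> ON. W U \<noteq> topspace (discrete_topology (comp U))}"
      "\<zero>\<^bsub>\<Lambda>\<^esub> \<in> Pi\<^sub>E ON W" "Pi\<^sub>E ON W \<subseteq> S"
    using S(1)[unfolded openin_product_topology_alt, THEN bspec, OF zS] by (elim exE conjE)
  let ?F = "{U \<in> ON. W U \<noteq> comp U}"
  have fin: "finite ?F" using W(1) by simp
  have vanish: "f x = \<zero>\<^bsub>R\<^esub>" if x: "x \<in> carrier \<Lambda>" and xF: "\<And>U. U \<in> ?F \<Longrightarrow> x U = \<zero>\<^bsub>\<Lambda>\<^esub> U" for x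
  proof -
    have "x U \<in> W U" if U: "U \<in> ON" for U
    proof (cases "W U = comp U")
      case True
      then show ?thesis using \<Lambda>_component[OF x U] by simp
    next
      case False
      then have "x U = \<zero>\<^bsub>\<Lambda>\<^esub> U" using xF U by simp
      then show ?thesis using W(2) U by (simp add: PiE_mem)
    qed
    moreover have "x \<in> extensional ON" using x by (auto simp: carrier_\<Lambda> PiE_def)
    ultimately have "x \<in> Pi\<^sub>E ON W" by (simp add: PiE_def)
    then have "x \<in> S \<inter> carrier \<Lambda>" using W(3) x by blast
    then show ?thesis unfolding S(2)[symmetric] by simp
  qed
  \<comment> \<open>The intersection with the whole space covers the case of an empty family, whose
    intersection would be the entire type.\<close>
  let ?V = "topspace (gtop G) \<inter> \<Inter>?F"
  have "openin (gtop G) ?V"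
  proof (cases "?F = {}")
    case False
    have "openin (gtop G) (\<Inter>?F)" using fin False by (intro openin_Inter) (auto simp: open_normal_def)
    then show ?thesis by auto
  next
    case True
    show ?thesis unfolding True by simp
  qed
  moreover have "\<one> \<in> ?V" using normal_imp_subgroup subgroup.one_closed
    by (fastforce simp: topspace_gtop open_normal_def)
  moreover have "f (\<delta> (inv v) \<otimes>\<^bsub>\<Lambda>\<^esub> x) = f x" if v: "v \<in> ?V" and x: "x \<in> carrier \<Lambda>" for v x
  proof -
    have vc: "v \<in> carrier G" using v by (simp add: topspace_gtop)
    \<comment> \<open>The difference of the translate and \<open>x\<close> has zero component at
      each \<open>U\<close> in \<open>?F\<close>, since an element of \<open>U\<close> acts
      trivially on the cosets of \<open>U\<close>.\<close>
    let ?d = "\<delta> (inv v) \<otimes>\<^bsub>\<Lambda>\<^esub> x" and ?e = "(\<delta> (inv v) \<otimes>\<^bsub>\<Lambda>\<^esub> x) \<oplus>\<^bsub>\<Lambda>\<^esub> neg x"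
    have d: "?d \<in> carrier \<Lambda>" and e: "?e \<in> carrier \<Lambda>" using vc x by simp_all
    have "f ?e = \<zero>\<^bsub>R\<^esub>"
    proof (rule vanish[OF e])
      fix U assume U: "U \<in> ?F"
      then have U': "U \<in> ON" and vU: "v \<in> U" using v by auto
      interpret UQ: topological_quotient G U using U' by (rule ON_quotient)
      have "?e U c = \<zero>\<^bsub>\<Lambda>\<^esub> U c" if c: "c \<in> rcosets U" for c
      proof -
        obtain z where z: "z \<in> carrier G" "c = U #> z" using c by (rule rcosets_cases)
        have "U #> v = U #> \<one>" using UQ.proj_H[OF vU] UQ.proj_one by simp
        then have "(U #> inv (inv v)) <#> c = (U #> \<one>) <#> (U #> z)" using vc z by simp
        also have "\<dots> = c" using U' z by (simp add: Mod_mult del: coset_mult_one)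
        finally have "?d U c = x U c" using \<delta>_mult_apply[OF U' _ x c, of "inv v"] vc by simp
        then show ?thesis using U' c x by (simp add: add_apply neg_apply zero_apply R.r_neg)
      qed
      moreover have "?e U \<in> comp U" "\<zero>\<^bsub>\<Lambda>\<^esub> U \<in> comp U"
        by (rule \<Lambda>_component[OF e U'], rule \<Lambda>_component[OF _ U']) simp
      ultimately show "?e U = \<zero>\<^bsub>\<Lambda>\<^esub> U" by (intro PiE_ext[of "?e U" "rcosets U" _ "\<zero>\<^bsub>\<Lambda>\<^esub> U"]) auto
    qed
    moreover have "?d = ?e \<oplus>\<^bsub>\<Lambda>\<^esub> x"
      using x vc d by (intro \<Lambda>_ext) (auto simp: add_apply neg_apply R.a_assoc R.l_neg)
    ultimately have "f ?d = \<zero>\<^bsub>R\<^esub> \<oplus>\<^bsub>R\<^esub> f x" using f_add[OF e x] by simp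
    then show ?thesis using f_closed[OF x] by simp
  qed
  ultimately show ?thesis by (intro exI[of _ ?V] conjI ballI)
qed

text \<open>The additive projection onto the augmentation ideal along the multiples of the identity.
  It is continuous but in general not equivariant; it serves to extend functionals from the ideal to
  the whole ring.\<close>

definition aug_proj :: "('g, 'r) cgr \<Rightarrow> ('g, 'r) cgr" where
  "aug_proj x = x \<oplus>\<^bsub>\<Lambda>\<^esub> neg (scale (\<epsilon> x) (\<delta> \<one>))"

lemma aug_proj_closed: "x \<in> carrier \<Lambda> \<Longrightarrow> aug_proj x \<in> carrier \<Lambda>"
  by (simp add: aug_proj_def)

lemma aug_proj_in: "x \<in> carrier \<Lambda> \<Longrightarrow> aug_proj x \<in> \<I>"
  by (simp add: \<I>_iff aug_proj_def \<epsilon>_add \<epsilon>_scale \<epsilon>_\<delta> R.l_minus R.r_neg)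

lemma aug_proj_id: "x \<in> \<I> \<Longrightarrow> aug_proj x = x"
  by (rule \<Lambda>_ext)
    (auto simp: \<I>_iff aug_proj_def add_apply scale_apply)

lemma aug_proj_add: "x \<in> carrier \<Lambda> \<Longrightarrow> y \<in> carrier \<Lambda> \<Longrightarrow> aug_proj (x \<oplus>\<^bsub>\<Lambda>\<^esub> y) = aug_proj x \<oplus>\<^bsub>\<Lambda>\<^esub> aug_proj y"
  by (rule \<Lambda>_ext)
    (auto simp: aug_proj_closed, auto simp: aug_proj_def add_apply neg_apply scale_apply \<epsilon>_add R.l_distr
        R.r_distr R.l_minus R.minus_add R.a_ac)

lemma aug_proj_decomp: "x \<in> carrier \<Lambda> \<Longrightarrow> x = aug_proj x \<oplus>\<^bsub>\<Lambda>\<^esub> scale (\<epsilon> x) (\<delta> \<one>)"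
  by (rule \<Lambda>_ext)
    (auto simp: aug_proj_closed, auto simp: aug_proj_def add_apply neg_apply scale_apply R.a_assoc R.l_minus R.l_neg)

lemma aug_proj_continuous: "continuous_map top\<^sub>\<Lambda> top\<^sub>\<Lambda> aug_proj"
  unfolding aug_proj_def
  by (intro add_continuous neg_continuous scale_continuous \<epsilon>_continuous)
    (simp_all add: topspace_\<Lambda>)

lemma \<I>_hom_extend:
  assumes f: "f \<in> hom (tsub K \<I>) (add_monoid R)"
    and cont: "continuous_map (gtop (tsub K \<I>)) (discrete_topology (carrier R)) f"
  shows "(\<lambda>x. f (aug_proj x)) \<in> hom K (add_monoid R)"
    "continuous_map top\<^sub>\<Lambda> (discrete_topology (carrier R)) (\<lambda>x. f (aug_proj x))"
proof -
  show "(\<lambda>x. f (aug_proj x)) \<in> hom K (add_monoid R)"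
  proof (rule homI)
    fix x y assume "x \<in> carrier K" "y \<in> carrier K"
    then show "f (aug_proj (x \<otimes>\<^bsub>K\<^esub> y)) = f (aug_proj x) \<otimes>\<^bsub>add_monoid R\<^esub> f (aug_proj y)"
      using hom_mult[OF f, of "aug_proj x" "aug_proj y"] by (simp add: aug_proj_add aug_proj_in)
  qed (use hom_in_carrier[OF f] aug_proj_in in auto)
  have "continuous_map top\<^sub>\<Lambda> (gtop (tsub K \<I>)) aug_proj"
    using aug_proj_continuous aug_proj_in by (auto simp: continuous_map_in_subtopology topspace_\<Lambda>)
  from continuous_map_compose[OF this cont]
  show "continuous_map top\<^sub>\<Lambda> (discrete_topology (carrier R)) (\<lambda>x. f (aug_proj x))" by (simp add: o_def)
qed

section \<open>The exact sequence of duals for a fixed exponent\<close>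

context
  fixes m :: nat
  assumes m: "m \<ge> 1"
begin

lemma P_subgroup_K: "subgroup (P m) K"
  using P_stable[of m] by (simp add: stable_subgroup_def subgroup_def cgr_add_def)

lemma \<I>_subgroup_K: "subgroup \<I> K"
  using \<I>_stable by (simp add: stable_subgroup_def subgroup_def cgr_add_def)

lemma \<I>_carrier: "x \<in> \<I> \<Longrightarrow> x \<in> carrier \<Lambda>"
  by (simp add: \<I>_iff)

lemma tsub_comm_group: "comm_group (tsub K \<I>)"
proof -
  interpret K: comm_group K by (rule K_comm_group)
  interpret I: group "K\<lparr>carrier := \<I>\<rparr>" by (rule K.subgroup_imp_group[OF \<I>_subgroup_K])
  have "comm_group (K\<lparr>carrier := \<I>\<rparr>)"
    by (rule I.group_comm_groupI) (use K.m_comm \<I>_carrier in simp)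
  then show ?thesis by (simp add: tsub_def)
qed

lemma quotient_K: "topological_quotient K (P m)"
proof -
  interpret K: comm_group K by (rule K_comm_group)
  show ?thesis
    using topological_group_K K.subgroup_imp_normal[OF P_subgroup_K] by (simp add: topological_quotient_def)
qed

lemma quotient_tsub: "topological_quotient (tsub K \<I>) (P m)"
proof -
  interpret K: topological_group K by (rule topological_group_K)
  interpret I: comm_group "tsub K \<I>" by (rule tsub_comm_group)
  have "subgroup (P m) (tsub K \<I>)"
    using P_subgroup_K P_subset_\<I>[OF m] subgroup.m_inv_closed[OF P_subgroup_K]
      K.m_inv_consistent[OF \<I>_subgroup_K]
    by (auto simp: subgroup_def tsub_def)
  then show ?thesis
    using K.topological_group_tsub[OF \<I>_subgroup_K] I.subgroup_imp_normal
    by (simp add: topological_quotient_def)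
qed

lemma r_coset_tsub: "X #>\<^bsub>tsub K \<I>\<^esub> x = X #>\<^bsub>K\<^esub> x"
  by (simp add: r_coset_def)

lemma dual_Lambda: "quotient_dual G K (P m) R (\<lambda>g x. \<delta> g \<otimes>\<^bsub>\<Lambda>\<^esub> x) (\<lambda>g X. \<delta> g <#\<^bsub>\<Lambda>\<^esub> X)"
proof (intro quotient_dual.intro quotient_dual_axioms.intro topological_group_axioms quotient_K R.cring_axioms)
  fix g assume g: "g \<in> carrier G"
  show "(\<lambda>x. \<delta> g \<otimes>\<^bsub>\<Lambda>\<^esub> x) \<in> hom K K" using g by (auto simp: hom_def \<delta>_mult_add)
  show "continuous_map (gtop K) (gtop K) (\<lambda>x. \<delta> g \<otimes>\<^bsub>\<Lambda>\<^esub> x)" using \<delta>_mult_continuous[OF g] by simp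
qed (use \<Lambda>_hom_locally_fixed \<delta>_l_coset[OF P_stable] in \<open>simp_all add: \<delta>_one_mult \<delta>_mult_mult\<close>)

lemma dual_Aug: "quotient_dual G (tsub K \<I>) (P m) R (\<lambda>g x. \<delta> g \<otimes>\<^bsub>\<Lambda>\<^esub> x) (\<lambda>g X. \<delta> g <#\<^bsub>\<Lambda>\<^esub> X)"
proof (intro quotient_dual.intro quotient_dual_axioms.intro topological_group_axioms quotient_tsub R.cring_axioms)
  have stable: "\<delta> g \<otimes>\<^bsub>\<Lambda>\<^esub> x \<in> \<I>" if "g \<in> carrier G" "x \<in> \<I>" for g x
    using stable_subgroupD(5)[OF \<I>_stable that] .
  fix g assume g: "g \<in> carrier G"
  show "(\<lambda>x. \<delta> g \<otimes>\<^bsub>\<Lambda>\<^esub> x) \<in> hom (tsub K \<I>) (tsub K \<I>)"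
    using g stable \<I>_carrier by (auto simp: hom_def \<delta>_mult_add)
  show "continuous_map (gtop (tsub K \<I>)) (gtop (tsub K \<I>)) (\<lambda>x. \<delta> g \<otimes>\<^bsub>\<Lambda>\<^esub> x)"
    using continuous_map_from_subtopology[OF \<delta>_mult_continuous[OF g], of \<I>] stable[OF g] \<I>_carrier
    by (auto simp: continuous_map_in_subtopology topspace_\<Lambda>)
next
  fix f assume f: "f \<in> hom (tsub K \<I>) (add_monoid R)"
    and cont: "continuous_map (gtop (tsub K \<I>)) (discrete_topology (carrier R)) f"
  \<comment> \<open>The functional is extended along \<open>aug_proj\<close> so that local fixedness
    on the whole ring applies. The ideal is stable under the group and \<open>aug_proj\<close> is
    the identity on it, which brings the result back to the functional itself.\<close>
  obtain V where V: "openin (gtop G) V" "\<one> \<in> V"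
    "\<And>v x. v \<in> V \<Longrightarrow> x \<in> carrier \<Lambda> \<Longrightarrow> f (aug_proj (\<delta> (inv v) \<otimes>\<^bsub>\<Lambda>\<^esub> x)) = f (aug_proj x)"
    using \<Lambda>_hom_locally_fixed[OF \<I>_hom_extend[OF f cont]] by blast
  have "f (\<delta> (inv v) \<otimes>\<^bsub>\<Lambda>\<^esub> x) = f x" if v: "v \<in> V" and x: "x \<in> \<I>" for v x
  proof -
    have "v \<in> carrier G" using V(1) v openin_subset_carrier by blast
    then have "\<delta> (inv v) \<otimes>\<^bsub>\<Lambda>\<^esub> x \<in> \<I>" using stable_subgroupD(5)[OF \<I>_stable _ x, of "inv v"] by simp
    then show ?thesis using V(3)[OF v \<I>_carrier[OF x]] x by (simp add: aug_proj_id)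
  qed
  then show "\<exists>V. openin (gtop G) V \<and> \<one> \<in> V \<and>
      (\<forall>v\<in>V. \<forall>x\<in>carrier (tsub K \<I>). f (\<delta> (inv v) \<otimes>\<^bsub>\<Lambda>\<^esub> x) = f x)" using V(1,2) by auto
qed (use \<delta>_l_coset[OF P_stable] in \<open>simp_all add: \<I>_carrier \<delta>_one_mult \<delta>_mult_mult r_coset_tsub\<close>)

abbreviation L where "L \<equiv> dual_mod R G (Lambda_mod R G m)"
abbreviation J where "J \<equiv> dual_mod R G (Aug_mod R G m)"
abbreviation A :: "('g, 'r) tmod" where "A \<equiv> trivial_mod (discrete_add R)"

interpretation L: quotient_dual G K "P m" R "\<lambda>g x. \<delta> g \<otimes>\<^bsub>\<Lambda>\<^esub> x" "\<lambda>g X. \<delta> g <#\<^bsub>\<Lambda>\<^esub> X"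
  rewrites "with_act (tquot K (P m)) (\<lambda>g X. \<delta> g <#\<^bsub>\<Lambda>\<^esub> X) = Lambda_mod R G m"
  using dual_Lambda by (simp_all add: Lambda_mod_def)

interpretation J: quotient_dual G "tsub K \<I>" "P m" R "\<lambda>g x. \<delta> g \<otimes>\<^bsub>\<Lambda>\<^esub> x" "\<lambda>g X. \<delta> g <#\<^bsub>\<Lambda>\<^esub> X"
  rewrites "with_act (tquot (tsub K \<I>) (P m)) (\<lambda>g X. \<delta> g <#\<^bsub>\<Lambda>\<^esub> X) = Aug_mod R G m"
  using dual_Aug by (simp_all add: Aug_mod_def)

lemma A_simps [simp]:
  "carrier A = carrier R" "monoid.mult A = ring.add R" "one A = \<zero>\<^bsub>R\<^esub>"
  "gtop A = discrete_topology (carrier R)" "act A g x = x"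
  by (simp_all add: trivial_mod_def discrete_add_def)

lemma discrete_module_A: "discrete_module G A"
proof -
  have "comm_group (add_monoid R)" by (rule R.a_comm_group)
  then have "comm_group A" by (simp add: trivial_mod_def discrete_add_def)
  then show ?thesis
    by (intro discrete_module.intro discrete_module_axioms.intro topological_group_axioms)
      (auto simp: hom_def)
qed

lemma carrier_Lambda_mod: "carrier (Lambda_mod R G m) = {P m #>\<^bsub>K\<^esub> x | x. x \<in> carrier \<Lambda>}"
  by (auto simp: Lambda_mod_def carrier_tquot RCOSETS_def)

lemma carrier_Aug_mod: "carrier (Aug_mod R G m) = {P m #>\<^bsub>K\<^esub> x | x. x \<in> \<I>}"
  by (auto simp: Aug_mod_def carrier_tquot RCOSETS_def r_coset_tsub)

lemma the_elem_augmentation: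
  assumes x: "x \<in> carrier \<Lambda>"
  shows "the_elem (\<epsilon> ` (P m #>\<^bsub>K\<^esub> x)) = \<epsilon> x"
proof -
  have "\<epsilon> y = \<epsilon> x" if y: "y \<in> P m #>\<^bsub>K\<^esub> x" for y
  proof -
    obtain p where p: "p \<in> P m" "y = p \<oplus>\<^bsub>\<Lambda>\<^esub> x" using y by (auto simp: r_coset_def)
    then have "\<epsilon> p = \<zero>\<^bsub>R\<^esub>" using P_subset_\<I>[OF m] by (auto simp: \<I>_iff)
    then show ?thesis using p(2) x by (simp add: \<epsilon>_add)
  qed
  moreover have "x \<in> P m #>\<^bsub>K\<^esub> x"
    using L.rcos_self[of x "P m"] x P_subgroup_K by simp
  ultimately have "\<epsilon> ` (P m #>\<^bsub>K\<^esub> x) = {\<epsilon> x}" by blast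
  then show ?thesis by simp
qed

lemma dual_augmentation_apply:
  assumes x: "x \<in> carrier \<Lambda>"
  shows "dual_augmentation R G m r (P m #>\<^bsub>K\<^esub> x) = r \<otimes>\<^bsub>R\<^esub> \<epsilon> x"
proof -
  have "P m #>\<^bsub>K\<^esub> x \<in> carrier (Lambda_mod R G m)" using x by (auto simp: carrier_Lambda_mod)
  then show ?thesis by (simp add: dual_augmentation_def the_elem_augmentation[OF x])
qed

lemma dual_restriction_apply: "x \<in> \<I> \<Longrightarrow> dual_restriction R G m f (P m #>\<^bsub>K\<^esub> x) = f (P m #>\<^bsub>K\<^esub> x)"
  by (auto simp: dual_restriction_def carrier_Aug_mod)

lemma dual_augmentation_closed:
  assumes r: "r \<in> carrier R"
  shows "dual_augmentation R G m r \<in> carrier L"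
proof (rule L.D_I)
  show "dual_augmentation R G m r \<in> extensional (rcosets\<^bsub>K\<^esub> P m)"
    by (simp add: dual_augmentation_def Lambda_mod_def carrier_tquot)
  show "(\<lambda>x. r \<otimes>\<^bsub>R\<^esub> \<epsilon> x) \<in> hom K (add_monoid R)"
    using r by (auto simp: hom_def \<epsilon>_add R.r_distr)
  show "continuous_map (gtop K) (discrete_topology (carrier R)) (\<lambda>x. r \<otimes>\<^bsub>R\<^esub> \<epsilon> x)"
    using continuous_map_discrete_unary[OF \<epsilon>_continuous, of "\<lambda>y. r \<otimes>\<^bsub>R\<^esub> y" "carrier R"] r by simp
qed (simp add: dual_augmentation_apply)

lemma dual_restriction_closed:
  assumes f: "f \<in> carrier L"
  shows "dual_restriction R G m f \<in> carrier J"
proof (rule J.D_I)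
  show "dual_restriction R G m f \<in> extensional (rcosets\<^bsub>tsub K \<I>\<^esub> P m)"
    by (simp add: dual_restriction_def Aug_mod_def carrier_tquot)
  have h: "(\<lambda>x. f (P m #>\<^bsub>K\<^esub> x)) \<in> hom K (add_monoid R)"
    and c: "continuous_map (gtop K) (discrete_topology (carrier R)) (\<lambda>x. f (P m #>\<^bsub>K\<^esub> x))"
    using f by (simp_all add: L.D_iff)
  show "(\<lambda>x. f (P m #>\<^bsub>K\<^esub> x)) \<in> hom (tsub K \<I>) (add_monoid R)"
    using h \<I>_carrier by (auto simp: hom_def Pi_def)
  show "continuous_map (gtop (tsub K \<I>)) (discrete_topology (carrier R)) (\<lambda>x. f (P m #>\<^bsub>K\<^esub> x))"
    using continuous_map_from_subtopology[OF c] by simp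
qed (simp add: dual_restriction_apply r_coset_tsub)

text \<open>Surjectivity of the restriction is extension along \<open>aug_proj\<close>. The
  assumption \<open>endo\<close> identifies \<open>R\<close> with its additive endomorphisms, and
  this is what makes the kernel of the restriction exactly \<open>R\<close>.\<close>

theorem dual_exact:
  assumes endo: "\<And>h r. h \<in> hom (add_monoid R) (add_monoid R) \<Longrightarrow> r \<in> carrier R \<Longrightarrow> h r = h \<one>\<^bsub>R\<^esub> \<otimes>\<^bsub>R\<^esub> r"
  shows "exact_modules G A L J (dual_augmentation R G m) (dual_restriction R G m)"
proof (intro exact_modules.intro exact_modules_axioms.intro discrete_module_A L.discrete_module_D J.discrete_module_D)
  let ?i = "dual_augmentation R G m" and ?p = "dual_restriction R G m"
  have p_apply: "?p f (P m #>\<^bsub>tsub K \<I>\<^esub> x) = f (P m #>\<^bsub>K\<^esub> x)" if "x \<in> \<I>" for f x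
    using that by (simp add: r_coset_tsub dual_restriction_apply)
  have \<delta>1: "\<delta> \<one> \<in> carrier K" by simp
  show "?i \<in> hom A L"
  proof (rule homI)
    fix r s assume "r \<in> carrier A" "s \<in> carrier A"
    then show "?i (r \<otimes>\<^bsub>A\<^esub> s) = ?i r \<otimes>\<^bsub>L\<^esub> ?i s"
      by (intro L.D_eqI) (auto simp: dual_augmentation_closed L.D_mult_closed L.D_mult_apply
          dual_augmentation_apply R.l_distr)
  qed (simp add: dual_augmentation_closed)
  show "?p \<in> hom L J"
  proof (rule homI)
    fix f f' assume "f \<in> carrier L" "f' \<in> carrier L"
    then show "?p (f \<otimes>\<^bsub>L\<^esub> f') = ?p f \<otimes>\<^bsub>J\<^esub> ?p f'"
      by (intro J.D_eqI) (auto simp: dual_restriction_closed L.D_mult_closed J.D_mult_closed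
          J.D_mult_apply L.D_mult_apply p_apply \<I>_carrier)
  qed (simp add: dual_restriction_closed)
  show "inj_on ?i (carrier A)"
  proof (rule inj_onI)
    fix r s assume rs: "r \<in> carrier A" "s \<in> carrier A" and eq: "?i r = ?i s"
    \<comment> \<open>Evaluation at the coset of 1, where the augmentation is 1, recovers the
      scalar.\<close>
    have "?i r (P m #>\<^bsub>K\<^esub> \<delta> \<one>) = ?i s (P m #>\<^bsub>K\<^esub> \<delta> \<one>)" by (simp only: eq)
    then show "r = s" using rs by (simp add: dual_augmentation_apply \<epsilon>_\<delta>)
  qed
  show "?p ` carrier L = carrier J"
  proof (intro equalityI subsetI)
    fix f assume f: "f \<in> carrier J"
    then have h: "(\<lambda>x. f (P m #>\<^bsub>tsub K \<I>\<^esub> x)) \<in> hom (tsub K \<I>) (add_monoid R)"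
      and c: "continuous_map (gtop (tsub K \<I>)) (discrete_topology (carrier R)) (\<lambda>x. f (P m #>\<^bsub>tsub K \<I>\<^esub> x))"
      by (simp_all only: J.D_iff)
    have z: "f (P m #>\<^bsub>tsub K \<I>\<^esub> aug_proj x) = \<zero>\<^bsub>R\<^esub>" if "x \<in> P m" for x
      using that P_subset_\<I>[OF m] J.D_zero[OF f that] by (simp add: aug_proj_id subsetD)
    obtain F where F: "F \<in> carrier L" "\<And>x. x \<in> carrier K \<Longrightarrow> F (P m #>\<^bsub>K\<^esub> x) = f (P m #>\<^bsub>tsub K \<I>\<^esub> aug_proj x)"
    proof (rule L.D_obtain[OF \<I>_hom_extend(1)[OF h c]])
      show "continuous_map (gtop K) (discrete_topology (carrier R)) (\<lambda>x. f (P m #>\<^bsub>tsub K \<I>\<^esub> aug_proj x))"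
        using \<I>_hom_extend(2)[OF h c] by simp
    qed (rule z, assumption, rule that)
    have "?p F = f"
      by (rule J.D_eqI) (use F f in \<open>auto simp: dual_restriction_closed p_apply \<I>_carrier aug_proj_id\<close>)
    then show "f \<in> ?p ` carrier L" using F(1) by blast
  qed (auto simp: dual_restriction_closed)
  show "?p f = \<one>\<^bsub>J\<^esub> \<longleftrightarrow> f \<in> ?i ` carrier A" if f: "f \<in> carrier L" for f
  proof
    assume pf: "?p f = \<one>\<^bsub>J\<^esub>"
    have fI: "f (P m #>\<^bsub>K\<^esub> x) = \<zero>\<^bsub>R\<^esub>" if x: "x \<in> \<I>" for x
      using p_apply[OF x, of f] J.D_one_apply[of x] x pf by simp
    have scale_add: "scale (r \<oplus>\<^bsub>R\<^esub> s) (\<delta> \<one>) = scale r (\<delta> \<one>) \<oplus>\<^bsub>\<Lambda>\<^esub> scale s (\<delta> \<one>)"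
      if "r \<in> carrier R" "s \<in> carrier R" for r s
      using that by (intro \<Lambda>_ext) (auto simp: add_apply scale_apply R.l_distr)
    \<comment> \<open>A functional that vanishes on the ideal is determined by its values on
      multiples of the identity. These values form an additive endomorphism of \<open>R\<close>,
      hence multiplication by the value at 1.\<close>
    have "(\<lambda>r. f (P m #>\<^bsub>K\<^esub> scale r (\<delta> \<one>))) \<in> hom (add_monoid R) (add_monoid R)"
    proof (rule homI)
      fix r s assume "r \<in> carrier (add_monoid R)" "s \<in> carrier (add_monoid R)"
      then show "f (P m #>\<^bsub>K\<^esub> scale (r \<otimes>\<^bsub>add_monoid R\<^esub> s) (\<delta> \<one>))
          = f (P m #>\<^bsub>K\<^esub> scale r (\<delta> \<one>)) \<otimes>\<^bsub>add_monoid R\<^esub> f (P m #>\<^bsub>K\<^esub> scale s (\<delta> \<one>))"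
        using L.D_add[OF f, of "scale r (\<delta> \<one>)" "scale s (\<delta> \<one>)"] by (simp add: scale_add)
    qed (use L.D_closed[OF f] in simp)
    note h = endo[OF this]
    have scale_one: "scale \<one>\<^bsub>R\<^esub> (\<delta> \<one>) = \<delta> \<one>" by (intro \<Lambda>_ext) (auto simp: scale_apply)
    let ?r = "f (P m #>\<^bsub>K\<^esub> \<delta> \<one>)"
    have r: "?r \<in> carrier R" using L.D_closed[OF f \<delta>1] .
    have "f = ?i ?r"
    proof (rule L.D_eqI[OF f dual_augmentation_closed[OF r]])
      fix x assume "x \<in> carrier K"
      then have x: "x \<in> carrier \<Lambda>" by simp
      have "f (P m #>\<^bsub>K\<^esub> x) = f (P m #>\<^bsub>K\<^esub> (aug_proj x \<otimes>\<^bsub>K\<^esub> scale (\<epsilon> x) (\<delta> \<one>)))"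
        using aug_proj_decomp[OF x] by simp
      also have "\<dots> = f (P m #>\<^bsub>K\<^esub> aug_proj x) \<oplus>\<^bsub>R\<^esub> f (P m #>\<^bsub>K\<^esub> scale (\<epsilon> x) (\<delta> \<one>))"
        using x by (intro L.D_add[OF f]) (simp_all add: aug_proj_closed)
      also have "\<dots> = ?r \<otimes>\<^bsub>R\<^esub> \<epsilon> x"
        using fI[OF aug_proj_in[OF x]] h[OF \<epsilon>_closed[OF x]] r x by (simp add: scale_one)
      also have "\<dots> = ?i ?r (P m #>\<^bsub>K\<^esub> x)" using x by (simp add: dual_augmentation_apply)
      finally show "f (P m #>\<^bsub>K\<^esub> x) = ?i ?r (P m #>\<^bsub>K\<^esub> x)" .
    qed
    then show "f \<in> ?i ` carrier A" using r by auto
  next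
    assume "f \<in> ?i ` carrier A"
    then obtain r where r: "r \<in> carrier R" "f = ?i r" by auto
    show "?p f = \<one>\<^bsub>J\<^esub>"
      by (rule J.D_eqI)
        (use r f in \<open>auto simp: dual_restriction_closed J.D_one_closed J.D_one_apply p_apply dual_augmentation_apply \<I>_iff\<close>)
  qed
  fix g assume g: "g \<in> carrier G"
  then have g': "inv g \<in> carrier G" by simp
  show "?i (act A g r) = act L g (?i r)" if "r \<in> carrier A" for r
    by (rule L.D_eqI)
      (use that g g' in \<open>auto simp: dual_augmentation_closed L.D_act_closed L.D_act_apply dual_augmentation_apply \<epsilon>_\<delta>_mult\<close>)
  show "?p (act L g f) = act J g (?p f)" if "f \<in> carrier L" for f
  proof (rule J.D_eqI)
    fix x assume "x \<in> carrier (tsub K \<I>)"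
    then have x: "x \<in> \<I>" by simp
    have x': "\<delta> (inv g) \<otimes>\<^bsub>\<Lambda>\<^esub> x \<in> \<I>" using stable_subgroupD(5)[OF \<I>_stable g' x] .
    show "?p (act L g f) (P m #>\<^bsub>tsub K \<I>\<^esub> x) = act J g (?p f) (P m #>\<^bsub>tsub K \<I>\<^esub> x)"
      using x x' g by (simp add: p_apply L.D_act_apply J.D_act_apply \<I>_carrier)
  qed (use that g in \<open>auto simp: dual_restriction_closed L.D_act_closed J.D_act_closed\<close>)
qed

end

end

text \<open>Lets the hypothesis on inflation, which names the same constant coefficients for both
  groups, match the inflated module of the general setting.\<close>

lemma inflated_trivial_mod: "inflated G H (trivial_mod M) = trivial_mod M"
  by (simp add: inflated_def pullback_mod_def trivial_mod_def with_act_def)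

text \<open>The additive group is cyclic with generator 1, so the claim is an induction over the
  multiples of 1, which exhaust the residues.\<close>

lemma (in residues) additive_endomorphism:
  assumes h: "h \<in> hom (add_monoid R) (add_monoid R)" and r: "r \<in> carrier R"
  shows "h r = h \<one> \<otimes> r"
proof -
  have h1: "h \<one> \<in> carrier R" using hom_in_carrier[OF h, of \<one>] by simp
  have h_add: "h (x \<oplus> y) = h x \<oplus> h y" if "x \<in> carrier R" "y \<in> carrier R" for x y
    using hom_mult[OF h, of x y] that by simp
  have mult_int: "h (int k mod m) = h \<one> \<otimes> (int k mod m)" for k
  proof (induction k)
    case 0
    have "h \<zero> \<oplus> h \<zero> = h \<zero>" using h_add[of \<zero> \<zero>] by simp
    then have "h \<zero> = \<zero>" using add.l_cancel_one[of "h \<zero>" "h \<zero>"] hom_in_carrier[OF h, of \<zero>] by simp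
    moreover have z: "int 0 mod m = \<zero>" by (simp add: res_zero_eq)
    ultimately show ?case unfolding z using h1 by simp
  next
    case (Suc k)
    have c: "int k mod m \<in> carrier R" using m_gt_one by (simp add: res_carrier_eq)
    have s: "int (Suc k) mod m = \<one> \<oplus> (int k mod m)" by (simp add: res_add_eq res_one_eq mod_simps add.commute)
    have "h (int (Suc k) mod m) = h \<one> \<oplus> h \<one> \<otimes> (int k mod m)" unfolding s
      using h_add[OF one_closed c] Suc.IH by simp
    also have "\<dots> = h \<one> \<otimes> (\<one> \<oplus> (int k mod m))" using h1 c by (simp add: r_distr)
    finally show ?case unfolding s .
  qed
  have "int (nat r) mod m = r" using r by (simp add: res_carrier_eq)
  then show ?thesis using mult_int[of "nat r"] by simp
qed

text \<open>The quotient of a compact group is compact, so its open normal subgroups have finite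
  index and \<open>dual_exact\<close> applies to its completed group ring.\<close>

theorem (in profinite_group) exact_coefficients_dual:
  assumes R: "cring R" and m: "m \<ge> 1" and H: "H \<lhd> G" and closed: "closedin (gtop G) H"
    and endo: "\<And>h r. h \<in> hom (add_monoid R) (add_monoid R) \<Longrightarrow> r \<in> carrier R \<Longrightarrow> h r = h \<one>\<^bsub>R\<^esub> \<otimes>\<^bsub>R\<^esub> r"
  shows "exact_coefficients G H (trivial_mod (discrete_add R)) (dual_mod R (tquot G H) (Lambda_mod R (tquot G H) m))
    (dual_mod R (tquot G H) (Aug_mod R (tquot G H) m)) (dual_augmentation R (tquot G H) m)
        (dual_restriction R (tquot G H) m)"
proof -
  let ?Q = "tquot G H"
  interpret TQ: topological_quotient G H
    using H by (simp add: topological_quotient_def topological_group_axioms)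
  have "finite_quotients ?Q R"
    by (intro finite_quotients.intro finite_quotients_axioms.intro TQ.topological_group_Q R
        topological_group.open_normal_finite_index[OF TQ.topological_group_Q] TQ.compact_Q compact)
  then have E: "exact_modules ?Q (trivial_mod (discrete_add R)) (dual_mod R ?Q (Lambda_mod R ?Q m))
      (dual_mod R ?Q (Aug_mod R ?Q m)) (dual_augmentation R ?Q m) (dual_restriction R ?Q m)"
    using m endo by (rule finite_quotients.dual_exact)
  then show ?thesis
    by (intro exact_coefficients.intro profinite_quotient_module.intro profinite_quotient_module_axioms.intro
        quotient_module.intro TQ.topological_quotient_axioms profinite_group_axioms closed)
      (simp_all add: exact_modules_def)
qed

theorem theorem4p1:
  fixes GG :: "'a tgroup" and I :: "'i set" and l n m :: nat
    and H :: "'a set" and G :: "'a set tgroup" and R :: "int ring"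
    and Lambda_dual Aug_dual :: "('a set, ('a set, int) cgr set \<Rightarrow> int) tmod"
    and \<phi> :: "((nat \<Rightarrow> 'a) \<Rightarrow> ('a set, int) cgr set \<Rightarrow> int) set"
  assumes "prime l" and "n \<ge> 1" and "m \<ge> 1"
    and "pro_l_group GG l"
    and "R = residue_ring (int (l ^ n))"
    and "H = central_series GG (l ^ n) 2"
    and "G = tquot GG H"
    and "tiso G (tproduct I (\<lambda>_. discrete_add R)) \<noteq> {}"
    and "Lambda_dual = dual_mod R G (Lambda_mod R G m)"
    and "Aug_dual = dual_mod R G (Aug_mod R G m)"
    and "\<phi> \<in> coh_invariants GG H (inflated GG H Aug_dual) 1"
  shows
    "(\<phi> \<in> coh_map (tsub GG H) (inflated GG H Aug_dual) 1 (\<lambda>h. h) (dual_restriction R G m)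
            ` coh_invariants GG H (inflated GG H Lambda_dual) 1
        \<longrightarrow> Psi R GG H m \<phi> = \<one>\<^bsub>cohomology G (trivial_mod (discrete_add R)) 3\<^esub>) \<and>
     (coh_map GG (trivial_mod (discrete_add R)) 2 (\<lambda>g. H #>\<^bsub>GG\<^esub> g) (\<lambda>x. x)
          ` carrier (cohomology G (trivial_mod (discrete_add R)) 2)
        = carrier (cohomology GG (trivial_mod (discrete_add R)) 2)
      \<longrightarrow> (\<phi> \<in> coh_map (tsub GG H) (inflated GG H Aug_dual) 1 (\<lambda>h. h) (dual_restriction R G m)
                  ` coh_invariants GG H (inflated GG H Lambda_dual) 1
             \<longleftrightarrow> Psi R GG H m \<phi> = \<one>\<^bsub>cohomology G (trivial_mod (discrete_add R)) 3\<^esub>))"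
proof -
  interpret pro_l_group GG l by fact
  \<comment> \<open>The locale \<open>residues\<close> asks for a modulus greater than 1.\<close>
  have "l ^ n > 1" using prime_gt_1_nat[OF assms(1)] assms(2) by (intro one_less_power) auto
  then have "int (l ^ n) > 1" by linarith
  then interpret residues "int (l ^ n)" R by unfold_locales (use assms(5) in simp_all)
  \<comment> \<open>The series is numbered from 1, so its second term is a single application of
    \<open>comm_pow\<close> to the whole group.\<close>
  have H: "H \<lhd> GG" "closedin (gtop GG) H"
    using comm_pow_normal[of "l ^ n"] by (simp_all add: assms(6) numeral_2_eq_2)
  interpret exact_coefficients GG H "trivial_mod (discrete_add R)" Lambda_dual Aug_dual
      "dual_augmentation R G m" "dual_restriction R G m"
    unfolding assms(7,9,10)
    by (rule exact_coefficients_dual[OF cring assms(3) H additive_endomorphism])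
  have Psi: "Psi R GG H m \<phi> = connecting G (trivial_mod (discrete_add R)) (dual_augmentation R G m)
      Lambda_dual (dual_restriction R G m) 2 (hs_d2 GG H Aug_dual \<phi>)"
    by (simp add: Psi_def Let_def assms(7,9,10))
  have \<phi>: "\<phi> \<in> coh_invariants GG H (inflated GG H Aug_dual) (Suc 0)" using assms(11) by simp
  show ?thesis
    using lifted_imp_connecting_trivial \<phi> connecting_trivial_imp_lifted[OF _ \<phi>]
    unfolding Psi inflated_trivial_mod One_nat_def assms(7)[symmetric] by blast
qed

end
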